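(* Let $S=S_d$ be the dyadic square function on $\mathbb{R}^n$ and let $g_\mu^*$ be the continuous Littlewood–Paley square function with $\mu>3$. Then there are constants $\alpha,c>0$ such that for every cube $Q$ and every $f\in L^\infty_c(\mathbb{R}^n)$ with $\operatorname{supp}(f)\subseteq Q$, $$|\{x\in Q: Sf(x)>t\,Mf(x)\}|\le c\,e^{-\alpha t^2}|Q|,\qquad t>0,$$ and $$|\{x\in Q: g_\mu^*(f)(x)>t\,Mf(x)\}|\le c\,e^{-\alpha t^2}|Q|,\qquad t>0.$$
   Context: Cubes have sides parallel to the axes; $L^\infty_c(\mathbb{R}^n)$ is the space of bounded compactly supported functions. The Hardy–Littlewood maximal operator is $Mf(x)=\sup_{Q\ni x}\frac1{|Q|}\int_Q|f(y)|\,dy$, the supremum over all cubes containing $x$. Let $\mathcal{D}$ be the collection of dyadic cubes in $\mathbb{R}^n$; for $P\in\mathcal{D}$, $\widehat P$ is its dyadic parent (the unique dyadic cube containing $P$ with $|\widehat P|=2^n|P|$), and $f_P=\frac1{|P|}\int_Pf$. The dyadic square function is $$S_df(x)=\Big(\sum_{P\in\mathcal{D}}(f_P-f_{\widehat P})^2\chi_P(x)\Big)^{1/2}.$$ The continuous square function is $$g_\mu^*(f)(x)=\left(\int_0^\infty\int_{\mathbb{R}^n}|\phi_t*f(y)|^2\Big(\frac{t}{t+|x-y|}\Big)^{n\mu}\frac{dy\,dt}{t^{n+1}}\right)^{1/2},$$ where $\phi\in\mathcal{S}(\mathbb{R}^n)$ is a fixed Schwartz function with $\int\phi\,dx=0$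 and $\phi_t(x)=t^{-n}\phi(x/t)$. The constants may depend on $n$, $\mu$ and $\phi$. *)

theory Defs
  imports "HOL-Analysis.Analysis"
begin

(* Taking cubes closed affects neither the maximal function nor the measures of level sets. *)
definition cubes :: "(real^'n) set set" where
  "cubes = {cbox a (a + (\<chi> i. l)) | a l. l > 0}"

(* Smallest closed set off which f vanishes almost everywhere. *)
definition ess_supp :: "(real^'n \<Rightarrow> real) \<Rightarrow> (real^'n) set" where
  "ess_supp f = - \<Union>{U. open U \<and> (AE x in lebesgue. x \<in> U \<longrightarrow> f x = 0)}"

definition Linf_c :: "(real^'n \<Rightarrow> real) set" where
  "Linf_c = {f. f \<in> borel_measurable lebesgue
               \<and> (\<exists>C. AE x in lebesgue. \<bar>f x\<bar> \<le> C)
               \<and> compact (ess_supp f)}"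

definition avg :: "(real^'n) set \<Rightarrow> (real^'n \<Rightarrow> real) \<Rightarrow> real" where
  "avg P f = (1 / measure lebesgue P) * (LINT x:P|lebesgue. f x)"

definition maximal_fun :: "(real^'n \<Rightarrow> real) \<Rightarrow> real^'n \<Rightarrow> ennreal" where
  "maximal_fun f x =
     (SUP Q \<in> {Q \<in> cubes. x \<in> Q}. (\<integral>\<^sup>+y\<in>Q. ennreal \<bar>f y\<bar> \<partial>lebesgue) / emeasure lebesgue Q)"

(* The square functions may take the value infinity, so the root is needed on [0,\<infinity>]. *)
definition ennreal_sqrt :: "ennreal \<Rightarrow> ennreal" where
  "ennreal_sqrt a = (if a = \<infinity> then \<infinity> else ennreal (sqrt (enn2real a)))"

definition dyadic_cubes :: "(real^'n) set set" where
  "dyadic_cubes =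
     {{x. \<forall>i. 2 powi k * of_int (m i) \<le> x $ i \<and> x $ i < 2 powi k * (of_int (m i) + 1)}
       | (k::int) (m :: 'n \<Rightarrow> int). True}"

definition dyadic_parent :: "(real^'n) set \<Rightarrow> (real^'n) set" where
  "dyadic_parent P =
     (THE P'. P' \<in> dyadic_cubes \<and> P \<subseteq> P' \<and> measure lebesgue P' = 2 ^ CARD('n) * measure lebesgue P)"

definition dyadic_square_fun :: "(real^'n \<Rightarrow> real) \<Rightarrow> real^'n \<Rightarrow> ennreal" where
  "dyadic_square_fun f x =
     ennreal_sqrt (\<Sum>\<^sub>\<infinity>P\<in>dyadic_cubes. ennreal ((avg P f - avg (dyadic_parent P) f)\<^sup>2) * indicator P x)"

(* Iterated partial derivatives, a multi-index being given as the list of the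
   coordinate directions to differentiate in (for the smooth functions considered
   below the order is irrelevant). *)
fun iter_partial :: "'n list \<Rightarrow> (real^'n \<Rightarrow> complex) \<Rightarrow> real^'n \<Rightarrow> complex" where
  "iter_partial [] \<phi> = \<phi>"
| "iter_partial (i # is) \<phi> = (\<lambda>x. frechet_derivative (iter_partial is \<phi>) (at x) (axis i 1))"

definition schwartz :: "(real^'n \<Rightarrow> complex) \<Rightarrow> bool" where
  "schwartz \<phi> \<longleftrightarrow>
     (\<forall>is. iter_partial is \<phi> differentiable_on UNIV) \<and>
     (\<forall>is (\<beta> :: 'n \<Rightarrow> nat). bounded (range (\<lambda>x. (\<Prod>i\<in>UNIV. (x $ i) ^ \<beta> i) *\<^sub>R iter_partial is \<phi> x)))"

definition dilate :: "(real^'n \<Rightarrow> complex) \<Rightarrow> real \<Rightarrow> real^'n \<Rightarrow> complex" where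
  "dilate \<phi> t x = (1 / t ^ CARD('n)) *\<^sub>R \<phi> ((1 / t) *\<^sub>R x)"

definition convolve :: "(real^'n \<Rightarrow> complex) \<Rightarrow> (real^'n \<Rightarrow> real) \<Rightarrow> real^'n \<Rightarrow> complex" where
  "convolve \<psi> f y = (LINT z|lebesgue. \<psi> (y - z) * complex_of_real (f z))"

definition g_star :: "(real^'n \<Rightarrow> complex) \<Rightarrow> real \<Rightarrow> (real^'n \<Rightarrow> real) \<Rightarrow> real^'n \<Rightarrow> ennreal" where
  "g_star \<phi> \<mu> f x =
     ennreal_sqrt (\<integral>\<^sup>+t\<in>{0<..}. (\<integral>\<^sup>+y.
        ennreal ((cmod (convolve (dilate \<phi> t) f y))\<^sup>2
                 * (t / (t + norm (x - y))) powr (real CARD('n) * \<mu>)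
                 / t ^ (CARD('n) + 1)) \<partial>lebesgue) \<partial>lebesgue)"

end

theory Submission
  imports Defs
begin

text \<open>Both square functions are sums over dyadic scales of local contributions. Divided by the
  square of the maximal averages over the coarser scales only, these contributions satisfy a Carleson
  packing condition on every cube, and the John--Nirenberg inequality turns packing into exponential
  integrability. This gives a tail \<open>exp (- \<alpha> s)\<close> for \<open>(S f)\<^sup>2 / (M f)\<^sup>2\<close>, that is \<open>exp (- \<alpha> t\<^sup>2)\<close>
  for \<open>S f / M f\<close>. Scales coarser than the given cube contribute at most a constant times \<open>(M f)\<^sup>2\<close>.

  For the dyadic square function the packing follows from a Bellman function argument along the dyadic
  tree. For the continuous one, fix \<open>t = \<tau> / 2 ^ j\<close> with \<open>\<tau>\<close> fixed and split the range of the maximal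
  averages into levels \<open>2 ^ m\<close>; below each level a Calderon--Zygmund decomposition reduces the estimate
  to the \<open>L\<^sup>2\<close> boundedness of the square function (almost orthogonality) and to the decay of the
  kernel off its scale. Moving the maximal averages from the integration point \<open>y\<close> to \<open>x\<close> costs twice
  an exponent larger than \<open>n\<close>, which the weight with exponent \<open>n \<mu>\<close> affords when \<open>\<mu> > 3\<close>.\<close>

section \<open>Half-open cubes and their bisection\<close>

text \<open>The maximal function cannot stay in the denominator: it depends on all scales, so the
  quotient is not even roughly constant on small cubes. The maximum over coarser averages is at most
  a constant times M f, so using it costs only a constant, and it changes slowly at the current
  scale. Hence a summand is comparable to its mean on a cube of its own generation, which is exactly
  what the exponential induction consumes; plain integrals over cubes are all it takes as input. In
  the continuous case these integrals stay bounded because the estimate below level l is linear in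
  l, namely l times the L1 norm, while the denominator contributes the inverse square of l. The
  levels double from the local average of |f| upwards, so the series of 1 / l is geometric and its
  first term turns the L1 norm into the volume of the cube. The squared convolution itself is not
  comparable at neighbouring points, since it may vanish at one of them; the polynomial weight of
  the square function supplies the averaging that restores comparability.\<close>

definition cube :: "real^'n \<Rightarrow> real \<Rightarrow> (real^'n) set" where
  "cube v r = {x. \<forall>i. v $ i \<le> x $ i \<and> x $ i < v $ i + r}"

text \<open>The set \<open>s\<close> lists the coordinates in which the upper half is taken, so the
  2^n children are indexed by the whole type \<open>'n set\<close>.\<close>

definition child :: "real^'n \<Rightarrow> real \<Rightarrow> 'n set \<Rightarrow> real^'n" where
  "child v r s = v + (r / 2) *\<^sub>R (\<chi> i. if i \<in> s then 1 else 0)"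

lemma child_nth: "child v r s $ i = v $ i + (if i \<in> s then r / 2 else 0)"
  by (simp add: child_def)

lemma cube_sets [measurable]: "cube v r \<in> sets borel"
proof -
  have "cube v r = {x \<in> space borel. \<forall>i. v $ i \<le> x $ i \<and> x $ i < v $ i + r}"
    by (simp add: cube_def)
  also have "\<dots> \<in> sets borel" by measurable
  finally show ?thesis .
qed

lemma cube_subset_cbox: "cube v r \<subseteq> cbox v (v + (\<chi> i. r))"
  by (auto simp: cube_def mem_box_cart less_imp_le)

lemma box_subset_cube: "box v (v + (\<chi> i. r)) \<subseteq> cube v r"
  by (auto simp: cube_def mem_box_cart less_imp_le)

lemma Basis_cart: "(Basis :: (real^'n) set) = range (\<lambda>i. axis i 1)"
  by (auto simp: Basis_vec_def)

lemma prod_Basis_const: "(\<Prod>b\<in>(Basis :: (real^'n) set). (\<chi> i. r) \<bullet> b) = r ^ CARD('n)"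
proof -
  have "(\<Prod>b\<in>(Basis :: (real^'n) set). (\<chi> i. r) \<bullet> b) = (\<Prod>b\<in>(Basis :: (real^'n) set). r)"
    by (intro prod.cong) (auto simp: Basis_cart inner_axis)
  then show ?thesis by simp
qed

lemma Basis_cart_nonneg: "b \<in> (Basis :: (real^'n) set) \<Longrightarrow> r \<ge> 0 \<Longrightarrow> 0 \<le> (\<chi> i. r) \<bullet> b"
  by (auto simp: Basis_cart inner_axis)

lemma emeasure_cbox_const:
  assumes "r \<ge> 0"
  shows "emeasure lborel (cbox v (v + (\<chi> i. r)) :: (real^'n) set) = ennreal (r ^ CARD('n))"
  using assms
  by (subst emeasure_lborel_cbox) (auto simp: prod_Basis_const inner_add_left Basis_cart_nonneg)

lemma emeasure_box_const:
  assumes "r \<ge> 0"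
  shows "emeasure lborel (box v (v + (\<chi> i. r)) :: (real^'n) set) = ennreal (r ^ CARD('n))"
  using assms
  by (subst emeasure_lborel_box) (auto simp: prod_Basis_const inner_add_left Basis_cart_nonneg)

lemma emeasure_cube:
  assumes "r \<ge> 0"
  shows "emeasure lborel (cube v r :: (real^'n) set) = ennreal (r ^ CARD('n))"
  using emeasure_mono[OF cube_subset_cbox[of v r], of lborel]
    emeasure_mono[OF box_subset_cube[of v r], of lborel]
  by (simp add: emeasure_cbox_const emeasure_box_const assms)

lemma measure_cube: "r \<ge> 0 \<Longrightarrow> measure lborel (cube v r :: (real^'n) set) = r ^ CARD('n)"
  by (simp add: measure_def emeasure_cube)

lemma cube_disj:
  assumes "x \<in> cube (child v r s) (r / 2)" "x \<in> cube (child v r s') (r / 2)" "r > 0"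
  shows "s = s'"
proof -
  have "i \<in> s \<longleftrightarrow> i \<in> s'" for i
    using assms(1,2)[unfolded cube_def mem_Collect_eq child_nth, THEN spec[of _ i]] assms(3)
    by (auto split: if_splits)
  then show ?thesis by auto
qed

lemma child_subset: "r > 0 \<Longrightarrow> cube (child v r s) (r / 2) \<subseteq> cube v r"
proof
  fix x assume r: "r > 0" and x: "x \<in> cube (child v r s) (r / 2)"
  have "v $ i \<le> x $ i \<and> x $ i < v $ i + r" for i
    using x[unfolded cube_def mem_Collect_eq child_nth, THEN spec[of _ i]] r
    by (auto split: if_splits)
  then show "x \<in> cube v r" by (simp add: cube_def)
qed

lemma cube_ex_child:
  assumes "x \<in> cube v r"
  shows "\<exists>s. x \<in> cube (child v r s) (r / 2)"
proof -
  have "x \<in> cube (child v r {i. x $ i \<ge> v $ i + r / 2}) (r / 2)"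
    using assms unfolding cube_def mem_Collect_eq child_nth
    by (smt (verit) field_sum_of_halves mem_Collect_eq)
  then show ?thesis by blast
qed

lemma indicator_cube_split:
  fixes v :: "real^'n"
  assumes "r > 0"
  shows "indicator (cube v r) x =
    (\<Sum>s\<in>UNIV. indicator (cube (child v r s) (r / 2)) x :: 'b :: {comm_monoid_add, zero_neq_one})"
proof (cases "x \<in> cube v r")
  case True
  then obtain s where s: "x \<in> cube (child v r s) (r / 2)" using cube_ex_child by blast
  have *: "x \<in> cube (child v r t) (r / 2) \<longleftrightarrow> t = s" for t
    using s cube_disj[OF s _ assms] by blast
  have "(\<Sum>s\<in>UNIV. indicator (cube (child v r s) (r / 2)) x :: 'b) =
      (\<Sum>t\<in>UNIV. if t = s then 1 else 0)"
    by (intro sum.cong) (simp_all add: indicator_def *)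
  then show ?thesis using True by simp
next
  case False
  then have "\<And>s. x \<notin> cube (child v r s) (r / 2)"
    using child_subset[OF assms] by blast
  then show ?thesis using False by simp
qed

lemma nn_integral_cube_split:
  fixes h :: "real^'n \<Rightarrow> ennreal"
  assumes "r > 0" and [measurable]: "h \<in> borel_measurable borel"
  shows "(\<integral>\<^sup>+x\<in>cube v r. h x \<partial>lborel) =
    (\<Sum>s\<in>UNIV. \<integral>\<^sup>+x\<in>cube (child v r s) (r / 2). h x \<partial>lborel)"
  by (subst nn_integral_sum[symmetric])
     (auto simp: indicator_cube_split[OF assms(1), of v] sum_distrib_left)

lemma integral_cube_split:
  fixes h :: "real^'n \<Rightarrow> real"
  assumes "r > 0" and "integrable lborel h"
  shows "(LINT x:cube v r|lborel. h x) =
    (\<Sum>s\<in>UNIV. LINT x:cube (child v r s) (r / 2)|lborel. h x)"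
proof -
  have "(\<Sum>s\<in>UNIV. LINT x:cube (child v r s) (r / 2)|lborel. h x) =
      (LINT x|lborel. (\<Sum>s\<in>UNIV. indicator (cube (child v r s) (r / 2)) x *\<^sub>R h x))"
    unfolding set_lebesgue_integral_def
    by (intro Bochner_Integration.integral_sum[symmetric] integrable_mult_indicator assms) simp
  then show ?thesis
    unfolding set_lebesgue_integral_def indicator_cube_split[OF assms(1), of v] scaleR_left.sum
    by simp
qed

lemma card_UNIV_subsets: "card (UNIV :: 'n::finite set set) = 2 ^ CARD('n)"
  by (metis Pow_UNIV card_Pow finite)

lemma sum_measure_children:
  fixes r :: real
  shows "(\<Sum>s\<in>(UNIV :: 'n::finite set set). (r / 2) ^ CARD('n)) = r ^ CARD('n)"
  by (simp add: card_UNIV_subsets power_divide)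

section \<open>Diameters and separation of cubes\<close>

lemma norm_diff_cube:
  fixes z z' u :: "real^'n"
  assumes "z \<in> cube u \<rho>" "z' \<in> cube u \<rho>"
  shows "norm (z - z') \<le> real CARD('n) * \<rho>"
proof -
  have "norm (z - z') \<le> (\<Sum>i\<in>UNIV. \<bar>(z - z') $ i\<bar>)" by (rule norm_le_l1_cart)
  also have "\<dots> \<le> (\<Sum>i\<in>(UNIV::'n set). \<rho>)"
  proof (rule sum_mono)
    fix i
    have "u $ i \<le> z $ i \<and> z $ i < u $ i + \<rho>" "u $ i \<le> z' $ i \<and> z' $ i < u $ i + \<rho>"
      using assms by (auto simp: cube_def)
    then have "\<bar>z $ i - z' $ i\<bar> \<le> \<rho>" by linarith
    then show "\<bar>(z - z') $ i\<bar> \<le> \<rho>" by simp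
  qed
  finally show ?thesis by simp
qed

text \<open>The cube of side \<open>4 * r\<close> is concentric with \<open>cube v r\<close>, which
  leaves a margin of \<open>3/2 * r\<close> on each side. The factor 4 is a power of two, so the
  enlarged cube is again accessible to repeated bisection.\<close>

lemma far_from_cube:
  fixes v y z :: "real^'n"
  assumes r: "r > 0" and y: "y \<in> cube v r" and z: "z \<notin> cube (v - (\<chi> i. 3/2 * r)) (4 * r)"
  shows "norm (y - z) \<ge> r"
proof -
  let ?v' = "v - (\<chi> i. 3/2 * r)"
  have nth: "?v' $ i = v $ i - 3/2 * r" for i by simp
  obtain i where i: "\<not> (?v' $ i \<le> z $ i \<and> z $ i < ?v' $ i + 4 * r)"
    using z by (auto simp: cube_def)
  have "v $ i \<le> y $ i" "y $ i < v $ i + r" using y by (auto simp: cube_def)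
  with i have "\<bar>y $ i - z $ i\<bar> \<ge> r" using r unfolding nth by linarith
  then have "\<bar>(y - z) $ i\<bar> \<ge> r" by simp
  then show ?thesis using component_le_norm_cart[of "y - z" i] by linarith
qed

section \<open>The John--Nirenberg inequality for Carleson sums\<close>

text \<open>By downward induction on the scale: the additive Carleson sum on the right pays for the
  factor \<open>exp (\<alpha> * B k x)\<close>, which is nearly constant on a cube of generation \<open>k\<close>.\<close>

lemma John_Nirenberg:
  fixes B :: "nat \<Rightarrow> real^'n \<Rightarrow> real" and I :: "nat \<Rightarrow> real^'n \<Rightarrow> bool"
  assumes r0: "r0 > 0" and C0: "C0 > 0" and C1: "C1 \<ge> 0"
    and [measurable]: "\<And>k. B k \<in> borel_measurable borel"
    and nonneg: "\<And>k x. B k x \<ge> 0"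
    and I: "\<And>k v s. I k v \<Longrightarrow> I (Suc k) (child v (r0 / 2 ^ k) s)"
    and harnack: "\<And>k v x y. I k v \<Longrightarrow> x \<in> cube v (r0 / 2 ^ k) \<Longrightarrow> y \<in> cube v (r0 / 2 ^ k)
        \<Longrightarrow> B k x \<le> C0 * B k y"
    and carleson: "\<And>k v. I k v \<Longrightarrow>
        (\<integral>\<^sup>+x\<in>cube v (r0 / 2 ^ k). ennreal (\<Sum>j\<in>{k..<N}. B j x) \<partial>lborel)
          \<le> ennreal (C1 * (r0 / 2 ^ k) ^ CARD('n))"
    and al: "\<alpha> = 1 / (2 * C0 * (1 + C1))"
    and "I k v"
  shows "(\<integral>\<^sup>+x\<in>cube v (r0 / 2 ^ k). ennreal (exp (\<alpha> * (\<Sum>j\<in>{k..<N}. B j x))) \<partial>lborel)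
    \<le> ennreal ((r0 / 2 ^ k) ^ CARD('n)) +
       (\<integral>\<^sup>+x\<in>cube v (r0 / 2 ^ k). ennreal (\<Sum>j\<in>{k..<N}. B j x) \<partial>lborel)"
  using \<open>I k v\<close>
proof (induction "N - k" arbitrary: k v)
  case 0
  then show ?case using r0 by (simp add: emeasure_cube)
next
  case (Suc m)
  define r where "r = r0 / 2 ^ k"
  have r: "r > 0" using r0 by (simp add: r_def)
  have kN: "k < N" and m: "m = N - Suc k" using Suc.hyps(2) by auto
  have r2: "r0 / 2 ^ Suc k = r / 2" by (simp add: r_def)
  define P where "P = cube v r"
  have P[measurable]: "P \<in> sets borel" by (simp add: P_def)
  have eP: "emeasure lborel P = ennreal (r ^ CARD('n))"
    using r by (simp add: P_def emeasure_cube)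
  define S where "S x = (\<Sum>j\<in>{Suc k..<N}. B j x)" for x
  have S[measurable]: "S \<in> borel_measurable borel" unfolding S_def by measurable
  have S0: "S x \<ge> 0" for x unfolding S_def by (simp add: sum_nonneg nonneg)
  have split: "(\<Sum>j\<in>{k..<N}. B j x) = B k x + S x" for x
    unfolding S_def using kN by (simp add: sum.atLeast_Suc_lessThan)
  have IH: "(\<integral>\<^sup>+x\<in>P. ennreal (exp (\<alpha> * S x)) \<partial>lborel)
      \<le> ennreal (r ^ CARD('n)) + (\<integral>\<^sup>+x\<in>P. ennreal (S x) \<partial>lborel)"
  proof -
    have "(\<integral>\<^sup>+x\<in>P. ennreal (exp (\<alpha> * S x)) \<partial>lborel)
      = (\<Sum>s\<in>UNIV. \<integral>\<^sup>+x\<in>cube (child v r s) (r / 2). ennreal (exp (\<alpha> * S x)) \<partial>lborel)"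
      unfolding P_def by (rule nn_integral_cube_split[OF r]) measurable
    also have "\<dots> \<le> (\<Sum>s\<in>(UNIV::'n set set). ennreal ((r / 2) ^ CARD('n)) +
        (\<integral>\<^sup>+x\<in>cube (child v r s) (r / 2). ennreal (S x) \<partial>lborel))"
    proof (rule sum_mono)
      fix s :: "'n set"
      have "I (Suc k) (child v r s)" using I[OF Suc.prems] by (simp add: r_def)
      from Suc.hyps(1)[OF m this]
      show "(\<integral>\<^sup>+x\<in>cube (child v r s) (r / 2). ennreal (exp (\<alpha> * S x)) \<partial>lborel)
        \<le> ennreal ((r / 2) ^ CARD('n)) +
           (\<integral>\<^sup>+x\<in>cube (child v r s) (r / 2). ennreal (S x) \<partial>lborel)"
        unfolding r2 S_def .
    qed
    also have "\<dots> = (\<Sum>s\<in>(UNIV::'n set set). ennreal ((r / 2) ^ CARD('n))) +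
        (\<Sum>s\<in>(UNIV::'n set set). \<integral>\<^sup>+x\<in>cube (child v r s) (r / 2). ennreal (S x) \<partial>lborel)"
      by (rule sum.distrib)
    also have "(\<Sum>s\<in>(UNIV::'n set set). ennreal ((r / 2) ^ CARD('n))) = ennreal (r ^ CARD('n))"
      using r by (subst sum_ennreal) (auto simp only: sum_measure_children, auto)
    also have "(\<Sum>s\<in>(UNIV::'n set set). \<integral>\<^sup>+x\<in>cube (child v r s) (r / 2). ennreal (S x) \<partial>lborel)
       = (\<integral>\<^sup>+x\<in>P. ennreal (S x) \<partial>lborel)"
      unfolding P_def by (rule nn_integral_cube_split[OF r, symmetric]) measurable
    finally show ?thesis .
  qed
  have totfin: "(\<integral>\<^sup>+x\<in>P. ennreal (B k x) \<partial>lborel) + (\<integral>\<^sup>+x\<in>P. ennreal (S x) \<partial>lborel)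
      \<le> ennreal (C1 * r ^ CARD('n))" (is "?Y + ?X \<le> _")
  proof -
    have "?Y + ?X = (\<integral>\<^sup>+x\<in>P. ennreal (\<Sum>j\<in>{k..<N}. B j x) \<partial>lborel)"
      unfolding split
      by (subst nn_integral_add[symmetric]) (auto simp: ennreal_plus nonneg S0 distrib_right)
    then show ?thesis using carleson[OF Suc.prems] by (simp add: P_def r_def)
  qed
  define X where "X = enn2real ?X"
  define Y where "Y = enn2real ?Y"
  have rn: "r ^ CARD('n) > 0" using r by simp
  have fin: "?X < \<infinity>" "?Y < \<infinity>"
    using totfin by (auto simp: less_top[symmetric] top_unique)
  have X: "?X = ennreal X" and Y: "?Y = ennreal Y" and XY0: "X \<ge> 0" "Y \<ge> 0"
    using fin by (auto simp: X_def Y_def)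
  have "ennreal (Y + X) \<le> ennreal (C1 * r ^ CARD('n))"
    using totfin X Y XY0 by (simp add: ennreal_plus)
  then have XYle: "Y + X \<le> C1 * r ^ CARD('n)" using C1 rn by (simp add: ennreal_le_iff)
  \<comment> \<open>Harnack bounds \<open>B k\<close> everywhere on the cube by \<open>C0\<close>
    times its mean \<open>Y / r ^ n\<close>; this constant can then be pulled out of the integral of
    the exponential.\<close>
  define a where "a = C0 * Y / r ^ CARD('n)"
  have a0: "a \<ge> 0" using C0 XY0 rn by (simp add: a_def)
  have Bk: "B k x \<le> a" if "x \<in> P" for x
  proof -
    have "ennreal (B k x) * emeasure lborel P = (\<integral>\<^sup>+y\<in>P. ennreal (B k x) \<partial>lborel)"
      by (simp add: nn_integral_cmult_indicator)
    also have "\<dots> \<le> (\<integral>\<^sup>+y. ennreal C0 * (ennreal (B k y) * indicator P y) \<partial>lborel)"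
    proof (intro nn_integral_mono)
      fix y
      show "ennreal (B k x) * indicator P y \<le> ennreal C0 * (ennreal (B k y) * indicator P y)"
        using harnack[OF Suc.prems, of x y] that C0 nonneg
        by (auto simp: indicator_def P_def r_def ennreal_mult[symmetric] intro!: ennreal_leI)
    qed
    also have "\<dots> = ennreal (C0 * Y)"
      using C0 XY0 by (subst nn_integral_cmult) (auto simp: Y ennreal_mult)
    finally have "B k x * r ^ CARD('n) \<le> C0 * Y"
      unfolding eP using nonneg C0 XY0 rn by (simp add: ennreal_mult[symmetric])
    then show ?thesis using rn by (simp add: a_def pos_le_divide_eq)
  qed
  have alpos: "\<alpha> > 0" using C0 C1 by (simp add: al)
  have "(\<integral>\<^sup>+x\<in>P. ennreal (exp (\<alpha> * (\<Sum>j\<in>{k..<N}. B j x))) \<partial>lborel)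
     \<le> (\<integral>\<^sup>+x. ennreal (exp (\<alpha> * a)) * (ennreal (exp (\<alpha> * S x)) * indicator P x) \<partial>lborel)"
  proof (intro nn_integral_mono)
    fix x
    show "ennreal (exp (\<alpha> * (\<Sum>j\<in>{k..<N}. B j x))) * indicator P x
      \<le> ennreal (exp (\<alpha> * a)) * (ennreal (exp (\<alpha> * S x)) * indicator P x)"
      using Bk[of x] alpos
      by (auto simp: indicator_def split distrib_left exp_add ennreal_mult[symmetric]
          intro!: ennreal_leI)
  qed
  also have "\<dots> = ennreal (exp (\<alpha> * a)) * (\<integral>\<^sup>+x\<in>P. ennreal (exp (\<alpha> * S x)) \<partial>lborel)"
    by (rule nn_integral_cmult) measurable
  also have "\<dots> \<le> ennreal (exp (\<alpha> * a)) * (ennreal (r ^ CARD('n)) + ennreal X)"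
    using IH unfolding X by (rule mult_left_mono) simp
  also have "\<dots> = ennreal (exp (\<alpha> * a) * (r ^ CARD('n) + X))"
    using XY0 rn by (simp add: ennreal_mult ennreal_plus)
  \<comment> \<open>The choice of \<alpha> enters here: since \<open>\<alpha> * a\<close> is at most
    1, exp x is at most 1 + 2 x, and the excess \<open>2 * (\<alpha> * a)\<close> times
    \<open>(1 + C1) * r ^ n\<close> is exactly \<open>Y\<close>, the mass of generation
    \<open>k\<close>.\<close>
  also have "\<dots> \<le> ennreal (r ^ CARD('n) + (Y + X))"
  proof (rule ennreal_leI)
    have "a \<le> C0 * C1"
      using XYle XY0 C0 rn unfolding a_def by (simp add: pos_divide_le_eq algebra_simps)
    then have "\<alpha> * a \<le> \<alpha> * (C0 * C1)" using alpos by simp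
    also have "\<dots> \<le> 1" using C0 C1 unfolding al by (simp add: field_simps add_pos_nonneg)
    finally have a1: "\<alpha> * a \<le> 1" .
    have aa: "\<alpha> * a \<ge> 0" using alpos a0 by simp
    have e: "exp (\<alpha> * a) \<le> 1 + 2 * (\<alpha> * a)"
    proof -
      have "exp (\<alpha> * a) \<le> 1 + \<alpha> * a + (\<alpha> * a)\<^sup>2" using exp_bound[OF aa a1] .
      also have "(\<alpha> * a)\<^sup>2 \<le> \<alpha> * a"
        using aa a1 by (simp add: power2_eq_square mult_left_le)
      finally show ?thesis by simp
    qed
    have "exp (\<alpha> * a) * (r ^ CARD('n) + X) \<le> (1 + 2 * (\<alpha> * a)) * (r ^ CARD('n) + X)"
      using e rn XY0 by (intro mult_right_mono) auto
    also have "\<dots> = r ^ CARD('n) + X + 2 * (\<alpha> * a) * (r ^ CARD('n) + X)"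
      by (simp add: algebra_simps)
    also have "2 * (\<alpha> * a) * (r ^ CARD('n) + X)
        \<le> 2 * (\<alpha> * a) * (r ^ CARD('n) + C1 * r ^ CARD('n))"
      using XYle XY0 aa by (intro mult_left_mono) auto
    also have "\<dots> = Y"
    proof -
      have "1 + C1 \<noteq> 0" "C0 \<noteq> 0" "r ^ CARD('n) \<noteq> 0" using C0 C1 r by auto
      then show ?thesis unfolding al a_def by (simp add: divide_simps) (simp add: algebra_simps)
    qed
    finally show "exp (\<alpha> * a) * (r ^ CARD('n) + X) \<le> r ^ CARD('n) + (Y + X)" by simp
  qed
  also have "\<dots> = ennreal (r ^ CARD('n)) + (?Y + ?X)"
    using XY0 rn by (simp add: X Y ennreal_plus)
  also have "?Y + ?X = (\<integral>\<^sup>+x\<in>P. ennreal (\<Sum>j\<in>{k..<N}. B j x) \<partial>lborel)"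
    unfolding split
    by (subst nn_integral_add[symmetric]) (auto simp: ennreal_plus nonneg S0 distrib_right)
  finally show ?case by (simp add: P_def r_def)
qed

text \<open>Chebyshev's inequality for the exponential integral over the top cube. The bound does
  not depend on \<open>N\<close>, so it survives the increasing union over \<open>N\<close>, which
  stands for the event that the full sum exceeds \<open>s\<close>.\<close>

lemma John_Nirenberg_tail:
  fixes B :: "nat \<Rightarrow> real^'n \<Rightarrow> real" and I :: "nat \<Rightarrow> real^'n \<Rightarrow> bool"
  assumes r0: "r0 > 0" and C0: "C0 > 0" and C1: "C1 \<ge> 0"
    and [measurable]: "\<And>k. B k \<in> borel_measurable borel"
    and nonneg: "\<And>k x. B k x \<ge> 0"
    and I: "\<And>k v s. I k v \<Longrightarrow> I (Suc k) (child v (r0 / 2 ^ k) s)"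
    and harnack: "\<And>k v x y. I k v \<Longrightarrow> x \<in> cube v (r0 / 2 ^ k) \<Longrightarrow> y \<in> cube v (r0 / 2 ^ k)
        \<Longrightarrow> B k x \<le> C0 * B k y"
    and carleson: "\<And>k v N. I k v \<Longrightarrow>
        (\<integral>\<^sup>+x\<in>cube v (r0 / 2 ^ k). ennreal (\<Sum>j\<in>{k..<N}. B j x) \<partial>lborel)
          \<le> ennreal (C1 * (r0 / 2 ^ k) ^ CARD('n))"
    and al: "\<alpha> = 1 / (2 * C0 * (1 + C1))"
    and v: "I 0 v"
  shows "emeasure lborel {x \<in> cube v r0. \<exists>N. (\<Sum>j<N. B j x) > s}
    \<le> ennreal ((1 + C1) * exp (- \<alpha> * s) * r0 ^ CARD('n))"
proof -
  have alpos: "\<alpha> > 0" using C0 C1 by (simp add: al)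
  define E where "E N = {x \<in> cube v r0. (\<Sum>j<N. B j x) > s}" for N
  have E[measurable]: "E N \<in> sets borel" for N
  proof -
    have "E N = {x \<in> space borel. x \<in> cube v r0 \<and> (\<Sum>j<N. B j x) > s}" by (simp add: E_def)
    also have "\<dots> \<in> sets borel" by measurable
    finally show ?thesis .
  qed
  have bound: "emeasure lborel (E N) \<le> ennreal ((1 + C1) * exp (- \<alpha> * s) * r0 ^ CARD('n))" for N
  proof -
    have "(\<integral>\<^sup>+x\<in>cube v (r0 / 2 ^ 0). ennreal (exp (\<alpha> * (\<Sum>j\<in>{0..<N}. B j x))) \<partial>lborel)
      \<le> ennreal ((r0 / 2 ^ 0) ^ CARD('n)) +
         (\<integral>\<^sup>+x\<in>cube v (r0 / 2 ^ 0). ennreal (\<Sum>j\<in>{0..<N}. B j x) \<partial>lborel)"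
      by (rule John_Nirenberg[of r0 C0 C1 B I N, OF assms(1-8) al v])
    also have "\<dots> \<le> ennreal ((r0 / 2 ^ 0) ^ CARD('n)) + ennreal (C1 * (r0 / 2 ^ 0) ^ CARD('n))"
      by (intro add_left_mono carleson v)
    also have "\<dots> = ennreal ((1 + C1) * r0 ^ CARD('n))"
      using r0 C1 by (simp add: ennreal_plus[symmetric] algebra_simps del: ennreal_plus)
    finally have ub: "(\<integral>\<^sup>+x\<in>cube v r0. ennreal (exp (\<alpha> * (\<Sum>j<N. B j x))) \<partial>lborel)
      \<le> ennreal ((1 + C1) * r0 ^ CARD('n))" by (simp add: atLeast0LessThan)
    have "ennreal (exp (\<alpha> * s)) * emeasure lborel (E N)
        = (\<integral>\<^sup>+x\<in>E N. ennreal (exp (\<alpha> * s)) \<partial>lborel)"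
      by (simp add: nn_integral_cmult_indicator)
    also have "\<dots> \<le> (\<integral>\<^sup>+x\<in>cube v r0. ennreal (exp (\<alpha> * (\<Sum>j<N. B j x))) \<partial>lborel)"
      using alpos by (intro nn_integral_mono) (auto simp: indicator_def E_def intro!: ennreal_leI)
    finally have "ennreal (exp (\<alpha> * s)) * emeasure lborel (E N) \<le> ennreal ((1 + C1) * r0 ^ CARD('n))"
      using ub by (rule order_trans)
    then have "ennreal (exp (- \<alpha> * s)) * (ennreal (exp (\<alpha> * s)) * emeasure lborel (E N))
      \<le> ennreal (exp (- \<alpha> * s)) * ennreal ((1 + C1) * r0 ^ CARD('n))"
      by (rule mult_left_mono) simp
    moreover have "ennreal (exp (- \<alpha> * s)) * (ennreal (exp (\<alpha> * s)) * emeasure lborel (E N))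
        = emeasure lborel (E N)"
      by (simp add: mult.assoc[symmetric] ennreal_mult[symmetric] exp_add[symmetric])
    moreover have "ennreal (exp (- \<alpha> * s)) * ennreal ((1 + C1) * r0 ^ CARD('n))
        = ennreal ((1 + C1) * exp (- \<alpha> * s) * r0 ^ CARD('n))"
      using C1 r0 by (simp add: ennreal_mult[symmetric] mult_ac)
    ultimately show ?thesis by simp
  qed
  have mono: "(\<Sum>j<N. B j x) \<le> (\<Sum>j<M. B j x)" if "N \<le> M" for N M x
    using that nonneg by (intro sum_mono2) auto
  have "incseq E"
    unfolding incseq_def E_def using less_le_trans[OF _ mono] by blast
  then have "emeasure lborel (\<Union>N. E N) = (SUP N. emeasure lborel (E N))"
    by (intro SUP_emeasure_incseq[symmetric]) auto
  also have "\<dots> \<le> ennreal ((1 + C1) * exp (- \<alpha> * s) * r0 ^ CARD('n))"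
    by (intro SUP_least bound)
  also have "(\<Union>N. E N) = {x \<in> cube v r0. \<exists>N. (\<Sum>j<N. B j x) > s}"
    by (auto simp: E_def)
  finally show ?thesis .
qed

section \<open>Averages over half-open cubes\<close>

definition cube_avg :: "(real^'n \<Rightarrow> real) \<Rightarrow> real^'n \<Rightarrow> real \<Rightarrow> real" where
  "cube_avg f v r = (1 / r ^ CARD('n)) * (LINT x:cube v r|lborel. f x)"

lemma cube_avg_split:
  fixes f :: "real^'n \<Rightarrow> real"
  assumes "integrable lborel f" "r > 0"
  shows "(\<Sum>s\<in>UNIV. cube_avg f (child v r s) (r / 2)) = 2 ^ CARD('n) * cube_avg f v r"
  using assms
  by (simp add: cube_avg_def integral_cube_split[of r f v] sum_distrib_left sum_divide_distrib power_divide)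

lemma set_integrable_cube:
  "integrable lborel f \<Longrightarrow> set_integrable lborel (cube v r) (f :: real^'n \<Rightarrow> real)"
  unfolding set_integrable_def by (rule integrable_mult_indicator) auto

lemma cube_avg_abs_nonneg: "r > 0 \<Longrightarrow> cube_avg (\<lambda>x. \<bar>f x\<bar>) v r \<ge> 0"
  by (simp add: cube_avg_def set_lebesgue_integral_def)

lemma cube_avg_abs_le:
  assumes "integrable lborel f" "r > 0"
  shows "\<bar>cube_avg f v r\<bar> \<le> cube_avg (\<lambda>x. \<bar>f x\<bar>) v r"
proof -
  have "\<bar>LINT x:cube v r|lborel. f x\<bar> \<le> (LINT x:cube v r|lborel. \<bar>f x\<bar>)"
    using set_integral_norm_bound[OF set_integrable_cube[OF assms(1)], of v r] by simp
  then show ?thesis using assms(2)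
    by (simp add: cube_avg_def abs_mult divide_right_mono)
qed

text \<open>A single term of a nonnegative sum: the children's averages of |f| add up to 2^n times
  the parent's.\<close>

lemma cube_avg_child_le:
  fixes f :: "real^'n \<Rightarrow> real"
  assumes "integrable lborel f" "r > 0"
  shows "cube_avg (\<lambda>x. \<bar>f x\<bar>) (child v r s) (r / 2) \<le> 2 ^ CARD('n) * cube_avg (\<lambda>x. \<bar>f x\<bar>) v r"
proof -
  have "cube_avg (\<lambda>x. \<bar>f x\<bar>) (child v r s) (r / 2)
     \<le> (\<Sum>s\<in>UNIV. cube_avg (\<lambda>x. \<bar>f x\<bar>) (child v r s) (r / 2))"
    using assms by (intro member_le_sum) (auto simp: cube_avg_abs_nonneg)
  also have "\<dots> = 2 ^ CARD('n) * cube_avg (\<lambda>x. \<bar>f x\<bar>) v r"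
    using assms by (intro cube_avg_split) auto
  finally show ?thesis .
qed

section \<open>The dyadic square function along the dyadic tree\<close>

text \<open>The lower corner of the cell of the lattice \<sigma> Z^n that contains \<open>x\<close>.
  Equality of corners is thus the relation of lying in the same cell, and this equality replaces
  membership in cubes throughout the dyadic part.\<close>

definition dcorner :: "real \<Rightarrow> real^'n \<Rightarrow> real^'n" where
  "dcorner \<sigma> x = (\<chi> i. \<sigma> * of_int \<lfloor>x $ i / \<sigma>\<rfloor>)"

lemma dcorner_eq_iff:
  assumes "\<sigma> > 0"
  shows "dcorner \<sigma> x = dcorner \<sigma> y \<longleftrightarrow> (\<forall>i. \<lfloor>x $ i / \<sigma>\<rfloor> = \<lfloor>y $ i / \<sigma>\<rfloor>)"
  using assms by (auto simp: dcorner_def vec_eq_iff)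

lemma mem_cube_lattice:
  assumes "\<sigma> > 0"
  shows "x \<in> cube (\<chi> i. \<sigma> * of_int (m i)) \<sigma> \<longleftrightarrow> (\<forall>i. \<lfloor>x $ i / \<sigma>\<rfloor> = m i)"
  using assms by (auto simp: cube_def floor_eq_iff field_simps)

lemma mem_cube_dcorner:
  "\<sigma> > 0 \<Longrightarrow> y \<in> cube (dcorner \<sigma> x) \<sigma> \<longleftrightarrow> dcorner \<sigma> y = dcorner \<sigma> x"
  unfolding dcorner_def[of \<sigma> x]
  by (subst mem_cube_lattice) (auto simp: dcorner_eq_iff dcorner_def[of \<sigma> x, symmetric])

lemma floor_half_div: "\<lfloor>(a::real) / 2\<rfloor> = \<lfloor>a\<rfloor> div 2"
  using floor_divide_real_eq_div[of 2 a] by simp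

text \<open>Cells are nested because the floor of half a number is determined by the floor of the
  number.\<close>

lemma dcorner_half:
  assumes "\<sigma> > 0" "dcorner (\<sigma> / 2) x = dcorner (\<sigma> / 2) y"
  shows "dcorner \<sigma> x = dcorner \<sigma> y"
proof -
  have "\<lfloor>z $ i / \<sigma>\<rfloor> = \<lfloor>z $ i / (\<sigma> / 2)\<rfloor> div 2" for z :: "real^'a" and i
    using floor_half_div[of "z $ i / (\<sigma> / 2)"] by simp
  then show ?thesis using assms by (simp add: dcorner_eq_iff)
qed

lemma dcorner_nested:
  assumes "r0 > 0" "j \<le> k" "dcorner (r0 / 2 ^ k) x = dcorner (r0 / 2 ^ k) y"
  shows "dcorner (r0 / 2 ^ j) x = dcorner (r0 / 2 ^ j) y"
  using assms(2,3)
proof (induction k rule: dec_induct)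
  case base
  then show ?case by simp
next
  case (step m)
  have "dcorner (r0 / 2 ^ m) x = dcorner (r0 / 2 ^ m) y"
    using dcorner_half[of "r0 / 2 ^ m" x y] step.prems assms(1) by (simp add: field_simps)
  then show ?case by (rule step.IH)
qed

locale dyadic_tree =
  fixes f :: "real^'n \<Rightarrow> real" and r0 :: real
  assumes f_int: "integrable lborel f" and r0: "r0 > 0"
begin

definition sc :: "nat \<Rightarrow> real" where "sc k = r0 / 2 ^ k"
definition F :: "nat \<Rightarrow> real^'n \<Rightarrow> real" where "F k x = cube_avg f (dcorner (sc k) x) (sc k)"
definition H :: "nat \<Rightarrow> real^'n \<Rightarrow> real" where "H k x = cube_avg (\<lambda>x. \<bar>f x\<bar>) (dcorner (sc k) x) (sc k)"
definition A :: "nat \<Rightarrow> real^'n \<Rightarrow> real" where "A k x = Max ((\<lambda>j. H j x) ` {..k})"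
text \<open>Generation 0 has no predecessor inside the tree and gets 0. For \<open>k > 0\<close>,
  where \<open>A k x\<close> vanishes both averages in the numerator vanish too, so the value 0 of
  the division loses nothing.\<close>

definition B :: "nat \<Rightarrow> real^'n \<Rightarrow> real" where
  "B k x = (if k = 0 then 0 else (F k x - F (k - 1) x)\<^sup>2 / (A k x)\<^sup>2)"

lemma sc_pos: "sc k > 0" using r0 by (simp add: sc_def)
lemma sc_Suc: "sc (Suc k) = sc k / 2" by (simp add: sc_def)

lemma f_borel [measurable]: "f \<in> borel_measurable borel"
  using borel_measurable_integrable[OF f_int] by simp

lemma B_nonneg: "B k x \<ge> 0" by (simp add: B_def)

text \<open>The cube moves with \<open>x\<close>, so membership is rewritten as equality of floors.
  This makes the integrand jointly measurable in \<open>(x, z)\<close>, and measurability of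
  parameter integrals applies.\<close>

lemma cube_avg_dcorner_measurable:
  fixes g :: "real^'n \<Rightarrow> real"
  assumes "\<sigma> > 0" and [measurable]: "g \<in> borel_measurable borel"
  shows "(\<lambda>x. cube_avg g (dcorner \<sigma> x) \<sigma>) \<in> borel_measurable borel"
proof -
  have "(\<lambda>x. LINT z|lborel. (if \<forall>i. \<lfloor>z $ i / \<sigma>\<rfloor> = \<lfloor>(x :: real^'n) $ i / \<sigma>\<rfloor> then g z else 0))
      \<in> borel_measurable borel"
  proof (rule lborel.borel_measurable_lebesgue_integral)
    have [measurable]: "(\<lambda>x :: real^'n. x $ i) \<in> borel_measurable borel" for i :: 'n
      by (intro borel_measurable_continuous_onI continuous_intros)
    show "(\<lambda>(x, z). if \<forall>i. \<lfloor>z $ i / \<sigma>\<rfloor> = \<lfloor>(x :: real^'n) $ i / \<sigma>\<rfloor> then g z else 0)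
       \<in> borel_measurable (borel \<Otimes>\<^sub>M lborel)"
      by measurable
  qed
  moreover have "(LINT z|lborel. (if \<forall>i. \<lfloor>z $ i / \<sigma>\<rfloor> = \<lfloor>x $ i / \<sigma>\<rfloor> then g z else 0))
     = (LINT z:cube (dcorner \<sigma> x) \<sigma>|lborel. g z)" for x
    unfolding set_lebesgue_integral_def
    by (intro Bochner_Integration.integral_cong)
       (auto simp: indicator_def mem_cube_dcorner[OF assms(1)] dcorner_eq_iff[OF assms(1)])
  ultimately show ?thesis unfolding cube_avg_def by simp
qed

lemma F_meas [measurable]: "F k \<in> borel_measurable borel"
  unfolding F_def[abs_def] by (rule cube_avg_dcorner_measurable[OF sc_pos]) simp
lemma H_meas [measurable]: "H k \<in> borel_measurable borel"
  unfolding H_def[abs_def] by (rule cube_avg_dcorner_measurable[OF sc_pos]) simp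
lemma A_meas [measurable]: "A k \<in> borel_measurable borel"
  unfolding A_def[abs_def] by measurable
lemma B_meas [measurable]: "B k \<in> borel_measurable borel"
  unfolding B_def[abs_def] by (cases k) auto

lemma H_nonneg: "H k x \<ge> 0" unfolding H_def by (rule cube_avg_abs_nonneg[OF sc_pos])
lemma F_le_H: "\<bar>F k x\<bar> \<le> H k x" unfolding F_def H_def by (rule cube_avg_abs_le[OF f_int sc_pos])
lemma H_le_A: "j \<le> k \<Longrightarrow> H j x \<le> A k x" unfolding A_def by (intro Max_ge) auto
lemma A_nonneg: "A k x \<ge> 0" using H_nonneg[of k x] H_le_A[of k k x] by simp
lemma A_Suc: "A (Suc k) x = max (A k x) (H (Suc k) x)"
  unfolding A_def by (simp add: atMost_Suc Max_insert max.commute)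

text \<open>Everything up to generation \<open>k\<close> is decided by the cell of generation
  \<open>k\<close>. The last part provides the Harnack hypothesis of the John--Nirenberg lemma with
  constant 1.\<close>

lemma const:
  assumes "dcorner (sc k) x = dcorner (sc k) y"
  shows "j \<le> k \<Longrightarrow> F j x = F j y" "j \<le> k \<Longrightarrow> H j x = H j y" "j \<le> k \<Longrightarrow> A j x = A j y" "B k x = B k y"
proof -
  have *: "dcorner (sc j) x = dcorner (sc j) y" if "j \<le> k" for j
    using dcorner_nested[OF r0 that] assms by (simp add: sc_def)
  show F: "F j x = F j y" if "j \<le> k" for j using *[OF that] by (simp add: F_def)
  show H: "H j x = H j y" if "j \<le> k" for j using *[OF that] by (simp add: H_def)
  show A: "A j x = A j y" if "j \<le> k" for j using H that by (simp add: A_def)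
  show "B k x = B k y" using F[of k] F[of "k - 1"] A[of k] by (simp add: B_def)
qed

text \<open>Restricts the John--Nirenberg induction to lattice cubes; on any other cube of the same
  side \<open>B k\<close> would see several cells and the Harnack hypothesis could fail.\<close>

definition I :: "nat \<Rightarrow> real^'n \<Rightarrow> bool" where "I k v \<longleftrightarrow> (\<exists>m :: 'n \<Rightarrow> int. v = (\<chi> i. sc k * of_int (m i)))"

lemma I_child:
  assumes "I k v"
  shows "I (Suc k) (child v (sc k) s)"
proof -
  obtain m :: "'n \<Rightarrow> int" where m: "v = (\<chi> i. sc k * of_int (m i))" using assms by (auto simp: I_def)
  have "child v (sc k) s = (\<chi> i. sc (Suc k) * of_int (2 * m i + (if i \<in> s then 1 else 0)))"
    by (auto simp: vec_eq_iff child_nth m sc_Suc algebra_simps)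
  then show ?thesis unfolding I_def by (intro exI[of _ "\<lambda>i. 2 * m i + (if i \<in> s then 1 else 0)"])
qed

lemma I_dcorner:
  assumes "I k v" "x \<in> cube v (sc k)"
  shows "dcorner (sc k) x = v"
proof -
  obtain m :: "'n \<Rightarrow> int" where m: "v = (\<chi> i. sc k * of_int (m i))" using assms by (auto simp: I_def)
  have "\<forall>i. \<lfloor>x $ i / sc k\<rfloor> = m i" using assms(2) unfolding m mem_cube_lattice[OF sc_pos] .
  then show ?thesis by (simp add: dcorner_def m)
qed

section \<open>The Bellman potential on the dyadic tree\<close>

lemma corner_mem: "r > 0 \<Longrightarrow> v \<in> cube v r" by (simp add: cube_def)

text \<open>When the running maximum \<open>A\<close> grows from \<open>a\<close> to \<open>h1\<close>, the potential \<open>F\<^sup>2 / A\<^sup>2\<close> may drop; the term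
  \<open>H / A\<close> with coefficient \<open>2 ^ n + 1\<close> compensates, because \<open>H\<close> grows by at most the factor \<open>2 ^ n\<close>
  from a cube to its children.\<close>

lemma bellman_step:
  fixes a :: real
  assumes "a > 0" "\<bar>f1\<bar> \<le> h1" "h1 \<le> 2 ^ CARD('n) * a" "a1 = max a h1"
  shows "(f1 - f0)\<^sup>2 / a1\<^sup>2 + (2 ^ CARD('n) + 1) * h1 / a1 - f1\<^sup>2 / a1\<^sup>2
     \<le> (f1 - f0)\<^sup>2 / a\<^sup>2 + (2 ^ CARD('n) + 1) * h1 / a - f1\<^sup>2 / a\<^sup>2"
proof (cases "h1 \<le> a")
  case True then show ?thesis using assms by (simp add: max_def)
next
  case False
  then have a1: "a1 = h1" and ha: "h1 > a" using assms by auto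
  have "(f1 - f0)\<^sup>2 / h1\<^sup>2 \<le> (f1 - f0)\<^sup>2 / a\<^sup>2"
    using ha assms by (intro divide_left_mono power_mono mult_pos_pos) auto
  moreover have "f1\<^sup>2 / a\<^sup>2 - f1\<^sup>2 / h1\<^sup>2 \<le> (2 ^ CARD('n) + 1) * h1 / a - (2 ^ CARD('n) + 1) * h1 / h1"
  proof -
    have h: "1 / a\<^sup>2 - 1 / h1\<^sup>2 \<ge> 0"
      using ha assms by (simp add: frac_le power_mono)
    have "f1\<^sup>2 / a\<^sup>2 - f1\<^sup>2 / h1\<^sup>2 = f1\<^sup>2 * (1 / a\<^sup>2 - 1 / h1\<^sup>2)" by (simp add: algebra_simps)
    also have "\<dots> \<le> h1\<^sup>2 * (1 / a\<^sup>2 - 1 / h1\<^sup>2)"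
      using h assms(2) by (intro mult_right_mono) (simp_all add: abs_le_square_iff[symmetric])
    also have "\<dots> = (h1 / a - 1) * (h1 / a + 1)"
      using assms(1) ha by (simp add: field_simps power2_eq_square)
    also have "\<dots> \<le> (h1 / a - 1) * (2 ^ CARD('n) + 1)"
    proof (rule mult_left_mono)
      show "h1 / a + 1 \<le> 2 ^ CARD('n) + 1" using assms(1,3) by (simp add: pos_divide_le_eq)
      show "0 \<le> h1 / a - 1" using assms(1) ha by simp
    qed
    also have "\<dots> = (2 ^ CARD('n) + 1) * h1 / a - (2 ^ CARD('n) + 1) * h1 / h1" using ha assms(1) by (simp add: left_diff_distrib)
    finally show ?thesis .
  qed
  ultimately show ?thesis unfolding a1 by linarith
qed

text \<open>After \<open>bellman_step\<close> all denominators are frozen at \<open>a\<close>. The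
  squares of \<open>fs s\<close> then cancel, and what remains is linear in \<open>fs s\<close> and
  \<open>hs s\<close>, whose sums over the children are known.\<close>

lemma bellman_sum:
  fixes fs hs :: "'n set \<Rightarrow> real"
  assumes "a \<ge> 0" "h \<le> a" "\<And>s. \<bar>fs s\<bar> \<le> hs s" "\<bar>f0\<bar> \<le> h"
    and sumf: "(\<Sum>s\<in>UNIV. fs s) = 2 ^ CARD('n) * f0"
    and sumh: "(\<Sum>s\<in>UNIV. hs s) = 2 ^ CARD('n) * h"
    and as: "\<And>s. as s = max a (hs s)"
  shows "(\<Sum>s\<in>UNIV. (fs s - f0)\<^sup>2 / (as s)\<^sup>2 + (1 + (2 ^ CARD('n) + 1) * hs s / as s - (fs s)\<^sup>2 / (as s)\<^sup>2))
     \<le> 2 ^ CARD('n) * (1 + (2 ^ CARD('n) + 1) * h / a - f0\<^sup>2 / a\<^sup>2)" (is "?L \<le> ?R")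
proof -
  have hs0: "hs s \<ge> 0" for s using assms(3)[of s] by linarith
  have hsle: "hs s \<le> 2 ^ CARD('n) * h" for s
    using member_le_sum[of s UNIV hs] hs0 by (simp add: sumh)
  show ?thesis
  proof (cases "a = 0")
    case True
    then have "h = 0" "f0 = 0" using assms by auto
    moreover from this have "hs s = 0" for s using hsle[of s] hs0[of s] by simp
    moreover from this have "fs s = 0" for s using assms(3)[of s] by simp
    ultimately show ?thesis using True by (simp add: card_UNIV_subsets)
  next
    case False
    then have a: "a > 0" using assms by simp
    have "?L \<le> (\<Sum>s\<in>UNIV. 1 + ((fs s - f0)\<^sup>2 / a\<^sup>2 + (2 ^ CARD('n) + 1) * hs s / a - (fs s)\<^sup>2 / a\<^sup>2))"
    proof (rule sum_mono)
      fix s :: "'n set"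
      have "hs s \<le> 2 ^ CARD('n) * a"
        by (rule order_trans[OF hsle[of s]], rule mult_left_mono[OF assms(2)]) simp
      from bellman_step[OF a assms(3) this as, of f0]
      show "(fs s - f0)\<^sup>2 / (as s)\<^sup>2 + (1 + (2 ^ CARD('n) + 1) * hs s / as s - (fs s)\<^sup>2 / (as s)\<^sup>2)
        \<le> 1 + ((fs s - f0)\<^sup>2 / a\<^sup>2 + (2 ^ CARD('n) + 1) * hs s / a - (fs s)\<^sup>2 / a\<^sup>2)" by linarith
    qed
    also have "\<dots> = (\<Sum>s\<in>UNIV. (1 + f0\<^sup>2 / a\<^sup>2) - (2 * f0 / a\<^sup>2) * fs s + ((2 ^ CARD('n) + 1) / a) * hs s)"
      using a by (intro sum.cong) (auto simp: power2_eq_square field_simps)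
    also have "\<dots> = 2 ^ CARD('n) * (1 + f0\<^sup>2 / a\<^sup>2) - (2 * f0 / a\<^sup>2) * (2 ^ CARD('n) * f0) +
        ((2 ^ CARD('n) + 1) / a) * (2 ^ CARD('n) * h)"
      by (simp only: sum.distrib sum_subtractf sum_distrib_left[symmetric] sumf sumh sum_constant
        card_UNIV_subsets of_nat_power of_nat_numeral distrib_left mult_1_right)
    also have "\<dots> = ?R" using a by (simp add: field_simps power2_eq_square)
    finally show ?thesis .
  qed
qed

lemma ennreal_aux:
  "b \<ge> 0 \<Longrightarrow> q \<ge> 0 \<Longrightarrow> p \<ge> 0 \<Longrightarrow> ennreal b * ennreal p + ennreal (p * q) = ennreal (p * (b + q))"
  by (simp add: ennreal_mult[symmetric] ennreal_plus[symmetric] algebra_simps del: ennreal_plus)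

text \<open>The right-hand side is the volume times the potential, whose summand 1 keeps it
  nonnegative. Going from fine to coarse, the potential of a cube pays for the differences to its
  children and for their potentials. The sum starts at \<open>Suc k\<close> because the term of
  generation \<open>k\<close> involves the parent of the cube, which lies outside.\<close>

lemma bellman:
  assumes "I k v"
  shows "(\<integral>\<^sup>+x\<in>cube v (sc k). ennreal (\<Sum>j\<in>{Suc k..<N}. B j x) \<partial>lborel)
    \<le> ennreal (sc k ^ CARD('n) * (1 + (2 ^ CARD('n) + 1) * H k v / A k v - (F k v)\<^sup>2 / (A k v)\<^sup>2))"
  using assms
proof (induction "N - k" arbitrary: k v rule: less_induct)
  case less
  show ?case
  proof (cases "Suc k < N")
    case False
    then show ?thesis by simp
  next
    case True
    let ?n = "CARD('n)"
    let ?\<Phi> = "\<lambda>k v. 1 + (2 ^ CARD('n) + 1) * H k v / A k v - (F k v)\<^sup>2 / (A k v)\<^sup>2"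
    let ?ch = "\<lambda>s. child v (sc k) s"
    have r: "sc k > 0" "sc k / 2 > 0" using sc_pos[of k] by auto
    have \<Phi>0: "?\<Phi> k v \<ge> 0" for k v
    proof -
      have "(F k v)\<^sup>2 / (A k v)\<^sup>2 \<le> 1"
      proof (cases "A k v = 0")
        case False
        have "\<bar>F k v\<bar> \<le> \<bar>A k v\<bar>" using F_le_H[of k v] H_le_A[of k k v] by simp
        then show ?thesis using False by (simp add: abs_le_square_iff)
      qed simp
      moreover have "(2 ^ CARD('n) + 1) * H k v / A k v \<ge> 0" using H_nonneg A_nonneg by simp
      ultimately show ?thesis by linarith
    qed
    have vch: "dcorner (sc k) (?ch s) = dcorner (sc k) v" for s
    proof -
      have "?ch s \<in> cube v (sc k)"
        using child_subset[OF r(1)] corner_mem[OF r(2)] by blast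
      then show ?thesis using I_dcorner[OF less.prems] corner_mem[OF r(1), of v] by metis
    qed
    have each: "(\<integral>\<^sup>+x\<in>cube (?ch s) (sc k / 2). ennreal (\<Sum>j\<in>{Suc k..<N}. B j x) \<partial>lborel)
      \<le> ennreal ((sc k / 2) ^ ?n * ((F (Suc k) (?ch s) - F k v)\<^sup>2 / (A (Suc k) (?ch s))\<^sup>2 + ?\<Phi> (Suc k) (?ch s)))"
      for s
    proof -
      have Is: "I (Suc k) (?ch s)" by (rule I_child[OF less.prems])
      have Bc: "B (Suc k) x = B (Suc k) (?ch s)" if "x \<in> cube (?ch s) (sc k / 2)" for x
        using I_dcorner[OF Is] that corner_mem[OF r(2), of "?ch s"]
        by (intro const(4)) (simp add: sc_Suc)
      have "(\<integral>\<^sup>+x\<in>cube (?ch s) (sc k / 2). ennreal (\<Sum>j\<in>{Suc k..<N}. B j x) \<partial>lborel)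
        = (\<integral>\<^sup>+x. ennreal (B (Suc k) (?ch s)) * indicator (cube (?ch s) (sc k / 2)) x +
            ennreal (\<Sum>j\<in>{Suc (Suc k)..<N}. B j x) * indicator (cube (?ch s) (sc k / 2)) x \<partial>lborel)"
        using True
        by (intro nn_integral_cong)
           (auto simp: indicator_def sum.atLeast_Suc_lessThan Bc ennreal_plus[symmetric] B_nonneg sum_nonneg
             simp del: ennreal_plus)
      also have "\<dots> = ennreal (B (Suc k) (?ch s)) * emeasure lborel (cube (?ch s) (sc k / 2)) +
          (\<integral>\<^sup>+x\<in>cube (?ch s) (sc k / 2). ennreal (\<Sum>j\<in>{Suc (Suc k)..<N}. B j x) \<partial>lborel)"
        by (subst nn_integral_add) (auto simp: nn_integral_cmult_indicator)
      also have "\<dots> \<le> ennreal (B (Suc k) (?ch s)) * ennreal ((sc k / 2) ^ ?n) +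
           ennreal ((sc k / 2) ^ ?n * ?\<Phi> (Suc k) (?ch s))"
        using less.hyps[OF _ Is] True r by (intro add_mono) (auto simp: emeasure_cube sc_Suc)
      also have "\<dots> = ennreal ((sc k / 2) ^ ?n * (B (Suc k) (?ch s) + ?\<Phi> (Suc k) (?ch s)))"
        using r by (intro ennreal_aux \<Phi>0 B_nonneg) simp
      also have "B (Suc k) (?ch s) = (F (Suc k) (?ch s) - F k v)\<^sup>2 / (A (Suc k) (?ch s))\<^sup>2"
        using const(1)[OF vch] by (simp add: B_def)
      finally show ?thesis .
    qed
    have dv: "dcorner (sc k) v = v" using I_dcorner[OF less.prems corner_mem[OF r(1)]] .
    have dch: "dcorner (sc k / 2) (?ch s) = ?ch s" for s
      using I_dcorner[OF I_child[OF less.prems], of "?ch s" s] corner_mem[OF r(2), of "?ch s"]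
      by (simp add: sc_Suc)
    have "(\<integral>\<^sup>+x\<in>cube v (sc k). ennreal (\<Sum>j\<in>{Suc k..<N}. B j x) \<partial>lborel)
      = (\<Sum>s\<in>UNIV. \<integral>\<^sup>+x\<in>cube (?ch s) (sc k / 2). ennreal (\<Sum>j\<in>{Suc k..<N}. B j x) \<partial>lborel)"
      by (rule nn_integral_cube_split[OF r(1)]) measurable
    also have "\<dots> \<le> (\<Sum>s\<in>UNIV. ennreal ((sc k / 2) ^ ?n *
        ((F (Suc k) (?ch s) - F k v)\<^sup>2 / (A (Suc k) (?ch s))\<^sup>2 + ?\<Phi> (Suc k) (?ch s))))"
      by (rule sum_mono[OF each])
    also have "\<dots> = ennreal (\<Sum>s\<in>UNIV. (sc k / 2) ^ ?n *
        ((F (Suc k) (?ch s) - F k v)\<^sup>2 / (A (Suc k) (?ch s))\<^sup>2 + ?\<Phi> (Suc k) (?ch s)))"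
      using r \<Phi>0 by (intro sum_ennreal) (simp add: add_nonneg_nonneg)
    also have "\<dots> \<le> ennreal (sc k ^ ?n * ?\<Phi> k v)"
    proof (rule ennreal_leI)
      have "(\<Sum>s\<in>UNIV. (F (Suc k) (?ch s) - F k v)\<^sup>2 / (A (Suc k) (?ch s))\<^sup>2 + ?\<Phi> (Suc k) (?ch s))
         \<le> 2 ^ ?n * ?\<Phi> k v"
      proof (rule bellman_sum)
        show "A k v \<ge> 0" by (rule A_nonneg)
        show "H k v \<le> A k v" by (simp add: H_le_A)
        show "\<bar>F (Suc k) (?ch s)\<bar> \<le> H (Suc k) (?ch s)" for s by (rule F_le_H)
        show "\<bar>F k v\<bar> \<le> H k v" by (rule F_le_H)
        show "(\<Sum>s\<in>UNIV. F (Suc k) (?ch s)) = 2 ^ ?n * F k v"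
          using cube_avg_split[OF f_int r(1), of v] by (simp add: F_def sc_Suc dch dv)
        show "(\<Sum>s\<in>UNIV. H (Suc k) (?ch s)) = 2 ^ ?n * H k v"
          using cube_avg_split[OF integrable_abs[OF f_int] r(1), of v] by (simp add: H_def sc_Suc dch dv)
        show "A (Suc k) (?ch s) = max (A k v) (H (Suc k) (?ch s))" for s
          using const(3)[OF vch, of k s] by (simp add: A_Suc)
      qed
      moreover have e: "(sc k / 2) ^ ?n * (2 ^ ?n * X) = sc k ^ ?n * X" for X
        by (simp add: power_divide)
      ultimately have "(sc k / 2) ^ ?n * (\<Sum>s\<in>UNIV. (F (Suc k) (?ch s) - F k v)\<^sup>2 / (A (Suc k) (?ch s))\<^sup>2
           + ?\<Phi> (Suc k) (?ch s)) \<le> (sc k / 2) ^ ?n * (2 ^ ?n * ?\<Phi> k v)"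
        using r by (intro mult_left_mono) auto
      then show "(\<Sum>s\<in>UNIV. (sc k / 2) ^ ?n *
        ((F (Suc k) (?ch s) - F k v)\<^sup>2 / (A (Suc k) (?ch s))\<^sup>2 + ?\<Phi> (Suc k) (?ch s)))
        \<le> sc k ^ ?n * ?\<Phi> k v"
        unfolding sum_distrib_left e .
    qed
    finally show ?thesis .
  qed
qed

text \<open>Generation \<open>k\<close>, left out by \<open>bellman\<close>, contributes at most 4
  pointwise because both averages are bounded by \<open>A\<close>. The potential is at most 2^n + 2,
  whence the constant 2^n + 6.\<close>

lemma carleson:
  assumes "I k v"
  shows "(\<integral>\<^sup>+x\<in>cube v (sc k). ennreal (\<Sum>j\<in>{k..<N}. B j x) \<partial>lborel)
    \<le> ennreal ((2 ^ CARD('n) + 6) * sc k ^ CARD('n))"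
proof -
  have r: "sc k > 0" by (rule sc_pos)
  have B4: "B j x \<le> 4" for j x
  proof -
    have "\<bar>F j x - F (j - 1) x\<bar> \<le> 2 * A j x"
      using F_le_H[of j x] F_le_H[of "j - 1" x] H_le_A[of j j x] H_le_A[of "j - 1" j x] by simp
    then have "(F j x - F (j - 1) x)\<^sup>2 \<le> (2 * A j x)\<^sup>2"
      using abs_le_square_iff[of "F j x - F (j - 1) x" "2 * A j x"] by simp
    then show ?thesis by (auto simp: B_def divide_le_eq power_mult_distrib)
  qed
  have "(\<Sum>j\<in>{k..<N}. B j x) \<le> 4 + (\<Sum>j\<in>{Suc k..<N}. B j x)" for x
    using B4[of k x] by (cases "k < N") (auto simp: sum.atLeast_Suc_lessThan)
  then have "(\<integral>\<^sup>+x\<in>cube v (sc k). ennreal (\<Sum>j\<in>{k..<N}. B j x) \<partial>lborel)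
    \<le> (\<integral>\<^sup>+x. ennreal 4 * indicator (cube v (sc k)) x +
         ennreal (\<Sum>j\<in>{Suc k..<N}. B j x) * indicator (cube v (sc k)) x \<partial>lborel)"
    by (intro nn_integral_mono)
       (auto simp: indicator_def ennreal_plus[symmetric] B_nonneg sum_nonneg ennreal_leI
         simp del: ennreal_plus ennreal_numeral)
  also have "\<dots> = ennreal 4 * ennreal (sc k ^ CARD('n)) +
      (\<integral>\<^sup>+x\<in>cube v (sc k). ennreal (\<Sum>j\<in>{Suc k..<N}. B j x) \<partial>lborel)"
    using r by (subst nn_integral_add) (auto simp: nn_integral_cmult_indicator emeasure_cube simp del: ennreal_numeral)
  also have "\<dots> \<le> ennreal 4 * ennreal (sc k ^ CARD('n)) +
      ennreal (sc k ^ CARD('n) * (1 + (2 ^ CARD('n) + 1) * H k v / A k v - (F k v)\<^sup>2 / (A k v)\<^sup>2))"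
    by (intro add_left_mono bellman assms)
  also have "\<dots> \<le> ennreal 4 * ennreal (sc k ^ CARD('n)) + ennreal (sc k ^ CARD('n) * (1 + (2 ^ CARD('n) + 1)))"
  proof (intro add_left_mono ennreal_leI mult_left_mono)
    have "H k v / A k v \<le> 1" using H_le_A[of k k v] A_nonneg[of k v] by (auto simp: divide_le_eq)
    then have *: "(2 ^ CARD('n) + 1) * (H k v / A k v) \<le> (2 ^ CARD('n) + 1) * 1"
      by (intro mult_left_mono) auto
    have aux: "1 + x - y \<le> 1 + c" if "x \<le> c" "y \<ge> 0" for x y c :: real
      using that by linarith
    show "1 + (2 ^ CARD('n) + 1) * H k v / A k v - (F k v)\<^sup>2 / (A k v)\<^sup>2 \<le> 1 + (2 ^ CARD('n) + 1)"
      using * by (intro aux) simp_all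
  qed (use r in auto)
  also have "\<dots> = ennreal ((2 ^ CARD('n) + 6) * sc k ^ CARD('n))"
    using r by (subst ennreal_mult[symmetric]) (auto simp: ennreal_plus[symmetric] algebra_simps simp del: ennreal_plus ennreal_numeral)
  finally show ?thesis .
qed

lemma tail:
  assumes "I 0 v"
  shows "emeasure lborel {x \<in> cube v r0. \<exists>N. (\<Sum>j<N. B j x) > s}
    \<le> ennreal ((1 + (2 ^ CARD('n) + 6)) * exp (- (1 / (2 * 1 * (1 + (2 ^ CARD('n) + 6)))) * s) * r0 ^ CARD('n))"
proof (rule John_Nirenberg_tail[where I = I and B = B and ?C0.0 = 1])
  show "B k x \<le> 1 * B k y" if "I k v" "x \<in> cube v (r0 / 2 ^ k)" "y \<in> cube v (r0 / 2 ^ k)" for k v x y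
    using const(4)[of k x y] I_dcorner[OF that(1)] that(2,3) by (simp add: sc_def)
  show "I (Suc k) (child v (r0 / 2 ^ k) s)" if "I k v" for k v s
    using I_child[OF that] by (simp add: sc_def)
  show "(\<integral>\<^sup>+x\<in>cube v (r0 / 2 ^ k). ennreal (\<Sum>j\<in>{k..<N}. B j x) \<partial>lborel)
    \<le> ennreal ((2 ^ CARD('n) + 6) * (r0 / 2 ^ k) ^ CARD('n))" if "I k v" for k v N
    using carleson[OF that] by (simp add: sc_def)
qed (auto simp: r0 B_nonneg assms intro: add_nonneg_nonneg)

end

section \<open>Change of variables\<close>

lemma nn_integral_affine:
  fixes h :: "'a::euclidean_space \<Rightarrow> ennreal"
  assumes [measurable]: "h \<in> borel_measurable borel" and "c \<noteq> 0"
  shows "(\<integral>\<^sup>+z. h z \<partial>lborel) = ennreal (\<bar>c\<bar> ^ DIM('a)) * (\<integral>\<^sup>+z. h (t + c *\<^sub>R z) \<partial>lborel)"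
  by (subst lborel_affine[OF assms(2), of t])
     (simp add: nn_integral_density nn_integral_distr nn_integral_cmult)

lemma nn_integral_reflect:
  fixes h :: "'a::euclidean_space \<Rightarrow> ennreal"
  assumes "h \<in> borel_measurable borel"
  shows "(\<integral>\<^sup>+z. h (y - z) \<partial>lborel) = (\<integral>\<^sup>+z. h z \<partial>lborel)"
  using nn_integral_affine[OF assms, of "-1" y] by simp

lemma nn_integral_shift:
  fixes h :: "'a::euclidean_space \<Rightarrow> ennreal"
  assumes "h \<in> borel_measurable borel"
  shows "(\<integral>\<^sup>+z. h (z - y) \<partial>lborel) = (\<integral>\<^sup>+z. h z \<partial>lborel)"
  using nn_integral_affine[OF assms, of 1 "-y"] by simp

lemma lebesgue_integral_affine:
  fixes h :: "'a::euclidean_space \<Rightarrow> real"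
  assumes [measurable]: "h \<in> borel_measurable borel" and "c \<noteq> 0"
  shows "(LINT z|lborel. h z) = \<bar>c\<bar> ^ DIM('a) * (LINT z|lborel. h (t + c *\<^sub>R z))"
  by (subst lborel_affine[OF assms(2), of t])
     (simp add: integral_density integral_distr)

lemma lebesgue_integral_reflect:
  fixes h :: "'a::euclidean_space \<Rightarrow> real"
  assumes "h \<in> borel_measurable borel"
  shows "(LINT z|lborel. h (y - z)) = (LINT z|lborel. h z)"
  using lebesgue_integral_affine[OF assms, of "-1" y] by simp

lemma lebesgue_integral_shift:
  fixes h :: "'a::euclidean_space \<Rightarrow> real"
  assumes "h \<in> borel_measurable borel"
  shows "(LINT z|lborel. h (z - y)) = (LINT z|lborel. h z)"
  using lebesgue_integral_affine[OF assms, of 1 "-y"] by simp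

section \<open>Convolution of bounded integrable functions\<close>

text \<open>Bounded and integrable functions lie in L1 and in L2, and are closed under sums,
  products and convolution. Inside this class every interchange of integrals and every pairing below
  converges absolutely.\<close>

definition bint :: "('a::euclidean_space \<Rightarrow> real) \<Rightarrow> bool" where
  "bint g \<longleftrightarrow> integrable lborel g \<and> (\<exists>G. \<forall>x. \<bar>g x\<bar> \<le> G)"

lemma bint_integrable: "bint g \<Longrightarrow> integrable lborel g" by (simp add: bint_def)

lemma bint_meas [measurable_dest]: "bint g \<Longrightarrow> g \<in> borel_measurable borel"
  using borel_measurable_integrable[of lborel g] by (simp add: bint_def)

lemma bint_bound: "bint g \<Longrightarrow> \<exists>G\<ge>0. \<forall>x. \<bar>g x\<bar> \<le> G"
  unfolding bint_def by (meson abs_ge_zero order_trans)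

lemma bint_reflect: 
  fixes g :: "'a::euclidean_space \<Rightarrow> real"
  assumes "bint g" shows "bint (\<lambda>z. g (y - z))"
proof -
  have [measurable]: "g \<in> borel_measurable borel" by (rule bint_meas[OF assms])
  have "(\<integral>\<^sup>+z. ennreal \<bar>g (y - z)\<bar> \<partial>lborel) = (\<integral>\<^sup>+z. ennreal \<bar>g z\<bar> \<partial>lborel)"
    by (rule nn_integral_reflect) measurable
  then show ?thesis using assms by (auto simp: bint_def integrable_iff_bounded)
qed

lemma bint_uminus: "bint g \<Longrightarrow> bint (\<lambda>z. g (- z))"
  using bint_reflect[of g 0] by simp

lemma bint_mult:
  assumes "bint u" "bint v" shows "bint (\<lambda>x. u x * v x)"
proof -
  have [measurable]: "u \<in> borel_measurable borel" "v \<in> borel_measurable borel"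
    using assms bint_meas by auto
  obtain U V where U: "\<And>x. \<bar>u x\<bar> \<le> U" "U \<ge> 0" and V: "\<And>x. \<bar>v x\<bar> \<le> V" "V \<ge> 0"
    using bint_bound[OF assms(1)] bint_bound[OF assms(2)] by blast
  have "integrable lborel (\<lambda>x. u x * v x)"
  proof (rule Bochner_Integration.integrable_bound)
    show "integrable lborel (\<lambda>x. U * v x)" using assms(2) by (simp add: bint_integrable)
    show "AE x in lborel. norm (u x * v x) \<le> norm (U * v x)"
      using U by (auto simp: abs_mult intro!: mult_right_mono)
  qed simp
  moreover have "\<bar>u x * v x\<bar> \<le> U * V" for x
    unfolding abs_mult by (intro mult_mono U V) auto
  ultimately show ?thesis unfolding bint_def by blast
qed

lemma bint_add:
  assumes "bint u" "bint v" shows "bint (\<lambda>x. u x + v x)"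
proof -
  obtain U V where U: "\<And>x. \<bar>u x\<bar> \<le> U" and V: "\<And>x. \<bar>v x\<bar> \<le> V"
    using bint_bound[OF assms(1)] bint_bound[OF assms(2)] by blast
  have "\<bar>u x + v x\<bar> \<le> U + V" for x using U[of x] V[of x] by linarith
  then show ?thesis using assms unfolding bint_def by auto
qed

lemma bint_cmult: assumes "bint v" shows "bint (\<lambda>x. c * v x)"
proof -
  obtain V where V: "\<And>x. \<bar>v x\<bar> \<le> V" using bint_bound[OF assms] by blast
  have "\<bar>c * v x\<bar> \<le> \<bar>c\<bar> * V" for x unfolding abs_mult by (intro mult_left_mono V) auto
  then show ?thesis using assms unfolding bint_def by auto
qed

lemma bint_zero: "bint (\<lambda>x. 0)" by (auto simp: bint_def)

lemma bint_sum: "(\<And>j. j \<in> J \<Longrightarrow> bint (u j)) \<Longrightarrow> bint (\<lambda>x. \<Sum>j\<in>J. u j x)"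
  by (induction J rule: infinite_finite_induct) (auto intro: bint_add bint_zero)

text \<open>The convolution of \<open>k\<close> and \<open>g\<close>, viewed as the operator with
  kernel \<open>k\<close> applied to \<open>g\<close>.\<close>

definition KC :: "('a::euclidean_space \<Rightarrow> real) \<Rightarrow> ('a \<Rightarrow> real) \<Rightarrow> 'a \<Rightarrow> real" where
  "KC k g y = (LINT z|lborel. k (y - z) * g z)"

context
  fixes k g :: "'a::euclidean_space \<Rightarrow> real"
  assumes k: "bint k" and g: "bint g"
begin

lemma KC_integrand: "bint (\<lambda>z. k (y - z) * g z)"
  by (intro bint_mult bint_reflect k g)

lemma KC_meas [measurable]: "KC k g \<in> borel_measurable borel"
proof -
  note [measurable] = bint_meas[OF k] bint_meas[OF g]
  have "(\<lambda>y. LINT z|lborel. k (y - z) * g z) \<in> borel_measurable borel"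
    by (rule lborel.borel_measurable_lebesgue_integral) measurable
  then show ?thesis unfolding KC_def[abs_def] by simp
qed

lemma KC_abs_le: "ennreal \<bar>KC k g y\<bar> \<le> (\<integral>\<^sup>+z. ennreal \<bar>k (y - z)\<bar> * ennreal \<bar>g z\<bar> \<partial>lborel)"
  using integral_norm_bound_ennreal[OF bint_integrable[OF KC_integrand[of y]]]
  by (simp add: KC_def abs_mult ennreal_mult)

lemma KC_norm1: "(\<integral>\<^sup>+y. ennreal \<bar>KC k g y\<bar> \<partial>lborel)
   \<le> (\<integral>\<^sup>+y. ennreal \<bar>k y\<bar> \<partial>lborel) * (\<integral>\<^sup>+y. ennreal \<bar>g y\<bar> \<partial>lborel)"
proof -
  note [measurable] = bint_meas[OF k] bint_meas[OF g]
  have "(\<integral>\<^sup>+y. ennreal \<bar>KC k g y\<bar> \<partial>lborel)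
    \<le> (\<integral>\<^sup>+y. (\<integral>\<^sup>+z. ennreal \<bar>k (y - z)\<bar> * ennreal \<bar>g z\<bar> \<partial>lborel) \<partial>lborel)"
    by (intro nn_integral_mono KC_abs_le)
  also have "\<dots> = (\<integral>\<^sup>+z. (\<integral>\<^sup>+y. ennreal \<bar>k (y - z)\<bar> * ennreal \<bar>g z\<bar> \<partial>lborel) \<partial>lborel)"
    by (rule lborel_pair.Fubini') measurable
  also have "\<dots> = (\<integral>\<^sup>+z. (\<integral>\<^sup>+y. ennreal \<bar>k y\<bar> \<partial>lborel) * ennreal \<bar>g z\<bar> \<partial>lborel)"
    using nn_integral_shift[of "\<lambda>y. ennreal \<bar>k y\<bar>"]
    by (simp add: nn_integral_multc)
  also have "\<dots> = (\<integral>\<^sup>+y. ennreal \<bar>k y\<bar> \<partial>lborel) * (\<integral>\<^sup>+y. ennreal \<bar>g y\<bar> \<partial>lborel)"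
    by (rule nn_integral_cmult) measurable
  finally show ?thesis .
qed

lemma KC_bint: "bint (KC k g)"
proof -
  note [measurable] = bint_meas[OF k] bint_meas[OF g]
  have kf: "(\<integral>\<^sup>+y. ennreal \<bar>k y\<bar> \<partial>lborel) < \<infinity>" and gf: "(\<integral>\<^sup>+y. ennreal \<bar>g y\<bar> \<partial>lborel) < \<infinity>"
    using bint_integrable[OF k] bint_integrable[OF g] by (auto simp: integrable_iff_bounded)
  have "(\<integral>\<^sup>+y. ennreal \<bar>KC k g y\<bar> \<partial>lborel) < \<infinity>"
    by (rule le_less_trans[OF KC_norm1]) (use kf gf in \<open>simp add: ennreal_mult_less_top\<close>)
  then have "integrable lborel (KC k g)" by (simp add: integrable_iff_bounded)
  moreover obtain K where K: "\<And>x. \<bar>k x\<bar> \<le> K" "K \<ge> 0" using bint_bound[OF k] by blast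
  have "\<bar>KC k g y\<bar> \<le> K * (LINT z|lborel. \<bar>g z\<bar>)" for y
  proof -
    have *: "integrable lborel (\<lambda>z. \<bar>k (y - z) * g z\<bar>)"
      by (intro integrable_abs bint_integrable KC_integrand)
    have "\<bar>KC k g y\<bar> \<le> (LINT z|lborel. \<bar>k (y - z) * g z\<bar>)"
      unfolding KC_def by (rule integral_abs_bound)
    also have "\<dots> \<le> (LINT z|lborel. K * \<bar>g z\<bar>)"
      using bint_integrable[OF g] * K
      by (intro integral_mono) (auto simp: abs_mult intro!: mult_right_mono)
    finally show ?thesis by simp
  qed
  ultimately show ?thesis unfolding bint_def by blast
qed

lemma KC_pair_integrable:
  assumes u: "bint u"
  shows "integrable (lborel \<Otimes>\<^sub>M lborel) (\<lambda>(y, z). u y * (k (y - z) * g z))"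
proof -
  note [measurable] = bint_meas[OF k] bint_meas[OF g]
  have [measurable]: "u \<in> borel_measurable borel" using u by (rule bint_meas)
  obtain U where U: "\<And>x. \<bar>u x\<bar> \<le> U" "U \<ge> 0" using bint_bound[OF u] by blast
  have kf: "(\<integral>\<^sup>+y. ennreal \<bar>k y\<bar> \<partial>lborel) < \<infinity>" and gf: "(\<integral>\<^sup>+y. ennreal \<bar>g y\<bar> \<partial>lborel) < \<infinity>"
    using bint_integrable[OF k] bint_integrable[OF g] by (auto simp: integrable_iff_bounded)
  have "(\<integral>\<^sup>+p. ennreal (norm (case p of (y, z) \<Rightarrow> u y * (k (y - z) * g z))) \<partial>(lborel \<Otimes>\<^sub>M lborel))
     = (\<integral>\<^sup>+z. (\<integral>\<^sup>+y. ennreal \<bar>u y * (k (y - z) * g z)\<bar> \<partial>lborel) \<partial>lborel)"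
    by (subst lborel_pair.nn_integral_snd[symmetric]) (auto simp: split_beta')
  also have "\<dots> \<le> (\<integral>\<^sup>+z. (\<integral>\<^sup>+y. ennreal \<bar>k (y - z)\<bar> * ennreal (U * \<bar>g z\<bar>) \<partial>lborel) \<partial>lborel)"
  proof (intro nn_integral_mono)
    fix y z
    have "\<bar>u y\<bar> * (\<bar>k (y - z)\<bar> * \<bar>g z\<bar>) \<le> U * (\<bar>k (y - z)\<bar> * \<bar>g z\<bar>)"
      by (intro mult_right_mono U) simp
    then show "ennreal \<bar>u y * (k (y - z) * g z)\<bar> \<le> ennreal \<bar>k (y - z)\<bar> * ennreal (U * \<bar>g z\<bar>)"
      using U(2) by (simp add: abs_mult ennreal_mult[symmetric] mult_ac ennreal_leI)
  qed
  also have "\<dots> = (\<integral>\<^sup>+z. (\<integral>\<^sup>+y. ennreal \<bar>k y\<bar> \<partial>lborel) * (ennreal U * ennreal \<bar>g z\<bar>) \<partial>lborel)"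
    using nn_integral_shift[of "\<lambda>y. ennreal \<bar>k y\<bar>"] U
    by (simp add: nn_integral_multc ennreal_mult)
  also have "\<dots> = (\<integral>\<^sup>+y. ennreal \<bar>k y\<bar> \<partial>lborel) * (ennreal U * (\<integral>\<^sup>+y. ennreal \<bar>g y\<bar> \<partial>lborel))"
    by (simp add: nn_integral_cmult)
  also have "\<dots> < \<infinity>" using kf gf by (simp add: ennreal_mult_less_top)
  finally show ?thesis by (simp add: integrable_iff_bounded)
qed

text \<open>Fubini's theorem, whose absolute convergence is \<open>KC_pair_integrable\<close>;
  exchanging the roles of the variables reflects the kernel.\<close>

lemma KC_adjoint:
  assumes u: "bint u"
  shows "(LINT y|lborel. u y * KC k g y) = (LINT z|lborel. KC (\<lambda>w. k (- w)) u z * g z)"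
proof -
  note [measurable] = bint_meas[OF k] bint_meas[OF g]
  have "(LINT y|lborel. u y * KC k g y) = (LINT y|lborel. (LINT z|lborel. u y * (k (y - z) * g z)))"
    unfolding KC_def by simp
  also have "\<dots> = (LINT z|lborel. (LINT y|lborel. u y * (k (y - z) * g z)))"
    using lborel_pair.Fubini_integral[OF KC_pair_integrable[OF u]] by simp
  also have "\<dots> = (LINT z|lborel. KC (\<lambda>w. k (- w)) u z * g z)"
    unfolding KC_def
    by (intro Bochner_Integration.integral_cong refl)
       (simp add: mult_ac flip: integral_mult_right_zero)
  finally show ?thesis .
qed

end

text \<open>For fixed \<open>y\<close> the outer convolution is a pairing with the function
  \<open>\<lambda>z. k (y - z)\<close>. Moving the inner convolution to the other side by
  adjointness and translating the variable produces the kernel \<open>KC k l\<close>.\<close>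

lemma KC_assoc:
  fixes k l u :: "'a::euclidean_space \<Rightarrow> real"
  assumes k: "bint k" and l: "bint l" and u: "bint u"
  shows "KC k (KC l u) y = KC (KC k l) u y"
proof -
  have [measurable]: "k \<in> borel_measurable borel" "l \<in> borel_measurable borel" "u \<in> borel_measurable borel"
    using assms bint_meas by auto
  have "KC k (KC l u) y = (LINT z|lborel. k (y - z) * KC l u z)" by (simp add: KC_def)
  also have "\<dots> = (LINT w|lborel. KC (\<lambda>w. l (- w)) (\<lambda>z. k (y - z)) w * u w)"
    by (rule KC_adjoint[OF l u bint_reflect[OF k]])
  also have "\<dots> = (LINT w|lborel. KC k l (y - w) * u w)"
  proof -
    have "KC (\<lambda>w. l (- w)) (\<lambda>z. k (y - z)) w = KC k l (y - w)" for w
    proof -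
      have "KC k l (y - w) = (LINT z|lborel. k (y - w - (z - w)) * l (z - w))"
        unfolding KC_def by (rule lebesgue_integral_shift[symmetric]) measurable
      then show ?thesis by (simp add: KC_def mult.commute)
    qed
    then show ?thesis by simp
  qed
  finally show ?thesis by (simp add: KC_def)
qed

text \<open>Schur's test: 2 |u v| is at most u^2 + v^2 under the double integral, and in either
  summand one variable occurs in the kernel only and integrates to at most \<open>K\<close>.\<close>

lemma KC_young2:
  assumes k: "bint k" and u: "bint u" and v: "bint v"
    and K: "(\<integral>\<^sup>+y. ennreal \<bar>k y\<bar> \<partial>lborel) \<le> ennreal K" "K \<ge> 0"
  shows "\<bar>LINT y|lborel. u y * KC k v y\<bar>
    \<le> K / 2 * ((LINT y|lborel. (u y)\<^sup>2) + (LINT y|lborel. (v y)\<^sup>2))"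
proof -
  have [measurable]: "k \<in> borel_measurable borel" "u \<in> borel_measurable borel" "v \<in> borel_measurable borel"
    using assms bint_meas by auto
  have u2: "bint (\<lambda>y. (u y)\<^sup>2)" and v2: "bint (\<lambda>y. (v y)\<^sup>2)"
    using bint_mult[OF u u] bint_mult[OF v v] by (simp_all add: power2_eq_square)
  define U where "U = (LINT y|lborel. (u y)\<^sup>2)"
  define V where "V = (LINT y|lborel. (v y)\<^sup>2)"
  have UV0: "U \<ge> 0" "V \<ge> 0" by (simp_all add: U_def V_def)
  have U: "(\<integral>\<^sup>+y. ennreal ((u y)\<^sup>2) \<partial>lborel) = ennreal U"
    unfolding U_def using bint_integrable[OF u2] by (rule nn_integral_eq_integral) simp
  have V: "(\<integral>\<^sup>+y. ennreal ((v y)\<^sup>2) \<partial>lborel) = ennreal V"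
    unfolding V_def using bint_integrable[OF v2] by (rule nn_integral_eq_integral) simp
  have "ennreal \<bar>LINT y|lborel. u y * KC k v y\<bar> \<le> (\<integral>\<^sup>+y. ennreal \<bar>u y * KC k v y\<bar> \<partial>lborel)"
    using integral_norm_bound_ennreal[OF bint_integrable[OF bint_mult[OF u KC_bint[OF k v]]]] by simp
  also have "\<dots> \<le> (\<integral>\<^sup>+y. (\<integral>\<^sup>+z. ennreal (\<bar>u y\<bar> * \<bar>k (y - z)\<bar> * \<bar>v z\<bar>) \<partial>lborel) \<partial>lborel)"
  proof (intro nn_integral_mono)
    fix y
    have "ennreal \<bar>u y * KC k v y\<bar> = ennreal \<bar>u y\<bar> * ennreal \<bar>KC k v y\<bar>"
      by (simp add: abs_mult ennreal_mult)
    also have "\<dots> \<le> ennreal \<bar>u y\<bar> * (\<integral>\<^sup>+z. ennreal \<bar>k (y - z)\<bar> * ennreal \<bar>v z\<bar> \<partial>lborel)"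
      by (intro mult_left_mono KC_abs_le k v) simp
    also have "\<dots> = (\<integral>\<^sup>+z. ennreal (\<bar>u y\<bar> * \<bar>k (y - z)\<bar> * \<bar>v z\<bar>) \<partial>lborel)"
      by (subst nn_integral_cmult[symmetric]) (auto simp: ennreal_mult mult_ac)
    finally show "ennreal \<bar>u y * KC k v y\<bar> \<le> (\<integral>\<^sup>+z. ennreal (\<bar>u y\<bar> * \<bar>k (y - z)\<bar> * \<bar>v z\<bar>) \<partial>lborel)" .
  qed
  also have "\<dots> \<le> (\<integral>\<^sup>+y. (\<integral>\<^sup>+z. (ennreal (1/2) * (ennreal ((u y)\<^sup>2) * ennreal \<bar>k (y - z)\<bar>)
      + ennreal (1/2) * (ennreal ((v z)\<^sup>2) * ennreal \<bar>k (y - z)\<bar>)) \<partial>lborel) \<partial>lborel)"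
  proof (intro nn_integral_mono)
    fix y z
    have "2 * (\<bar>u y\<bar> * \<bar>v z\<bar>) \<le> (u y)\<^sup>2 + (v z)\<^sup>2"
      using sum_squares_bound[of "\<bar>u y\<bar>" "\<bar>v z\<bar>"] by simp
    then have "(2 * (\<bar>u y\<bar> * \<bar>v z\<bar>)) * \<bar>k (y - z)\<bar> \<le> ((u y)\<^sup>2 + (v z)\<^sup>2) * \<bar>k (y - z)\<bar>"
      by (rule mult_right_mono) simp
    then have *: "\<bar>u y\<bar> * \<bar>k (y - z)\<bar> * \<bar>v z\<bar>
        \<le> 1/2 * ((u y)\<^sup>2 * \<bar>k (y - z)\<bar>) + 1/2 * ((v z)\<^sup>2 * \<bar>k (y - z)\<bar>)"
      by (simp add: algebra_simps)
    have "ennreal (\<bar>u y\<bar> * \<bar>k (y - z)\<bar> * \<bar>v z\<bar>)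
      \<le> ennreal (1/2 * ((u y)\<^sup>2 * \<bar>k (y - z)\<bar>) + 1/2 * ((v z)\<^sup>2 * \<bar>k (y - z)\<bar>))"
      by (rule ennreal_leI[OF *])
    also have "\<dots> = ennreal (1/2) * (ennreal ((u y)\<^sup>2) * ennreal \<bar>k (y - z)\<bar>)
      + ennreal (1/2) * (ennreal ((v z)\<^sup>2) * ennreal \<bar>k (y - z)\<bar>)"
    proof -
      have m: "ennreal (1/2 * (a * b)) = ennreal (1/2) * (ennreal a * ennreal b)"
        if "a \<ge> 0" "b \<ge> 0" for a b
        using that by (subst ennreal_mult) (auto simp: ennreal_mult)
      show ?thesis unfolding m[OF zero_le_power2 abs_ge_zero, symmetric]
        by (intro ennreal_plus) auto
    qed
    finally show "ennreal (\<bar>u y\<bar> * \<bar>k (y - z)\<bar> * \<bar>v z\<bar>)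
      \<le> ennreal (1/2) * (ennreal ((u y)\<^sup>2) * ennreal \<bar>k (y - z)\<bar>)
      + ennreal (1/2) * (ennreal ((v z)\<^sup>2) * ennreal \<bar>k (y - z)\<bar>)" .
  qed
  also have "\<dots> = ennreal (1/2) * (\<integral>\<^sup>+y. (\<integral>\<^sup>+z. ennreal ((u y)\<^sup>2) * ennreal \<bar>k (y - z)\<bar> \<partial>lborel) \<partial>lborel)
      + ennreal (1/2) * (\<integral>\<^sup>+y. (\<integral>\<^sup>+z. ennreal ((v z)\<^sup>2) * ennreal \<bar>k (y - z)\<bar> \<partial>lborel) \<partial>lborel)"
    by (simp add: nn_integral_add nn_integral_cmult)
  also have "(\<integral>\<^sup>+y. (\<integral>\<^sup>+z. ennreal ((u y)\<^sup>2) * ennreal \<bar>k (y - z)\<bar> \<partial>lborel) \<partial>lborel)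
     = ennreal U * (\<integral>\<^sup>+z. ennreal \<bar>k z\<bar> \<partial>lborel)"
    using nn_integral_reflect[of "\<lambda>y. ennreal \<bar>k y\<bar>"]
    by (simp add: nn_integral_cmult nn_integral_multc U)
  also have "(\<integral>\<^sup>+y. (\<integral>\<^sup>+z. ennreal ((v z)\<^sup>2) * ennreal \<bar>k (y - z)\<bar> \<partial>lborel) \<partial>lborel)
     = (\<integral>\<^sup>+z. (\<integral>\<^sup>+y. ennreal ((v z)\<^sup>2) * ennreal \<bar>k (y - z)\<bar> \<partial>lborel) \<partial>lborel)"
    by (rule lborel_pair.Fubini') measurable
  also have "\<dots> = ennreal V * (\<integral>\<^sup>+z. ennreal \<bar>k z\<bar> \<partial>lborel)"
    using nn_integral_shift[of "\<lambda>y. ennreal \<bar>k y\<bar>"]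
    by (simp add: nn_integral_cmult nn_integral_multc V)
  also have "ennreal (1/2) * (ennreal U * (\<integral>\<^sup>+z. ennreal \<bar>k z\<bar> \<partial>lborel)) +
       ennreal (1/2) * (ennreal V * (\<integral>\<^sup>+z. ennreal \<bar>k z\<bar> \<partial>lborel))
     \<le> ennreal (1/2) * (ennreal U * ennreal K) + ennreal (1/2) * (ennreal V * ennreal K)"
    by (intro add_mono mult_left_mono K) auto
  also have "\<dots> = ennreal (K / 2 * (U + V))"
  proof -
    have "ennreal (K / 2 * (U + V)) = ennreal (1/2 * (U * K) + 1/2 * (V * K))"
      by (simp add: algebra_simps add_divide_distrib)
    also have "\<dots> = ennreal (1/2 * (U * K)) + ennreal (1/2 * (V * K))"
      using UV0 K(2) by (intro ennreal_plus) auto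
    also have "\<dots> = ennreal (1/2) * ennreal (U * K) + ennreal (1/2) * ennreal (V * K)"
      using UV0 K(2) by (subst (1 2) ennreal_mult[of "1/2"]) auto
    finally show ?thesis using UV0 K(2) by (simp only: ennreal_mult)
  qed
  finally show ?thesis using UV0 K(2) by (simp add: U_def V_def)
qed

section \<open>Polynomially decaying weights\<close>

definition wt :: "real \<Rightarrow> real^'n \<Rightarrow> real" where
  "wt p u = (1 + norm u) powr (- p)"

text \<open>The dilation of \<open>wt p\<close> to scale \<open>s\<close>, normalized so that its
  integral does not depend on \<open>s\<close>.\<close>

definition wts :: "real \<Rightarrow> real \<Rightarrow> real^'n \<Rightarrow> real" where
  "wts p s u = wt p ((1 / s) *\<^sub>R u) / s ^ CARD('n)"

lemma wt_nonneg: "wt p u \<ge> 0" by (simp add: wt_def)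
lemma wt_pos: "wt p u > 0" using norm_ge_zero[of u] by (simp add: wt_def add_nonneg_eq_0_iff)
lemma wts_nonneg: "s > 0 \<Longrightarrow> wts p s u \<ge> 0" by (simp add: wts_def wt_nonneg)

lemma wt_le1: "p \<ge> 0 \<Longrightarrow> wt p u \<le> 1"
  unfolding wt_def using powr_mono2'[of "- p" 1 "1 + norm u"] by simp

lemma wts_minus: "wts p s (- u) = wts p s u" by (simp add: wts_def wt_def)

lemma wts_eq: "s > 0 \<Longrightarrow> wts p s (u :: real^'n) = (1 + norm u / s) powr (- p) / s ^ CARD('n)"
  by (simp add: wts_def wt_def)

lemma wts_le: "p \<ge> 0 \<Longrightarrow> s > 0 \<Longrightarrow> wts p s (u :: real^'n) \<le> 1 / s ^ CARD('n)"
  using wt_le1[of p "(1 / s) *\<^sub>R u"] by (simp add: wts_def divide_right_mono)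

lemma wt_measurable [measurable]: "wt p \<in> borel_measurable borel"
  unfolding wt_def[abs_def] by measurable

lemma wts_measurable [measurable]:
  fixes u :: "'b \<Rightarrow> real^'n"
  assumes [measurable]: "s \<in> borel_measurable M" "u \<in> borel_measurable M"
  shows "(\<lambda>x. wts p (s x) (u x)) \<in> borel_measurable M"
  unfolding wts_def[abs_def] wt_def by measurable

lemma wts_antimono: "p \<le> q \<Longrightarrow> s > 0 \<Longrightarrow> wts q s u \<le> wts p s u"
  unfolding wts_def wt_def
  by (intro divide_right_mono powr_mono) (auto simp: field_simps)

text \<open>One power of decay is exchanged for a factor \<open>norm u / s\<close>. Every gain of a
  ratio of scales below, from cancellation or from distance, is paid for in this way.\<close>

lemma norm_wts_le:
  fixes u :: "real^'n"
  assumes "s > 0"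
  shows "norm u / s * wts (p + 1) s u \<le> wts p s u"
proof -
  let ?a = "1 + norm u / s"
  have a: "?a \<ge> 1" using assms by simp
  have "norm u / s * ?a powr (- (p + 1)) \<le> ?a * ?a powr (- (p + 1))"
    by (intro mult_right_mono) auto
  also have "\<dots> = ?a powr (- p)"
    using a by (simp add: powr_mult_base)
  finally have "norm u / s * ?a powr (- (p + 1)) / s ^ CARD('n) \<le> ?a powr (- p) / s ^ CARD('n)"
    by (rule divide_right_mono) (use assms in simp)
  then show ?thesis using assms by (simp add: wts_eq)
qed

text \<open>Peetre's inequality: the function 1 + |u| / s is submultiplicative under addition of
  vectors. It is the source of all Harnack estimates of the continuous part.\<close>

lemma wts_harnack:
  fixes x y :: "real^'n"
  assumes "s > 0" "M \<ge> 0"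
  shows "wts M s x \<le> (1 + norm (x - y) / s) powr M * wts M s y"
proof -
  have "1 + norm y / s \<le> (1 + norm (x - y) / s) * (1 + norm x / s)"
  proof -
    have "norm y \<le> norm x + norm (x - y)" using norm_triangle_ineq[of x "y - x"] by (simp add: norm_minus_commute)
    then have "norm y / s \<le> norm x / s + norm (x - y) / s"
      using assms by (simp add: add_divide_distrib[symmetric] divide_right_mono)
    moreover have "(norm (x - y) / s) * (norm x / s) \<ge> 0" using assms by simp
ultimately show ?thesis by (simp only: distrib_left distrib_right)
  qed
  moreover have p: "1 + norm y / s > 0" "1 + norm x / s > 0" "1 + norm (x - y) / s > 0"
    using assms by (auto intro!: add_pos_nonneg)
  ultimately have "(1 + norm y / s) powr M \<le> ((1 + norm (x - y) / s) * (1 + norm x / s)) powr M"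
    using assms by (intro powr_mono2) auto
  also have "\<dots> = (1 + norm (x - y) / s) powr M * (1 + norm x / s) powr M"
    using p by (intro powr_mult) 
  finally have "1 / (1 + norm x / s) powr M \<le> (1 + norm (x - y) / s) powr M * (1 / (1 + norm y / s) powr M)"
    using p by (simp add: field_simps)
  from divide_right_mono[OF this, of "s ^ CARD('n)"] show ?thesis
    using assms by (simp add: wts_eq powr_minus_divide)
qed

text \<open>The value of a geometric series, \<open>4 ^ n\<close> times the sum of
  \<open>2 powr (k * (n - p))\<close> over the dyadic shells \<open>k\<close>; it converges exactly
  for \<open>p > n\<close>.\<close>

definition Wc :: "nat \<Rightarrow> real \<Rightarrow> real" where
  "Wc n p = 4 ^ n / (1 - 2 powr (real n - p))"

lemma Wc_pos: "p > real n \<Longrightarrow> Wc n p > 0"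
  by (simp add: Wc_def powr_less_one)

definition ccube :: "real^'n \<Rightarrow> real \<Rightarrow> (real^'n) set" where
  "ccube y R = cube (y - (\<chi> i. R)) (2 * R)"

lemma ccube_sets [measurable]: "ccube y R \<in> sets borel" by (simp add: ccube_def)

lemma mem_ccube: "norm (z - y) < R \<Longrightarrow> z \<in> ccube y R"
proof -
  assume "norm (z - y) < R"
  then have "\<bar>(z - y) $ i\<bar> < R" for i
    by (rule le_less_trans[OF component_le_norm_cart])
  then have "\<bar>z $ i - y $ i\<bar> < R" for i by simp
  then show ?thesis unfolding ccube_def cube_def by (simp add: abs_less_iff) (smt (verit))
qed

text \<open>\<open>k\<close> is the dyadic shell of \<open>u\<close>, given by 2^k <= 1 + |u| / s <
  2^(k + 1).\<close>

lemma wts_shell: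
  fixes u :: "real^'n"
  assumes "s > 0" "p \<ge> 0"
  shows "\<exists>k. wts p s u \<le> (2 powr (- p)) ^ k / s ^ CARD('n) \<and> norm u < 2 ^ (k + 1) * s"
proof -
  let ?a = "1 + norm u / s"
  have a: "?a \<ge> 1" using assms by simp
  obtain m where m: "?a < 2 ^ m" using real_arch_pow[of 2 ?a] by auto
  define l where "l = (LEAST m. ?a < 2 ^ m)"
  have l: "?a < 2 ^ l" unfolding l_def by (rule LeastI[of "\<lambda>m. ?a < 2 ^ m", OF m])
  have "l \<noteq> 0" using l a by (intro notI) simp
  then obtain k where k: "l = Suc k" by (cases l) auto
  have "\<not> ?a < 2 ^ k" using not_less_Least[of k "\<lambda>m. ?a < 2 ^ m"] k by (simp add: l_def)
  then have ge: "2 ^ k \<le> ?a" by simp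
  have "?a powr (- p) \<le> (2 ^ k) powr (- p)"
    using ge assms by (intro powr_mono2') auto
  also have "\<dots> = (2 powr (- p)) ^ k"
    by (simp add: powr_realpow[symmetric] powr_powr mult.commute)
  finally have "wts p s u \<le> (2 powr (- p)) ^ k / s ^ CARD('n)"
    using assms by (simp add: wts_eq divide_right_mono)
  moreover have "norm u < 2 ^ (k + 1) * s"
  proof -
    have "norm u / s < 2 ^ (k + 1)" using l k by simp
    then show ?thesis using assms by (simp add: pos_divide_less_eq)
  qed
  ultimately show ?thesis by blast
qed

text \<open>A weighted integral is a superposition of integrals over dyadic centred cubes, so bounds
  for the latter carry over with the factor \<open>Wc\<close>. The exponent \<open>k + 2\<close> in
  the hypothesis appears because \<open>ccube\<close> is described by half its side. The lemma
  serves both for comparison with the maximal function and for packing sums over distant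
  cubes.\<close>

lemma nn_integral_wts_le:
  fixes h :: "real^'n \<Rightarrow> ennreal"
  assumes [measurable]: "h \<in> borel_measurable borel" and s: "s > 0" and p: "p > real CARD('n)" and K: "K \<ge> 0"
    and le: "\<And>k. (\<integral>\<^sup>+z\<in>ccube y (2 ^ (k + 1) * s). h z \<partial>lborel) \<le> ennreal (K * (2 ^ (k + 2) * s) ^ CARD('n))"
  shows "(\<integral>\<^sup>+z. ennreal (wts p s (y - z)) * h z \<partial>lborel) \<le> ennreal (K * Wc CARD('n) p)"
proof -
  let ?n = "CARD('n)"
  let ?c = "\<lambda>k. (2 powr (- p)) ^ k / s ^ ?n"
  have p0: "p \<ge> 0" using p by linarith
  have "(\<integral>\<^sup>+z. ennreal (wts p s (y - z)) * h z \<partial>lborel)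
    \<le> (\<integral>\<^sup>+z. (\<Sum>k. ennreal (?c k) * (h z * indicator (ccube y (2 ^ (k + 1) * s)) z)) \<partial>lborel)"
  proof (intro nn_integral_mono)
    fix z
    obtain k where k: "wts p s (y - z) \<le> ?c k" "norm (y - z) < 2 ^ (k + 1) * s"
      using wts_shell[OF s p0] by blast
    have zm: "z \<in> ccube y (2 ^ (k + 1) * s)" using k(2) by (intro mem_ccube) (simp add: norm_minus_commute)
    have "ennreal (wts p s (y - z)) * h z \<le> ennreal (?c k) * (h z * indicator (ccube y (2 ^ (k + 1) * s)) z)"
      using zm k(1) by (auto intro!: mult_right_mono ennreal_leI)
    also have "\<dots> \<le> (\<Sum>k. ennreal (?c k) * (h z * indicator (ccube y (2 ^ (k + 1) * s)) z))"
      using sum_le_suminf[of "\<lambda>k. ennreal (?c k) * (h z * indicator (ccube y (2 ^ (k + 1) * s)) z)" "{k}"]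
      by simp
    finally show "ennreal (wts p s (y - z)) * h z
       \<le> (\<Sum>k. ennreal (?c k) * (h z * indicator (ccube y (2 ^ (k + 1) * s)) z))" .
  qed
  also have "\<dots> = (\<Sum>k. ennreal (?c k) * (\<integral>\<^sup>+z\<in>ccube y (2 ^ (k + 1) * s). h z \<partial>lborel))"
    by (subst nn_integral_suminf) (simp_all add: nn_integral_cmult)
  also have "\<dots> \<le> (\<Sum>k. ennreal (?c k) * ennreal (K * (2 ^ (k + 2) * s) ^ ?n))"
    by (intro suminf_le mult_left_mono le summableI) simp
  also have "\<dots> = (\<Sum>k. ennreal (K * 4 ^ ?n * (2 powr (real ?n - p)) ^ k))"
  proof (intro suminf_cong)
    fix k
    have "?c k * (K * (2 ^ (k + 2) * s) ^ ?n) = K * 4 ^ ?n * (2 powr (real ?n - p)) ^ k"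
    proof -
      have "(2 powr (real ?n - p)) ^ k = (2 ^ ?n * 2 powr (- p)) ^ k"
        using powr_add[of 2 "real ?n" "- p"] by (simp add: powr_realpow)
      then show ?thesis using s
        by (simp add: power_mult_distrib power_add field_simps power_mult[symmetric] mult.commute)
    qed
    then show "ennreal (?c k) * ennreal (K * (2 ^ (k + 2) * s) ^ ?n)
        = ennreal (K * 4 ^ ?n * (2 powr (real ?n - p)) ^ k)"
      using s K by (subst ennreal_mult[symmetric]) auto
  qed
  also have "\<dots> = ennreal (\<Sum>k. K * 4 ^ ?n * (2 powr (real ?n - p)) ^ k)"
  proof (rule suminf_ennreal2)
    show "summable (\<lambda>k. K * 4 ^ ?n * (2 powr (real ?n - p)) ^ k)"
      using p by (intro summable_mult summable_geometric) (simp add: powr_less_one)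
  qed (use K in auto)
  also have "(\<Sum>k. K * 4 ^ ?n * (2 powr (real ?n - p)) ^ k) = K * Wc ?n p"
  proof -
    have lt: "norm (2 powr (real ?n - p)) < 1" using p by (simp add: powr_less_one)
    show ?thesis
      using suminf_mult[OF summable_geometric[OF lt], of "K * 4 ^ ?n"] suminf_geometric[OF lt]
      by (simp add: Wc_def)
  qed
  finally show ?thesis .
qed

lemma emeasure_ccube:
  "R \<ge> 0 \<Longrightarrow> emeasure lborel (ccube y R :: (real^'n) set) = ennreal ((2 * R) ^ CARD('n))"
  by (simp add: ccube_def emeasure_cube)

lemma nn_integral_wts:
  fixes y :: "real^'n"
  assumes "s > 0" "p > real CARD('n)"
  shows "(\<integral>\<^sup>+z. ennreal (wts p s (y - z)) \<partial>lborel) \<le> ennreal (Wc CARD('n) p)"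
proof -
  have "(\<integral>\<^sup>+z. ennreal (wts p s (y - z)) * 1 \<partial>lborel) \<le> ennreal (1 * Wc CARD('n) p)"
    using assms by (intro nn_integral_wts_le) (simp_all add: emeasure_ccube power_mult_distrib)
  then show ?thesis by simp
qed

lemma nn_integral_wts':
  fixes y :: "real^'n"
  assumes "s > 0" "p > real CARD('n)"
  shows "(\<integral>\<^sup>+z. ennreal (wts p s (z - y)) \<partial>lborel) \<le> ennreal (Wc CARD('n) p)"
proof -
  have "wts p s (z - y) = wts p s (y - z)" for z using wts_minus[of p s "y - z"] by simp
  then show ?thesis using nn_integral_wts[OF assms, of y] by simp
qed

lemma nn_integral_wts0:
  assumes "s > 0" "p > real CARD('n)"
  shows "(\<integral>\<^sup>+z. ennreal (wts p s (z :: real^'n)) \<partial>lborel) \<le> ennreal (Wc CARD('n) p)"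
  using nn_integral_wts'[OF assms, of 0] by simp

lemma wts_bint:
  assumes "s > 0" "p > real CARD('n)"
  shows "bint (wts p s :: real^'n \<Rightarrow> real)"
proof -
  have "integrable lborel (wts p s :: real^'n \<Rightarrow> real)"
    using le_less_trans[OF nn_integral_wts0[OF assms] ennreal_less_top]
    by (simp add: integrable_iff_bounded abs_of_nonneg[OF wts_nonneg[OF assms(1)]])
  moreover have "\<bar>wts p s u\<bar> \<le> 1 / s ^ CARD('n)" for u :: "real^'n"
    using wts_le[of p s u] wts_nonneg[of s p u] assms by simp
  ultimately show ?thesis unfolding bint_def by blast
qed

section \<open>Littlewood--Paley kernels\<close>

abbreviation (input) tj :: "real \<Rightarrow> nat \<Rightarrow> real" where "tj \<tau> j \<equiv> \<tau> / 2 ^ j"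

text \<open>The constant of \<open>almost_orth\<close> without the ratio of the two scales.\<close>

definition orth_const :: "nat \<Rightarrow> real \<Rightarrow> real" where
  "orth_const n c = 2 * c\<^sup>2 * Wc n (real n + 2) * Wc n (real n + 1)"

text \<open>Decay of order n + 2 leaves one power to trade for a ratio of scales and then still the
  integrable order n + 1. The kernel is real; a complex Schwartz function enters through its real
  and imaginary parts.\<close>

locale lp_kernel =
  fixes \<psi> :: "real^'n \<Rightarrow> real" and c :: real
  assumes meas [measurable]: "\<psi> \<in> borel_measurable borel"
    and c: "c > 0"
    and decay: "\<And>u. \<bar>\<psi> u\<bar> \<le> c * wt (real CARD('n) + 2) u"
    and lip: "\<And>u v. \<bar>\<psi> u - \<psi> v\<bar> \<le> c * norm (u - v) * (wt (real CARD('n) + 2) u + wt (real CARD('n) + 2) v)"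
    and mean0: "(LINT u|lborel. \<psi> u) = 0"
begin

definition dl :: "real \<Rightarrow> real^'n \<Rightarrow> real" where
  "dl s u = \<psi> ((1 / s) *\<^sub>R u) / s ^ CARD('n)"

lemma Wc_pos_dim: "Wc CARD('n) (real CARD('n) + 1) > 0" "Wc CARD('n) (real CARD('n) + 2) > 0" by (auto intro!: Wc_pos)

lemma dl_measurable [measurable]:
  assumes [measurable]: "s \<in> borel_measurable M" "u \<in> borel_measurable M"
  shows "(\<lambda>x. dl (s x) (u x)) \<in> borel_measurable M"
  unfolding dl_def[abs_def] by measurable

lemma dl_le: "s > 0 \<Longrightarrow> \<bar>dl s u\<bar> \<le> c * wts (real CARD('n) + 2) s u"
  using decay[of "(1 / s) *\<^sub>R u"] by (simp add: dl_def wts_def divide_right_mono abs_divide)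

lemma dl_lip:
  assumes "s > 0"
  shows "\<bar>dl s u - dl s v\<bar> \<le> c * (norm (u - v) / s) * (wts (real CARD('n) + 2) s u + wts (real CARD('n) + 2) s v)"
proof -
  have "\<bar>dl s u - dl s v\<bar> = \<bar>\<psi> ((1 / s) *\<^sub>R u) - \<psi> ((1 / s) *\<^sub>R v)\<bar> / s ^ CARD('n)"
    using assms by (simp add: dl_def diff_divide_distrib[symmetric])
  also have "\<dots> \<le> c * norm ((1 / s) *\<^sub>R u - (1 / s) *\<^sub>R v) *
      (wt (real CARD('n) + 2) ((1 / s) *\<^sub>R u) + wt (real CARD('n) + 2) ((1 / s) *\<^sub>R v)) / s ^ CARD('n)"
    using assms lip[of "(1 / s) *\<^sub>R u" "(1 / s) *\<^sub>R v"]
    by (intro divide_right_mono) (auto simp: add_ac)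
  also have "norm ((1 / s) *\<^sub>R u - (1 / s) *\<^sub>R v) = norm (u - v) / s"
    using assms by (simp add: scaleR_diff_right[symmetric])
  finally show ?thesis by (simp add: wts_def add_divide_distrib distrib_left)
qed

lemma dl_norm1: assumes "s > 0" shows "(\<integral>\<^sup>+u. ennreal \<bar>dl s u\<bar> \<partial>lborel) \<le> ennreal (c * Wc CARD('n) (real CARD('n) + 2))"
proof -
  have "(\<integral>\<^sup>+u. ennreal \<bar>dl s u\<bar> \<partial>lborel) \<le> (\<integral>\<^sup>+u. ennreal c * ennreal (wts (real CARD('n) + 2) s (u :: real^'n)) \<partial>lborel)"
    using assms c by (intro nn_integral_mono)
      (auto simp: ennreal_mult[symmetric] wts_nonneg intro!: ennreal_leI dl_le)
  also have "\<dots> \<le> ennreal c * ennreal (Wc CARD('n) (real CARD('n) + 2))"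
    by (subst nn_integral_cmult) (auto intro!: mult_left_mono nn_integral_wts0 assms)
  finally show ?thesis using c Wc_pos_dim by (simp add: ennreal_mult)
qed

lemma dl_bint: assumes "s > 0" shows "bint (dl s)"
proof -
  have "(\<integral>\<^sup>+u. ennreal \<bar>dl s u\<bar> \<partial>lborel) < \<infinity>"
    using le_less_trans[OF dl_norm1[OF assms] ennreal_less_top] by simp
  then have "integrable lborel (dl s)" by (simp add: integrable_iff_bounded)
  moreover have "\<bar>dl s u\<bar> \<le> c * (1 / s ^ CARD('n))" for u
    using dl_le[OF assms, of u] wts_le[of "real CARD('n) + 2" s u] assms c
    by (meson add_nonneg_nonneg mult_left_mono less_imp_le of_nat_0_le_iff order_trans zero_le_numeral)
  ultimately show ?thesis unfolding bint_def by blast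
qed

lemma dl_mean0: assumes "s > 0" shows "(LINT u|lborel. dl s u) = 0"
proof -
  have "(LINT u|lborel. \<psi> u) = \<bar>1 / s\<bar> ^ DIM(real^'n) * (LINT u|lborel. \<psi> (0 + (1 / s) *\<^sub>R u))"
    using assms by (intro lebesgue_integral_affine) auto
  then have "(LINT u|lborel. \<psi> ((1 / s) *\<^sub>R u)) = 0" using mean0 assms by simp
  then show ?thesis unfolding dl_def by simp
qed

text \<open>The modulus of continuity in L1. It is the form of smoothness that is set against mean
  zero, once for pairs of kernels and once for atoms.\<close>

lemma dl_modulus:
  assumes "s > 0"
  shows "(\<integral>\<^sup>+y. ennreal \<bar>dl s (y - z) - dl s (y - z')\<bar> \<partial>lborel) \<le> ennreal (2 * c * Wc CARD('n) (real CARD('n) + 2) * (norm (z - z') / s))"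
proof -
  let ?d = "c * (norm (z - z') / s)"
  have d: "?d \<ge> 0" using c assms by simp
  have dd: "ennreal (?d * a + ?d * b) = ennreal ?d * ennreal a + ennreal ?d * ennreal b"
    if "a \<ge> 0" "b \<ge> 0" for a b
    using d that by (simp only: ennreal_plus mult_nonneg_nonneg ennreal_mult)
  have "(\<integral>\<^sup>+y. ennreal \<bar>dl s (y - z) - dl s (y - z')\<bar> \<partial>lborel)
    \<le> (\<integral>\<^sup>+y. ennreal ?d * ennreal (wts (real CARD('n) + 2) s (y - z)) + ennreal ?d * ennreal (wts (real CARD('n) + 2) s (y - z')) \<partial>lborel)"
  proof (intro nn_integral_mono)
    fix y
    have "\<bar>dl s (y - z) - dl s (y - z')\<bar> \<le> ?d * wts (real CARD('n) + 2) s (y - z) + ?d * wts (real CARD('n) + 2) s (y - z')"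
      using dl_lip[OF assms, of "y - z" "y - z'"] by (simp add: distrib_left norm_minus_commute)
    then show "ennreal \<bar>dl s (y - z) - dl s (y - z')\<bar>
      \<le> ennreal ?d * ennreal (wts (real CARD('n) + 2) s (y - z)) + ennreal ?d * ennreal (wts (real CARD('n) + 2) s (y - z'))"
      using ennreal_leI dd[OF wts_nonneg[OF assms] wts_nonneg[OF assms], of "real CARD('n) + 2" "y - z" "real CARD('n) + 2" "y - z'"]
      by metis
  qed
  also have "\<dots> = ennreal ?d * (\<integral>\<^sup>+y. ennreal (wts (real CARD('n) + 2) s (y - z)) \<partial>lborel) +
      ennreal ?d * (\<integral>\<^sup>+y. ennreal (wts (real CARD('n) + 2) s (y - z')) \<partial>lborel)"
    by (simp add: nn_integral_add nn_integral_cmult)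
  also have "\<dots> \<le> ennreal ?d * ennreal (Wc CARD('n) (real CARD('n) + 2)) + ennreal ?d * ennreal (Wc CARD('n) (real CARD('n) + 2))"
    by (intro add_mono mult_left_mono nn_integral_wts' assms) auto
  also have "\<dots> = ennreal (2 * c * Wc CARD('n) (real CARD('n) + 2) * (norm (z - z') / s))"
  proof -
    have "ennreal ?d * ennreal (Wc CARD('n) (real CARD('n) + 2)) + ennreal ?d * ennreal (Wc CARD('n) (real CARD('n) + 2)) = ennreal (?d * Wc CARD('n) (real CARD('n) + 2) + ?d * Wc CARD('n) (real CARD('n) + 2))"
      by (rule dd[OF less_imp_le[OF Wc_pos_dim(2)] less_imp_le[OF Wc_pos_dim(2)], symmetric])
    then show ?thesis by (simp add: mult_ac)
  qed
  finally show ?thesis .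
qed

text \<open>Almost orthogonality: the mean zero of the finer kernel is played off against the
  smoothness of the coarser one.\<close>

lemma almost_orth:
  assumes s: "s > 0" and t: "t > 0"
  shows "(\<integral>\<^sup>+y. ennreal \<bar>KC (dl t) (\<lambda>u. dl s (- u)) y\<bar> \<partial>lborel) \<le> ennreal (2 * c\<^sup>2 * Wc CARD('n) (real CARD('n) + 2) * Wc CARD('n) (real CARD('n) + 1) * (s / t))"
proof -
  have bs: "bint (\<lambda>u. dl s (- u))" by (rule bint_uminus[OF dl_bint[OF s]])
  have bt: "bint (dl t)" by (rule dl_bint[OF t])
  have z0: "(LINT u|lborel. dl s (- u)) = 0"
    using lebesgue_integral_reflect[of "dl s" 0] dl_mean0[OF s] bint_meas[OF dl_bint[OF s]] by simp
  have eq: "KC (dl t) (\<lambda>u. dl s (- u)) y = (LINT z|lborel. (dl t (y - z) - dl t (y - 0)) * dl s (- z))" for y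
  proof -
    have "(LINT z|lborel. (dl t (y - z) - dl t (y - 0)) * dl s (- z))
      = (LINT z|lborel. dl t (y - z) * dl s (- z) - dl t y * dl s (- z))"
      by (simp add: left_diff_distrib)
    also have "\<dots> = KC (dl t) (\<lambda>u. dl s (- u)) y - (LINT z|lborel. dl t y * dl s (- z))"
      unfolding KC_def
      by (intro Bochner_Integration.integral_diff bint_integrable KC_integrand bt bs bint_cmult)
    finally show ?thesis using z0 by simp
  qed
  have "(\<integral>\<^sup>+y. ennreal \<bar>KC (dl t) (\<lambda>u. dl s (- u)) y\<bar> \<partial>lborel)
    \<le> (\<integral>\<^sup>+y. (\<integral>\<^sup>+z. ennreal \<bar>dl t (y - z) - dl t (y - 0)\<bar> * ennreal \<bar>dl s (- z)\<bar> \<partial>lborel) \<partial>lborel)"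
  proof (intro nn_integral_mono)
    fix y
    have i: "integrable lborel (\<lambda>z. (dl t (y - z) - dl t (y - 0)) * dl s (- z))"
      unfolding left_diff_distrib
      by (intro Bochner_Integration.integrable_diff bint_integrable KC_integrand bt bs bint_cmult)
    show "ennreal \<bar>KC (dl t) (\<lambda>u. dl s (- u)) y\<bar>
      \<le> (\<integral>\<^sup>+z. ennreal \<bar>dl t (y - z) - dl t (y - 0)\<bar> * ennreal \<bar>dl s (- z)\<bar> \<partial>lborel)"
      using integral_norm_bound_ennreal[OF i] unfolding eq by (simp add: abs_mult ennreal_mult)
  qed
  also have "\<dots> = (\<integral>\<^sup>+z. (\<integral>\<^sup>+y. ennreal \<bar>dl t (y - z) - dl t (y - 0)\<bar> * ennreal \<bar>dl s (- z)\<bar> \<partial>lborel) \<partial>lborel)"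
    by (rule lborel_pair.Fubini') measurable
  also have "\<dots> = (\<integral>\<^sup>+z. (\<integral>\<^sup>+y. ennreal \<bar>dl t (y - z) - dl t (y - 0)\<bar> \<partial>lborel) * ennreal \<bar>dl s (- z)\<bar> \<partial>lborel)"
    by (simp add: nn_integral_multc)
  also have "\<dots> \<le> (\<integral>\<^sup>+z. ennreal (2 * c * Wc CARD('n) (real CARD('n) + 2) * (norm z / t)) * ennreal \<bar>dl s (- z)\<bar> \<partial>lborel)"
    using dl_modulus[OF t, of _ 0] by (intro nn_integral_mono mult_right_mono) auto
  also have "\<dots> \<le> (\<integral>\<^sup>+z. ennreal (2 * c\<^sup>2 * Wc CARD('n) (real CARD('n) + 2) * (s / t)) * ennreal (wts (real CARD('n) + 1) s (z :: real^'n)) \<partial>lborel)"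
  proof (intro nn_integral_mono)
    fix z :: "real^'n"
    have "2 * c * Wc CARD('n) (real CARD('n) + 2) * (norm z / t) * \<bar>dl s (- z)\<bar> \<le> 2 * c * Wc CARD('n) (real CARD('n) + 2) * (norm z / t) * (c * wts (real CARD('n) + 2) s z)"
      using dl_le[OF s, of "- z"] c Wc_pos_dim t by (intro mult_left_mono) (auto simp: wts_minus)
    \<comment> \<open>The factor \<open>norm z\<close>, measured in units of the finer scale
      \<open>s\<close>, is absorbed by one power of decay of the finer kernel; the change of units
      leaves \<open>s / t\<close>.\<close>
    also have "\<dots> = 2 * c\<^sup>2 * Wc CARD('n) (real CARD('n) + 2) * (s / t) * (norm z / s * wts (real CARD('n) + 1 + 1) s z)"
      using s t by (simp add: power2_eq_square add_ac)
    also have "\<dots> \<le> 2 * c\<^sup>2 * Wc CARD('n) (real CARD('n) + 2) * (s / t) * wts (real CARD('n) + 1) s z"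
      using c Wc_pos_dim t s norm_wts_le[OF s, of z "real CARD('n) + 1"] by (intro mult_left_mono) auto
    finally show "ennreal (2 * c * Wc CARD('n) (real CARD('n) + 2) * (norm z / t)) * ennreal \<bar>dl s (- z)\<bar>
        \<le> ennreal (2 * c\<^sup>2 * Wc CARD('n) (real CARD('n) + 2) * (s / t)) * ennreal (wts (real CARD('n) + 1) s z)"
      using c Wc_pos_dim s t by (simp add: ennreal_mult[symmetric] wts_nonneg ennreal_leI)
  qed
  also have "\<dots> \<le> ennreal (2 * c\<^sup>2 * Wc CARD('n) (real CARD('n) + 2) * (s / t)) * ennreal (Wc CARD('n) (real CARD('n) + 1))"
    by (subst nn_integral_cmult) (auto intro!: mult_left_mono nn_integral_wts0 s)
  also have "\<dots> = ennreal (2 * c\<^sup>2 * Wc CARD('n) (real CARD('n) + 2) * Wc CARD('n) (real CARD('n) + 1) * (s / t))"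
    using Wc_pos_dim s t by (simp add: ennreal_mult[symmetric] mult_ac)
  finally show ?thesis .
qed

lemma orth_const_pos: "orth_const CARD('n) c > 0" using c Wc_pos_dim by (simp add: orth_const_def)

text \<open>\<open>max i j - min i j\<close> is the distance of \<open>i\<close> and
  \<open>j\<close> in \<open>nat\<close>; each side of \<open>j\<close> contributes a geometric
  series of value at most 2.\<close>

lemma sum_half_powers_le: "(\<Sum>i<N. (1/2 :: real) ^ (max i j - min i j)) \<le> 4"
proof -
  have s2: "(\<Sum>m<L. (1/2::real) ^ m) \<le> 2" for L :: nat
    by (subst geometric_sum) (auto simp: field_simps)
  have re: "(\<Sum>i\<in>S. (1/2 :: real) ^ h i) \<le> (\<Sum>m<L. (1/2) ^ m)"
    if "inj_on h S" "h ` S \<subseteq> {..<L}" for h L and S :: "nat set"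
  proof -
    have "(\<Sum>i\<in>S. (1/2 :: real) ^ h i) = (\<Sum>m\<in>h ` S. (1/2) ^ m)"
      by (simp add: sum.reindex[OF that(1)])
    also have "\<dots> \<le> (\<Sum>m<L. (1/2) ^ m)" using that(2) by (intro sum_mono2) auto
    finally show ?thesis .
  qed
  have "(\<Sum>i<N. (1/2 :: real) ^ (max i j - min i j))
     \<le> (\<Sum>i\<in>{..<N} \<inter> {..j}. (1/2 :: real) ^ (j - i)) + (\<Sum>i\<in>{..<N} - {..j}. (1/2 :: real) ^ (i - j))"
    by (subst sum.Int_Diff[of _ _ "{..j}"]) (auto intro!: add_mono sum_mono simp: max_def min_def)
  also have "(\<Sum>i\<in>{..<N} \<inter> {..j}. (1/2 :: real) ^ (j - i)) \<le> (\<Sum>m<Suc j. (1/2) ^ m)"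
    by (rule re) (auto simp: inj_on_def)
  also have "(\<Sum>i\<in>{..<N} - {..j}. (1/2 :: real) ^ (i - j)) \<le> (\<Sum>m<Suc N. (1/2) ^ m)"
    by (rule re) (auto simp: inj_on_def)
  finally show ?thesis using s2[of "Suc j"] s2[of "Suc N"] by linarith
qed

text \<open>A Cotlar--Stein argument by duality. The sum \<open>I\<close> on the left is the pairing
  of \<open>g\<close> with \<open>V\<close>, the sum of the operators composed with their adjoints,
  applied to \<open>g\<close>. Expanding the square of \<open>V\<close> and using almost
  orthogonality bounds its integral by a multiple of \<open>I\<close> itself, and Young's inequality
  then lets \<open>I\<close> be absorbed.\<close>

lemma L2_estimate:
  assumes \<tau>: "\<tau> > 0" and g: "bint g"
  shows "(\<Sum>j<N. LINT y|lborel. (KC (dl (tj \<tau> j)) g y)\<^sup>2) \<le> 4 * orth_const CARD('n) c * (LINT y|lborel. (g y)\<^sup>2)"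
proof -
  have t: "tj \<tau> j > 0" for j using \<tau> by simp
  define k where "k j = dl (tj \<tau> j)" for j
  define k' where "k' j = (\<lambda>u. k j (- u))" for j
  have kb: "bint (k j)" for j unfolding k_def by (rule dl_bint[OF t])
  have k'b: "bint (k' j)" for j unfolding k'_def by (rule bint_uminus[OF kb])
  define u where "u j = KC (k j) g" for j
  have ub: "bint (u j)" for j unfolding u_def by (rule KC_bint[OF kb g])
  define v where "v j = KC (k' j) (u j)" for j
  have vb: "bint (v j)" for j unfolding v_def by (rule KC_bint[OF k'b ub])
  define q where "q j = (LINT y|lborel. (u j y)\<^sup>2)" for j
  have q0: "q j \<ge> 0" for j by (simp add: q_def)
  define I where "I = (\<Sum>j<N. q j)"
  define G where "G = (LINT y|lborel. (g y)\<^sup>2)"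
  have gv: "q j = (LINT z|lborel. g z * v j z)" for j
  proof -
    have "q j = (LINT y|lborel. u j y * KC (k j) g y)"
      unfolding q_def by (simp add: u_def power2_eq_square)
    also have "\<dots> = (LINT z|lborel. KC (\<lambda>w. k j (- w)) (u j) z * g z)"
      by (rule KC_adjoint[OF kb g ub])
    finally show ?thesis by (simp add: v_def k'_def mult.commute)
  qed
  \<comment> \<open>Moving the reflected kernel off \<open>v i\<close> pairs \<open>u i\<close> with
    the composite kernel \<open>KC (k i) (k' j)\<close> applied to \<open>u j\<close>. The L1 norm
    of this composite decays geometrically in \<open>j - i\<close>.\<close>
  have vv: "(LINT z|lborel. v i z * v j z) \<le> orth_const CARD('n) c * (1/2) ^ (j - i) / 2 * (q i + q j)" if "i \<le> j" for i j
  proof -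
    have "(LINT z|lborel. v j z * v i z) = (LINT z|lborel. v j z * KC (k' i) (u i) z)"
      by (simp add: v_def)
    also have "\<dots> = (LINT z|lborel. KC (\<lambda>w. k' i (- w)) (v j) z * u i z)"
      by (rule KC_adjoint[OF k'b ub vb])
    also have "KC (\<lambda>w. k' i (- w)) (v j) = KC (KC (k i) (k' j)) (u j)"
      unfolding v_def by (rule ext) (simp add: k'_def KC_assoc[OF kb k'b ub, unfolded k'_def])
    finally have "(LINT z|lborel. v i z * v j z) = (LINT z|lborel. u i z * KC (KC (k i) (k' j)) (u j) z)"
      by (simp add: mult.commute)
    also have "\<dots> \<le> \<bar>LINT z|lborel. u i z * KC (KC (k i) (k' j)) (u j) z\<bar>" by simp
    also have "\<dots> \<le> (orth_const CARD('n) c * (1/2) ^ (j - i)) / 2 * (q i + q j)"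
      unfolding q_def
    proof (rule KC_young2)
      show "bint (KC (k i) (k' j))" by (rule KC_bint[OF kb k'b])
      show "(\<integral>\<^sup>+y. ennreal \<bar>KC (k i) (k' j) y\<bar> \<partial>lborel) \<le> ennreal (orth_const CARD('n) c * (1/2) ^ (j - i))"
      proof -
        have "tj \<tau> j / tj \<tau> i = (1/2) ^ (j - i)"
          using \<tau> that by (simp add: power_one_over power_diff)
        then show ?thesis using almost_orth[OF t t, of i j] by (simp add: orth_const_def k_def k'_def)
      qed
    qed (use ub orth_const_pos in auto)
    finally show ?thesis .
  qed
  have vv': "(LINT z|lborel. v i z * v j z) \<le> orth_const CARD('n) c / 2 * ((1/2) ^ (max i j - min i j) * q i + (1/2) ^ (max i j - min i j) * q j)" for i j
  proof (cases "i \<le> j")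
    case True then show ?thesis using vv[OF True] by (simp add: max_def min_def algebra_simps)
  next
    case False
    then have "j \<le> i" by simp
    from vv[OF this] False show ?thesis by (simp add: max_def min_def mult.commute algebra_simps)
  qed
  define V where "V z = (\<Sum>j<N. v j z)" for z
  have Vb: "bint V" unfolding V_def[abs_def] by (rule bint_sum[OF vb])
  have V2: "(LINT z|lborel. (V z)\<^sup>2) \<le> 4 * orth_const CARD('n) c * I"
  proof -
    have "(LINT z|lborel. (V z)\<^sup>2) = (LINT z|lborel. (\<Sum>i<N. \<Sum>j<N. v i z * v j z))"
      by (simp add: V_def power2_eq_square sum_product)
    also have "\<dots> = (\<Sum>i<N. \<Sum>j<N. LINT z|lborel. v i z * v j z)"
      by (subst Bochner_Integration.integral_sum;
          (subst Bochner_Integration.integral_sum)?)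
         (auto intro!: bint_integrable bint_mult vb Bochner_Integration.integrable_sum)
    also have "\<dots> \<le> (\<Sum>i<N. \<Sum>j<N. orth_const CARD('n) c / 2 * ((1/2) ^ (max i j - min i j) * q i + (1/2) ^ (max i j - min i j) * q j))"
      by (intro sum_mono vv')
    also have "\<dots> = orth_const CARD('n) c / 2 * ((\<Sum>i<N. \<Sum>j<N. (1/2) ^ (max i j - min i j) * q i) +
        (\<Sum>i<N. \<Sum>j<N. (1/2) ^ (max i j - min i j) * q j))"
      by (simp add: sum.distrib sum_distrib_left distrib_left)
    also have "(\<Sum>i<N. \<Sum>j<N. (1/2) ^ (max i j - min i j) * q j) = (\<Sum>i<N. \<Sum>j<N. (1/2) ^ (max i j - min i j) * q i)"
      by (subst sum.swap) (simp add: max.commute min.commute)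
    also have "orth_const CARD('n) c / 2 * ((\<Sum>i<N. \<Sum>j<N. (1/2) ^ (max i j - min i j) * q i) +
        (\<Sum>i<N. \<Sum>j<N. (1/2) ^ (max i j - min i j) * q i))
        \<le> orth_const CARD('n) c / 2 * ((\<Sum>i<N. 4 * q i) + (\<Sum>i<N. 4 * q i))"
    proof (intro mult_left_mono add_mono sum_mono)
      fix i
      have "(\<Sum>j<N. (1/2) ^ (max i j - min i j) * q i) = (\<Sum>j<N. (1/2::real) ^ (max j i - min j i)) * q i"
        by (simp add: sum_distrib_right max.commute min.commute)
      also have "\<dots> \<le> 4 * q i" by (intro mult_right_mono sum_half_powers_le q0)
      finally have *: "(\<Sum>j<N. (1/2) ^ (max i j - min i j) * q i) \<le> 4 * q i" .
      show "(\<Sum>j<N. (1/2) ^ (max i j - min i j) * q i) \<le> 4 * q i"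
        "(\<Sum>j<N. (1/2) ^ (max i j - min i j) * q i) \<le> 4 * q i" by (rule *)+
    qed (use orth_const_pos in simp)
    also have "(\<Sum>i<N. 4 * q i) = 4 * I" by (simp add: I_def sum_distrib_left)
    finally show ?thesis by (simp add: algebra_simps)
  qed
  have "I = (LINT z|lborel. g z * V z)"
    unfolding I_def gv V_def sum_distrib_left
    by (intro Bochner_Integration.integral_sum[symmetric] bint_integrable bint_mult g vb)
  \<comment> \<open>The two weights are chosen against \<open>V2\<close>: the term in
    \<open>V\<close> returns at most \<open>I / 2\<close>, which the left side absorbs,
    \<open>I\<close> being a real number.\<close>
  also have "\<dots> \<le> (LINT z|lborel. (2 * orth_const CARD('n) c) * (g z)\<^sup>2 + (1 / (8 * orth_const CARD('n) c)) * (V z)\<^sup>2)"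
  proof (rule integral_mono)
    show "integrable lborel (\<lambda>z. g z * V z)" by (intro bint_integrable bint_mult g Vb)
    show "integrable lborel (\<lambda>z. (2 * orth_const CARD('n) c) * (g z)\<^sup>2 + (1 / (8 * orth_const CARD('n) c)) * (V z)\<^sup>2)"
      unfolding power2_eq_square by (intro bint_integrable bint_add bint_cmult bint_mult g Vb)
    fix z
    have "0 \<le> (4 * orth_const CARD('n) c * g z - V z)\<^sup>2" by simp
    then have "8 * orth_const CARD('n) c * (g z * V z) \<le> 8 * orth_const CARD('n) c * ((2 * orth_const CARD('n) c) * (g z)\<^sup>2 + (1 / (8 * orth_const CARD('n) c)) * (V z)\<^sup>2)"
      using orth_const_pos by (simp add: power2_eq_square algebra_simps)
    then show "g z * V z \<le> (2 * orth_const CARD('n) c) * (g z)\<^sup>2 + (1 / (8 * orth_const CARD('n) c)) * (V z)\<^sup>2"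
      using orth_const_pos by simp
  qed
  also have "\<dots> = (2 * orth_const CARD('n) c) * G + (1 / (8 * orth_const CARD('n) c)) * (LINT z|lborel. (V z)\<^sup>2)"
    unfolding G_def power2_eq_square
    by (subst Bochner_Integration.integral_add)
       (auto intro!: bint_integrable bint_cmult bint_mult g Vb simp del: times_divide_eq_left mult_cancel_left1)
  also have "\<dots> \<le> (2 * orth_const CARD('n) c) * G + (1 / (8 * orth_const CARD('n) c)) * (4 * orth_const CARD('n) c * I)"
    using orth_const_pos by (intro add_left_mono mult_left_mono V2) auto
  also have "\<dots> = 2 * orth_const CARD('n) c * G + I / 2" using orth_const_pos by simp
  finally have "I \<le> 4 * orth_const CARD('n) c * G" by simp
  then show ?thesis by (simp add: I_def q_def G_def u_def k_def)
qed

end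

section \<open>A finite Calderon--Zygmund decomposition\<close>

text \<open>The stopping rule: a cube is bisected until its average exceeds \<open>l\<close> or
  depth \<open>D\<close> is reached. Its parent was not stopped, so the average is at most 2^n times
  \<open>l\<close>. The cutoff keeps the family finite and makes it a partition of the whole cube;
  cubes that reach depth \<open>D\<close> with a small average simply remain in the family.\<close>

lemma CZ_family:
  fixes f :: "real^'n \<Rightarrow> real"
  assumes f: "integrable lborel f" and r: "r > 0" and le: "cube_avg (\<lambda>x. \<bar>f x\<bar>) v r \<le> l" and l: "l \<ge> 0"
  shows "\<exists>C :: ((real^'n) \<times> nat) set. finite C \<and>
    disjoint_family_on (\<lambda>(u, m). cube u (r / 2 ^ m)) C \<and>
    (\<Union>(u, m)\<in>C. cube u (r / 2 ^ m)) = cube v r \<and>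
    (\<forall>(u, m)\<in>C. m \<le> D \<and> cube_avg (\<lambda>x. \<bar>f x\<bar>) u (r / 2 ^ m) \<le> 2 ^ CARD('n) * l \<and>
       (m = D \<or> cube_avg (\<lambda>x. \<bar>f x\<bar>) u (r / 2 ^ m) > l))"
  using r le
proof (induction D arbitrary: v r)
  case 0
  have "l * 1 \<le> l * 2 ^ CARD('n)" using l by (intro mult_left_mono) auto
  with 0 show ?case
    by (intro exI[of _ "{(v, 0)}"]) (auto simp: disjoint_family_on_def mult.commute)
next
  case (Suc D)
  let ?a = "\<lambda>u m. cube_avg (\<lambda>x. \<bar>f x\<bar>) u (r / 2 ^ m)"
  let ?P = "\<lambda>s C. finite C \<and>
    disjoint_family_on (\<lambda>(u, m). cube u (r / 2 ^ m)) C \<and>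
    (\<Union>(u, m)\<in>C. cube u (r / 2 ^ m)) = cube (child v r s) (r / 2) \<and>
    (\<forall>(u, m)\<in>C. m \<le> Suc D \<and> ?a u m \<le> 2 ^ CARD('n) * l \<and> (m = Suc D \<or> ?a u m > l))"
  have "\<exists>C. ?P s C" for s
  proof (cases "cube_avg (\<lambda>x. \<bar>f x\<bar>) (child v r s) (r / 2) > l")
    case True
    have "cube_avg (\<lambda>x. \<bar>f x\<bar>) (child v r s) (r / 2) \<le> 2 ^ CARD('n) * l"
      using cube_avg_child_le[OF f Suc.prems(1), of v s] mult_left_mono[OF Suc.prems(2), of "2 ^ CARD('n)"]
      by (simp only: zero_le_power zero_le_numeral order_trans)
    with True show ?thesis
      by (intro exI[of _ "{(child v r s, 1)}"]) (auto simp: disjoint_family_on_def)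
  next
    case False
    then obtain C where C: "finite C" "disjoint_family_on (\<lambda>(u, m). cube u (r / 2 / 2 ^ m)) C"
      "(\<Union>(u, m)\<in>C. cube u (r / 2 / 2 ^ m)) = cube (child v r s) (r / 2)"
      "\<forall>(u, m)\<in>C. m \<le> D \<and> cube_avg (\<lambda>x. \<bar>f x\<bar>) u (r / 2 / 2 ^ m) \<le> 2 ^ CARD('n) * l \<and>
       (m = D \<or> cube_avg (\<lambda>x. \<bar>f x\<bar>) u (r / 2 / 2 ^ m) > l)"
      using Suc.IH[of "r / 2" "child v r s"] Suc.prems by (auto simp: not_less)
    have *: "r / 2 / 2 ^ m = r / 2 ^ Suc m" for m :: nat by simp
    let ?C = "(\<lambda>(u, m). (u, Suc m)) ` C"
    have "finite ?C" using C(1) by simp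
    moreover have "disjoint_family_on (\<lambda>(u, m). cube u (r / 2 ^ m)) ?C"
      using C(2) unfolding disjoint_family_on_def * by fastforce
    moreover have "(\<Union>(u, m)\<in>?C. cube u (r / 2 ^ m)) = cube (child v r s) (r / 2)"
    proof -
      have "(\<Union>(u, m)\<in>?C. cube u (r / 2 ^ m)) = (\<Union>(u, m)\<in>C. cube u (r / 2 ^ Suc m))"
        by (simp only: image_image image_Union split_beta fst_conv snd_conv SUP_image comp_def case_prod_beta')
      then show ?thesis using C(3) unfolding * by simp
    qed
    moreover have "\<forall>(u, m)\<in>?C. m \<le> Suc D \<and> ?a u m \<le> 2 ^ CARD('n) * l \<and> (m = Suc D \<or> ?a u m > l)"
      using C(4) unfolding * by auto
    ultimately show ?thesis by blast
  qed
  then have "\<forall>s. \<exists>C. ?P s C" by (rule allI)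
  then have "\<exists>C. \<forall>s. ?P s (C s)" by (rule choice)
  then obtain C where C0: "\<forall>s. ?P s (C s)" by (rule exE)
  have C: "?P s (C s)" for s by (rule spec[OF C0])
  have Cf: "finite (C s)" for s using C[of s] by (elim conjE)
  have Cd: "disjoint_family_on (\<lambda>(u, m). cube u (r / 2 ^ m)) (C s)" for s using C[of s] by (elim conjE)
  have CU: "(\<Union>(u, m)\<in>C s. cube u (r / 2 ^ m)) = cube (child v r s) (r / 2)" for s using C[of s] by (elim conjE)
  have Cq: "\<forall>(u, m)\<in>C s. m \<le> Suc D \<and> ?a u m \<le> 2 ^ CARD('n) * l \<and> (m = Suc D \<or> ?a u m > l)" for s
    using C[of s] by (elim conjE)
  let ?C = "\<Union>s. C s"
  have sub: "cube u (r / 2 ^ m) \<subseteq> cube (child v r s) (r / 2)" if "(u, m) \<in> C s" for u m s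
    using CU[of s] that by fast
  have f1: "finite ?C" by (simp add: Cf)
  have f2: "disjoint_family_on (\<lambda>(u, m). cube u (r / 2 ^ m)) ?C"
    unfolding disjoint_family_on_def
  proof (intro ballI impI)
    fix p q assume "p \<in> ?C" "q \<in> ?C" and ne: "p \<noteq> q"
    then obtain s s' where s: "p \<in> C s" "q \<in> C s'" by blast
    obtain u m u' m' where pq: "p = (u, m)" "q = (u', m')" by fastforce
    show "(case p of (u, m) \<Rightarrow> cube u (r / 2 ^ m)) \<inter> (case q of (u, m) \<Rightarrow> cube u (r / 2 ^ m)) = {}"
    proof (cases "s = s'")
      case True
      then show ?thesis using Cd[of s] s ne unfolding disjoint_family_on_def by blast
    next
      case False
      then have "cube (child v r s) (r / 2) \<inter> cube (child v r s') (r / 2) = {}"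
        using cube_disj[of _ v r s s'] Suc.prems(1) by blast
      then show ?thesis using sub[of u m s] sub[of u' m' s'] s pq by auto
    qed
  qed
  have f3: "(\<Union>(u, m)\<in>?C. cube u (r / 2 ^ m)) = cube v r"
  proof -
    have "(\<Union>(u, m)\<in>?C. cube u (r / 2 ^ m)) = (\<Union>s. \<Union>(u, m)\<in>C s. cube u (r / 2 ^ m))" by blast
    also have "\<dots> = (\<Union>s. cube (child v r s) (r / 2))" by (simp only: CU)
    also have "\<dots> = cube v r"
    proof (rule equalityI)
      show "(\<Union>s. cube (child v r s) (r / 2)) \<subseteq> cube v r"
        by (intro UN_least child_subset Suc.prems(1))
      show "cube v r \<subseteq> (\<Union>s. cube (child v r s) (r / 2))"
        by (rule subsetI, drule cube_ex_child) simp
    qed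
    finally show ?thesis .
  qed
  have f4: "\<forall>(u, m)\<in>?C. m \<le> Suc D \<and> ?a u m \<le> 2 ^ CARD('n) * l \<and> (m = Suc D \<or> ?a u m > l)"
  proof (rule ballI)
    fix p assume "p \<in> ?C"
    then obtain s where "p \<in> C s" by (rule UN_E)
    then show "case p of (u, m) \<Rightarrow> m \<le> Suc D \<and> ?a u m \<le> 2 ^ CARD('n) * l \<and> (m = Suc D \<or> ?a u m > l)"
      by (rule bspec[OF Cq])
  qed
  show ?case by (intro exI[of _ ?C] conjI f1 f2 f3 f4)
qed

lemma KC_add: "bint k \<Longrightarrow> bint u \<Longrightarrow> bint v \<Longrightarrow> KC k (\<lambda>x. u x + v x) y = KC k u y + KC k v y"
  unfolding KC_def distrib_left
  by (intro Bochner_Integration.integral_add bint_integrable KC_integrand)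

lemma KC_sum:
  assumes "bint k" "\<And>j. j \<in> J \<Longrightarrow> bint (u j)"
  shows "KC k (\<lambda>x. \<Sum>j\<in>J. u j x) y = (\<Sum>j\<in>J. KC k (u j) y)"
  unfolding KC_def sum_distrib_left
  by (intro Bochner_Integration.integral_sum bint_integrable KC_integrand assms)

lemma KC_bound:
  assumes k: "bint k" and g: "bint g" and K: "(\<integral>\<^sup>+y. ennreal \<bar>k y\<bar> \<partial>lborel) \<le> ennreal K" "K \<ge> 0"
    and G: "\<And>x. \<bar>g x\<bar> \<le> G"
  shows "\<bar>KC k g y\<bar> \<le> K * G"
proof -
  have [measurable]: "k \<in> borel_measurable borel" by (rule bint_meas[OF k])
  have G0: "G \<ge> 0" using G[of 0] by linarith
  have "ennreal \<bar>KC k g y\<bar> \<le> (\<integral>\<^sup>+z. ennreal \<bar>k (y - z)\<bar> * ennreal \<bar>g z\<bar> \<partial>lborel)"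
    by (rule KC_abs_le[OF k g])
  also have "\<dots> \<le> (\<integral>\<^sup>+z. ennreal \<bar>k (y - z)\<bar> * ennreal G \<partial>lborel)"
    by (intro nn_integral_mono mult_left_mono ennreal_leI G) simp
  also have "\<dots> = (\<integral>\<^sup>+z. ennreal \<bar>k z\<bar> \<partial>lborel) * ennreal G"
    using nn_integral_reflect[of "\<lambda>y. ennreal \<bar>k y\<bar>" y] by (simp add: nn_integral_multc)
  also have "\<dots> \<le> ennreal K * ennreal G" by (intro mult_right_mono K) simp
  finally show ?thesis using K(2) G0 by (simp add: ennreal_mult[symmetric])
qed

lemma bint_indicator_mult:
  assumes "bint f" and [measurable]: "A \<in> sets borel"
  shows "bint (\<lambda>x. f x * indicator A x)"
proof -
  have "integrable lborel (\<lambda>x. f x * indicator A x)"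
    using integrable_mult_indicator[of A lborel f] bint_integrable[OF assms(1)] by (simp add: mult.commute)
  moreover obtain G where "\<And>x. \<bar>f x\<bar> \<le> G" "G \<ge> 0" using bint_bound[OF assms(1)] by blast
  then have "\<bar>f x * indicator A x\<bar> \<le> G" for x by (auto simp: indicator_def)
  ultimately show ?thesis unfolding bint_def by blast
qed

lemma bint_indicator_cube: "r \<ge> 0 \<Longrightarrow> bint (indicator (cube u r) :: real^'n \<Rightarrow> real)"
  by (auto simp: bint_def emeasure_cube indicator_def intro!: exI[of _ 1])

lemma bint_abs: "bint f \<Longrightarrow> bint (\<lambda>x. \<bar>f x\<bar>)"
  by (auto simp: bint_def)

lemma nn_integral_abs_bint: "bint f \<Longrightarrow> (\<integral>\<^sup>+x. ennreal \<bar>f x\<bar> \<partial>lborel) = ennreal (LINT x|lborel. \<bar>f x\<bar>)"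
  by (intro nn_integral_eq_integral) (auto simp: bint_integrable)

lemma norm_diff_cube_le:
  fixes u :: "real^'n"
  assumes "z \<in> cube u r"
  shows "norm (z - u) \<le> real CARD('n) * r"
proof (rule norm_diff_cube[OF assms])
  have "u $ i \<le> z $ i \<and> z $ i < u $ i + r" for i using assms by (simp add: cube_def)
  then have "r > 0" by (meson le_less_trans less_add_same_cancel1)
  then show "u \<in> cube u r" by (simp add: cube_def)
qed

section \<open>Convolution of a kernel with an atom\<close>

context lp_kernel
begin

text \<open>For atoms on cubes smaller than the scale \<open>t\<close>: mean zero allows the kernel
  to be compared with its value at the corner \<open>u\<close>, and the L1 modulus of continuity
  yields the gain \<open>r / t\<close>.\<close>

lemma KC_cancel:
  assumes t: "t > 0" and b: "bint b" and mean: "(LINT z|lborel. b z) = 0"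
    and supp: "\<And>z. z \<notin> cube u r \<Longrightarrow> b z = 0" and r: "r \<ge> 0"
  shows "(\<integral>\<^sup>+y. ennreal \<bar>KC (dl t) b y\<bar> \<partial>lborel)
    \<le> ennreal (2 * c * Wc CARD('n) (real CARD('n) + 2) * (real CARD('n) * r / t) * (LINT z|lborel. \<bar>b z\<bar>))"
proof -
  let ?W = "2 * c * Wc CARD('n) (real CARD('n) + 2)"
  have [measurable]: "b \<in> borel_measurable borel" by (rule bint_meas[OF b])
  have bt: "bint (dl t)" by (rule dl_bint[OF t])
  have eq: "KC (dl t) b y = (LINT z|lborel. (dl t (y - z) - dl t (y - u)) * b z)" for y
  proof -
    have "(LINT z|lborel. (dl t (y - z) - dl t (y - u)) * b z)
      = KC (dl t) b y - (LINT z|lborel. dl t (y - u) * b z)"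
      unfolding KC_def left_diff_distrib
      by (intro Bochner_Integration.integral_diff bint_integrable KC_integrand bt b bint_cmult)
    then show ?thesis using mean by simp
  qed
  have "(\<integral>\<^sup>+y. ennreal \<bar>KC (dl t) b y\<bar> \<partial>lborel)
    \<le> (\<integral>\<^sup>+y. (\<integral>\<^sup>+z. ennreal \<bar>dl t (y - z) - dl t (y - u)\<bar> * ennreal \<bar>b z\<bar> \<partial>lborel) \<partial>lborel)"
  proof (intro nn_integral_mono)
    fix y
    have i: "integrable lborel (\<lambda>z. (dl t (y - z) - dl t (y - u)) * b z)"
      unfolding left_diff_distrib
      by (intro Bochner_Integration.integrable_diff bint_integrable KC_integrand bt b bint_cmult)
    show "ennreal \<bar>KC (dl t) b y\<bar>
      \<le> (\<integral>\<^sup>+z. ennreal \<bar>dl t (y - z) - dl t (y - u)\<bar> * ennreal \<bar>b z\<bar> \<partial>lborel)"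
      using integral_norm_bound_ennreal[OF i] unfolding eq by (simp add: abs_mult ennreal_mult)
  qed
  also have "\<dots> = (\<integral>\<^sup>+z. (\<integral>\<^sup>+y. ennreal \<bar>dl t (y - z) - dl t (y - u)\<bar> * ennreal \<bar>b z\<bar> \<partial>lborel) \<partial>lborel)"
    by (rule lborel_pair.Fubini') measurable
  also have "\<dots> = (\<integral>\<^sup>+z. (\<integral>\<^sup>+y. ennreal \<bar>dl t (y - z) - dl t (y - u)\<bar> \<partial>lborel) * ennreal \<bar>b z\<bar> \<partial>lborel)"
    by (simp add: nn_integral_multc)
  also have "\<dots> \<le> (\<integral>\<^sup>+z. ennreal (?W * (real CARD('n) * r / t)) * ennreal \<bar>b z\<bar> \<partial>lborel)"
  proof (intro nn_integral_mono)
    fix z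
    show "(\<integral>\<^sup>+y. ennreal \<bar>dl t (y - z) - dl t (y - u)\<bar> \<partial>lborel) * ennreal \<bar>b z\<bar>
       \<le> ennreal (?W * (real CARD('n) * r / t)) * ennreal \<bar>b z\<bar>"
    proof (cases "z \<in> cube u r")
      case True
      have "ennreal (?W * (norm (z - u) / t)) \<le> ennreal (?W * (real CARD('n) * r / t))"
        using norm_diff_cube_le[OF True] t c Wc_pos_dim
        by (intro ennreal_leI mult_left_mono divide_right_mono) auto
      then show ?thesis using dl_modulus[OF t, of z u]
        by (intro mult_right_mono) (auto intro: order_trans)
    next
      case False then show ?thesis by (simp add: supp)
    qed
  qed
  also have "\<dots> = ennreal (?W * (real CARD('n) * r / t)) * ennreal (LINT z|lborel. \<bar>b z\<bar>)"
    by (simp add: nn_integral_cmult nn_integral_abs_bint[OF b])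
  also have "\<dots> = ennreal (?W * (real CARD('n) * r / t) * (LINT z|lborel. \<bar>b z\<bar>))"
    using t c Wc_pos_dim r by (intro ennreal_mult[symmetric]) auto
  finally show ?thesis .
qed

text \<open>For atoms on cubes larger than the scale \<open>t\<close>: the gain \<open>t / r\<close>
  comes from the distance to the support, by giving up one power of decay.\<close>

lemma KC_far:
  assumes t: "t > 0" and b: "bint b" and r: "r > 0"
    and supp: "\<And>z. z \<notin> Q \<Longrightarrow> b z = 0" and F[measurable]: "F \<in> sets borel"
    and far: "\<And>y z. y \<in> F \<Longrightarrow> z \<in> Q \<Longrightarrow> norm (y - z) \<ge> r"
  shows "(\<integral>\<^sup>+y\<in>F. ennreal \<bar>KC (dl t) b y\<bar> \<partial>lborel)
    \<le> ennreal (c * Wc CARD('n) (real CARD('n) + 1) * (t / r) * (LINT z|lborel. \<bar>b z\<bar>))"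
proof -
  have [measurable]: "b \<in> borel_measurable borel" by (rule bint_meas[OF b])
  have bt: "bint (dl t)" by (rule dl_bint[OF t])
  let ?k = "c * (t / r)"
  have k0: "?k \<ge> 0" using c t r by simp
  have key: "\<bar>dl t w\<bar> \<le> ?k * wts (real CARD('n) + 1) t w" if "norm w \<ge> r" for w
  proof -
    have "norm w > 0" using that r by linarith
    then have "wts (real CARD('n) + 2) t w = (t / norm w) * (norm w / t * wts (real CARD('n) + 1 + 1) t w)"
      using t by (simp add: add_ac)
    also have "\<dots> \<le> (t / r) * wts (real CARD('n) + 1) t w"
      using that t r norm_wts_le[OF t, of w "real CARD('n) + 1"]
      by (intro mult_mono) (auto simp: wts_nonneg intro!: divide_left_mono mult_pos_pos)
    finally have "c * wts (real CARD('n) + 2) t w \<le> c * ((t / r) * wts (real CARD('n) + 1) t w)"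
      using c by (intro mult_left_mono) auto
    then show ?thesis using dl_le[OF t, of w] by (simp add: mult.assoc)
  qed
  have "(\<integral>\<^sup>+y\<in>F. ennreal \<bar>KC (dl t) b y\<bar> \<partial>lborel)
    \<le> (\<integral>\<^sup>+y. (\<integral>\<^sup>+z. ennreal \<bar>dl t (y - z)\<bar> * ennreal \<bar>b z\<bar> \<partial>lborel) * indicator F y \<partial>lborel)"
    by (intro nn_integral_mono mult_right_mono KC_abs_le[OF bt b]) simp
  also have "\<dots> \<le> (\<integral>\<^sup>+y. (\<integral>\<^sup>+z. ennreal (?k * wts (real CARD('n) + 1) t (y - z)) * ennreal \<bar>b z\<bar> \<partial>lborel) \<partial>lborel)"
  proof (intro nn_integral_mono)
    fix y
    show "(\<integral>\<^sup>+z. ennreal \<bar>dl t (y - z)\<bar> * ennreal \<bar>b z\<bar> \<partial>lborel) * indicator F y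
      \<le> (\<integral>\<^sup>+z. ennreal (?k * wts (real CARD('n) + 1) t (y - z)) * ennreal \<bar>b z\<bar> \<partial>lborel)"
    proof (cases "y \<in> F")
      case True
      have "ennreal \<bar>dl t (y - z)\<bar> * ennreal \<bar>b z\<bar>
          \<le> ennreal (?k * wts (real CARD('n) + 1) t (y - z)) * ennreal \<bar>b z\<bar>" for z
        using supp[of z] key[OF far[OF True, of z]]
        by (cases "z \<in> Q") (auto intro!: mult_right_mono ennreal_leI)
      then show ?thesis using True by (auto intro!: nn_integral_mono)
    qed simp
  qed
  also have "\<dots> = (\<integral>\<^sup>+z. (\<integral>\<^sup>+y. ennreal (?k * wts (real CARD('n) + 1) t (y - z)) * ennreal \<bar>b z\<bar> \<partial>lborel) \<partial>lborel)"
    by (rule lborel_pair.Fubini') measurable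
  also have "\<dots> \<le> (\<integral>\<^sup>+z. ennreal (?k * Wc CARD('n) (real CARD('n) + 1)) * ennreal \<bar>b z\<bar> \<partial>lborel)"
  proof (intro nn_integral_mono)
    fix z :: "real^'n"
    have "(\<integral>\<^sup>+y. ennreal (?k * wts (real CARD('n) + 1) t (y - z)) * ennreal \<bar>b z\<bar> \<partial>lborel)
      = ennreal ?k * (\<integral>\<^sup>+y. ennreal (wts (real CARD('n) + 1) t (y - z)) \<partial>lborel) * ennreal \<bar>b z\<bar>"
      using k0 by (simp add: ennreal_mult' nn_integral_cmult nn_integral_multc del: times_divide_eq_right)
    also have "\<dots> \<le> ennreal ?k * ennreal (Wc CARD('n) (real CARD('n) + 1)) * ennreal \<bar>b z\<bar>"
      by (intro mult_right_mono mult_left_mono nn_integral_wts' t) auto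
    also have "\<dots> = ennreal (?k * Wc CARD('n) (real CARD('n) + 1)) * ennreal \<bar>b z\<bar>"
      by (simp only: ennreal_mult'[OF k0])
    finally show "(\<integral>\<^sup>+y. ennreal (?k * wts (real CARD('n) + 1) t (y - z)) * ennreal \<bar>b z\<bar> \<partial>lborel)
      \<le> ennreal (?k * Wc CARD('n) (real CARD('n) + 1)) * ennreal \<bar>b z\<bar>" .
  qed
  also have "\<dots> = ennreal (?k * Wc CARD('n) (real CARD('n) + 1)) * ennreal (LINT z|lborel. \<bar>b z\<bar>)"
    by (simp add: nn_integral_cmult nn_integral_abs_bint[OF b])
  also have "\<dots> = ennreal (?k * Wc CARD('n) (real CARD('n) + 1) * (LINT z|lborel. \<bar>b z\<bar>))"
    using mult_nonneg_nonneg[OF k0 less_imp_le[OF Wc_pos_dim(1)]] by (intro ennreal_mult[symmetric]) simp_all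
  finally show ?thesis by (simp add: mult_ac)
qed

end

section \<open>The estimate below a fixed level\<close>

text \<open>The first summand comes from the L2 estimate of the good part, whose sup norm is at most
  2^n times the level. The second is the pointwise bound of the bad part, divided by the level,
  times the sum of the constants of the two regimes of an atom.\<close>

definition loc_const :: "nat \<Rightarrow> real \<Rightarrow> real \<Rightarrow> real" where
  "loc_const n c a =
     8 * orth_const n c * 2 ^ n +
     16 * (a + c * Wc n (real n + 2) * 2 ^ n) * (16 * c * Wc n (real n + 2) * real n + c * Wc n (real n + 1))"

context lp_kernel
begin

text \<open>Split \<open>f\<close> at height \<open>l\<close>. The good part is handled by \<open>L2_estimate\<close>. The sets \<open>F j\<close> are so far from
  every bad cube that is large compared with the scale \<open>j\<close> that each atom contributes a geometric
  series around its own scale; one factor of the square is bounded by \<open>l\<close>.\<close>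

lemma local_estimate:
  assumes \<tau>: "\<tau> > 0" and r0: "r0 > 0" and tk: "r0 / 8 \<le> \<tau> / 2 ^ k" "\<tau> / 2 ^ k \<le> r0 / 4"
    and f: "bint f" and supp: "\<And>x. x \<notin> cube v r0 \<Longrightarrow> f x = 0"
    and l: "l \<ge> 0" and avl: "cube_avg (\<lambda>x. \<bar>f x\<bar>) v r0 \<le> l" and a: "a \<ge> 0"
    and F[measurable]: "\<And>j. F j \<in> sets borel"
    and Fa: "\<And>j y. k \<le> j \<Longrightarrow> y \<in> F j \<Longrightarrow> \<bar>KC (dl (\<tau> / 2 ^ j)) f y\<bar> \<le> a * l"
    and Fb: "\<And>u m j y z. cube_avg (\<lambda>x. \<bar>f x\<bar>) u (r0 / 2 ^ m) > l \<Longrightarrow> k + m \<le> j \<Longrightarrow> y \<in> F j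
        \<Longrightarrow> z \<in> cube u (r0 / 2 ^ m) \<Longrightarrow> norm (y - z) \<ge> r0 / 2 ^ m"
  shows "(\<Sum>j\<in>{k..<N}. \<integral>\<^sup>+y\<in>F j. ennreal ((KC (dl (\<tau> / 2 ^ j)) f y)\<^sup>2) \<partial>lborel)
    \<le> ennreal (loc_const CARD('n) c a * l * (LINT x|lborel. \<bar>f x\<bar>))"
proof -
  let ?n = "CARD('n)"
  define W where "W = Wc ?n (real ?n + 2)"
  define W' where "W' = Wc ?n (real ?n + 1)"
  have W: "W > 0" "W' > 0" using Wc_pos_dim by (auto simp: W_def W'_def)
  define t where "t j = \<tau> / 2 ^ j" for j
  have t: "t j > 0" for j using \<tau> by (simp add: t_def)
  define L where "L = (LINT x|lborel. \<bar>f x\<bar>)"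
  have L0: "L \<ge> 0" by (simp add: L_def)
  obtain C :: "((real^'n) \<times> nat) set" where C: "finite C"
    and dis: "disjoint_family_on (\<lambda>(u, m). cube u (r0 / 2 ^ m)) C"
    and Un: "(\<Union>(u, m)\<in>C. cube u (r0 / 2 ^ m)) = cube v r0"
    and Cp0: "\<forall>(u, m)\<in>C. m \<le> N \<and> cube_avg (\<lambda>x. \<bar>f x\<bar>) u (r0 / 2 ^ m) \<le> 2 ^ ?n * l \<and>
       (m = N \<or> cube_avg (\<lambda>x. \<bar>f x\<bar>) u (r0 / 2 ^ m) > l)"
    using CZ_family[OF bint_integrable[OF f] r0 avl l, of N] by (elim exE conjE) (rule that)
  have Cp: "m \<le> N \<and> cube_avg (\<lambda>x. \<bar>f x\<bar>) u (r0 / 2 ^ m) \<le> 2 ^ ?n * l \<and>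
       (m = N \<or> cube_avg (\<lambda>x. \<bar>f x\<bar>) u (r0 / 2 ^ m) > l)" if "(u, m) \<in> C" for u m
    using bspec[OF Cp0 that] by simp
  define q where "q p = cube (fst p) (r0 / 2 ^ snd p)" for p :: "(real^'n) \<times> nat"
  define av where "av p = cube_avg f (fst p) (r0 / 2 ^ snd p)" for p :: "(real^'n) \<times> nat"
  define Lq where "Lq p = (LINT x:q p|lborel. \<bar>f x\<bar>)" for p :: "(real^'n) \<times> nat"
  have q_sets [measurable]: "q p \<in> sets borel" for p by (simp add: q_def)
  have rp: "r0 / 2 ^ snd p > 0" for p :: "(real^'n) \<times> nat" using r0 by simp
  have ind: "indicator (cube v r0) x = (\<Sum>p\<in>C. indicator (q p) x :: real)" for x
  proof -
    have q: "q = (\<lambda>(u, m). cube u (r0 / 2 ^ m))" by (auto simp: fun_eq_iff q_def)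
    have "disjoint_family_on q C" using dis by (simp only: q)
    from indicator_UN_disjoint[OF C this, of x] show ?thesis
      using Un by (simp only: q)
  qed
  have Lq_def': "Lq p = (LINT x|lborel. \<bar>f x\<bar> * indicator (q p) x)" for p
    by (simp add: Lq_def set_lebesgue_integral_def mult.commute)
  have Lq0: "Lq p \<ge> 0" for p by (simp add: Lq_def')
  have sumLq: "(\<Sum>p\<in>C. Lq p) = L"
  proof -
    have "(\<Sum>p\<in>C. Lq p) = (LINT x|lborel. (\<Sum>p\<in>C. \<bar>f x\<bar> * indicator (q p) x))"
      unfolding Lq_def'
      by (intro Bochner_Integration.integral_sum[symmetric] bint_integrable bint_indicator_mult bint_abs f) simp
    also have "\<dots> = (LINT x|lborel. \<bar>f x\<bar> * indicator (cube v r0) x)"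
      by (simp add: sum_distrib_left[symmetric] ind[symmetric])
    also have "\<dots> = L" unfolding L_def
      by (intro Bochner_Integration.integral_cong) (auto simp: indicator_def supp)
    finally show ?thesis .
  qed
  have measq: "measure lborel (q p) = (r0 / 2 ^ snd p) ^ ?n" for p
    using rp[of p] by (simp add: q_def measure_cube)
  have av_le: "\<bar>av p\<bar> * (r0 / 2 ^ snd p) ^ ?n \<le> Lq p" for p
  proof -
    have "\<bar>av p\<bar> \<le> cube_avg (\<lambda>x. \<bar>f x\<bar>) (fst p) (r0 / 2 ^ snd p)"
      unfolding av_def by (rule cube_avg_abs_le[OF bint_integrable[OF f] rp])
    also have "\<dots> = Lq p / (r0 / 2 ^ snd p) ^ ?n" by (simp add: cube_avg_def Lq_def q_def)
    finally show ?thesis using rp[of p] by (simp add: pos_le_divide_eq)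
  qed
  have av_l: "\<bar>av p\<bar> \<le> 2 ^ ?n * l" if "p \<in> C" for p
    using cube_avg_abs_le[OF bint_integrable[OF f] rp[of p], of "fst p"] Cp[of "fst p" "snd p"] that
    by (simp add: av_def)
  \<comment> \<open>The good part averages over every cube of the family, including those of depth
    \<open>N\<close> that never exceeded the level, so that all atoms \<open>b p\<close> have mean
    zero.\<close>
  define g where "g x = (\<Sum>p\<in>C. av p * indicator (q p) x)" for x
  define b where "b p x = f x * indicator (q p) x + (- av p) * indicator (q p) x" for p x
  have qb: "bint (indicator (q p) :: real^'n \<Rightarrow> real)" for p
    unfolding q_def using rp[of p] by (intro bint_indicator_cube) simp
  have gb: "bint g" unfolding g_def[abs_def] by (intro bint_sum bint_cmult qb)
  have bb: "bint (b p)" for p unfolding b_def[abs_def]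
    by (intro bint_add bint_cmult qb bint_indicator_mult f) simp
  have fgb: "f x = g x + (\<Sum>p\<in>C. b p x)" for x
  proof -
    have "g x + (\<Sum>p\<in>C. b p x) = (\<Sum>p\<in>C. f x * indicator (q p) x)"
      by (simp add: g_def b_def sum_subtractf)
    also have "\<dots> = f x * indicator (cube v r0) x" by (simp add: sum_distrib_left[symmetric] ind[symmetric])
    finally show ?thesis by (auto simp: indicator_def supp)
  qed
  have g_bd: "\<bar>g x\<bar> \<le> 2 ^ ?n * l" for x
  proof -
    have "\<bar>g x\<bar> \<le> (\<Sum>p\<in>C. \<bar>av p * indicator (q p) x\<bar>)" unfolding g_def by (rule sum_abs)
    also have "\<dots> \<le> (\<Sum>p\<in>C. (2 ^ ?n * l) * indicator (q p) x)"
      using av_l by (intro sum_mono) (auto simp: indicator_def)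
    also have "\<dots> = (2 ^ ?n * l) * indicator (cube v r0) x" by (simp add: sum_distrib_left[symmetric] ind[symmetric])
    also have "\<dots> \<le> 2 ^ ?n * l" using l by (auto simp: indicator_def)
    finally show ?thesis .
  qed
  \<comment> \<open>One factor of the square is bounded by the sup norm 2^n l, the other is
    integrated; this is where the L2 bound becomes linear in \<open>l\<close>.\<close>
  have g2: "(LINT x|lborel. (g x)\<^sup>2) \<le> 2 ^ ?n * l * L"
  proof -
    have "(LINT x|lborel. (g x)\<^sup>2) \<le> (LINT x|lborel. (2 ^ ?n * l) * (\<Sum>p\<in>C. \<bar>av p\<bar> * indicator (q p) x))"
    proof (rule integral_mono)
      show "integrable lborel (\<lambda>x. (g x)\<^sup>2)"
        unfolding power2_eq_square by (intro bint_integrable bint_mult gb)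
      show "integrable lborel (\<lambda>x. (2 ^ ?n * l) * (\<Sum>p\<in>C. \<bar>av p\<bar> * indicator (q p) x))"
        by (intro bint_integrable bint_cmult bint_sum qb)
      fix x
      have "\<bar>g x\<bar> \<le> (\<Sum>p\<in>C. \<bar>av p * indicator (q p) x\<bar>)" unfolding g_def by (rule sum_abs)
      also have "\<dots> = (\<Sum>p\<in>C. \<bar>av p\<bar> * indicator (q p) x)" by (simp add: abs_mult)
      finally have "\<bar>g x\<bar> * \<bar>g x\<bar> \<le> (2 ^ ?n * l) * (\<Sum>p\<in>C. \<bar>av p\<bar> * indicator (q p) x)"
        using l by (intro mult_mono g_bd) auto
      then show "(g x)\<^sup>2 \<le> (2 ^ ?n * l) * (\<Sum>p\<in>C. \<bar>av p\<bar> * indicator (q p) x)"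
        by (simp add: power2_eq_square)
    qed
    also have "\<dots> = (2 ^ ?n * l) * (\<Sum>p\<in>C. LINT x|lborel. \<bar>av p\<bar> * indicator (q p) x)"
      by (subst Bochner_Integration.integral_mult_right_zero, subst Bochner_Integration.integral_sum)
         (auto intro!: bint_integrable bint_cmult qb)
    also have "\<dots> = (2 ^ ?n * l) * (\<Sum>p\<in>C. \<bar>av p\<bar> * (r0 / 2 ^ snd p) ^ ?n)"
      by (simp add: measq del: power_divide)
    also have "\<dots> \<le> (2 ^ ?n * l) * (\<Sum>p\<in>C. Lq p)"
      using l by (intro mult_left_mono sum_mono av_le) auto
    finally show ?thesis by (simp add: sumLq)
  qed
  have b_mean: "(LINT x|lborel. b p x) = 0" for p
  proof -
    have "(LINT x|lborel. b p x) = (LINT x|lborel. f x * indicator (q p) x) + (LINT x|lborel. (- av p) * indicator (q p) x)"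
      unfolding b_def
      by (intro Bochner_Integration.integral_add bint_integrable bint_cmult qb bint_indicator_mult f) simp
    also have "(LINT x|lborel. (- av p) * indicator (q p) x) = - av p * (r0 / 2 ^ snd p) ^ ?n"
      by (simp add: measq del: power_divide)
    also have "- av p * (r0 / 2 ^ snd p) ^ ?n = - (LINT x|lborel. f x * indicator (q p) x)"
      using r0 by (simp add: av_def cube_avg_def q_def set_lebesgue_integral_def mult.commute)
    finally show ?thesis by simp
  qed
  have b_L1: "(LINT x|lborel. \<bar>b p x\<bar>) \<le> 2 * Lq p" for p
  proof -
    have "(LINT x|lborel. \<bar>b p x\<bar>) \<le> (LINT x|lborel. \<bar>f x\<bar> * indicator (q p) x + \<bar>av p\<bar> * indicator (q p) x)"
    proof (rule integral_mono)
      show "integrable lborel (\<lambda>x. \<bar>b p x\<bar>)" by (intro bint_integrable bint_abs bb)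
      show "integrable lborel (\<lambda>x. \<bar>f x\<bar> * indicator (q p) x + \<bar>av p\<bar> * indicator (q p) x)"
        by (intro bint_integrable bint_add bint_indicator_mult bint_abs bint_cmult f qb) simp
      show "\<bar>b p x\<bar> \<le> \<bar>f x\<bar> * indicator (q p) x + \<bar>av p\<bar> * indicator (q p) x" for x
        by (auto simp: b_def indicator_def)
    qed
    also have "\<dots> = Lq p + \<bar>av p\<bar> * (r0 / 2 ^ snd p) ^ ?n"
      unfolding Lq_def'
      by (subst Bochner_Integration.integral_add)
         (auto intro!: bint_integrable bint_indicator_mult bint_abs bint_cmult f qb simp: measq)
    finally show ?thesis using av_le[of p] by simp
  qed
  \<comment> \<open>\<open>c3\<close> serves both regimes: the first summand is the constant of
    \<open>KC_cancel\<close> times the 8 of \<open>scale\<close>, the second the constant of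
    \<open>KC_far\<close>.\<close>
  define c3 where "c3 = 16 * c * W * real ?n + c * W'"
  have c30: "c3 \<ge> 0" using c W by (simp add: c3_def)
  have tk': "r0 \<le> 8 * t k" "t k \<le> r0" using tk r0 unfolding t_def by linarith+
  have scale: "r0 / 2 ^ m / t j \<le> 8 * (1/2) ^ (k + m - j)" if "k \<le> j" "j < k + m" for j m
  proof -
    have "r0 / 2 ^ m / t j \<le> (8 * t k) / 2 ^ m / t j"
      using tk' less_imp_le[OF t[of j]] by (intro divide_right_mono) simp_all
    also have "\<dots> = 8 * (2 ^ j / (2 ^ k * 2 ^ m))" using \<tau> by (simp add: t_def)
    also have "2 ^ j / (2 ^ k * 2 ^ m) = (1/2 :: real) ^ (k + m - j)"
      using that by (simp add: power_diff power_add power_one_over field_simps)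
    finally show ?thesis .
  qed
  have scale': "t j / (r0 / 2 ^ m) \<le> (1/2) ^ (j - (k + m))" if "k + m \<le> j" for j m
  proof -
    have "t j / (r0 / 2 ^ m) \<le> t j / (t k / 2 ^ m)"
      using tk'(2) t[of j] t[of k] r0
      by (intro divide_left_mono divide_right_mono mult_pos_pos) (simp_all add: less_imp_le)
    also have "\<dots> = (2 ^ k * 2 ^ m) / 2 ^ j" using \<tau> by (simp add: t_def)
    also have "\<dots> = (1/2 :: real) ^ (j - (k + m))"
      using that by (simp add: power_diff power_add power_one_over)
    finally show ?thesis .
  qed
  have bad: "(\<integral>\<^sup>+y\<in>F j. ennreal \<bar>KC (dl (t j)) (b p) y\<bar> \<partial>lborel)
      \<le> ennreal (c3 * (1/2) ^ (max j (k + snd p) - min j (k + snd p)) * (2 * Lq p))"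
    if p: "p \<in> C" and j: "k \<le> j" "j < N" for p j
  proof -
    define m where "m = snd p"
    have supp_b: "b p z = 0" if "z \<notin> q p" for z using that by (simp add: b_def)
    show ?thesis
    \<comment> \<open>Generation \<open>k + m\<close> is the one whose scale matches the side of the
      atom's cube. For coarser scales cancellation gains, for finer ones the distance.\<close>
    proof (cases "j < k + m")
      case True
      have "(\<integral>\<^sup>+y\<in>F j. ennreal \<bar>KC (dl (t j)) (b p) y\<bar> \<partial>lborel) \<le> (\<integral>\<^sup>+y. ennreal \<bar>KC (dl (t j)) (b p) y\<bar> \<partial>lborel)"
        by (intro nn_integral_mono) (auto simp: indicator_def)
      also have "\<dots> \<le> ennreal (2 * c * W * (real ?n * (r0 / 2 ^ m) / t j) * (LINT z|lborel. \<bar>b p z\<bar>))"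
        unfolding W_def m_def
        by (rule KC_cancel[OF t bb b_mean, of "fst p"]) (use supp_b rp[of p] in \<open>auto simp: q_def\<close>)
      also have "\<dots> \<le> ennreal (c3 * (1/2) ^ (max j (k + snd p) - min j (k + snd p)) * (2 * Lq p))"
      proof (rule ennreal_leI, rule mult_mono[OF _ b_L1])
        have "2 * c * W * (real ?n * (r0 / 2 ^ m) / t j) = 2 * c * W * real ?n * (r0 / 2 ^ m / t j)" by simp
        also have "\<dots> \<le> 2 * c * W * real ?n * (8 * (1/2) ^ (k + m - j))"
          using c W by (intro mult_left_mono scale[OF j(1) True]) auto
        also have "\<dots> = (16 * c * W * real ?n) * (1/2) ^ (k + m - j)" by simp
        also have "\<dots> \<le> c3 * (1/2) ^ (k + m - j)"
          unfolding c3_def using c W by (intro mult_right_mono) auto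
        finally show "2 * c * W * (real ?n * (r0 / 2 ^ m) / t j) \<le> c3 * (1/2) ^ (max j (k + snd p) - min j (k + snd p))"
          using True by (simp add: m_def max_def min_def)
      qed (use c30 in auto)
      finally show ?thesis .
    next
      case False
      \<comment> \<open>Cubes of depth \<open>N\<close> never reach this case because
        \<open>j < N\<close>. Hence the cube was stopped for its large average, and hypothesis
        \<open>Fb\<close> keeps \<open>F j\<close> away from it.\<close>
      then have mN: "m \<noteq> N" and kj: "k + m \<le> j" using j by auto
      have av_gt: "cube_avg (\<lambda>x. \<bar>f x\<bar>) (fst p) (r0 / 2 ^ m) > l"
        using Cp[of "fst p" "snd p"] p mN by (simp add: m_def)
      have "(\<integral>\<^sup>+y\<in>F j. ennreal \<bar>KC (dl (t j)) (b p) y\<bar> \<partial>lborel)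
        \<le> ennreal (c * W' * (t j / (r0 / 2 ^ m)) * (LINT z|lborel. \<bar>b p z\<bar>))"
        unfolding W'_def
        by (rule KC_far[OF t bb, where Q = "q p"])
           (use supp_b r0 Fb[OF av_gt kj] in \<open>auto simp: q_def m_def\<close>)
      also have "\<dots> \<le> ennreal (c3 * (1/2) ^ (max j (k + snd p) - min j (k + snd p)) * (2 * Lq p))"
      proof (rule ennreal_leI, rule mult_mono[OF _ b_L1])
        have mx: "max j (k + snd p) - min j (k + snd p) = j - (k + m)"
          using kj by (simp add: m_def max.absorb1 min.absorb2)
        have "c * W' * (t j / (r0 / 2 ^ m)) \<le> c * W' * (1/2) ^ (j - (k + m))"
          using c W by (intro mult_left_mono scale'[OF kj]) auto
        also have "\<dots> \<le> c3 * (1/2) ^ (j - (k + m))"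
          unfolding c3_def using c W by (intro mult_right_mono) auto
        finally show "c * W' * (t j / (r0 / 2 ^ m)) \<le> c3 * (1/2) ^ (max j (k + snd p) - min j (k + snd p))"
          unfolding mx .
      qed (use c30 in auto)
      finally show ?thesis .
    qed
  qed
  define a2 where "a2 = a + c * W * 2 ^ ?n"
  have a20: "a2 \<ge> 0" using a c W by (simp add: a2_def)
  have pt: "(KC (dl (t j)) f y)\<^sup>2 \<le> 2 * (KC (dl (t j)) g y)\<^sup>2 + 2 * a2 * l * (\<Sum>p\<in>C. \<bar>KC (dl (t j)) (b p) y\<bar>)"
    if "k \<le> j" "y \<in> F j" for j y
  proof -
    define X where "X = KC (dl (t j)) g y"
    define Y where "Y = (\<Sum>p\<in>C. KC (dl (t j)) (b p) y)"
    have db: "bint (dl (t j))" by (rule dl_bint[OF t])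
    have XY: "KC (dl (t j)) f y = X + Y"
    proof -
      have "KC (dl (t j)) f y = KC (dl (t j)) (\<lambda>x. g x + (\<Sum>p\<in>C. b p x)) y" by (simp add: fgb[symmetric])
      also have "\<dots> = X + Y" unfolding X_def Y_def
        by (subst KC_add[OF db gb bint_sum[OF bb]], subst KC_sum[OF db bb]) simp
      finally show ?thesis .
    qed
    have "\<bar>X\<bar> \<le> (c * W) * (2 ^ ?n * l)"
      unfolding X_def W_def using dl_norm1[OF t] c Wc_pos_dim by (intro KC_bound db gb g_bd) auto
    moreover have "\<bar>X + Y\<bar> \<le> a * l" using Fa[OF that] XY by (simp add: t_def)
    \<comment> \<open>On \<open>F j\<close> the bad part is bounded as a difference: the whole
      convolution is at most \<open>a * l\<close> there, and the good part is bounded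
      everywhere.\<close>
    ultimately have "\<bar>Y\<bar> \<le> a2 * l" by (simp add: a2_def algebra_simps)
    moreover have "\<bar>Y\<bar> \<le> (\<Sum>p\<in>C. \<bar>KC (dl (t j)) (b p) y\<bar>)" unfolding Y_def by (rule sum_abs)
    ultimately have "\<bar>Y\<bar> * \<bar>Y\<bar> \<le> (a2 * l) * (\<Sum>p\<in>C. \<bar>KC (dl (t j)) (b p) y\<bar>)"
      using a20 l by (intro mult_mono) auto
    moreover have "(X + Y)\<^sup>2 \<le> 2 * X\<^sup>2 + 2 * Y\<^sup>2"
      using zero_le_power2[of "X - Y"] by (simp add: power2_eq_square algebra_simps)
    ultimately show ?thesis unfolding XY X_def[symmetric] by (simp add: power2_eq_square)
  qed
  define S where "S j = (\<integral>\<^sup>+y\<in>F j. ennreal ((KC (dl (t j)) f y)\<^sup>2) \<partial>lborel)" for j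
  have KCm [measurable]: "KC (dl (t j)) g \<in> borel_measurable borel" "KC (dl (t j)) (b p) \<in> borel_measurable borel" for j p
    by (intro KC_meas dl_bint t gb bb)+
  have Sj: "S j \<le> ennreal (2 * (LINT y|lborel. (KC (dl (t j)) g y)\<^sup>2) +
      2 * a2 * l * (\<Sum>p\<in>C. c3 * (1/2) ^ (max j (k + snd p) - min j (k + snd p)) * (2 * Lq p)))"
    if j: "j \<in> {k..<N}" for j
  proof -
    have al0: "2 * a2 * l \<ge> 0" using a20 l by simp
    have i2: "integrable lborel (\<lambda>y. (KC (dl (t j)) g y)\<^sup>2)"
      unfolding power2_eq_square by (intro bint_integrable bint_mult KC_bint dl_bint t gb)
    have "S j \<le> (\<integral>\<^sup>+y. ennreal 2 * ennreal ((KC (dl (t j)) g y)\<^sup>2) +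
        ennreal (2 * a2 * l) * (\<Sum>p\<in>C. ennreal \<bar>KC (dl (t j)) (b p) y\<bar> * indicator (F j) y) \<partial>lborel)"
      unfolding S_def
    proof (intro nn_integral_mono)
      fix y
      show "ennreal ((KC (dl (t j)) f y)\<^sup>2) * indicator (F j) y \<le> ennreal 2 * ennreal ((KC (dl (t j)) g y)\<^sup>2) +
        ennreal (2 * a2 * l) * (\<Sum>p\<in>C. ennreal \<bar>KC (dl (t j)) (b p) y\<bar> * indicator (F j) y)"
      proof (cases "y \<in> F j")
        case True
        have "ennreal ((KC (dl (t j)) f y)\<^sup>2)
          \<le> ennreal (2 * (KC (dl (t j)) g y)\<^sup>2 + 2 * a2 * l * (\<Sum>p\<in>C. \<bar>KC (dl (t j)) (b p) y\<bar>))"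
          using pt[OF _ True] j by (intro ennreal_leI) auto
        also have "\<dots> = ennreal (2 * (KC (dl (t j)) g y)\<^sup>2) + ennreal (2 * a2 * l * (\<Sum>p\<in>C. \<bar>KC (dl (t j)) (b p) y\<bar>))"
          using al0 by (intro ennreal_plus) (auto intro!: mult_nonneg_nonneg sum_nonneg)
        also have "\<dots> = ennreal 2 * ennreal ((KC (dl (t j)) g y)\<^sup>2) +
          ennreal (2 * a2 * l) * (\<Sum>p\<in>C. ennreal \<bar>KC (dl (t j)) (b p) y\<bar>)"
          using al0 by (subst sum_ennreal) (auto simp: ennreal_mult' simp del: ennreal_numeral)
        finally show ?thesis using True by simp
      qed simp
    qed
    also have "\<dots> = ennreal 2 * (\<integral>\<^sup>+y. ennreal ((KC (dl (t j)) g y)\<^sup>2) \<partial>lborel) +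
        ennreal (2 * a2 * l) * (\<Sum>p\<in>C. \<integral>\<^sup>+y\<in>F j. ennreal \<bar>KC (dl (t j)) (b p) y\<bar> \<partial>lborel)"
      by (simp add: nn_integral_add nn_integral_cmult nn_integral_sum)
    also have "(\<integral>\<^sup>+y. ennreal ((KC (dl (t j)) g y)\<^sup>2) \<partial>lborel) = ennreal (LINT y|lborel. (KC (dl (t j)) g y)\<^sup>2)"
      by (intro nn_integral_eq_integral i2) simp
    also have "ennreal 2 * \<dots> + ennreal (2 * a2 * l) * (\<Sum>p\<in>C. \<integral>\<^sup>+y\<in>F j. ennreal \<bar>KC (dl (t j)) (b p) y\<bar> \<partial>lborel)
      \<le> ennreal 2 * ennreal (LINT y|lborel. (KC (dl (t j)) g y)\<^sup>2) + ennreal (2 * a2 * l) *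
        (\<Sum>p\<in>C. ennreal (c3 * (1/2) ^ (max j (k + snd p) - min j (k + snd p)) * (2 * Lq p)))"
      using j by (intro add_left_mono mult_left_mono sum_mono bad) auto
    also have "\<dots> = ennreal (2 * (LINT y|lborel. (KC (dl (t j)) g y)\<^sup>2) +
      2 * a2 * l * (\<Sum>p\<in>C. c3 * (1/2) ^ (max j (k + snd p) - min j (k + snd p)) * (2 * Lq p)))"
    proof -
      have nn: "c3 * (1/2) ^ (max j (k + snd p) - min j (k + snd p)) * (2 * Lq p) \<ge> 0" for p
        using c30 Lq0 by simp
      show ?thesis
        by (subst sum_ennreal[OF nn], subst ennreal_plus)
           (use al0 nn in \<open>auto simp: ennreal_mult' sum_nonneg simp del: ennreal_numeral\<close>)
    qed
    finally show ?thesis .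
  qed
  have "(\<Sum>j\<in>{k..<N}. S j) \<le> (\<Sum>j\<in>{k..<N}. ennreal (2 * (LINT y|lborel. (KC (dl (t j)) g y)\<^sup>2) +
      2 * a2 * l * (\<Sum>p\<in>C. c3 * (1/2) ^ (max j (k + snd p) - min j (k + snd p)) * (2 * Lq p))))"
    by (rule sum_mono[OF Sj])
  \<comment> \<open>The range is enlarged to all \<open>j < N\<close> because the L2 estimate starts
    at generation 0.\<close>
  also have "\<dots> \<le> (\<Sum>j<N. ennreal (2 * (LINT y|lborel. (KC (dl (t j)) g y)\<^sup>2) +
      2 * a2 * l * (\<Sum>p\<in>C. c3 * (1/2) ^ (max j (k + snd p) - min j (k + snd p)) * (2 * Lq p))))"
    by (intro sum_mono2) auto
  also have "\<dots> = ennreal (\<Sum>j<N. 2 * (LINT y|lborel. (KC (dl (t j)) g y)\<^sup>2) +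
      2 * a2 * l * (\<Sum>p\<in>C. c3 * (1/2) ^ (max j (k + snd p) - min j (k + snd p)) * (2 * Lq p)))"
    using a20 l c30 Lq0 by (intro sum_ennreal) (auto intro!: add_nonneg_nonneg mult_nonneg_nonneg sum_nonneg)
  also have "\<dots> \<le> ennreal (loc_const ?n c a * l * L)"
  proof (rule ennreal_leI)
    have "(\<Sum>j<N. 2 * (LINT y|lborel. (KC (dl (t j)) g y)\<^sup>2) +
      2 * a2 * l * (\<Sum>p\<in>C. c3 * (1/2) ^ (max j (k + snd p) - min j (k + snd p)) * (2 * Lq p)))
      = 2 * (\<Sum>j<N. LINT y|lborel. (KC (dl (t j)) g y)\<^sup>2) + 2 * a2 * l *
        (\<Sum>j<N. \<Sum>p\<in>C. c3 * (1/2) ^ (max j (k + snd p) - min j (k + snd p)) * (2 * Lq p))"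
      by (simp only: sum.distrib sum_distrib_left)
    also have "(\<Sum>j<N. \<Sum>p\<in>C. c3 * (1/2) ^ (max j (k + snd p) - min j (k + snd p)) * (2 * Lq p))
      = (\<Sum>p\<in>C. \<Sum>j<N. c3 * (1/2) ^ (max j (k + snd p) - min j (k + snd p)) * (2 * Lq p))"
      by (rule sum.swap)
    also have "\<dots> = (\<Sum>p\<in>C. c3 * (2 * Lq p) * (\<Sum>j<N. (1/2) ^ (max j (k + snd p) - min j (k + snd p))))"
      by (simp add: sum_distrib_left mult_ac)
    also have "2 * (\<Sum>j<N. LINT y|lborel. (KC (dl (t j)) g y)\<^sup>2) + 2 * a2 * l * \<dots>
       \<le> 2 * (4 * orth_const ?n c * (2 ^ ?n * l * L)) + 2 * a2 * l * (\<Sum>p\<in>C. c3 * (2 * Lq p) * 4)"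
    proof (intro add_mono mult_left_mono sum_mono sum_half_powers_le)
      have "(\<Sum>j<N. LINT y|lborel. (KC (dl (t j)) g y)\<^sup>2) \<le> 4 * orth_const ?n c * (LINT y|lborel. (g y)\<^sup>2)"
        unfolding t_def by (rule L2_estimate[OF \<tau> gb])
      also have "\<dots> \<le> 4 * orth_const ?n c * (2 ^ ?n * l * L)"
        using orth_const_pos by (intro mult_left_mono g2) auto
      finally show "(\<Sum>j<N. LINT y|lborel. (KC (dl (t j)) g y)\<^sup>2) \<le> 4 * orth_const ?n c * (2 ^ ?n * l * L)" .
    qed (use a20 l c30 Lq0 in auto)
    also have "(\<Sum>p\<in>C. c3 * (2 * Lq p) * 4) = 8 * c3 * L"
      by (simp add: sumLq[symmetric] sum_distrib_left[symmetric] sum_distrib_right[symmetric])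
    also have "2 * (4 * orth_const ?n c * (2 ^ ?n * l * L)) + 2 * a2 * l * (8 * c3 * L) = loc_const ?n c a * l * L"
      by (simp add: loc_const_def a2_def c3_def W_def W'_def algebra_simps)
    finally show "(\<Sum>j<N. 2 * (LINT y|lborel. (KC (dl (t j)) g y)\<^sup>2) +
      2 * a2 * l * (\<Sum>p\<in>C. c3 * (1/2) ^ (max j (k + snd p) - min j (k + snd p)) * (2 * Lq p)))
      \<le> loc_const ?n c a * l * L" .
  qed
  finally show ?thesis unfolding S_def t_def L_def .
qed

end

section \<open>Carleson estimates\<close>

text \<open>At distances beyond both scales the weight behaves like s^(q - n) |w|^(- q), which
  increases with \<open>s\<close> as \<open>q >= n\<close>. The factor \<open>2 powr q\<close> pays
  for replacing |w| / t by 1 + |w| / t.\<close>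

lemma wts_scale:
  fixes w :: "real^'n"
  assumes s: "s > 0" "s \<le> t" "t \<le> norm w" and q: "q \<ge> real CARD('n)"
  shows "wts q s w \<le> 2 powr q * wts q t w"
proof -
  let ?n = "CARD('n)" and ?d = "norm w"
  have t: "t > 0" and d: "?d > 0" using s by linarith+
  have q0: "q \<ge> 0" using q by linarith
  have "wts q s w = (1 + ?d / s) powr (- q) / s ^ ?n" using s by (simp add: wts_eq)
  also have "\<dots> \<le> (?d / s) powr (- q) / s ^ ?n"
    using s d q0 by (intro divide_right_mono powr_mono2') auto
  also have "\<dots> = ?d powr (- q) * s powr (q - real ?n)"
    using s d by (simp add: powr_divide powr_minus powr_diff powr_realpow field_simps)
  also have "\<dots> \<le> ?d powr (- q) * t powr (q - real ?n)"
    using s q by (intro mult_left_mono powr_mono2) auto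
  also have "\<dots> = (?d / t) powr (- q) / t ^ ?n"
    using t d by (simp add: powr_divide powr_minus powr_diff powr_realpow field_simps)
  also have "\<dots> \<le> ((1 + ?d / t) / 2) powr (- q) / t ^ ?n"
  proof (intro divide_right_mono powr_mono2')
    show "(1 + ?d / t) / 2 \<le> ?d / t" using s(3) t by (simp add: field_simps)
    show "0 < (1 + ?d / t) / 2" using t d by (simp add: add_pos_pos)
  qed (use q0 t in auto)
  also have "\<dots> = 2 powr q * wts q t w"
    using t d by (simp add: wts_eq powr_divide powr_minus powr_mult field_simps add_pos_pos)
  finally show ?thesis .
qed

text \<open>An average of |f| at scale \<open>s\<close> around \<open>y\<close> with a polynomial
  tail in place of a cube; the tail is what makes it vary slowly in \<open>y\<close>.\<close>

definition sm :: "real \<Rightarrow> (real^'n \<Rightarrow> real) \<Rightarrow> real \<Rightarrow> real^'n \<Rightarrow> real" where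
  "sm M f s y = KC (wts M s) (\<lambda>z. \<bar>f z\<bar>) y"

lemma sm_nonneg: "s > 0 \<Longrightarrow> sm M f s y \<ge> 0"
  unfolding sm_def KC_def by (rule Bochner_Integration.integral_nonneg) (simp add: wts_nonneg)

lemma sm_integrand:
  fixes f :: "real^'n \<Rightarrow> real"
  assumes "bint f" "s > 0" "M > real CARD('n)"
  shows "integrable lborel (\<lambda>z. wts M s (y - z) * \<bar>f z\<bar>)"
  by (intro bint_integrable KC_integrand wts_bint bint_abs assms)

lemma sm_harnack:
  fixes f :: "real^'n \<Rightarrow> real"
  assumes "bint f" "s > 0" "M > real CARD('n)"
  shows "sm M f s y \<le> (1 + norm (x - y) / s) powr M * sm M f s x"
proof -
  have M0: "M \<ge> 0" using assms(3) by linarith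
  have "sm M f s y \<le> (LINT z|lborel. (1 + norm (x - y) / s) powr M * (wts M s (x - z) * \<bar>f z\<bar>))"
    unfolding sm_def KC_def
  proof (rule integral_mono)
    show "integrable lborel (\<lambda>z. wts M s (y - z) * \<bar>f z\<bar>)" by (rule sm_integrand[OF assms])
    show "integrable lborel (\<lambda>z. (1 + norm (x - y) / s) powr M * (wts M s (x - z) * \<bar>f z\<bar>))"
      by (intro integrable_mult_right sm_integrand assms)
    fix z
    have "wts M s (y - z) \<le> (1 + norm (x - y) / s) powr M * wts M s (x - z)"
      using wts_harnack[OF assms(2) M0, of "y - z" "x - z"] by (simp add: norm_minus_commute)
    from mult_right_mono[OF this, of "\<bar>f z\<bar>"]
    show "wts M s (y - z) * \<bar>f z\<bar> \<le> (1 + norm (x - y) / s) powr M * (wts M s (x - z) * \<bar>f z\<bar>)"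
      by (simp add: mult.assoc)
  qed
  then show ?thesis by (simp add: sm_def KC_def)
qed

lemma sm_lower:
  fixes f :: "real^'n \<Rightarrow> real"
  assumes f: "bint f" and s: "s > 0" and M: "M > real CARD('n)" and Q[measurable]: "Q \<in> sets borel"
    and R: "\<And>z. z \<in> Q \<Longrightarrow> norm (y - z) \<le> R" and "R \<ge> 0"
  shows "(LINT z|lborel. \<bar>f z\<bar> * indicator Q z) / ((1 + R / s) powr M * s ^ CARD('n)) \<le> sm M f s y"
proof -
  have M0: "M \<ge> 0" using M by linarith
  let ?k = "1 / ((1 + R / s) powr M * s ^ CARD('n))"
  have "(LINT z|lborel. ?k * (\<bar>f z\<bar> * indicator Q z)) \<le> sm M f s y"
    unfolding sm_def KC_def
  proof (rule integral_mono)
    show "integrable lborel (\<lambda>z. wts M s (y - z) * \<bar>f z\<bar>)" by (rule sm_integrand[OF f s M])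
    show "integrable lborel (\<lambda>z. ?k * (\<bar>f z\<bar> * indicator Q z))"
      by (intro integrable_mult_right bint_integrable bint_indicator_mult bint_abs f Q)
    fix z
    have "?k \<le> wts M s (y - z)" if "z \<in> Q"
    proof -
      have "(1 + R / s) powr (- M) \<le> (1 + norm (y - z) / s) powr (- M)"
        using R[OF that] s M0 by (intro powr_mono2') (auto intro!: divide_right_mono add_pos_nonneg)
      from divide_right_mono[OF this, of "s ^ CARD('n)"] show ?thesis
        using s by (simp add: wts_eq powr_minus field_simps)
    qed
    then show "?k * (\<bar>f z\<bar> * indicator Q z) \<le> wts M s (y - z) * \<bar>f z\<bar>"
      using wts_nonneg[OF s, of M "y - z"] by (auto simp: indicator_def intro!: mult_right_mono simp del: times_divide_eq_left)
  qed
  then show ?thesis by simp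
qed

lemma sm_measurable [measurable]:
  fixes f :: "real^'n \<Rightarrow> real"
  assumes [measurable]: "f \<in> borel_measurable borel" "s \<in> borel_measurable N" "y \<in> borel_measurable N"
  shows "(\<lambda>x. sm M f (s x) (y x)) \<in> borel_measurable N"
  unfolding sm_def KC_def
  by (rule lborel.borel_measurable_lebesgue_integral) measurable

context lp_kernel
begin

lemma KC_dl_measurable [measurable]:
  assumes [measurable]: "f \<in> borel_measurable borel" "s \<in> borel_measurable N" "y \<in> borel_measurable N"
  shows "(\<lambda>x. KC (dl (s x)) f (y x)) \<in> borel_measurable N"
  unfolding KC_def
  by (rule lborel.borel_measurable_lebesgue_integral) measurable

lemma KC_dl_le_sm:
  assumes f: "bint f" and s: "s > 0" and M: "M > real CARD('n)" "M \<le> real CARD('n) + 2"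
  shows "\<bar>KC (dl s) f y\<bar> \<le> c * sm M f s y"
proof -
  have "\<bar>KC (dl s) f y\<bar> \<le> (LINT z|lborel. \<bar>dl s (y - z) * f z\<bar>)"
    unfolding KC_def by (rule integral_abs_bound)
  also have "\<dots> \<le> (LINT z|lborel. c * (wts M s (y - z) * \<bar>f z\<bar>))"
  proof (rule integral_mono)
    show "integrable lborel (\<lambda>z. \<bar>dl s (y - z) * f z\<bar>)"
      by (intro bint_integrable bint_abs KC_integrand dl_bint s f)
    show "integrable lborel (\<lambda>z. c * (wts M s (y - z) * \<bar>f z\<bar>))"
      by (intro integrable_mult_right sm_integrand f s M)
    fix z
    have "\<bar>dl s (y - z)\<bar> \<le> c * wts M s (y - z)"
      by (rule order_trans[OF dl_le[OF s] mult_left_mono[OF wts_antimono[OF M(2) s]]]) (use c in simp)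
    from mult_right_mono[OF this, of "\<bar>f z\<bar>"]
    show "\<bar>dl s (y - z) * f z\<bar> \<le> c * (wts M s (y - z) * \<bar>f z\<bar>)" by (simp add: abs_mult mult.assoc)
  qed
  finally show ?thesis by (simp add: sm_def KC_def)
qed

end

text \<open>The base 9 + 8 n comes from comparing cube averages with \<open>sm\<close>. The first
  summand is the contribution of the part of the function near the cube, summed over the levels; the
  second is a geometric series from the distant part.\<close>

definition carl_const :: "nat \<Rightarrow> real \<Rightarrow> real \<Rightarrow> real" where
  "carl_const n c M = 16 * ((9 + 8 * real n) powr M)\<^sup>2 * loc_const n c c + 4 * c\<^sup>2 * (2 powr M)\<^sup>2"

text \<open>\<open>el\<close> is the side of the top cube. With \<tau> between \<open>el / 2\<close>
  and \<open>el\<close>, the scales \<open>\<tau> / 2 ^ j\<close> exhaust all t up to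
  \<open>el\<close>. The bound n + 1 on \<open>M\<close> leaves a power of the kernel's decay n + 2
  to be traded for a ratio of scales.\<close>

locale lp_carleson = lp_kernel \<psi> c for \<psi> :: "real^'n \<Rightarrow> real" and c :: real +
  fixes f :: "real^'n \<Rightarrow> real" and M el :: real
  assumes f: "bint f" and M: "M > real CARD('n)" "M \<le> real CARD('n) + 1" and el: "el > 0"
begin

lemma M0: "M \<ge> 0" using M by linarith

lemma f_meas [measurable]: "f \<in> borel_measurable borel" by (rule bint_meas[OF f])

text \<open>\<open>AA\<close> is the running maximum, over the scales not below \<open>\<tau> / 2 ^ j\<close>, of weighted averages of
  \<open>|f|\<close>. It is dominated by the maximal function and, unlike a supremum over cubes, varies slowly
  (\<open>AA_harnack\<close>). Dividing by it keeps \<open>DD\<close> bounded; where \<open>AA\<close> vanishes so does the numerator.\<close>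

definition AA :: "real \<Rightarrow> nat \<Rightarrow> real^'n \<Rightarrow> real" where
  "AA \<tau> j y = Max ((\<lambda>i. sm M f (\<tau> / 2 ^ i) y) ` {..j})"

definition DD :: "real \<Rightarrow> nat \<Rightarrow> real^'n \<Rightarrow> real" where
  "DD \<tau> j y = (KC (dl (\<tau> / 2 ^ j)) f y)\<^sup>2 / (AA \<tau> j y)\<^sup>2"

lemma AA_measurable [measurable]:
  assumes [measurable]: "s \<in> borel_measurable N" "y \<in> borel_measurable N"
  shows "(\<lambda>x. AA (s x) j (y x)) \<in> borel_measurable N"
  unfolding AA_def by measurable

lemma DD_measurable [measurable]:
  assumes [measurable]: "s \<in> borel_measurable N" "y \<in> borel_measurable N"
  shows "(\<lambda>x. DD (s x) j (y x)) \<in> borel_measurable N"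
  unfolding DD_def by measurable

lemma sm_le_AA: "i \<le> j \<Longrightarrow> sm M f (\<tau> / 2 ^ i) y \<le> AA \<tau> j y"
  unfolding AA_def by (intro Max_ge) auto

lemma AA_nonneg: "\<tau> > 0 \<Longrightarrow> AA \<tau> j y \<ge> 0"
  using sm_le_AA[of j j \<tau> y] sm_nonneg[of "\<tau> / 2 ^ j" M f y] by simp

lemma KC_le_AA: "\<tau> > 0 \<Longrightarrow> \<bar>KC (dl (\<tau> / 2 ^ j)) f y\<bar> \<le> c * AA \<tau> j y"
  by (rule order_trans[OF KC_dl_le_sm[OF f] mult_left_mono[OF sm_le_AA]]) (use M c in auto)

lemma DD_nonneg: "DD \<tau> j y \<ge> 0" by (simp add: DD_def)

lemma square_ratio_le:
  fixes a b k :: real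
  assumes "\<bar>a\<bar> \<le> k * b"
  shows "a\<^sup>2 / b\<^sup>2 \<le> k\<^sup>2"
proof (cases "b = 0")
  case False
  have "\<bar>a\<bar> \<le> \<bar>k * b\<bar>" using assms by linarith
  then have "a\<^sup>2 \<le> (k * b)\<^sup>2" by (simp only: abs_le_square_iff)
  then show ?thesis using False by (simp add: divide_le_eq power_mult_distrib)
qed simp

lemma DD_le: "\<tau> > 0 \<Longrightarrow> DD \<tau> j y \<le> c\<^sup>2"
  unfolding DD_def by (rule square_ratio_le[OF KC_le_AA])

lemma KC_sq_eq: "\<tau> > 0 \<Longrightarrow> (KC (dl (\<tau> / 2 ^ j)) f y)\<^sup>2 = (AA \<tau> j y)\<^sup>2 * DD \<tau> j y"
  using KC_le_AA[of \<tau> j y] by (cases "AA \<tau> j y = 0") (auto simp: DD_def)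

text \<open>Averages of coarser scales vary more slowly, so the finest scale occurring in the
  maximum dictates the factor.\<close>

lemma AA_harnack:
  assumes \<tau>: "\<tau> > 0"
  shows "AA \<tau> j y \<le> (1 + norm (x - y) / (\<tau> / 2 ^ j)) powr M * AA \<tau> j x"
proof -
  have "sm M f (\<tau> / 2 ^ i) y \<le> (1 + norm (x - y) / (\<tau> / 2 ^ j)) powr M * AA \<tau> j x" if "i \<le> j" for i
  proof -
    have ti: "\<tau> / 2 ^ i > 0" "\<tau> / 2 ^ j > 0" using \<tau> by auto
    have le: "\<tau> / 2 ^ j \<le> \<tau> / 2 ^ i" using \<tau> that by (intro divide_left_mono power_increasing) auto
    have "sm M f (\<tau> / 2 ^ i) y \<le> (1 + norm (x - y) / (\<tau> / 2 ^ i)) powr M * sm M f (\<tau> / 2 ^ i) x"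
      by (rule sm_harnack[OF f ti(1) M(1)])
    also have "\<dots> \<le> (1 + norm (x - y) / (\<tau> / 2 ^ j)) powr M * AA \<tau> j x"
    proof (rule mult_mono[OF _ sm_le_AA[OF that]])
      have "norm (x - y) / (\<tau> / 2 ^ i) \<le> norm (x - y) / (\<tau> / 2 ^ j)"
        by (rule divide_left_mono[OF le _ mult_pos_pos[OF ti]]) simp
      then show "(1 + norm (x - y) / (\<tau> / 2 ^ i)) powr M \<le> (1 + norm (x - y) / (\<tau> / 2 ^ j)) powr M"
        by (intro powr_mono2[OF M0] add_left_mono add_nonneg_nonneg divide_nonneg_pos ti) auto
    qed (use sm_nonneg[OF ti(1)] in auto)
    finally show ?thesis .
  qed
  then show ?thesis unfolding AA_def[of \<tau> j y] by (subst Max_le_iff) auto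
qed

lemma loc_const_nonneg: "loc_const CARD('n) c c \<ge> 0"
  unfolding loc_const_def using c Wc_pos_dim orth_const_pos
  by (intro add_nonneg_nonneg mult_nonneg_nonneg) auto

lemma carl_const_nonneg: "carl_const CARD('n) c M \<ge> 0"
  unfolding carl_const_def using loc_const_nonneg by (intro add_nonneg_nonneg) auto

text \<open>The function is split at the cube \<open>R'\<close>, concentric with \<open>R\<close>
  and four times as large. The distant part is handled pointwise and gains a geometric factor in
  \<open>j - k\<close>. The near part is distributed over the doubling levels \<open>l m\<close> of
  \<open>AA\<close> and estimated on each by \<open>local_estimate\<close>.\<close>

lemma carleson_DD:
  assumes \<tau>: "el / 2 \<le> \<tau>" "\<tau> \<le> el"
  shows "(\<Sum>j\<in>{k..<N}. \<integral>\<^sup>+y\<in>cube v (el / 2 ^ k). ennreal (DD \<tau> j y) \<partial>lborel)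
    \<le> ennreal (carl_const CARD('n) c M * (el / 2 ^ k) ^ CARD('n))"
proof -
  let ?n = "CARD('n)"
  have \<tau>0: "\<tau> > 0" using \<tau> el by linarith
  \<comment> \<open>\<open>K\<close> is the price for seeing a cube average in \<open>sm\<close>: at
    distance at most (n + 1) \<rho> from all points of the cube, and at a scale of at least \<rho> /
    8, the quantity 1 + distance / scale is at most 9 + 8 n.\<close>
  define K where "K = (9 + 8 * real CARD('n)) powr M"
  define r where "r = el / 2 ^ k"
  define t where "t j = \<tau> / 2 ^ j" for j
  have r: "r > 0" using el by (simp add: r_def)
  have t: "t j > 0" for j using \<tau>0 by (simp add: t_def)
  have tk: "r / 2 \<le> t k" "t k \<le> r"
    using \<tau> unfolding r_def t_def by (simp_all add: divide_right_mono field_simps)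
  have tmono: "t j \<le> t i" if "i \<le> j" for i j
    unfolding t_def using \<tau>0 that by (intro divide_left_mono power_increasing) auto
  define R where "R = cube v r"
  define v' where "v' = v - (\<chi> i. 3/2 * r)"
  have v'_nth: "v' $ i = v $ i - 3/2 * r" for i by (simp add: v'_def)
  define R' where "R' = cube v' (4 * r)"
  have R[measurable]: "R \<in> sets borel" "R' \<in> sets borel" by (auto simp: R_def R'_def)
  have RR: "R \<subseteq> R'"
  proof
    fix x assume "x \<in> R"
    then have x: "v $ i \<le> x $ i" "x $ i < v $ i + r" for i by (auto simp: R_def cube_def)
    have "v' $ i \<le> x $ i \<and> x $ i < v' $ i + 4 * r" for i
      using r x[of i] unfolding v'_nth by linarith
    then show "x \<in> R'" by (simp add: R'_def cube_def)
  qed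
  have far: "norm (y - z) \<ge> r" if "y \<in> R" "z \<notin> R'" for y z
    using that by (intro far_from_cube[OF r]) (simp_all add: R_def R'_def v'_def)
  have diam: "norm (z - z') \<le> real ?n * \<rho>" if "z \<in> cube u \<rho>" "z' \<in> cube u \<rho>" for u z z' :: "real^'n" and \<rho>
    by (rule norm_diff_cube[OF that])
  define f1 where "f1 x = f x * indicator R' x" for x
  define f2 where "f2 x = f x * indicator (- R') x" for x
  have f1b: "bint f1" and f2b: "bint f2"
    unfolding f1_def[abs_def] f2_def[abs_def] by (auto intro!: bint_indicator_mult f)
  have f12: "f x = f1 x + f2 x" for x by (auto simp: f1_def f2_def indicator_def)
  have KC12: "KC (dl (t j)) f y = KC (dl (t j)) f1 y + KC (dl (t j)) f2 y" for j y
  proof -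
    have "f = (\<lambda>x. f1 x + f2 x)" using f12 by (rule ext)
    then have "KC (dl (t j)) f y = KC (dl (t j)) (\<lambda>x. f1 x + f2 x) y" by simp
    then show ?thesis using KC_add[OF dl_bint[OF t] f1b f2b] by simp
  qed
  have Apos: "AA \<tau> j y \<ge> 0" for j y by (rule AA_nonneg[OF \<tau>0])
  \<comment> \<open>\<open>f2\<close> lives at distance at least \<open>r\<close>, hence at least
    \<open>t k\<close>. One power of the decay n + 2 becomes the factor \<open>t j / t k\<close>,
    and \<open>wts_scale\<close> lifts the remaining weight to scale \<open>t k\<close>, whose
    average is part of \<open>AA\<close>.\<close>
  have farest: "(KC (dl (t j)) f2 y)\<^sup>2 / (AA \<tau> j y)\<^sup>2 \<le> c\<^sup>2 * (2 powr M)\<^sup>2 * (1/4) ^ (j - k)"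
    if y: "y \<in> R" and j: "k \<le> j" for y j
  proof -
    have "\<bar>KC (dl (t j)) f2 y\<bar> \<le> (LINT z|lborel. \<bar>dl (t j) (y - z) * f2 z\<bar>)"
      unfolding KC_def by (rule integral_abs_bound)
    also have "\<dots> \<le> (LINT z|lborel. (c * 2 powr M * (t j / t k)) * (wts M (t k) (y - z) * \<bar>f z\<bar>))"
    proof (rule integral_mono)
      show "integrable lborel (\<lambda>z. \<bar>dl (t j) (y - z) * f2 z\<bar>)"
        by (intro bint_integrable bint_abs KC_integrand dl_bint t f2b)
      show "integrable lborel (\<lambda>z. (c * 2 powr M * (t j / t k)) * (wts M (t k) (y - z) * \<bar>f z\<bar>))"
        by (intro integrable_mult_right sm_integrand f t M)
      fix z
      show "\<bar>dl (t j) (y - z) * f2 z\<bar> \<le> (c * 2 powr M * (t j / t k)) * (wts M (t k) (y - z) * \<bar>f z\<bar>)"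
      proof (cases "z \<in> R'")
        case True
        then have "f2 z = 0" by (simp add: f2_def)
        then show ?thesis using c t[of j] t[of k] wts_nonneg[OF t, of M k "y - z"] by simp
      next
        case False
        let ?w = "y - z"
        have wk: "t k \<le> norm ?w" using far[OF y False] tk by linarith
        then have w0: "norm ?w > 0" using t[of k] by linarith
        have "wts (real ?n + 2) (t j) ?w = (t j / norm ?w) * (norm ?w / t j * wts (real ?n + 1 + 1) (t j) ?w)"
          using t[of j] w0 by (simp add: add_ac)
        also have "\<dots> \<le> (t j / t k) * wts (real ?n + 1) (t j) ?w"
          using wk t[of j] t[of k] w0 norm_wts_le[OF t, of ?w j "real ?n + 1"]
          by (intro mult_mono) (auto simp: wts_nonneg intro!: divide_left_mono mult_pos_pos)
        also have "\<dots> \<le> (t j / t k) * wts M (t j) ?w"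
          using t[of j] t[of k] by (intro mult_left_mono wts_antimono M t) auto
        also have "\<dots> \<le> (t j / t k) * (2 powr M * wts M (t k) ?w)"
          using t[of j] t[of k] M by (intro mult_left_mono wts_scale t tmono j wk) auto
        finally have "c * wts (real ?n + 2) (t j) ?w \<le> c * ((t j / t k) * (2 powr M * wts M (t k) ?w))"
          using c by (intro mult_left_mono) auto
        then have "\<bar>dl (t j) ?w\<bar> \<le> (c * 2 powr M * (t j / t k)) * wts M (t k) ?w"
          using dl_le[OF t, of j ?w] by (simp add: mult_ac)
        from mult_right_mono[OF this, of "\<bar>f z\<bar>"] show ?thesis
          using False by (simp add: f2_def abs_mult mult.assoc)
      qed
    qed
    also have "\<dots> = (c * 2 powr M * (t j / t k)) * sm M f (t k) y" by (simp add: sm_def KC_def)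
    also have "\<dots> \<le> (c * 2 powr M * (t j / t k)) * AA \<tau> j y"
      using c t[of j] t[of k] sm_le_AA[OF j, of \<tau> y] by (intro mult_left_mono) (auto simp: t_def)
    also have "t j / t k = (1/2) ^ (j - k)"
      using \<tau>0 j by (simp add: t_def power_diff power_one_over)
    finally have "(KC (dl (t j)) f2 y)\<^sup>2 / (AA \<tau> j y)\<^sup>2 \<le> (c * 2 powr M * (1/2) ^ (j - k))\<^sup>2"
      by (rule square_ratio_le)
    also have "\<dots> = c\<^sup>2 * (2 powr M)\<^sup>2 * ((1/2) ^ (j - k))\<^sup>2" by (simp add: power_mult_distrib)
    also have "((1/2 :: real) ^ (j - k))\<^sup>2 = (1/4) ^ (j - k)"
      by (simp add: power2_eq_square power_mult_distrib[symmetric])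
    finally show ?thesis .
  qed
  define L where "L = (LINT x|lborel. \<bar>f1 x\<bar>)"
  have L0: "L \<ge> 0" by (simp add: L_def)
  have rn: "r ^ ?n > 0" using r by simp
  \<comment> \<open>The levels start at the average \<open>L / r ^ n\<close>, since generation
    \<open>k\<close> already sees all of \<open>f1\<close>: up to \<open>K\<close> this is a lower
    bound of \<open>AA\<close> on \<open>R\<close>, as \<open>A_lower\<close> shows.\<close>
  define l where "l m = 2 ^ m * (L / r ^ ?n)" for m :: nat
  have l0: "l m \<ge> 0" for m using L0 rn by (simp add: l_def)
  have Kpos: "K > 0" by (simp add: K_def add_pos_nonneg)
  have smf1: "sm M f1 s y \<le> sm M f s y" if "s > 0" for s y
    unfolding sm_def KC_def
    by (intro integral_mono sm_integrand f f1b that M)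
       (auto simp: f1_def indicator_def wts_nonneg that)
  have lower: "cube_avg (\<lambda>x. \<bar>f1 x\<bar>) u \<rho> / K \<le> sm M f s y"
    if "\<rho> > 0" "\<rho> / 8 \<le> s" "s \<le> \<rho>" and near: "\<And>z. z \<in> cube u \<rho> \<Longrightarrow> norm (y - z) \<le> (real ?n + 1) * \<rho>"
    for u y \<rho> s
  proof -
    have s: "s > 0" using that by linarith
    let ?I = "LINT z|lborel. \<bar>f1 z\<bar> * indicator (cube u \<rho>) z"
    have I0: "?I \<ge> 0" by simp
    have "cube_avg (\<lambda>x. \<bar>f1 x\<bar>) u \<rho> / K = ?I / (K * \<rho> ^ ?n)"
      by (simp add: cube_avg_def set_lebesgue_integral_def mult.commute)
    also have "\<dots> \<le> ?I / ((1 + ((real ?n + 1) * \<rho>) / s) powr M * s ^ ?n)"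
    proof (rule divide_left_mono[OF _ I0])
      have "\<rho> / s \<le> 8" using that s by (simp add: field_simps)
      then have "(real ?n + 1) * (\<rho> / s) \<le> (real ?n + 1) * 8" by (intro mult_left_mono) auto
      then have "1 + ((real ?n + 1) * \<rho>) / s \<le> 9 + 8 * real ?n" by simp
      then have "(1 + ((real ?n + 1) * \<rho>) / s) powr M \<le> K"
        unfolding K_def using M0 s that(1) by (intro powr_mono2) (auto intro!: add_nonneg_nonneg divide_nonneg_pos)
      moreover have "s ^ ?n \<le> \<rho> ^ ?n" using that s by (intro power_mono) auto
      ultimately show "(1 + ((real ?n + 1) * \<rho>) / s) powr M * s ^ ?n \<le> K * \<rho> ^ ?n"
        using s Kpos by (intro mult_mono) auto
      have "1 + ((real ?n + 1) * \<rho>) / s > 0"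
        using s that(1) by (intro add_pos_nonneg divide_nonneg_pos) auto
      then have "(1 + ((real ?n + 1) * \<rho>) / s) powr M > 0" by simp
      then show "0 < K * \<rho> ^ ?n * ((1 + ((real ?n + 1) * \<rho>) / s) powr M * s ^ ?n)"
        using that(1) s Kpos by (intro mult_pos_pos) auto
    qed
    also have "\<dots> \<le> sm M f1 s y"
      by (rule sm_lower[OF f1b s M(1) _ near]) (use that(1) in auto)
    also have "\<dots> \<le> sm M f s y" by (rule smf1[OF s])
    finally show ?thesis .
  qed
  have avR': "cube_avg (\<lambda>x. \<bar>f1 x\<bar>) v' (4 * r) = L / (4 * r) ^ ?n"
    by (auto simp: cube_avg_def set_lebesgue_integral_def L_def f1_def R'_def indicator_def
        intro!: Bochner_Integration.integral_cong)
  have A_lower: "l 0 / K \<le> AA \<tau> j y" if y: "y \<in> R" and j: "k \<le> j" for y j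
  proof -
    let ?I = "LINT z|lborel. \<bar>f1 z\<bar> * indicator R' z"
    have IL: "?I = L" unfolding L_def
      by (intro Bochner_Integration.integral_cong) (auto simp: f1_def indicator_def)
    have "l 0 / K = L / (K * r ^ ?n)" by (simp add: l_def)
    also have "\<dots> \<le> L / ((1 + (real ?n * (4 * r)) / t k) powr M * t k ^ ?n)"
    proof (rule divide_left_mono[OF _ L0])
      have "r / t k \<le> 2" using tk t[of k] by (simp add: field_simps)
      then have "(real ?n * 4) * (r / t k) \<le> (real ?n * 4) * 2" by (intro mult_left_mono) auto
      then have "1 + (real ?n * (4 * r)) / t k \<le> 9 + 8 * real ?n" by simp
      then have "(1 + (real ?n * (4 * r)) / t k) powr M \<le> K"
        unfolding K_def using M0 t[of k] r by (intro powr_mono2) (auto intro!: add_nonneg_nonneg divide_nonneg_pos)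
      moreover have "t k ^ ?n \<le> r ^ ?n" using tk t[of k] by (intro power_mono) auto
      ultimately show "(1 + (real ?n * (4 * r)) / t k) powr M * t k ^ ?n \<le> K * r ^ ?n"
        using t[of k] Kpos by (intro mult_mono) auto
      have "1 + (real ?n * (4 * r)) / t k > 0"
        using t[of k] r by (intro add_pos_nonneg divide_nonneg_pos) auto
      then have "(1 + (real ?n * (4 * r)) / t k) powr M > 0" by simp
      then show "0 < K * r ^ ?n * ((1 + (real ?n * (4 * r)) / t k) powr M * t k ^ ?n)"
        using r t[of k] Kpos by (intro mult_pos_pos) auto
    qed
    also have "\<dots> \<le> sm M f1 (t k) y"
      unfolding IL[symmetric]
      by (rule sm_lower[OF f1b t M(1)]) (use y RR diam r in \<open>auto simp: R'_def\<close>)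
    also have "\<dots> \<le> sm M f (t k) y" by (rule smf1[OF t])
    also have "\<dots> \<le> AA \<tau> j y" unfolding t_def by (rule sm_le_AA[OF j])
    finally show ?thesis .
  qed
  define F where "F m j = {y \<in> R. AA \<tau> j y \<le> l m / K}" for m j
  have F[measurable]: "F m j \<in> sets borel" for m j
  proof -
    have "F m j = R \<inter> {y \<in> space borel. AA \<tau> j y \<le> l m / K}" by (auto simp: F_def)
    also have "\<dots> \<in> sets borel" by measurable
    finally show ?thesis .
  qed
  have loc: "(\<Sum>j\<in>{k..<N}. \<integral>\<^sup>+y\<in>F m j. ennreal ((KC (dl (\<tau> / 2 ^ j)) f1 y)\<^sup>2) \<partial>lborel)
     \<le> ennreal (loc_const ?n c c * l m * (LINT x|lborel. \<bar>f1 x\<bar>))" for m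
  proof (rule local_estimate[where k = k and v = v' and ?r0.0 = "4 * r"])
    show "\<tau> > 0" "4 * r > 0" using \<tau>0 r by auto
    show "4 * r / 8 \<le> \<tau> / 2 ^ k" "\<tau> / 2 ^ k \<le> 4 * r / 4" using tk by (auto simp: t_def)
    show "bint f1" by (rule f1b)
    show "f1 x = 0" if "x \<notin> cube v' (4 * r)" for x using that by (simp add: f1_def R'_def)
    show "l m \<ge> 0" by (rule l0)
    have "L / (4 * r) ^ ?n \<le> 1 * (L / r ^ ?n)"
      using L0 r by (simp only: mult_1) (intro divide_left_mono power_mono, auto)
    also have "\<dots> \<le> l m" unfolding l_def using L0 rn by (intro mult_right_mono) auto
    finally show "cube_avg (\<lambda>x. \<bar>f1 x\<bar>) v' (4 * r) \<le> l m" by (simp only: avR')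
    show "c \<ge> 0" using c by simp
    show "F m j \<in> sets borel" for j by (rule F)
    show "\<bar>KC (dl (\<tau> / 2 ^ j)) f1 y\<bar> \<le> c * l m" if "k \<le> j" "y \<in> F m j" for j y
    proof -
      have "\<bar>KC (dl (\<tau> / 2 ^ j)) f1 y\<bar> \<le> c * sm M f1 (\<tau> / 2 ^ j) y"
        using \<tau>0 M by (intro KC_dl_le_sm f1b) auto
      also have "\<dots> \<le> c * l m"
      proof (rule mult_left_mono)
        have "sm M f1 (\<tau> / 2 ^ j) y \<le> sm M f (\<tau> / 2 ^ j) y" using \<tau>0 by (intro smf1) auto
        also have "\<dots> \<le> AA \<tau> j y" by (rule sm_le_AA) simp
        also have "\<dots> \<le> l m / K" using that(2) by (simp add: F_def)
        also have "\<dots> \<le> l m / 1"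
          using l0[of m] M0 Kpos by (intro divide_left_mono) (auto simp: K_def intro!: ge_one_powr_ge_zero)
        finally show "sm M f1 (\<tau> / 2 ^ j) y \<le> l m" by simp
      qed (use c in simp)
      finally show ?thesis .
    qed
    show "norm (y - z) \<ge> 4 * r / 2 ^ m'"
      if big: "cube_avg (\<lambda>x. \<bar>f1 x\<bar>) u (4 * r / 2 ^ m') > l m" and j: "k + m' \<le> j" and y: "y \<in> F m j"
        and z: "z \<in> cube u (4 * r / 2 ^ m')" for u m' j y z
    \<comment> \<open>A cube of side \<rho> with average above \<open>l m\<close> within distance
      \<rho> of \<open>y\<close> would, by \<open>lower\<close>, push the weighted average of
      generation \<open>k + m'\<close> at \<open>y\<close> above \<open>l m / K\<close>. As
      \<open>k + m' <= j\<close>, that average enters \<open>AA\<close>, which contradicts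
      \<open>y\<close> being in \<open>F m j\<close>.\<close>
    proof (rule ccontr)
      let ?\<rho> = "4 * r / 2 ^ m'"
      assume "\<not> ?thesis"
      then have yz: "norm (y - z) \<le> ?\<rho>" by simp
      have "cube_avg (\<lambda>x. \<bar>f1 x\<bar>) u ?\<rho> / K \<le> sm M f (t (k + m')) y"
      proof (rule lower)
        have e: "t (k + m') = t k / 2 ^ m'" by (simp add: t_def power_add)
        show "?\<rho> > 0" using r by simp
        have "4 * r / 8 \<le> t k" using tk by simp
        then have "4 * r / 8 / 2 ^ m' \<le> t k / 2 ^ m'" by (intro divide_right_mono) auto
        then show "?\<rho> / 8 \<le> t (k + m')" unfolding e by simp
        have "t k \<le> 4 * r" using tk r by simp
        then show "t (k + m') \<le> ?\<rho>" unfolding e by (intro divide_right_mono) auto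
        fix z' assume z': "z' \<in> cube u ?\<rho>"
        have "norm (y - z') \<le> norm (y - z) + norm (z - z')"
          using norm_triangle_ineq[of "y - z" "z - z'"] by simp
        with diam[OF z z'] yz show "norm (y - z') \<le> (real ?n + 1) * ?\<rho>"
          unfolding distrib_right mult_1 by linarith
      qed
      also have "\<dots> \<le> AA \<tau> j y" unfolding t_def by (rule sm_le_AA[OF j])
      also have "\<dots> \<le> l m / K" using y by (simp add: F_def)
      finally show False using big Kpos by (simp add: divide_le_cancel)
    qed
  qed
  have near_est: "(\<Sum>j\<in>{k..<N}. \<integral>\<^sup>+y\<in>R. ennreal ((KC (dl (t j)) f1 y)\<^sup>2 / (AA \<tau> j y)\<^sup>2) \<partial>lborel)
     \<le> ennreal (8 * K\<^sup>2 * loc_const ?n c c * r ^ ?n)"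
  \<comment> \<open>With \<open>L = 0\<close> all levels collapse to 0 and would reach no positive
    value of \<open>AA\<close>, but then \<open>f1\<close> vanishes almost everywhere.\<close>
  proof (cases "L = 0")
    case True
    have "KC (dl (t j)) f1 y = 0" for j y
    proof -
      have "AE z in lborel. \<bar>f1 z\<bar> = 0"
        using True bint_integrable[OF bint_abs[OF f1b]] unfolding L_def
        by (subst (asm) integral_nonneg_eq_0_iff_AE) auto
      then have "(LINT z|lborel. dl (t j) (y - z) * f1 z) = 0"
        by (intro integral_eq_zero_AE) auto
      then show ?thesis by (simp add: KC_def)
    qed
    then show ?thesis by simp
  next
    case False
    then have L: "L > 0" using L0 by simp
    have lpos: "l m > 0" for m using L rn by (simp add: l_def)
    have pt: "ennreal ((KC (dl (t j)) f1 y)\<^sup>2 / (AA \<tau> j y)\<^sup>2) * indicator R y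
        \<le> (\<Sum>m. ennreal (4 * K\<^sup>2 / (l m)\<^sup>2) * (ennreal ((KC (dl (t j)) f1 y)\<^sup>2) * indicator (F m j) y))"
      if j: "k \<le> j" for j y
    proof (cases "y \<in> R")
      case y: True
      have low: "l 0 / K \<le> AA \<tau> j y" by (rule A_lower[OF y j])
      obtain m0 where m0: "AA \<tau> j y * K * (r ^ ?n / L) < 2 ^ m0"
        using real_arch_pow[of 2] by auto
      have ex: "AA \<tau> j y \<le> l m0 / K"
        using m0 L rn Kpos by (simp add: l_def field_simps)
      \<comment> \<open>The least level above \<open>K * AA\<close> is also at most
        \<open>2 * K * AA\<close>: its predecessor fails, and for \<open>m = 0\<close> the lower
        bound \<open>low\<close> takes over.\<close>
      define m where "m = (LEAST m. AA \<tau> j y \<le> l m / K)"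
      have m: "AA \<tau> j y \<le> l m / K" unfolding m_def by (rule LeastI[of "\<lambda>m. AA \<tau> j y \<le> l m / K", OF ex])
      have m2: "l m / (2 * K) \<le> AA \<tau> j y"
      proof (cases m)
        case 0
        have "l 0 / (2 * K) \<le> l 0 / K" using lpos[of 0] Kpos by (intro divide_left_mono) auto
        then show ?thesis using low 0 by simp
      next
        case (Suc m')
        have "\<not> AA \<tau> j y \<le> l m' / K"
          using not_less_Least[of m' "\<lambda>m. AA \<tau> j y \<le> l m / K"] Suc by (simp add: m_def)
        then show ?thesis by (simp add: Suc l_def)
      qed
      have yF: "y \<in> F m j" using y m by (simp add: F_def)
      have "l m / (2 * K) > 0" using lpos Kpos by simp
      then have "(KC (dl (t j)) f1 y)\<^sup>2 / (AA \<tau> j y)\<^sup>2 \<le> (KC (dl (t j)) f1 y)\<^sup>2 / (l m / (2 * K))\<^sup>2"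
        using m2 by (intro divide_left_mono power_mono mult_pos_pos zero_less_power) auto
      also have "\<dots> = 4 * K\<^sup>2 / (l m)\<^sup>2 * (KC (dl (t j)) f1 y)\<^sup>2"
        by (simp add: power_divide power_mult_distrib)
      finally have "ennreal ((KC (dl (t j)) f1 y)\<^sup>2 / (AA \<tau> j y)\<^sup>2) * indicator R y
         \<le> ennreal (4 * K\<^sup>2 / (l m)\<^sup>2) * (ennreal ((KC (dl (t j)) f1 y)\<^sup>2) * indicator (F m j) y)"
        using y yF by (simp add: ennreal_mult'[symmetric] ennreal_leI del: times_divide_eq_left)
      also have "\<dots> \<le> (\<Sum>m. ennreal (4 * K\<^sup>2 / (l m)\<^sup>2) * (ennreal ((KC (dl (t j)) f1 y)\<^sup>2) * indicator (F m j) y))"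
        using sum_le_suminf[of "\<lambda>m. ennreal (4 * K\<^sup>2 / (l m)\<^sup>2) * (ennreal ((KC (dl (t j)) f1 y)\<^sup>2) * indicator (F m j) y)" "{m}"]
        by simp
      finally show ?thesis .
    qed simp
    have f1m [measurable]: "f1 \<in> borel_measurable borel" by (rule bint_meas[OF f1b])
    have "(\<Sum>j\<in>{k..<N}. \<integral>\<^sup>+y\<in>R. ennreal ((KC (dl (t j)) f1 y)\<^sup>2 / (AA \<tau> j y)\<^sup>2) \<partial>lborel)
      \<le> (\<Sum>j\<in>{k..<N}. \<integral>\<^sup>+y. (\<Sum>m. ennreal (4 * K\<^sup>2 / (l m)\<^sup>2) * (ennreal ((KC (dl (t j)) f1 y)\<^sup>2) * indicator (F m j) y)) \<partial>lborel)"
      by (intro sum_mono nn_integral_mono pt) auto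
    also have "\<dots> = (\<Sum>j\<in>{k..<N}. \<Sum>m. ennreal (4 * K\<^sup>2 / (l m)\<^sup>2) * (\<integral>\<^sup>+y\<in>F m j. ennreal ((KC (dl (t j)) f1 y)\<^sup>2) \<partial>lborel))"
      by (subst nn_integral_suminf) (simp_all add: nn_integral_cmult)
    also have "\<dots> = (\<Sum>m. \<Sum>j\<in>{k..<N}. ennreal (4 * K\<^sup>2 / (l m)\<^sup>2) * (\<integral>\<^sup>+y\<in>F m j. ennreal ((KC (dl (t j)) f1 y)\<^sup>2) \<partial>lborel))"
      by (intro suminf_sum[symmetric] summableI)
    also have "\<dots> \<le> (\<Sum>m. ennreal (4 * K\<^sup>2 / (l m)\<^sup>2) * ennreal (loc_const ?n c c * l m * L))"
      unfolding sum_distrib_left[symmetric]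
      using loc unfolding L_def t_def by (intro suminf_le mult_left_mono summableI) auto
    also have "\<dots> = (\<Sum>m. ennreal (4 * K\<^sup>2 * loc_const ?n c c * r ^ ?n * (1/2) ^ m))"
    proof (intro suminf_cong)
      fix m
      \<comment> \<open>A single \<open>l m\<close> survives in the denominator; its factor
        \<open>L\<close> cancels the L1 norm and leaves the volume times
        \<open>(1/2) ^ m\<close>.\<close>
      have "4 * K\<^sup>2 / (l m)\<^sup>2 * (loc_const ?n c c * l m * L) = 4 * K\<^sup>2 * loc_const ?n c c * r ^ ?n * (1/2) ^ m"
        using lpos[of m] L rn by (simp add: l_def power2_eq_square power_one_over)
      then show "ennreal (4 * K\<^sup>2 / (l m)\<^sup>2) * ennreal (loc_const ?n c c * l m * L) = ennreal (4 * K\<^sup>2 * loc_const ?n c c * r ^ ?n * (1/2) ^ m)"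
        by (subst ennreal_mult'[symmetric]) auto
    qed
    also have "\<dots> = ennreal (\<Sum>m. 4 * K\<^sup>2 * loc_const ?n c c * r ^ ?n * (1/2) ^ m)"
      using loc_const_nonneg rn by (intro suminf_ennreal2 summable_mult summable_geometric) auto
    also have "(\<Sum>m. 4 * K\<^sup>2 * loc_const ?n c c * r ^ ?n * (1/2) ^ m) = 4 * K\<^sup>2 * loc_const ?n c c * r ^ ?n * 2"
      using suminf_mult[OF summable_geometric[of "1/2::real"], of "4 * K\<^sup>2 * loc_const ?n c c * r ^ ?n"]
        suminf_geometric[of "1/2::real"] by simp
    finally show ?thesis by (simp add: mult_ac)
  qed
  have f12m [measurable]: "f1 \<in> borel_measurable borel" "f2 \<in> borel_measurable borel"
    using bint_meas f1b f2b by auto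
  have "(\<Sum>j\<in>{k..<N}. \<integral>\<^sup>+y\<in>R. ennreal (DD \<tau> j y) \<partial>lborel)
    \<le> (\<Sum>j\<in>{k..<N}. \<integral>\<^sup>+y. ennreal 2 * (ennreal ((KC (dl (t j)) f1 y)\<^sup>2 / (AA \<tau> j y)\<^sup>2) * indicator R y)
         + ennreal (2 * (c\<^sup>2 * (2 powr M)\<^sup>2 * (1/4) ^ (j - k))) * indicator R y \<partial>lborel)"
  proof (intro sum_mono nn_integral_mono)
    fix j y assume j: "j \<in> {k..<N}"
    show "ennreal (DD \<tau> j y) * indicator R y \<le> ennreal 2 * (ennreal ((KC (dl (t j)) f1 y)\<^sup>2 / (AA \<tau> j y)\<^sup>2) * indicator R y)
         + ennreal (2 * (c\<^sup>2 * (2 powr M)\<^sup>2 * (1/4) ^ (j - k))) * indicator R y"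
    proof (cases "y \<in> R")
      case True
      define a where "a = KC (dl (t j)) f1 y"
      define b where "b = KC (dl (t j)) f2 y"
      have ab: "(a + b)\<^sup>2 \<le> 2 * a\<^sup>2 + 2 * b\<^sup>2"
        using zero_le_power2[of "a - b"] by (simp add: power2_eq_square algebra_simps)
      have "DD \<tau> j y = (a + b)\<^sup>2 / (AA \<tau> j y)\<^sup>2"
        using KC12[of j y] by (simp add: DD_def a_def b_def t_def)
      also have "\<dots> \<le> (2 * a\<^sup>2 + 2 * b\<^sup>2) / (AA \<tau> j y)\<^sup>2" by (intro divide_right_mono ab) simp
      also have "\<dots> = 2 * (a\<^sup>2 / (AA \<tau> j y)\<^sup>2) + 2 * (b\<^sup>2 / (AA \<tau> j y)\<^sup>2)" by (simp add: add_divide_distrib)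
      also have "\<dots> \<le> 2 * (a\<^sup>2 / (AA \<tau> j y)\<^sup>2) + 2 * (c\<^sup>2 * (2 powr M)\<^sup>2 * (1/4) ^ (j - k))"
        using farest[OF True, of j] j by (intro add_left_mono mult_left_mono) (auto simp: b_def)
      finally have "ennreal (DD \<tau> j y) \<le> ennreal (2 * (a\<^sup>2 / (AA \<tau> j y)\<^sup>2) + 2 * (c\<^sup>2 * (2 powr M)\<^sup>2 * (1/4) ^ (j - k)))"
        by (rule ennreal_leI)
      also have "\<dots> = ennreal (2 * (a\<^sup>2 / (AA \<tau> j y)\<^sup>2)) + ennreal (2 * (c\<^sup>2 * (2 powr M)\<^sup>2 * (1/4) ^ (j - k)))"
        by (intro ennreal_plus) auto
      also have "ennreal (2 * (a\<^sup>2 / (AA \<tau> j y)\<^sup>2)) = ennreal 2 * ennreal (a\<^sup>2 / (AA \<tau> j y)\<^sup>2)"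
        by (rule ennreal_mult') simp
      finally show ?thesis using True by (simp add: a_def)
    qed simp
  qed
  also have "\<dots> = ennreal 2 * (\<Sum>j\<in>{k..<N}. \<integral>\<^sup>+y\<in>R. ennreal ((KC (dl (t j)) f1 y)\<^sup>2 / (AA \<tau> j y)\<^sup>2) \<partial>lborel)
     + (\<Sum>j\<in>{k..<N}. ennreal (2 * (c\<^sup>2 * (2 powr M)\<^sup>2 * (1/4) ^ (j - k))) * emeasure lborel R)"
    by (simp add: nn_integral_add nn_integral_cmult nn_integral_cmult_indicator sum.distrib sum_distrib_left)
  also have "\<dots> \<le> ennreal 2 * ennreal (8 * K\<^sup>2 * loc_const ?n c c * r ^ ?n) + ennreal (4 * c\<^sup>2 * (2 powr M)\<^sup>2 * r ^ ?n)"
  proof (intro add_mono mult_left_mono near_est)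
    have eR: "emeasure lborel R = ennreal (r ^ ?n)" using r by (simp add: R_def emeasure_cube)
    have "(\<Sum>j\<in>{k..<N}. ennreal (2 * (c\<^sup>2 * (2 powr M)\<^sup>2 * (1/4) ^ (j - k))) * emeasure lborel R)
      = (\<Sum>j\<in>{k..<N}. ennreal (2 * (c\<^sup>2 * (2 powr M)\<^sup>2 * r ^ ?n) * (1/4) ^ (j - k)))"
      unfolding eR by (intro sum.cong refl, subst ennreal_mult'[symmetric]) (auto simp: mult_ac)
    also have "\<dots> = ennreal (\<Sum>j\<in>{k..<N}. 2 * (c\<^sup>2 * (2 powr M)\<^sup>2 * r ^ ?n) * (1/4) ^ (j - k))"
      using r by (intro sum_ennreal) auto
    also have "\<dots> \<le> ennreal (4 * c\<^sup>2 * (2 powr M)\<^sup>2 * r ^ ?n)"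
    proof (rule ennreal_leI)
      have "(\<Sum>j\<in>{k..<N}. (1/4 :: real) ^ (j - k)) = (\<Sum>i\<in>{0..<N - k}. (1/4) ^ i)"
        by (rule sum.reindex_bij_witness[of _ "\<lambda>i. i + k" "\<lambda>j. j - k"]) auto
      also have "\<dots> \<le> 2"
        unfolding atLeast0LessThan by (subst geometric_sum) (auto simp: field_simps)
      finally have "2 * (c\<^sup>2 * (2 powr M)\<^sup>2 * r ^ ?n) * (\<Sum>j\<in>{k..<N}. (1/4 :: real) ^ (j - k))
         \<le> 2 * (c\<^sup>2 * (2 powr M)\<^sup>2 * r ^ ?n) * 2"
        using r by (intro mult_left_mono) auto
      then show "(\<Sum>j\<in>{k..<N}. 2 * (c\<^sup>2 * (2 powr M)\<^sup>2 * r ^ ?n) * (1/4) ^ (j - k)) \<le> 4 * c\<^sup>2 * (2 powr M)\<^sup>2 * r ^ ?n"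
        by (simp add: sum_distrib_left[symmetric])
    qed
    finally show "(\<Sum>j\<in>{k..<N}. ennreal (2 * (c\<^sup>2 * (2 powr M)\<^sup>2 * (1/4) ^ (j - k))) * emeasure lborel R)
      \<le> ennreal (4 * c\<^sup>2 * (2 powr M)\<^sup>2 * r ^ ?n)" .
  qed simp
  also have "\<dots> = ennreal (carl_const CARD('n) c M * r ^ ?n)"
    using loc_const_nonneg rn
    by (subst ennreal_mult'[symmetric], simp, subst ennreal_plus[symmetric])
       (auto simp: carl_const_def K_def algebra_simps)
  finally show ?thesis by (simp add: R_def r_def)
qed

end

text \<open>The term \<open>4 ^ n\<close> is the volume ratio of the enlarged cube. In the distant
  term, \<open>2 powr q\<close> is the constant of \<open>wts_scale\<close> and \<open>2 ^ n\<close>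
  comes from \<open>r <= 2 * t k\<close>.\<close>

definition bb_const :: "nat \<Rightarrow> real \<Rightarrow> real \<Rightarrow> real \<Rightarrow> real" where
  "bb_const n c M q = carl_const n c M * Wc n q * (4 ^ n + 2 powr q * 2 ^ n)"

text \<open>Bisection backwards: a packing bound for all cubes of side \<open>r\<close> passes to
  larger cubes because the volumes of the parts add up.\<close>

lemma nn_integral_cube_double:
  fixes h :: "real^'n \<Rightarrow> ennreal"
  assumes [measurable]: "h \<in> borel_measurable borel" and r: "r > 0" and K: "K \<ge> 0"
    and le: "\<And>v. (\<integral>\<^sup>+y\<in>cube v r. h y \<partial>lborel) \<le> ennreal (K * r ^ CARD('n))"
  shows "(\<integral>\<^sup>+y\<in>cube v (2 ^ m * r). h y \<partial>lborel) \<le> ennreal (K * (2 ^ m * r) ^ CARD('n))"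
proof (induction m arbitrary: v)
  case 0
  then show ?case using le by simp
next
  case (Suc m)
  have e: "2 ^ Suc m * r / 2 = 2 ^ m * r" by simp
  have "(\<integral>\<^sup>+y\<in>cube v (2 ^ Suc m * r). h y \<partial>lborel)
    = (\<Sum>s\<in>UNIV. \<integral>\<^sup>+y\<in>cube (child v (2 ^ Suc m * r) s) (2 ^ Suc m * r / 2). h y \<partial>lborel)"
    using r by (intro nn_integral_cube_split) auto
  also have "\<dots> \<le> (\<Sum>s\<in>(UNIV::'n set set). ennreal (K * (2 ^ Suc m * r / 2) ^ CARD('n)))"
    unfolding e by (intro sum_mono Suc.IH)
  also have "\<dots> = ennreal (\<Sum>s\<in>(UNIV::'n set set). K * (2 ^ Suc m * r / 2) ^ CARD('n))"
    using K r by (intro sum_ennreal) auto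
  also have "(\<Sum>s\<in>(UNIV::'n set set). K * (2 ^ Suc m * r / 2) ^ CARD('n)) = K * (2 ^ Suc m * r) ^ CARD('n)"
    unfolding sum_distrib_left[symmetric] sum_measure_children ..
  finally show ?case .
qed

locale lp_tail = lp_carleson \<psi> c f M el for \<psi> :: "real^'n \<Rightarrow> real" and c f M el +
  fixes q :: real
  assumes q: "q > real CARD('n)"
begin

text \<open>\<open>DD\<close> admits no Harnack inequality, since its numerator can vanish at a
  point. Averaging it with the weight of its own scale repairs this, and the exponent
  \<open>q\<close> is what the weight of the square function retains after the denominators have
  been moved to \<open>x\<close>.\<close>

definition BB :: "real \<Rightarrow> nat \<Rightarrow> real^'n \<Rightarrow> ennreal" where
  "BB \<tau> j x = (\<integral>\<^sup>+y. ennreal (DD \<tau> j y) * ennreal (wts q (\<tau> / 2 ^ j) (x - y)) \<partial>lborel)"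

text \<open>Under the substitution t = \<tau> / 2 ^ j this is integration against dt / t over the
  block of scales between \<open>el / 2 ^ Suc j\<close> and \<open>el / 2 ^ j\<close>.\<close>

definition BT :: "nat \<Rightarrow> real^'n \<Rightarrow> ennreal" where
  "BT j x = (\<integral>\<^sup>+\<tau>. BB \<tau> j x * (ennreal (1 / \<tau>) * indicator {el / 2<..el} \<tau>) \<partial>lborel)"

lemma q0: "q \<ge> 0" using q by linarith

lemma BB_measurable [measurable]:
  assumes [measurable]: "s \<in> borel_measurable N" "x \<in> borel_measurable N"
  shows "(\<lambda>w. BB (s w) j (x w)) \<in> borel_measurable N"
  unfolding BB_def by measurable

lemma BT_measurable [measurable]: "BT j \<in> borel_measurable borel"
  unfolding BT_def[abs_def] by measurable

lemma BB_le: assumes "\<tau> > 0" shows "BB \<tau> j x \<le> ennreal (c\<^sup>2 * Wc CARD('n) q)"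
proof -
  have "BB \<tau> j x \<le> (\<integral>\<^sup>+y. ennreal (c\<^sup>2) * ennreal (wts q (\<tau> / 2 ^ j) (x - y)) \<partial>lborel)"
    unfolding BB_def using DD_le[OF assms] by (intro nn_integral_mono mult_right_mono ennreal_leI) auto
  also have "\<dots> \<le> ennreal (c\<^sup>2) * ennreal (Wc CARD('n) q)"
    using assms q by (subst nn_integral_cmult) (auto intro!: mult_left_mono nn_integral_wts)
  finally show ?thesis by (simp add: ennreal_mult')
qed

lemma tau_weight: "(\<integral>\<^sup>+\<tau>. ennreal (1 / \<tau>) * indicator {el / 2<..el} \<tau> \<partial>lborel) \<le> 1"
proof -
  have "(\<integral>\<^sup>+\<tau>. ennreal (1 / \<tau>) * indicator {el / 2<..el} \<tau> \<partial>lborel)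
    \<le> (\<integral>\<^sup>+\<tau>. ennreal (2 / el) * indicator {el / 2<..el} \<tau> \<partial>lborel)"
    using el by (intro nn_integral_mono) (auto simp: indicator_def field_simps intro!: ennreal_leI)
  also have "\<dots> = ennreal (2 / el) * ennreal (el / 2)"
    using el by (simp add: nn_integral_cmult_indicator)
  also have "\<dots> = 1" using el by (simp add: ennreal_mult'[symmetric])
  finally show ?thesis .
qed

lemma weighted_le:
  assumes "\<And>\<tau>. \<tau> \<in> {el / 2<..el} \<Longrightarrow> h \<tau> \<le> K"
  shows "(\<integral>\<^sup>+\<tau>. h \<tau> * (ennreal (1 / \<tau>) * indicator {el / 2<..el} \<tau>) \<partial>lborel) \<le> K"
proof -
  have "(\<integral>\<^sup>+\<tau>. h \<tau> * (ennreal (1 / \<tau>) * indicator {el / 2<..el} \<tau>) \<partial>lborel)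
    \<le> (\<integral>\<^sup>+\<tau>. K * (ennreal (1 / \<tau>) * indicator {el / 2<..el} \<tau>) \<partial>lborel)"
    using assms by (intro nn_integral_mono) (auto simp: indicator_def intro!: mult_right_mono)
  also have "\<dots> = K * (\<integral>\<^sup>+\<tau>. ennreal (1 / \<tau>) * indicator {el / 2<..el} \<tau> \<partial>lborel)"
    by (rule nn_integral_cmult) measurable
  also have "\<dots> \<le> K * 1" by (intro mult_left_mono tau_weight) simp
  finally show ?thesis by simp
qed

lemma BT_le: "BT j x \<le> ennreal (c\<^sup>2 * Wc CARD('n) q)"
  unfolding BT_def using el by (intro weighted_le BB_le) auto

lemma BT_fin: "BT j x < \<infinity>"
  using le_less_trans[OF BT_le ennreal_less_top] by simp

definition Br :: "nat \<Rightarrow> real^'n \<Rightarrow> real" where "Br j x = enn2real (BT j x)"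

lemma Br_measurable [measurable]: "Br j \<in> borel_measurable borel"
  unfolding Br_def[abs_def] by measurable

lemma Br_nonneg: "Br j x \<ge> 0" by (simp add: Br_def)

lemma ennreal_Br: "ennreal (Br j x) = BT j x"
  using BT_fin[of j x] by (simp add: Br_def)

text \<open>Points of a cube of generation \<open>j\<close> are at most 2 n times the scale apart,
  as \<tau> > \<open>el / 2\<close>; Peetre's inequality transfers the weight between them.\<close>

lemma BB_harnack:
  assumes \<tau>: "el / 2 < \<tau>" and x: "x \<in> cube v (el / 2 ^ j)" "x' \<in> cube v (el / 2 ^ j)"
  shows "BB \<tau> j x \<le> ennreal ((1 + 2 * real CARD('n)) powr q) * BB \<tau> j x'"
proof -
  let ?s = "\<tau> / 2 ^ j"
  have \<tau>0: "\<tau> > 0" using \<tau> el by linarith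
  have s: "?s > 0" using \<tau>0 by simp
  have "norm (x - x') / ?s \<le> (real CARD('n) * (el / 2 ^ j)) / ?s"
    using norm_diff_cube[OF x] s by (intro divide_right_mono) auto
  also have "\<dots> = real CARD('n) * (el / \<tau>)" by simp
  also have "\<dots> \<le> real CARD('n) * 2" using \<tau> \<tau>0 by (intro mult_left_mono) (auto simp: field_simps)
  finally have "(1 + norm (x - x') / ?s) powr q \<le> (1 + 2 * real CARD('n)) powr q"
    using s by (intro powr_mono2[OF q0]) (auto intro!: add_nonneg_nonneg divide_nonneg_pos simp del: divide_divide_eq_right)
  note k = this
  have "BB \<tau> j x \<le> (\<integral>\<^sup>+y. ennreal ((1 + 2 * real CARD('n)) powr q) *
      (ennreal (DD \<tau> j y) * ennreal (wts q ?s (x' - y))) \<partial>lborel)"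
    unfolding BB_def
  proof (intro nn_integral_mono)
    fix y
    have "wts q ?s (x - y) \<le> (1 + norm (x - x') / ?s) powr q * wts q ?s (x' - y)"
      using wts_harnack[OF s q0, of "x - y" "x' - y"] by simp
    also have "\<dots> \<le> (1 + 2 * real CARD('n)) powr q * wts q ?s (x' - y)"
      by (rule mult_right_mono[OF k wts_nonneg[OF s]])
    finally have "ennreal (wts q ?s (x - y)) \<le> ennreal ((1 + 2 * real CARD('n)) powr q) * ennreal (wts q ?s (x' - y))"
      by (subst ennreal_mult'[symmetric]) (auto intro: ennreal_leI)
    from mult_left_mono[OF this, of "ennreal (DD \<tau> j y)"]
    show "ennreal (DD \<tau> j y) * ennreal (wts q ?s (x - y)) \<le> ennreal ((1 + 2 * real CARD('n)) powr q) *
      (ennreal (DD \<tau> j y) * ennreal (wts q ?s (x' - y)))" by (simp add: mult_ac)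
  qed
  also have "\<dots> = ennreal ((1 + 2 * real CARD('n)) powr q) * BB \<tau> j x'"
    unfolding BB_def by (rule nn_integral_cmult) measurable
  finally show ?thesis .
qed

lemma Br_harnack:
  assumes x: "x \<in> cube v (el / 2 ^ j)" "x' \<in> cube v (el / 2 ^ j)"
  shows "Br j x \<le> (1 + 2 * real CARD('n)) powr q * Br j x'"
proof -
  let ?C = "ennreal ((1 + 2 * real CARD('n)) powr q)"
  have "BT j x \<le> (\<integral>\<^sup>+\<tau>. ?C * (BB \<tau> j x' * (ennreal (1 / \<tau>) * indicator {el / 2<..el} \<tau>)) \<partial>lborel)"
    unfolding BT_def
  proof (intro nn_integral_mono)
    fix \<tau>
    show "BB \<tau> j x * (ennreal (1 / \<tau>) * indicator {el / 2<..el} \<tau>)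
       \<le> ?C * (BB \<tau> j x' * (ennreal (1 / \<tau>) * indicator {el / 2<..el} \<tau>))"
      using mult_right_mono[OF BB_harnack[OF _ x, of \<tau>], of "ennreal (1 / \<tau>)"]
      by (auto simp: indicator_def mult.assoc)
  qed
  also have "\<dots> = ?C * BT j x'" unfolding BT_def by (rule nn_integral_cmult) measurable
  finally have "ennreal (Br j x) \<le> ennreal ((1 + 2 * real CARD('n)) powr q * Br j x')"
    by (simp add: ennreal_Br ennreal_mult')
  then show ?thesis by (subst (asm) ennreal_le_iff) (auto simp: Br_nonneg)
qed

lemma bb_const_nonneg: "bb_const CARD('n) c M q \<ge> 0"
  unfolding bb_const_def using carl_const_nonneg Wc_pos[OF q] by (intro mult_nonneg_nonneg add_nonneg_nonneg) auto

text \<open>For \<open>y\<close> in \<open>R'\<close> the weight is integrated in \<open>x\<close>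
  first, which leaves the packing of \<open>DD\<close> on \<open>R'\<close>. For other
  \<open>y\<close> the distance to \<open>R\<close> is at least \<open>t k\<close>, and the weight
  of scale \<open>t j\<close> is replaced by that of scale \<open>t k\<close>. This no longer
  depends on \<open>j\<close>, so the sum over \<open>j\<close> can be formed first and packed on
  all large cubes around \<open>x\<close>.\<close>

lemma carleson_BB:
  assumes \<tau>: "el / 2 < \<tau>" "\<tau> \<le> el"
  shows "(\<Sum>j\<in>{k..<N}. \<integral>\<^sup>+x\<in>cube v (el / 2 ^ k). BB \<tau> j x \<partial>lborel)
    \<le> ennreal (bb_const CARD('n) c M q * (el / 2 ^ k) ^ CARD('n))"
proof -
  let ?n = "CARD('n)"
  define cD where "cD = carl_const ?n c M"
  have cD: "cD \<ge> 0" unfolding cD_def by (rule carl_const_nonneg)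
  define W where "W = Wc ?n q"
  have W: "W > 0" unfolding W_def by (rule Wc_pos[OF q])
  have \<tau>0: "\<tau> > 0" using \<tau> el by linarith
  define r where "r = el / 2 ^ k"
  define t where "t j = \<tau> / 2 ^ j" for j
  have r: "r > 0" using el by (simp add: r_def)
  have t: "t j > 0" for j using \<tau>0 by (simp add: t_def)
  have tk: "r / 2 \<le> t k" "t k \<le> r"
    using \<tau> unfolding r_def t_def by (simp_all add: divide_right_mono field_simps)
  have tmono: "t j \<le> t i" if "i \<le> j" for i j
    unfolding t_def using \<tau>0 that by (intro divide_left_mono power_increasing) auto
  define R where "R = cube v r"
  define R' where "R' = cube (v - (\<chi> i. 3/2 * r)) (4 * r)"
  have R[measurable]: "R \<in> sets borel" "R' \<in> sets borel" by (auto simp: R_def R'_def)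
  define h where "h y = (\<Sum>j\<in>{k..<N}. ennreal (DD \<tau> j y))" for y
  have h[measurable]: "h \<in> borel_measurable borel" unfolding h_def[abs_def] by measurable
  have hr: "(\<integral>\<^sup>+y\<in>cube u r. h y \<partial>lborel) \<le> ennreal (cD * r ^ ?n)" for u
  proof -
    have "(\<integral>\<^sup>+y\<in>cube u r. h y \<partial>lborel) = (\<Sum>j\<in>{k..<N}. \<integral>\<^sup>+y\<in>cube u r. ennreal (DD \<tau> j y) \<partial>lborel)"
      unfolding h_def by (subst nn_integral_sum[symmetric]) (auto simp: sum_distrib_right)
    then show ?thesis using carleson_DD[where \<tau>=\<tau> and k=k and N=N and v=u] \<tau> by (simp add: r_def cD_def)
  qed
  have hd: "(\<integral>\<^sup>+y\<in>cube u (2 ^ m * r). h y \<partial>lborel) \<le> ennreal (cD * (2 ^ m * r) ^ ?n)" for u m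
    by (rule nn_integral_cube_double[OF h r cD hr])
  have near: "(\<Sum>j\<in>{k..<N}. \<integral>\<^sup>+x. (\<integral>\<^sup>+y. (ennreal (DD \<tau> j y) * indicator R' y) * ennreal (wts q (t j) (x - y)) \<partial>lborel) \<partial>lborel)
     \<le> ennreal (cD * W * (4 * r) ^ ?n)"
  proof -
    have "(\<integral>\<^sup>+x. (\<integral>\<^sup>+y. (ennreal (DD \<tau> j y) * indicator R' y) * ennreal (wts q (t j) (x - y)) \<partial>lborel) \<partial>lborel)
       \<le> (\<integral>\<^sup>+y\<in>R'. ennreal (DD \<tau> j y) \<partial>lborel) * ennreal W" for j
    proof -
      have "(\<integral>\<^sup>+x. (\<integral>\<^sup>+y. (ennreal (DD \<tau> j y) * indicator R' y) * ennreal (wts q (t j) (x - y)) \<partial>lborel) \<partial>lborel)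
        = (\<integral>\<^sup>+y. (\<integral>\<^sup>+x. (ennreal (DD \<tau> j y) * indicator R' y) * ennreal (wts q (t j) (x - y)) \<partial>lborel) \<partial>lborel)"
        by (rule lborel_pair.Fubini') measurable
      also have "\<dots> = (\<integral>\<^sup>+y. (ennreal (DD \<tau> j y) * indicator R' y) * (\<integral>\<^sup>+x. ennreal (wts q (t j) (x - y)) \<partial>lborel) \<partial>lborel)"
        by (simp add: nn_integral_cmult)
      also have "\<dots> \<le> (\<integral>\<^sup>+y. (ennreal (DD \<tau> j y) * indicator R' y) * ennreal W \<partial>lborel)"
        unfolding W_def by (intro nn_integral_mono mult_left_mono nn_integral_wts' t q) auto
      also have "\<dots> = (\<integral>\<^sup>+y\<in>R'. ennreal (DD \<tau> j y) \<partial>lborel) * ennreal W"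
        by (rule nn_integral_multc) measurable
      finally show ?thesis .
    qed
    then have "(\<Sum>j\<in>{k..<N}. \<integral>\<^sup>+x. (\<integral>\<^sup>+y. (ennreal (DD \<tau> j y) * indicator R' y) * ennreal (wts q (t j) (x - y)) \<partial>lborel) \<partial>lborel)
       \<le> (\<Sum>j\<in>{k..<N}. (\<integral>\<^sup>+y\<in>R'. ennreal (DD \<tau> j y) \<partial>lborel) * ennreal W)"
      by (rule sum_mono)
    also have "\<dots> = (\<integral>\<^sup>+y\<in>R'. h y \<partial>lborel) * ennreal W"
      unfolding h_def by (subst sum_distrib_right[symmetric], subst nn_integral_sum[symmetric]) (auto simp: sum_distrib_right)
    also have "\<dots> \<le> ennreal (cD * (2 ^ 2 * r) ^ ?n) * ennreal W"
      unfolding R'_def using hd[of "v - (\<chi> i. 3/2 * r)" 2] by (intro mult_right_mono) auto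
    also have "\<dots> = ennreal (cD * W * (4 * r) ^ ?n)"
      using W by (subst ennreal_mult''[symmetric]) (auto simp: mult_ac)
    finally show ?thesis .
  qed
  have farx: "(\<integral>\<^sup>+y. ennreal (wts q (t k) (x - y)) * h y \<partial>lborel) \<le> ennreal (cD * 2 ^ ?n * W)" for x
    unfolding W_def
  proof (rule nn_integral_wts_le[OF h t q])
    show "cD * 2 ^ ?n \<ge> 0" using cD by simp
    fix i
    have "ccube x (2 ^ (i + 1) * t k) \<subseteq> cube (x - (\<chi> j. 2 ^ (i + 1) * t k)) (2 ^ (i + 2) * r)"
      unfolding ccube_def cube_def using tk mult_left_mono[OF tk(2), of "2 ^ (i + 2)"]
      by (auto intro: less_le_trans)
    then have "(\<integral>\<^sup>+z\<in>ccube x (2 ^ (i + 1) * t k). h z \<partial>lborel)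
      \<le> (\<integral>\<^sup>+z\<in>cube (x - (\<chi> j. 2 ^ (i + 1) * t k)) (2 ^ (i + 2) * r). h z \<partial>lborel)"
      by (intro nn_integral_mono mult_left_mono) (auto simp: indicator_def)
    also have "\<dots> \<le> ennreal (cD * (2 ^ (i + 2) * r) ^ ?n)" by (rule hd)
    also have "\<dots> \<le> ennreal (cD * 2 ^ ?n * (2 ^ (i + 2) * t k) ^ ?n)"
    proof (rule ennreal_leI)
      \<comment> \<open>Packing is known for sides that are multiples of \<open>r\<close>;
        expressing them through \<open>t k >= r / 2\<close> costs the factor
        \<open>2 ^ n\<close>.\<close>
      have "(2 ^ (i + 2) * r) ^ ?n \<le> (2 * (2 ^ (i + 2) * t k)) ^ ?n"
        using tk r by (intro power_mono) auto
      then have "cD * (2 ^ (i + 2) * r) ^ ?n \<le> cD * (2 * (2 ^ (i + 2) * t k)) ^ ?n"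
        using cD by (intro mult_left_mono) auto
      then show "cD * (2 ^ (i + 2) * r) ^ ?n \<le> cD * 2 ^ ?n * (2 ^ (i + 2) * t k) ^ ?n"
        unfolding power_mult_distrib[of 2 "2 ^ (i + 2) * t k"] by (simp only: mult.assoc)
    qed
    finally show "(\<integral>\<^sup>+z\<in>ccube x (2 ^ (i + 1) * t k). h z \<partial>lborel)
      \<le> ennreal (cD * 2 ^ ?n * (2 ^ (i + 2) * t k) ^ ?n)" .
  qed
  have far: "(\<integral>\<^sup>+x\<in>R. ennreal (2 powr q) * (\<integral>\<^sup>+y. ennreal (wts q (t k) (x - y)) * h y \<partial>lborel) \<partial>lborel)
     \<le> ennreal (2 powr q * (cD * 2 ^ ?n * W) * r ^ ?n)"
  proof -
    have "(\<integral>\<^sup>+x\<in>R. ennreal (2 powr q) * (\<integral>\<^sup>+y. ennreal (wts q (t k) (x - y)) * h y \<partial>lborel) \<partial>lborel)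
      \<le> (\<integral>\<^sup>+x\<in>R. ennreal (2 powr q) * ennreal (cD * 2 ^ ?n * W) \<partial>lborel)"
      by (intro nn_integral_mono mult_right_mono mult_left_mono farx) auto
    also have "\<dots> = ennreal (2 powr q) * ennreal (cD * 2 ^ ?n * W) * ennreal (r ^ ?n)"
      using r by (simp add: nn_integral_cmult_indicator R_def emeasure_cube)
    also have "\<dots> = ennreal (2 powr q * (cD * 2 ^ ?n * W) * r ^ ?n)"
      using cD W r by (simp add: ennreal_mult')
    finally show ?thesis .
  qed
  have "(\<Sum>j\<in>{k..<N}. \<integral>\<^sup>+x\<in>R. BB \<tau> j x \<partial>lborel)
     \<le> (\<Sum>j\<in>{k..<N}. \<integral>\<^sup>+x. ((\<integral>\<^sup>+y. (ennreal (DD \<tau> j y) * indicator R' y) * ennreal (wts q (t j) (x - y)) \<partial>lborel)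
       + (\<integral>\<^sup>+y. ennreal (2 powr q) * (ennreal (wts q (t k) (x - y)) * ennreal (DD \<tau> j y)) \<partial>lborel) * indicator R x) \<partial>lborel)"
  proof (intro sum_mono nn_integral_mono)
    fix j x assume j: "j \<in> {k..<N}"
    show "BB \<tau> j x * indicator R x \<le> (\<integral>\<^sup>+y. (ennreal (DD \<tau> j y) * indicator R' y) * ennreal (wts q (t j) (x - y)) \<partial>lborel)
       + (\<integral>\<^sup>+y. ennreal (2 powr q) * (ennreal (wts q (t k) (x - y)) * ennreal (DD \<tau> j y)) \<partial>lborel) * indicator R x"
    proof (cases "x \<in> R")
      case True
      have "BB \<tau> j x \<le> (\<integral>\<^sup>+y. ((ennreal (DD \<tau> j y) * indicator R' y) * ennreal (wts q (t j) (x - y)))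
          + ennreal (2 powr q) * (ennreal (wts q (t k) (x - y)) * ennreal (DD \<tau> j y)) \<partial>lborel)"
        unfolding BB_def t_def[symmetric]
      proof (intro nn_integral_mono)
        fix y
        show "ennreal (DD \<tau> j y) * ennreal (wts q (t j) (x - y))
          \<le> ((ennreal (DD \<tau> j y) * indicator R' y) * ennreal (wts q (t j) (x - y)))
          + ennreal (2 powr q) * (ennreal (wts q (t k) (x - y)) * ennreal (DD \<tau> j y))"
        proof (cases "y \<in> R'")
          case False
          have "t k \<le> norm (x - y)"
            using far_from_cube[OF r, of x v y] True False tk by (simp add: R_def R'_def)
          then have "wts q (t j) (x - y) \<le> 2 powr q * wts q (t k) (x - y)"
            using j q by (intro wts_scale t tmono) auto
          then have "ennreal (wts q (t j) (x - y)) \<le> ennreal (2 powr q) * ennreal (wts q (t k) (x - y))"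
            by (subst ennreal_mult'[symmetric]) (auto intro: ennreal_leI)
          from mult_left_mono[OF this, of "ennreal (DD \<tau> j y)"] show ?thesis
            using False by (simp add: mult_ac)
        qed simp
      qed
      also have "\<dots> = (\<integral>\<^sup>+y. (ennreal (DD \<tau> j y) * indicator R' y) * ennreal (wts q (t j) (x - y)) \<partial>lborel)
       + (\<integral>\<^sup>+y. ennreal (2 powr q) * (ennreal (wts q (t k) (x - y)) * ennreal (DD \<tau> j y)) \<partial>lborel)"
        by (rule nn_integral_add) measurable
      finally show ?thesis using True by simp
    qed simp
  qed
  also have "\<dots> = (\<Sum>j\<in>{k..<N}. (\<integral>\<^sup>+x. (\<integral>\<^sup>+y. (ennreal (DD \<tau> j y) * indicator R' y) * ennreal (wts q (t j) (x - y)) \<partial>lborel) \<partial>lborel)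
       + (\<integral>\<^sup>+x. (\<integral>\<^sup>+y. ennreal (2 powr q) * (ennreal (wts q (t k) (x - y)) * ennreal (DD \<tau> j y)) \<partial>lborel) * indicator R x \<partial>lborel))"
    by (intro sum.cong refl nn_integral_add) measurable
  also have "\<dots> = (\<Sum>j\<in>{k..<N}. (\<integral>\<^sup>+x. (\<integral>\<^sup>+y. (ennreal (DD \<tau> j y) * indicator R' y) * ennreal (wts q (t j) (x - y)) \<partial>lborel) \<partial>lborel))
       + (\<integral>\<^sup>+x\<in>R. ennreal (2 powr q) * (\<integral>\<^sup>+y. ennreal (wts q (t k) (x - y)) * h y \<partial>lborel) \<partial>lborel)"
  proof -
    have "(\<Sum>j\<in>{k..<N}. (\<integral>\<^sup>+x. (\<integral>\<^sup>+y. ennreal (2 powr q) * (ennreal (wts q (t k) (x - y)) * ennreal (DD \<tau> j y)) \<partial>lborel) * indicator R x \<partial>lborel))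
      = (\<integral>\<^sup>+x. (\<Sum>j\<in>{k..<N}. (\<integral>\<^sup>+y. ennreal (2 powr q) * (ennreal (wts q (t k) (x - y)) * ennreal (DD \<tau> j y)) \<partial>lborel) * indicator R x) \<partial>lborel)"
      by (rule nn_integral_sum[symmetric]) measurable
    also have "\<dots> = (\<integral>\<^sup>+x\<in>R. ennreal (2 powr q) * (\<integral>\<^sup>+y. ennreal (wts q (t k) (x - y)) * h y \<partial>lborel) \<partial>lborel)"
    proof (intro nn_integral_cong)
      fix x
      have "(\<integral>\<^sup>+y. ennreal (wts q (t k) (x - y)) * h y \<partial>lborel)
        = (\<Sum>j\<in>{k..<N}. \<integral>\<^sup>+y. ennreal (wts q (t k) (x - y)) * ennreal (DD \<tau> j y) \<partial>lborel)"
        unfolding h_def sum_distrib_left by (rule nn_integral_sum) measurable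
      then show "(\<Sum>j\<in>{k..<N}. (\<integral>\<^sup>+y. ennreal (2 powr q) * (ennreal (wts q (t k) (x - y)) * ennreal (DD \<tau> j y)) \<partial>lborel) * indicator R x)
        = ennreal (2 powr q) * (\<integral>\<^sup>+y. ennreal (wts q (t k) (x - y)) * h y \<partial>lborel) * indicator R x"
        by (simp add: nn_integral_cmult sum_distrib_left sum_distrib_right)
    qed
    finally show ?thesis by (simp only: sum.distrib)
  qed
  also have "\<dots> \<le> ennreal (cD * W * (4 * r) ^ ?n) + ennreal (2 powr q * (cD * 2 ^ ?n * W) * r ^ ?n)"
    by (intro add_mono near far)
  also have "\<dots> = ennreal (bb_const ?n c M q * r ^ ?n)"
    using cD W r
    by (subst ennreal_plus[symmetric]) (auto simp: bb_const_def cD_def W_def power_mult_distrib algebra_simps)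
  finally show ?thesis by (simp add: R_def r_def)
qed

lemma carleson_Br:
  "(\<integral>\<^sup>+x\<in>cube v (el / 2 ^ k). ennreal (\<Sum>j\<in>{k..<N}. Br j x) \<partial>lborel)
    \<le> ennreal (bb_const CARD('n) c M q * (el / 2 ^ k) ^ CARD('n))"
proof -
  let ?R = "cube v (el / 2 ^ k)"
  let ?w = "\<lambda>\<tau>. ennreal (1 / \<tau>) * indicator {el / 2<..el} \<tau>"
  have "(\<integral>\<^sup>+x\<in>?R. ennreal (\<Sum>j\<in>{k..<N}. Br j x) \<partial>lborel) = (\<Sum>j\<in>{k..<N}. \<integral>\<^sup>+x\<in>?R. BT j x \<partial>lborel)"
    by (subst sum_ennreal[symmetric], simp add: Br_nonneg,
        subst nn_integral_sum[symmetric]) (auto simp: ennreal_Br sum_distrib_right)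
  also have "\<dots> = (\<Sum>j\<in>{k..<N}. \<integral>\<^sup>+\<tau>. (\<integral>\<^sup>+x\<in>?R. BB \<tau> j x \<partial>lborel) * ?w \<tau> \<partial>lborel)"
  proof (intro sum.cong refl)
    fix j
    have "(\<integral>\<^sup>+x\<in>?R. BT j x \<partial>lborel) = (\<integral>\<^sup>+x. (\<integral>\<^sup>+\<tau>. (BB \<tau> j x * indicator ?R x) * ?w \<tau> \<partial>lborel) \<partial>lborel)"
      unfolding BT_def by (subst nn_integral_multc[symmetric]) (auto simp: mult_ac)
    also have "\<dots> = (\<integral>\<^sup>+\<tau>. (\<integral>\<^sup>+x. (BB \<tau> j x * indicator ?R x) * ?w \<tau> \<partial>lborel) \<partial>lborel)"
      by (rule lborel_pair.Fubini') measurable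
    also have "\<dots> = (\<integral>\<^sup>+\<tau>. (\<integral>\<^sup>+x\<in>?R. BB \<tau> j x \<partial>lborel) * ?w \<tau> \<partial>lborel)"
      by (intro nn_integral_cong nn_integral_multc) measurable
    finally show "(\<integral>\<^sup>+x\<in>?R. BT j x \<partial>lborel) = (\<integral>\<^sup>+\<tau>. (\<integral>\<^sup>+x\<in>?R. BB \<tau> j x \<partial>lborel) * ?w \<tau> \<partial>lborel)" .
  qed
  also have "\<dots> = (\<integral>\<^sup>+\<tau>. (\<Sum>j\<in>{k..<N}. \<integral>\<^sup>+x\<in>?R. BB \<tau> j x \<partial>lborel) * ?w \<tau> \<partial>lborel)"
    by (subst nn_integral_sum[symmetric]) (auto simp: sum_distrib_right)
  also have "\<dots> \<le> ennreal (bb_const CARD('n) c M q * (el / 2 ^ k) ^ CARD('n))"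
    using carleson_BB by (intro weighted_le) auto
  finally show ?thesis .
qed

lemma Br_tail:
  assumes "\<alpha> = 1 / (2 * (1 + 2 * real CARD('n)) powr q * (1 + bb_const CARD('n) c M q))"
  shows "emeasure lborel {x \<in> cube v el. \<exists>N. (\<Sum>j<N. Br j x) > s}
    \<le> ennreal ((1 + bb_const CARD('n) c M q) * exp (- \<alpha> * s) * el ^ CARD('n))"
\<comment> \<open>Every cube is admissible: unlike the dyadic quotients, \<open>Br\<close> is tied
  to no lattice and satisfies Harnack on all cubes of the right side.\<close>
proof (rule John_Nirenberg_tail[where I = "\<lambda>_ _. True" and B = Br
      and ?C0.0 = "(1 + 2 * real CARD('n)) powr q"])
  show "0 < (1 + 2 * real CARD('n)) powr q"
    by (simp add: add_pos_nonneg)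
  show "Br k x \<le> (1 + 2 * real CARD('n)) powr q * Br k y"
    if "x \<in> cube v (el / 2 ^ k)" "y \<in> cube v (el / 2 ^ k)" for k v x y
    by (rule Br_harnack[OF that])
qed (use el bb_const_nonneg Br_nonneg carleson_Br assms in auto)

end

section \<open>The square function of a kernel\<close>

lemma nn_integral_inverse_square:
  fixes a :: real
  assumes "a > 0"
  shows "(\<integral>\<^sup>+t. ennreal (a / t\<^sup>2) * indicator {a..} t \<partial>lborel) = 1"
proof -
  have "(\<integral>\<^sup>+t. ennreal (a / t\<^sup>2) * indicator {a..} t \<partial>lborel) = ennreal (0 - (- a / a))"
  proof (rule nn_integral_FTC_atLeast[where F = "\<lambda>t. - a / t" and T = 0])
    show "DERIV (\<lambda>t. - a / t) t :> a / t\<^sup>2" if "a \<le> t" for t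
      using that assms by (auto intro!: derivative_eq_intros simp: power2_eq_square)
    show "((\<lambda>t. - a / t) \<longlongrightarrow> 0) at_top"
      by (intro tendsto_divide_0[OF tendsto_const] filterlim_at_top_imp_at_infinity filterlim_ident)
  qed (use assms in auto)
  then show ?thesis using assms by simp
qed

lemma ennreal_le_suminf: "g j \<le> (\<Sum>j. g j)" for g :: "nat \<Rightarrow> ennreal"
  using sum_le_suminf[of g "{j}"] by simp

lemma dyadic_interval:
  fixes t el :: real
  assumes "0 < t" "t \<le> el"
  shows "\<exists>j. t \<in> {el / 2 ^ Suc j<..el / 2 ^ j}"
proof -
  obtain m where m: "el / t < 2 ^ m" using real_arch_pow[of 2 "el / t"] by auto
  define l where "l = (LEAST m. el / t < 2 ^ m)"
  have l: "el / t < 2 ^ l" unfolding l_def by (rule LeastI[of "\<lambda>m. el / t < 2 ^ m", OF m])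
  have "l \<noteq> 0" using l assms by (intro notI) (simp add: divide_less_eq)
  then obtain k where k: "l = Suc k" by (cases l) auto
  have "\<not> el / t < 2 ^ k" using not_less_Least[of k "\<lambda>m. el / t < 2 ^ m"] k by (simp add: l_def)
  then have "t \<le> el / 2 ^ k" "el / 2 ^ Suc k < t"
    using l assms unfolding k by (simp_all add: field_simps)
  then show ?thesis by (intro exI[of _ k]) simp
qed

section \<open>The square function as an integral over scales\<close>

context lp_kernel
begin

definition gfun :: "real \<Rightarrow> (real^'n \<Rightarrow> real) \<Rightarrow> real^'n \<Rightarrow> real \<Rightarrow> ennreal" where
  "gfun p f x t = (\<integral>\<^sup>+y. ennreal ((KC (dl t) f y)\<^sup>2 * (t / (t + norm (x - y))) powr p / t ^ (CARD('n) + 1)) \<partial>lborel)"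

definition gint :: "real \<Rightarrow> (real^'n \<Rightarrow> real) \<Rightarrow> real^'n \<Rightarrow> ennreal" where
  "gint p f x = (\<integral>\<^sup>+t. gfun p f x t * indicator {0<..} t \<partial>lborel)"

lemma gfun_measurable [measurable]:
  assumes [measurable]: "f \<in> borel_measurable borel" "x \<in> borel_measurable N" "t \<in> borel_measurable N"
  shows "(\<lambda>w. gfun p f (x w) (t w)) \<in> borel_measurable N"
  unfolding gfun_def by measurable

lemma gint_measurable [measurable]:
  assumes [measurable]: "f \<in> borel_measurable borel"
  shows "gint p f \<in> borel_measurable borel"
  unfolding gint_def[abs_def] by measurable

lemma quotient_weight:
  fixes w :: "real^'n"
  assumes "t > 0"
  shows "(t / (t + norm w)) powr p = (1 + norm w / t) powr (- p)"
proof -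
  have "t / (t + norm w) = 1 / (1 + norm w / t)"
    using assms by (simp add: field_simps add_pos_nonneg)
  then show ?thesis using assms by (simp add: powr_divide powr_minus_divide add_pos_nonneg)
qed

text \<open>Of the denominator t^(n + 1), the factor t^n normalizes the weight and the remaining 1 /
  t belongs to the measure dt / t.\<close>

lemma gfun_eq:
  assumes "t > 0"
  shows "gfun p f x t = (\<integral>\<^sup>+y. ennreal ((KC (dl t) f y)\<^sup>2 / t * wts p t (x - y)) \<partial>lborel)"
  unfolding gfun_def quotient_weight[OF assms] using assms
  by (intro nn_integral_cong) (simp add: wts_eq mult_ac)

lemma KC_dl_sup:
  assumes f: "bint f" and t: "t > 0"
  shows "\<bar>KC (dl t) f y\<bar> \<le> c / t ^ CARD('n) * (LINT z|lborel. \<bar>f z\<bar>)"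
proof -
  have "\<bar>KC (dl t) f y\<bar> \<le> (LINT z|lborel. \<bar>dl t (y - z) * f z\<bar>)"
    unfolding KC_def by (rule integral_abs_bound)
  also have "\<dots> \<le> (LINT z|lborel. c / t ^ CARD('n) * \<bar>f z\<bar>)"
  proof (rule integral_mono)
    show "integrable lborel (\<lambda>z. \<bar>dl t (y - z) * f z\<bar>)"
      by (intro bint_integrable bint_abs KC_integrand dl_bint t f)
    show "integrable lborel (\<lambda>z. c / t ^ CARD('n) * \<bar>f z\<bar>)"
      by (intro integrable_mult_right bint_integrable bint_abs f)
    fix z
    have "c * wts (real CARD('n) + 2) t (y - z) \<le> c * (1 / t ^ CARD('n))"
      using c t by (intro mult_left_mono wts_le) auto
    then have "\<bar>dl t (y - z)\<bar> \<le> c / t ^ CARD('n)" using dl_le[OF t, of "y - z"] by simp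
    then show "\<bar>dl t (y - z) * f z\<bar> \<le> c / t ^ CARD('n) * \<bar>f z\<bar>"
      unfolding abs_mult by (rule mult_right_mono) simp
  qed
  finally show ?thesis by simp
qed

end

context lp_tail
begin

text \<open>The comparison with the maximal function: \<open>A\<close> bounds the averages of |f|
  over cubes centred at \<open>x\<close>, and a sum over shells then controls the weighted averages
  of all scales.\<close>

lemma AA_le:
  assumes \<tau>: "\<tau> > 0" and A: "A \<ge> 0"
    and near: "\<And>R. R > 0 \<Longrightarrow> (\<integral>\<^sup>+z\<in>ccube x R. ennreal \<bar>f z\<bar> \<partial>lborel) \<le> ennreal (A * (2 * R) ^ CARD('n))"
  shows "AA \<tau> j x \<le> A * Wc CARD('n) M"
proof -
  have "sm M f s x \<le> A * Wc CARD('n) M" if s: "s > 0" for s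
  proof -
    have "ennreal (sm M f s x) = (\<integral>\<^sup>+z. ennreal (wts M s (x - z) * \<bar>f z\<bar>) \<partial>lborel)"
      unfolding sm_def KC_def
      using sm_integrand[OF f s M(1), of x] s
      by (intro nn_integral_eq_integral[symmetric]) (auto simp: wts_nonneg)
    also have "\<dots> = (\<integral>\<^sup>+z. ennreal (wts M s (x - z)) * ennreal \<bar>f z\<bar> \<partial>lborel)"
      using s by (simp add: ennreal_mult' wts_nonneg)
    also have "\<dots> \<le> ennreal (A * Wc CARD('n) M)"
    proof (rule nn_integral_wts_le[OF _ s M(1) A])
      fix k
      have e: "2 * (2 ^ (k + 1) * s) = 2 ^ (k + 2) * s" by simp
      have "0 < 2 ^ (k + 1) * s" using s by simp
      from near[OF this]
      show "(\<integral>\<^sup>+z\<in>ccube x (2 ^ (k + 1) * s). ennreal \<bar>f z\<bar> \<partial>lborel) \<le> ennreal (A * (2 ^ (k + 2) * s) ^ CARD('n))"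
        unfolding e .
    qed measurable
    finally show ?thesis using A Wc_pos[OF M(1)] by (subst (asm) ennreal_le_iff) auto
  qed
  then show ?thesis unfolding AA_def using \<tau> by (subst Max_le_iff) auto
qed

text \<open>\<open>KC_sq_eq\<close> restores the square as \<open>AA\<close> squared times
  \<open>DD\<close>. Harnack moves \<open>AA\<close> from \<open>y\<close> to \<open>x\<close> at
  the price of the exponent 2 M, and the weight keeps at least \<open>q\<close>.\<close>

lemma gfun_small:
  assumes \<tau>: "\<tau> > 0" and A: "A \<ge> 0"
    and near: "\<And>R. R > 0 \<Longrightarrow> (\<integral>\<^sup>+z\<in>ccube x R. ennreal \<bar>f z\<bar> \<partial>lborel) \<le> ennreal (A * (2 * R) ^ CARD('n))"
    and p: "p \<ge> q + 2 * M"
  shows "gfun p f x (\<tau> / 2 ^ j) \<le> ennreal ((A * Wc CARD('n) M)\<^sup>2 / (\<tau> / 2 ^ j)) * BB \<tau> j x"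
proof -
  define t where "t = \<tau> / 2 ^ j"
  have t: "t > 0" using \<tau> by (simp add: t_def)
  define A' where "A' = A * Wc CARD('n) M"
  have A': "A' \<ge> 0" using A Wc_pos[OF M(1)] by (simp add: A'_def)
  have "gfun p f x t \<le> (\<integral>\<^sup>+y. ennreal (A'\<^sup>2 / t) * (ennreal (DD \<tau> j y) * ennreal (wts q t (x - y))) \<partial>lborel)"
    unfolding gfun_eq[OF t]
  proof (intro nn_integral_mono)
    fix y
    let ?a = "1 + norm (x - y) / t"
    have a: "?a \<ge> 1" using t by simp
    have "AA \<tau> j y \<le> ?a powr M * AA \<tau> j x" using AA_harnack[OF \<tau>, of j y x] by (simp add: t_def)
    also have "\<dots> \<le> ?a powr M * A'" unfolding A'_def by (intro mult_left_mono AA_le \<tau> A near) auto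
    finally have "(AA \<tau> j y)\<^sup>2 \<le> (?a powr M * A')\<^sup>2" using AA_nonneg[OF \<tau>] by (intro power_mono) auto
    also have "\<dots> = ?a powr (2 * M) * A'\<^sup>2"
      by (simp add: power_mult_distrib power2_eq_square powr_add[symmetric])
    finally have AA2: "(AA \<tau> j y)\<^sup>2 \<le> ?a powr (2 * M) * A'\<^sup>2" .
    have "(KC (dl t) f y)\<^sup>2 / t * wts p t (x - y) = (AA \<tau> j y)\<^sup>2 * (DD \<tau> j y / t * wts p t (x - y))"
      using KC_sq_eq[OF \<tau>, of j y] by (simp add: t_def)
    also have "\<dots> \<le> (?a powr (2 * M) * A'\<^sup>2) * (DD \<tau> j y / t * wts p t (x - y))"
      using DD_nonneg t by (intro mult_right_mono AA2 mult_nonneg_nonneg divide_nonneg_pos wts_nonneg) auto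
    also have "\<dots> = A'\<^sup>2 / t * DD \<tau> j y * (?a powr (2 * M) * wts p t (x - y))" by simp
    also have "\<dots> \<le> A'\<^sup>2 / t * DD \<tau> j y * wts q t (x - y)"
    proof (rule mult_left_mono)
      have "?a powr (2 * M) * wts p t (x - y) = ?a powr (2 * M - p) / t ^ CARD('n)"
        using t a by (simp add: wts_eq powr_add[symmetric])
      also have "\<dots> \<le> ?a powr (- q) / t ^ CARD('n)"
        using p a t by (intro divide_right_mono powr_mono) auto
      finally show "?a powr (2 * M) * wts p t (x - y) \<le> wts q t (x - y)" using t by (simp add: wts_eq)
    qed (use DD_nonneg t in \<open>auto intro!: mult_nonneg_nonneg divide_nonneg_pos\<close>)
    finally have "ennreal ((KC (dl t) f y)\<^sup>2 / t * wts p t (x - y)) \<le> ennreal (A'\<^sup>2 / t * (DD \<tau> j y * wts q t (x - y)))"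
      by (intro ennreal_leI) (simp add: mult.assoc)
    also have "\<dots> = ennreal (A'\<^sup>2 / t) * (ennreal (DD \<tau> j y) * ennreal (wts q t (x - y)))"
      using t by (simp add: ennreal_mult'[OF DD_nonneg, symmetric] ennreal_mult'[of "A'\<^sup>2 / t", symmetric])
    finally show "ennreal ((KC (dl t) f y)\<^sup>2 / t * wts p t (x - y))
      \<le> ennreal (A'\<^sup>2 / t) * (ennreal (DD \<tau> j y) * ennreal (wts q t (x - y)))" .
  qed
  also have "\<dots> = ennreal (A'\<^sup>2 / t) * BB \<tau> j x"
    unfolding BB_def t_def by (rule nn_integral_cmult) measurable
  finally show ?thesis by (simp add: t_def A'_def)
qed

text \<open>Scales up to \<open>el\<close> are cut into dyadic blocks, each of which becomes
  \<open>BT j x\<close>. Beyond \<open>el\<close> the whole mass of \<open>f\<close> is seen at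
  once: the convolution is at most c A (el / t)^n, and the integral over t converges.\<close>

lemma gint_le:
  assumes A: "A \<ge> 0"
    and near: "\<And>R. R > 0 \<Longrightarrow> (\<integral>\<^sup>+z\<in>ccube x R. ennreal \<bar>f z\<bar> \<partial>lborel) \<le> ennreal (A * (2 * R) ^ CARD('n))"
    and L1: "(LINT z|lborel. \<bar>f z\<bar>) \<le> A * el ^ CARD('n)"
    and p: "p \<ge> q + 2 * M"
  shows "gint p f x \<le> ennreal (c\<^sup>2 * Wc CARD('n) p * A\<^sup>2) + ennreal ((Wc CARD('n) M)\<^sup>2 * A\<^sup>2) * (\<Sum>j. BT j x)"
proof -
  let ?n = "CARD('n)"
  define A' where "A' = A * Wc ?n M"
  have pn: "p > real ?n" using p q M0 by linarith
  have "gint p f x \<le> (\<integral>\<^sup>+t. (\<Sum>j. gfun p f x t * indicator {el / 2 ^ Suc j<..el / 2 ^ j} t)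
       + gfun p f x t * indicator {el<..} t \<partial>lborel)"
    unfolding gint_def
  proof (intro nn_integral_mono)
    fix t :: real
    consider "t \<le> 0" | "0 < t" "t \<le> el" | "t > el" by linarith
    then show "gfun p f x t * indicator {0<..} t \<le> (\<Sum>j. gfun p f x t * indicator {el / 2 ^ Suc j<..el / 2 ^ j} t)
       + gfun p f x t * indicator {el<..} t"
    proof cases
      case 2
      then obtain j where j: "t \<in> {el / 2 ^ Suc j<..el / 2 ^ j}" using dyadic_interval by blast
      have "gfun p f x t = gfun p f x t * indicator {el / 2 ^ Suc j<..el / 2 ^ j} t"
        by (simp only: indicator_simps(1)[OF j] mult_1_right)
      also have "\<dots> \<le> (\<Sum>j. gfun p f x t * indicator {el / 2 ^ Suc j<..el / 2 ^ j} t)"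
        by (rule ennreal_le_suminf)
      finally have "gfun p f x t \<le> (\<Sum>j. gfun p f x t * indicator {el / 2 ^ Suc j<..el / 2 ^ j} t)" .
      then show ?thesis using 2 by (simp add: add_increasing2)
    next
      case 3
      then show ?thesis using el by (simp add: add_increasing)
    qed simp
  qed
  also have "\<dots> = (\<Sum>j. \<integral>\<^sup>+t. gfun p f x t * indicator {el / 2 ^ Suc j<..el / 2 ^ j} t \<partial>lborel)
       + (\<integral>\<^sup>+t. gfun p f x t * indicator {el<..} t \<partial>lborel)"
  proof -
    have "(\<integral>\<^sup>+t. (\<Sum>j. gfun p f x t * indicator {el / 2 ^ Suc j<..el / 2 ^ j} t) \<partial>lborel)
      = (\<Sum>j. \<integral>\<^sup>+t. gfun p f x t * indicator {el / 2 ^ Suc j<..el / 2 ^ j} t \<partial>lborel)"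
      by (rule nn_integral_suminf) measurable
    then show ?thesis by (subst nn_integral_add) auto
  qed
  also have "\<dots> \<le> (\<Sum>j. ennreal (A'\<^sup>2) * BT j x) + ennreal (c\<^sup>2 * Wc ?n p * A\<^sup>2)"
  proof (intro add_mono suminf_le summableI)
    fix j
    have "(\<integral>\<^sup>+t. gfun p f x t * indicator {el / 2 ^ Suc j<..el / 2 ^ j} t \<partial>lborel)
      = ennreal (1 / 2 ^ j) * (\<integral>\<^sup>+\<tau>. gfun p f x (\<tau> / 2 ^ j) * indicator {el / 2<..el} \<tau> \<partial>lborel)"
    proof -
      have "(\<integral>\<^sup>+t. gfun p f x t * indicator {el / 2 ^ Suc j<..el / 2 ^ j} t \<partial>lborel)
        = ennreal (\<bar>1 / 2 ^ j\<bar> ^ DIM(real)) * (\<integral>\<^sup>+\<tau>. gfun p f x (0 + (1 / 2 ^ j) *\<^sub>R \<tau>) *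
            indicator {el / 2 ^ Suc j<..el / 2 ^ j} (0 + (1 / 2 ^ j) *\<^sub>R \<tau>) \<partial>lborel)"
        by (rule nn_integral_affine) auto
      moreover have "indicator {el / 2 ^ Suc j<..el / 2 ^ j} (0 + (1 / 2 ^ j) *\<^sub>R \<tau>) = (indicator {el / 2<..el} \<tau> :: ennreal)" for \<tau>
        by (auto simp: indicator_def field_simps)
      ultimately show ?thesis by simp
    qed
    also have "\<dots> = (\<integral>\<^sup>+\<tau>. ennreal (1 / 2 ^ j) * (gfun p f x (\<tau> / 2 ^ j) * indicator {el / 2<..el} \<tau>) \<partial>lborel)"
      by (rule nn_integral_cmult[symmetric]) measurable
    also have "\<dots> \<le> (\<integral>\<^sup>+\<tau>. ennreal (A'\<^sup>2) * (BB \<tau> j x * (ennreal (1 / \<tau>) * indicator {el / 2<..el} \<tau>)) \<partial>lborel)"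
    proof (intro nn_integral_mono)
      fix \<tau> :: real
      show "ennreal (1 / 2 ^ j) * (gfun p f x (\<tau> / 2 ^ j) * indicator {el / 2<..el} \<tau>)
        \<le> ennreal (A'\<^sup>2) * (BB \<tau> j x * (ennreal (1 / \<tau>) * indicator {el / 2<..el} \<tau>))"
      proof (cases "\<tau> \<in> {el / 2<..el}")
        case True
        then have \<tau>: "\<tau> > 0" using el by simp
        have "ennreal (1 / 2 ^ j) * gfun p f x (\<tau> / 2 ^ j)
          \<le> ennreal (1 / 2 ^ j) * (ennreal (A'\<^sup>2 / (\<tau> / 2 ^ j)) * BB \<tau> j x)"
          unfolding A'_def by (intro mult_left_mono gfun_small \<tau> A near p) auto
        also have "\<dots> = ennreal (A'\<^sup>2 * (1 / \<tau>)) * BB \<tau> j x"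
          unfolding mult.assoc[symmetric] by (subst ennreal_mult'[symmetric]) auto
        also have "\<dots> = ennreal (A'\<^sup>2) * (BB \<tau> j x * ennreal (1 / \<tau>))"
          by (subst ennreal_mult') (auto simp: mult_ac)
        finally show ?thesis using True by simp
      qed simp
    qed
    also have "\<dots> = ennreal (A'\<^sup>2) * BT j x" unfolding BT_def by (rule nn_integral_cmult) measurable
    finally show "(\<integral>\<^sup>+t. gfun p f x t * indicator {el / 2 ^ Suc j<..el / 2 ^ j} t \<partial>lborel) \<le> ennreal (A'\<^sup>2) * BT j x" .
  next
    let ?K = "c\<^sup>2 * Wc ?n p * A\<^sup>2"
    have "(\<integral>\<^sup>+t. gfun p f x t * indicator {el<..} t \<partial>lborel)
      \<le> (\<integral>\<^sup>+t. ennreal ?K * (ennreal (el / t\<^sup>2) * indicator {el..} t) \<partial>lborel)"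
    proof (intro nn_integral_mono)
      fix t :: real
      show "gfun p f x t * indicator {el<..} t \<le> ennreal ?K * (ennreal (el / t\<^sup>2) * indicator {el..} t)"
      proof (cases "t > el")
        case True
        then have t: "t > 0" using el by linarith
        define B where "B = c * A * (el / t) ^ ?n"
        have B0: "B \<ge> 0" using c A el t by (simp add: B_def)
        have "\<bar>KC (dl t) f y\<bar> \<le> B" for y
        proof -
          have "\<bar>KC (dl t) f y\<bar> \<le> c / t ^ ?n * (LINT z|lborel. \<bar>f z\<bar>)" by (rule KC_dl_sup[OF f t])
          also have "\<dots> \<le> c / t ^ ?n * (A * el ^ ?n)" using c t by (intro mult_left_mono L1) auto
          finally show ?thesis by (simp add: B_def power_divide)
        qed
        then have KB: "(KC (dl t) f y)\<^sup>2 \<le> B\<^sup>2" for y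
          using B0 by (metis abs_le_square_iff abs_of_nonneg)
        have "gfun p f x t \<le> (\<integral>\<^sup>+y. ennreal (B\<^sup>2 / t) * ennreal (wts p t (x - y)) \<partial>lborel)"
          unfolding gfun_eq[OF t] using t
          by (intro nn_integral_mono)
             (auto simp: ennreal_mult'[symmetric] simp del: times_divide_eq_left
               intro!: ennreal_leI mult_right_mono divide_right_mono KB wts_nonneg)
        also have "\<dots> = ennreal (B\<^sup>2 / t) * (\<integral>\<^sup>+y. ennreal (wts p t (x - y)) \<partial>lborel)"
          by (rule nn_integral_cmult) measurable
        also have "\<dots> \<le> ennreal (B\<^sup>2 / t) * ennreal (Wc ?n p)"
          by (intro mult_left_mono nn_integral_wts t pn) auto
        also have "\<dots> = ennreal (B\<^sup>2 / t * Wc ?n p)" using t by (intro ennreal_mult'[symmetric]) auto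
        also have "\<dots> \<le> ennreal (?K * (el / t\<^sup>2))"
        proof (rule ennreal_leI)
          have lt1: "el / t \<le> 1" "el / t \<ge> 0" using True el t by auto
          \<comment> \<open>As n >= 1 and el / t <= 1, the decay is at least that of el / t, which
            together with 1 / t gives the integrable el / t^2.\<close>
          have "((el / t) ^ ?n)\<^sup>2 = (el / t) ^ (2 * ?n)" by (simp add: power_mult[symmetric] mult.commute)
          also have "\<dots> \<le> (el / t) ^ 1"
            using lt1 zero_less_card_finite[where 'a='n] by (intro power_decreasing) auto
          finally have "((el / t) ^ ?n)\<^sup>2 \<le> el / t" by simp
          then have "(c\<^sup>2 * A\<^sup>2 * Wc ?n p / t) * ((el / t) ^ ?n)\<^sup>2 \<le> (c\<^sup>2 * A\<^sup>2 * Wc ?n p / t) * (el / t)"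
            using t Wc_pos[OF pn] by (intro mult_left_mono) auto
          then show "B\<^sup>2 / t * Wc ?n p \<le> ?K * (el / t\<^sup>2)"
            unfolding B_def by (simp add: power_mult_distrib power2_eq_square mult_ac)
        qed
        also have "\<dots> = ennreal ?K * ennreal (el / t\<^sup>2)"
          using Wc_pos[OF pn] by (intro ennreal_mult') auto
        finally show ?thesis using True by simp
      qed simp
    qed
    also have "\<dots> = ennreal ?K * (\<integral>\<^sup>+t. ennreal (el / t\<^sup>2) * indicator {el..} t \<partial>lborel)"
      by (rule nn_integral_cmult) measurable
    also have "\<dots> = ennreal ?K" using el by (simp add: nn_integral_inverse_square)
    finally show "(\<integral>\<^sup>+t. gfun p f x t * indicator {el<..} t \<partial>lborel) \<le> ennreal ?K" .
  qed
  also have "\<dots> = ennreal (c\<^sup>2 * Wc ?n p * A\<^sup>2) + ennreal ((Wc ?n M)\<^sup>2 * A\<^sup>2) * (\<Sum>j. BT j x)"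
    by (simp add: A'_def power_mult_distrib mult.commute add.commute)
  finally show ?thesis .
qed

end

text \<open>\<open>A\<close> ranges over all numbers that dominate the averages of |f| at
  \<open>x\<close> and its mean at the top scale; M f x will be one of them. The exceptional set
  \<open>E\<close> is chosen before \<open>x\<close> and \<open>A\<close>, so it serves them
  all.\<close>

definition tail_bound :: "((real^'n \<Rightarrow> real) \<Rightarrow> real^'n \<Rightarrow> ennreal) \<Rightarrow> real \<Rightarrow> real \<Rightarrow> bool" where
  "tail_bound T \<alpha> C \<longleftrightarrow> (\<forall>el>0. \<forall>v f s. bint f \<longrightarrow> (\<exists>E \<in> sets borel.
    emeasure lborel E \<le> ennreal (C * exp (- \<alpha> * s) * el ^ CARD('n)) \<and>
    (\<forall>x\<in>cube v el. \<forall>A\<ge>0. (\<forall>R>0. (\<integral>\<^sup>+z\<in>ccube x R. ennreal \<bar>f z\<bar> \<partial>lborel) \<le> ennreal (A * (2 * R) ^ CARD('n))) \<longrightarrow>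
       (LINT z|lborel. \<bar>f z\<bar>) \<le> A * el ^ CARD('n) \<longrightarrow> T f x > ennreal (s * A\<^sup>2) \<longrightarrow> x \<in> E)))"

text \<open>The weight exponents \<open>M > n\<close> (for the averages) and \<open>q = p - 2 M > n\<close> (left over after changing
  the base point of the averages) can be chosen together exactly because \<open>p > 3 n\<close>.\<close>

lemma (in lp_kernel) kernel_tail:
  fixes p :: real
  assumes p: "p > 3 * real CARD('n)"
  shows "\<exists>\<alpha>>0. \<exists>C>0. tail_bound (gint p) \<alpha> C"
proof -
  let ?n = "CARD('n)"
  \<comment> \<open>A quarter of the slack in \<open>p > 3 n\<close>: it is used twice, so
    \<open>q - n = p - 3 n - 2 e\<close> stays positive. The cap 1 ensures
    \<open>M <= n + 1\<close>.\<close>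
  define e where "e = min 1 ((p - 3 * real ?n) / 4)"
  define M where "M = real ?n + e"
  define q where "q = p - 2 * M"
  have e: "e > 0" using p by (simp add: e_def)
  have e1: "e \<le> 1" unfolding e_def by (rule min.cobounded1)
  have e2: "e \<le> (p - 3 * real ?n) / 4" unfolding e_def by (rule min.cobounded2)
  have M: "M > real ?n" "M \<le> real ?n + 1" using e e1 by (auto simp: M_def)
  have q: "q > real ?n" 
  proof -
    have "a < b - 2 * (a + d)" if "d \<le> (b - 3 * a) / 4" "b > 3 * a" for a b d :: real
      using that by (simp add: field_simps)
    from this[OF e2 p] show ?thesis by (simp add: q_def M_def)
  qed
  define C1 where "C1 = c\<^sup>2 * Wc ?n p"
  define C2 where "C2 = (Wc ?n M)\<^sup>2"
  have pn: "p > real ?n" using p by linarith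
  have C1: "C1 > 0" using c Wc_pos[OF pn] by (simp add: C1_def)
  have C2: "C2 > 0" using Wc_pos[OF M(1)] by (simp add: C2_def)
  define bb where "bb = bb_const ?n c M q"
  have bb: "bb \<ge> 0"
  proof -
    \<comment> \<open>The constants depend neither on \<open>f\<close> nor on \<open>el\<close>, so
      the zero function at side 1 suffices to read off their sign.\<close>
    have "lp_tail \<psi> c (\<lambda>x. 0) M 1 q" by unfold_locales (use M q bint_zero in auto)
    then show ?thesis unfolding bb_def by (rule lp_tail.bb_const_nonneg)
  qed
  define \<alpha> where "\<alpha> = 1 / (2 * (1 + 2 * real ?n) powr q * (1 + bb))"
  have \<alpha>: "\<alpha> > 0" unfolding \<alpha>_def using bb by (auto intro!: divide_pos_pos mult_pos_pos simp: add_pos_nonneg)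
  show ?thesis unfolding tail_bound_def
  proof (rule exI[of _ "\<alpha> / C2"], rule conjI[rotated], rule exI[of _ "(1 + bb) * exp (\<alpha> * C1 / C2)"],
      intro conjI allI impI)
    show "\<alpha> / C2 > 0" using \<alpha> C2 by simp
    show "(1 + bb) * exp (\<alpha> * C1 / C2) > 0" using bb by simp
    fix el :: real and v :: "real^'n" and f :: "real^'n \<Rightarrow> real" and s :: real
    assume el: "0 < el" and f: "bint f"
    interpret lp_tail \<psi> c f M el q by unfold_locales (use f M q el in auto)
    \<comment> \<open>The threshold for the Carleson sum that corresponds to \<open>s\<close> in
      \<open>gint_le\<close>. The shift by \<open>C1\<close> is absorbed into the factor
      \<open>exp (\<alpha> * C1 / C2)\<close>.\<close>
    define s' where "s' = (s - C1) / C2"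
    have s: "s = C1 + C2 * s'" using C2 by (simp add: s'_def)
    have ex: "(1 + bb) * exp (\<alpha> * C1 / C2) * exp (- (\<alpha> / C2) * s) = (1 + bb) * exp (- \<alpha> * s')"
      unfolding s'_def by (simp add: exp_add[symmetric] mult.assoc diff_divide_distrib algebra_simps)
    show "\<exists>E \<in> sets borel. 
      emeasure lborel E \<le> ennreal ((1 + bb) * exp (\<alpha> * C1 / C2) * exp (- (\<alpha> / C2) * s) * el ^ CARD('n)) \<and>
      (\<forall>x\<in>cube v el. \<forall>A\<ge>0. (\<forall>R>0. (\<integral>\<^sup>+z\<in>ccube x R. ennreal \<bar>f z\<bar> \<partial>lborel) \<le> ennreal (A * (2 * R) ^ CARD('n))) \<longrightarrow>
       (LINT z|lborel. \<bar>f z\<bar>) \<le> A * el ^ CARD('n) \<longrightarrow> gint p f x > ennreal (s * A\<^sup>2) \<longrightarrow> x \<in> E)"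
    proof (cases "s' < 0")
      case True
      \<comment> \<open>For negative \<open>s'\<close> the claimed bound exceeds the volume, so the
        entire cube may serve as exceptional set.\<close>
      have "1 * 1 \<le> (1 + bb) * exp (- \<alpha> * s')"
        using bb \<alpha> True by (intro mult_mono) (auto simp: mult_le_0_iff)
      then have "1 * el ^ CARD('n) \<le> ((1 + bb) * exp (- \<alpha> * s')) * el ^ CARD('n)"
        using el by (intro mult_right_mono) auto
      then show ?thesis unfolding ex using el
        by (intro bexI[of _ "cube v el"]) (auto simp: emeasure_cube ennreal_leI)
    next
      case False
      define E where "E = {x \<in> cube v el. \<exists>N. (\<Sum>j<N. Br j x) > s'}"
      have "E = cube v el \<inter> {x \<in> space borel. \<exists>N. (\<Sum>j<N. Br j x) > s'}" by (auto simp: E_def)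
      also have "\<dots> \<in> sets borel" by measurable
      finally have E: "E \<in> sets borel" .
      have Em: "emeasure lborel E \<le> ennreal ((1 + bb) * exp (- \<alpha> * s') * el ^ CARD('n))"
        unfolding E_def bb_def by (rule Br_tail) (simp add: \<alpha>_def bb_def)
      have "x \<in> E" if x: "x \<in> cube v el" and A: "A \<ge> 0"
        and near: "\<forall>R>0. (\<integral>\<^sup>+z\<in>ccube x R. ennreal \<bar>f z\<bar> \<partial>lborel) \<le> ennreal (A * (2 * R) ^ CARD('n))"
        and L1: "(LINT z|lborel. \<bar>f z\<bar>) \<le> A * el ^ CARD('n)"
        and big: "gint p f x > ennreal (s * A\<^sup>2)" for x A
      proof (rule ccontr)
        assume "x \<notin> E"
        then have le: "(\<Sum>j<N. Br j x) \<le> s'" for N using x by (auto simp: E_def not_less)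
        have "(\<Sum>j. BT j x) \<le> ennreal s'"
        proof (rule suminf_le_const[OF summableI])
          fix N
          have "(\<Sum>j<N. BT j x) = ennreal (\<Sum>j<N. Br j x)"
            by (subst sum_ennreal[symmetric]) (auto simp: Br_nonneg ennreal_Br)
          then show "(\<Sum>j<N. BT j x) \<le> ennreal s'" using le[of N] by (simp add: ennreal_leI)
        qed
        then have "ennreal (C1 * A\<^sup>2) + ennreal (C2 * A\<^sup>2) * (\<Sum>j. BT j x)
          \<le> ennreal (C1 * A\<^sup>2) + ennreal (C2 * A\<^sup>2) * ennreal s'"
          by (intro add_left_mono mult_left_mono) auto
        also have "\<dots> = ennreal (s * A\<^sup>2)"
          using C1 C2 False by (simp add: s ennreal_mult'[symmetric] ennreal_plus[symmetric] algebra_simps del: ennreal_plus)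
        finally have "gint p f x \<le> ennreal (s * A\<^sup>2)"
          using gint_le[OF A _ L1, of x p] near by (simp add: q_def C1_def C2_def)
        then show False using big by simp
      qed
      then show ?thesis unfolding ex using E Em by blast
    qed
  qed
qed

section \<open>Schwartz functions as kernels\<close>

lemma one_plus_power_le: "x \<ge> 0 \<Longrightarrow> (1 + x :: real) ^ m \<le> 2 ^ m * (1 + x ^ m)"
proof -
  assume x: "x \<ge> 0"
  have "(1 + x) ^ m \<le> (2 * max 1 x) ^ m" using x by (intro power_mono) auto
  also have "\<dots> = 2 ^ m * (max 1 x) ^ m" by (rule power_mult_distrib)
  also have "(max 1 x) ^ m \<le> 1 + x ^ m" using x by (auto simp: max_def)
  finally show ?thesis by simp
qed

text \<open>The constant monomial and the pure powers of single coordinates suffice, since the norm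
  is at most n times the largest coordinate.\<close>

lemma schwartz_decay:
  fixes \<phi> :: "real^'n \<Rightarrow> complex"
  assumes "schwartz \<phi>"
  shows "\<exists>C\<ge>0. \<forall>u. cmod (iter_partial is \<phi> u) \<le> C * wt (real m) u"
proof -
  let ?F = "iter_partial is \<phi>"
  have bd: "\<exists>B. \<forall>x. norm ((\<Prod>i\<in>UNIV. (x $ i) ^ \<beta> i) *\<^sub>R ?F x) \<le> B" for \<beta> :: "'n \<Rightarrow> nat"
  proof -
    have "bounded (range (\<lambda>x. (\<Prod>i\<in>UNIV. (x $ i) ^ \<beta> i) *\<^sub>R ?F x))"
      using assms unfolding schwartz_def by blast
    then show ?thesis unfolding bounded_iff by auto
  qed
  obtain B0 where B0: "\<And>x. cmod (?F x) \<le> B0" using bd[of "\<lambda>_. 0"] by auto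
  have "\<exists>B. \<forall>x. \<bar>x $ i\<bar> ^ m * cmod (?F x) \<le> B" for i
  proof -
    have "(\<Prod>j\<in>UNIV. (x $ j) ^ (if j = i then m else 0)) = (x $ i) ^ m" for x :: "real^'n"
    proof -
      have "(\<Prod>j\<in>UNIV. (x $ j) ^ (if j = i then m else 0)) = (\<Prod>j\<in>UNIV. if j = i then (x $ i) ^ m else 1)"
        by (intro prod.cong) auto
      then show ?thesis by simp
    qed
    then show ?thesis using bd[of "\<lambda>j. if j = i then m else 0"] by (simp add: power_abs)
  qed
  then obtain B where B: "\<And>i x. \<bar>x $ i\<bar> ^ m * cmod (?F x) \<le> B i" by metis
  let ?C = "2 ^ m * (B0 + real CARD('n) ^ m * (\<Sum>i\<in>UNIV. B i))"
  have Bp: "B i \<ge> 0" for i by (rule order_trans[OF _ B[of 0 i]]) simp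
  have B0p: "B0 \<ge> 0" by (rule order_trans[OF _ B0[of 0]]) simp
  have "cmod (?F u) \<le> ?C * wt (real m) u" for u
  proof -
    have nu: "norm u ^ m \<le> real CARD('n) ^ m * (\<Sum>i\<in>UNIV. \<bar>u $ i\<bar> ^ m)"
    proof -
      define M where "M = Max (range (\<lambda>i. \<bar>u $ i\<bar>))"
      have "M \<in> range (\<lambda>i. \<bar>u $ i\<bar>)" unfolding M_def by (intro Max_in) auto
      then obtain i where i: "M = \<bar>u $ i\<bar>" by auto
      have "norm u \<le> (\<Sum>j\<in>UNIV. \<bar>u $ j\<bar>)" by (rule norm_le_l1_cart)
      also have "\<dots> \<le> (\<Sum>j\<in>(UNIV::'n set). M)" unfolding M_def by (intro sum_mono Max_ge) auto
      finally have "norm u \<le> real CARD('n) * M" by simp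
      then have "norm u ^ m \<le> (real CARD('n) * M) ^ m" by (intro power_mono) auto
      also have "\<dots> = real CARD('n) ^ m * \<bar>u $ i\<bar> ^ m" unfolding i by (rule power_mult_distrib)
      also have "\<dots> \<le> real CARD('n) ^ m * (\<Sum>i\<in>UNIV. \<bar>u $ i\<bar> ^ m)"
        by (intro mult_left_mono member_le_sum) auto
      finally show ?thesis .
    qed
    have "(1 + norm u) ^ m * cmod (?F u) \<le> (2 ^ m * (1 + norm u ^ m)) * cmod (?F u)"
      by (intro mult_right_mono one_plus_power_le) auto
    also have "\<dots> \<le> (2 ^ m * (1 + real CARD('n) ^ m * (\<Sum>i\<in>UNIV. \<bar>u $ i\<bar> ^ m))) * cmod (?F u)"
      by (intro mult_right_mono mult_left_mono add_left_mono nu) auto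
    also have "\<dots> = 2 ^ m * (cmod (?F u) + real CARD('n) ^ m * (\<Sum>i\<in>UNIV. \<bar>u $ i\<bar> ^ m * cmod (?F u)))"
      by (simp add: distrib_left distrib_right sum_distrib_right mult.assoc)
    also have "\<dots> \<le> ?C"
      by (intro mult_left_mono add_mono B0 sum_mono B) auto
    finally have "(1 + norm u) ^ m * cmod (?F u) \<le> ?C" .
    then have "cmod (?F u) \<le> ?C / (1 + norm u) ^ m"
      by (subst pos_le_divide_eq) (auto simp: mult.commute add_pos_nonneg)
    also have "\<dots> = ?C * wt (real m) u"
      by (simp add: wt_def powr_minus_divide powr_realpow add_pos_nonneg)
    finally show ?thesis .
  qed
  moreover have "?C \<ge> 0" using Bp B0p by (intro mult_nonneg_nonneg add_nonneg_nonneg sum_nonneg) auto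
  ultimately show ?thesis by blast
qed

lemma schwartz_has_derivative:
  assumes "schwartz \<phi>"
  shows "(\<phi> has_derivative frechet_derivative \<phi> (at x)) (at x)"
proof -
  have "iter_partial [] \<phi> differentiable_on UNIV" using assms unfolding schwartz_def by blast
  then show ?thesis by (simp add: differentiable_on_def frechet_derivative_works)
qed

lemma schwartz_onorm:
  fixes \<phi> :: "real^'n \<Rightarrow> complex"
  assumes "schwartz \<phi>"
  shows "\<exists>C\<ge>0. \<forall>u. onorm (frechet_derivative \<phi> (at u)) \<le> C * wt (real m) u"
proof -
  have "\<forall>i. \<exists>C\<ge>0. \<forall>u. cmod (iter_partial [i] \<phi> u) \<le> C * wt (real m) u"
    using schwartz_decay[OF assms] by blast
  then obtain C where C: "\<And>i. C i \<ge> 0" "\<And>i u. cmod (iter_partial [i] \<phi> u) \<le> C i * wt (real m) u" by metis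
  have "onorm (frechet_derivative \<phi> (at u)) \<le> (\<Sum>i\<in>UNIV. C i) * wt (real m) u" for u
  proof (rule onorm_le)
    fix h :: "real^'n"
    let ?D = "frechet_derivative \<phi> (at u)"
    have lin: "linear ?D"
      using schwartz_has_derivative[OF assms, of u] has_derivative_linear by blast
    have h: "h = (\<Sum>i\<in>UNIV. h $ i *\<^sub>R axis i 1)"
      using basis_expansion[of h] by (simp add: scalar_mult_eq_scaleR)
    have "?D h = (\<Sum>i\<in>UNIV. h $ i *\<^sub>R ?D (axis i 1))"
      by (subst h) (simp only: linear_sum[OF lin] linear_scale[OF lin])
    then have "norm (?D h) \<le> (\<Sum>i\<in>UNIV. norm (h $ i *\<^sub>R ?D (axis i 1)))"
      by (simp only: norm_sum)
    also have "\<dots> \<le> (\<Sum>i\<in>UNIV. norm h * (C i * wt (real m) u))"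
    proof (rule sum_mono)
      fix i
      have "cmod (?D (axis i 1)) \<le> C i * wt (real m) u" using C(2)[of i u] by simp
      then show "norm (h $ i *\<^sub>R ?D (axis i 1)) \<le> norm h * (C i * wt (real m) u)"
        using component_le_norm_cart[of h i] by (simp add: mult_mono)
    qed
    also have "\<dots> = (\<Sum>i\<in>UNIV. C i) * wt (real m) u * norm h"
      by (simp add: sum_distrib_left sum_distrib_right mult_ac)
    finally show "norm (?D h) \<le> (\<Sum>i\<in>UNIV. C i) * wt (real m) u * norm h" .
  qed
  moreover have "(\<Sum>i\<in>UNIV. C i) \<ge> 0" using C(1) by (intro sum_nonneg) auto
  ultimately show ?thesis by blast
qed

lemma wts_one: "wts p 1 u = wt p u" by (simp add: wts_def)

text \<open>For points at distance at most 1 the mean value inequality applies along the segment, on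
  which the weight is comparable to its value at \<open>u\<close>. For other points
  \<open>norm (u - v)\<close> exceeds 1 and the decay of both values is enough.\<close>

lemma schwartz_lipschitz:
  fixes \<phi> :: "real^'n \<Rightarrow> complex"
  assumes "schwartz \<phi>"
  shows "\<exists>C\<ge>0. \<forall>u v. cmod (\<phi> u - \<phi> v) \<le> C * norm (u - v) * (wt (real m) u + wt (real m) v)"
proof -
  obtain C where C: "C \<ge> 0" "\<And>u. cmod (\<phi> u) \<le> C * wt (real m) u"
    using schwartz_decay[OF assms, of "[]" m] by auto
  obtain D where D: "D \<ge> 0" "\<And>u. onorm (frechet_derivative \<phi> (at u)) \<le> D * wt (real m) u"
    using schwartz_onorm[OF assms, of m] by blast
  define K where "K = C + D * 2 powr (real m)"
  have K: "K \<ge> 0" "C \<le> K" "D * 2 powr (real m) \<le> K" using C D by (simp_all add: K_def)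
  have "cmod (\<phi> u - \<phi> v) \<le> K * norm (u - v) * (wt (real m) u + wt (real m) v)" for u v
  proof (cases "norm (u - v) \<le> 1")
    case True
    have "norm (\<phi> u - \<phi> v) \<le> (D * 2 powr (real m) * wt (real m) u) * norm (u - v)"
    proof (rule differentiable_bound[where S = "closed_segment u v"])
      show "convex (closed_segment u v)" by simp
      show "u \<in> closed_segment u v" "v \<in> closed_segment u v" by auto
      fix x assume x: "x \<in> closed_segment u v"
      show "(\<phi> has_derivative frechet_derivative \<phi> (at x)) (at x within closed_segment u v)"
        by (rule has_derivative_at_withinI[OF schwartz_has_derivative[OF assms]])
      have "norm (x - u) \<le> norm (u - v)"
        using segment_bound1[OF x] by (simp add: norm_minus_commute)
      then have nx: "norm (x - u) \<le> 1" using True by linarith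
      have "wt (real m) x \<le> (1 + norm (x - u)) powr (real m) * wt (real m) u"
        using wts_harnack[of 1 "real m" x u] by (simp add: wts_one)
      also have "\<dots> \<le> 2 powr (real m) * wt (real m) u"
        using nx by (intro mult_right_mono powr_mono2) (auto simp: wt_nonneg)
      finally have "D * wt (real m) x \<le> D * (2 powr (real m) * wt (real m) u)"
        by (rule mult_left_mono) (rule D)
      with D(2)[of x] show "onorm (frechet_derivative \<phi> (at x)) \<le> D * 2 powr (real m) * wt (real m) u"
        by (simp only: mult.assoc)
    qed
    also have "\<dots> \<le> (K * (wt (real m) u + wt (real m) v)) * norm (u - v)"
      using K by (intro mult_right_mono mult_mono) (auto simp: wt_nonneg)
    finally show ?thesis by (simp add: mult_ac)
  next
    case False
    have "cmod (\<phi> u - \<phi> v) \<le> cmod (\<phi> u) + cmod (\<phi> v)" by (rule norm_triangle_ineq4)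
    also have "\<dots> \<le> C * (wt (real m) u + wt (real m) v)"
      using C(2)[of u] C(2)[of v] by (simp add: distrib_left)
    also have "\<dots> \<le> (K * norm (u - v)) * (wt (real m) u + wt (real m) v)"
    proof (rule mult_right_mono)
      have "K * 1 \<le> K * norm (u - v)" using K(1) False by (intro mult_left_mono) auto
      then show "C \<le> K * norm (u - v)" using K(2) by simp
    qed (simp add: wt_nonneg)
    finally show ?thesis .
  qed
  then show ?thesis using K(1) by blast
qed

lemma schwartz_continuous: "schwartz \<phi> \<Longrightarrow> continuous_on UNIV \<phi>"
  using schwartz_has_derivative by (meson has_derivative_continuous continuous_at_imp_continuous_on)

lemma schwartz_borel: "schwartz \<phi> \<Longrightarrow> \<phi> \<in> borel_measurable borel"
  by (intro borel_measurable_continuous_onI schwartz_continuous)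

lemma schwartz_integrable:
  fixes \<phi> :: "real^'n \<Rightarrow> complex"
  assumes "schwartz \<phi>" shows "integrable lborel \<phi>"
proof -
  obtain C where C: "C \<ge> 0" "\<And>u. cmod (\<phi> u) \<le> C * wt (real (CARD('n) + 1)) u"
    using schwartz_decay[OF assms, of "[]" "CARD('n) + 1"] by auto
  have "integrable lborel (\<lambda>u :: real^'n. C * wts (real (CARD('n) + 1)) 1 u)"
    by (intro integrable_mult_right bint_integrable wts_bint) auto
  then show ?thesis
  proof (rule Bochner_Integration.integrable_bound)
    show "AE u in lborel. norm (\<phi> u) \<le> norm (C * wts (real (CARD('n) + 1)) 1 u)"
      using C by (auto simp: wts_one wt_nonneg)
  qed (use schwartz_borel[OF assms] in simp)
qed

lemma schwartz_lp_kernel: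
  fixes \<phi> :: "real^'n \<Rightarrow> complex"
  assumes "schwartz \<phi>" "(LINT x|lebesgue. \<phi> x) = 0"
  shows "\<exists>c. lp_kernel (\<lambda>u. Re (\<phi> u)) c \<and> lp_kernel (\<lambda>u. Im (\<phi> u)) c"
proof -
  have rn: "real CARD('n) + 2 = real (CARD('n) + 2)" by simp
  obtain C where C: "C \<ge> 0" "\<And>u. cmod (\<phi> u) \<le> C * wt (real CARD('n) + 2) u"
    using schwartz_decay[OF assms(1), of "[]" "CARD('n) + 2"] unfolding rn by auto
  obtain D where D: "D \<ge> 0" "\<And>u v. cmod (\<phi> u - \<phi> v) \<le> D * norm (u - v) * (wt (real CARD('n) + 2) u + wt (real CARD('n) + 2) v)"
    using schwartz_lipschitz[OF assms(1), of "CARD('n) + 2"] unfolding rn by blast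
  \<comment> \<open>One constant for decay and smoothness of both parts; the summand 1 makes it
    strictly positive.\<close>
  define c where "c = C + D + 1"
  have c: "c > 0" "C \<le> c" "D \<le> c" using C D by (auto simp: c_def)
  have dec: "cmod (\<phi> u) \<le> c * wt (real CARD('n) + 2) u" for u
    by (rule order_trans[OF C(2) mult_right_mono[OF c(2) wt_nonneg]])
  have lip: "cmod (\<phi> u - \<phi> v) \<le> c * norm (u - v) * (wt (real CARD('n) + 2) u + wt (real CARD('n) + 2) v)" for u v
    by (rule order_trans[OF D(2)], intro mult_right_mono c) (auto simp: wt_nonneg)
  have [measurable]: "\<phi> \<in> borel_measurable borel" by (rule schwartz_borel[OF assms(1)])
  have i: "integrable lborel \<phi>" by (rule schwartz_integrable[OF assms(1)])
  have z: "(LINT x|lborel. \<phi> x) = 0"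
    using assms(2) by (simp add: integral_completion)
  have re: "(LINT x|lborel. Re (\<phi> x)) = 0" "(LINT x|lborel. Im (\<phi> x)) = 0"
    using integral_Re[OF i] integral_Im[OF i] z by simp_all
  have "lp_kernel (\<lambda>u. Re (\<phi> u)) c"
  proof
    show "\<bar>Re (\<phi> u)\<bar> \<le> c * wt (real CARD('n) + 2) u" for u
      by (rule order_trans[OF abs_Re_le_cmod dec])
    show "\<bar>Re (\<phi> u) - Re (\<phi> v)\<bar> \<le> c * norm (u - v) * (wt (real CARD('n) + 2) u + wt (real CARD('n) + 2) v)" for u v
      using order_trans[OF abs_Re_le_cmod lip[of u v]] by simp
  qed (use c re in auto)
  moreover have "lp_kernel (\<lambda>u. Im (\<phi> u)) c"
  proof
    show "\<bar>Im (\<phi> u)\<bar> \<le> c * wt (real CARD('n) + 2) u" for u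
      by (rule order_trans[OF abs_Im_le_cmod dec])
    show "\<bar>Im (\<phi> u) - Im (\<phi> v)\<bar> \<le> c * norm (u - v) * (wt (real CARD('n) + 2) u + wt (real CARD('n) + 2) v)" for u v
      using order_trans[OF abs_Im_le_cmod lip[of u v]] by simp
  qed (use c re in auto)
  ultimately show ?thesis by blast
qed

section \<open>Dyadic cubes\<close>

abbreviation (input) dsc :: "int \<Rightarrow> real" where "dsc k \<equiv> 2 powi k"

text \<open>Dyadic cubes are indexed by a scale and one of their points, so that the parent is
  reached by raising the scale with the point kept.\<close>

definition dycube :: "int \<Rightarrow> real^'n \<Rightarrow> (real^'n) set" where
  "dycube k x = cube (dcorner (dsc k) x) (dsc k)"

lemma dsc_pos: "dsc k > 0" by simp

lemma dsc_Suc: "dsc (k + 1) = 2 * dsc k" by (simp add: power_int_add)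

lemma dycube_sets [measurable]: "dycube k x \<in> sets borel" by (simp add: dycube_def)

lemma dyadic_cubes_eq: "dyadic_cubes = (\<Union>k. range (dycube k :: real^'n \<Rightarrow> _))"
proof (intro equalityI subsetI)
  fix P :: "(real^'n) set" assume "P \<in> dyadic_cubes"
  then obtain k and m :: "'n \<Rightarrow> int" where
    P: "P = {x. \<forall>i. dsc k * of_int (m i) \<le> x $ i \<and> x $ i < dsc k * (of_int (m i) + 1)}"
    unfolding dyadic_cubes_def by blast
  have "dcorner (dsc k) (\<chi> i. dsc k * of_int (m i)) = (\<chi> i. dsc k * of_int (m i))"
    by (simp add: dcorner_def)
  then have "P = dycube k (\<chi> i. dsc k * of_int (m i))"
    unfolding P dycube_def cube_def by (simp add: algebra_simps)
  then show "P \<in> (\<Union>k. range (dycube k))" by blast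
next
  fix P :: "(real^'n) set" assume "P \<in> (\<Union>k. range (dycube k))"
  then obtain k x where "P = dycube k x" by blast
  then have "P = {y. \<forall>i. dsc k * of_int \<lfloor>x $ i / dsc k\<rfloor> \<le> y $ i \<and> y $ i < dsc k * (of_int \<lfloor>x $ i / dsc k\<rfloor> + 1)}"
    unfolding dycube_def cube_def by (simp add: dcorner_def algebra_simps)
  then show "P \<in> dyadic_cubes"
    unfolding dyadic_cubes_def by (intro CollectI exI[of _ k] exI[of _ "\<lambda>i. \<lfloor>x $ i / dsc k\<rfloor>"] conjI TrueI)
qed

lemma mem_dycube: "y \<in> dycube k x \<longleftrightarrow> dcorner (dsc k) y = dcorner (dsc k) x"
  unfolding dycube_def by (rule mem_cube_dcorner[OF dsc_pos])

lemma self_mem_dycube: "x \<in> dycube k x" by (simp add: mem_dycube)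

lemma dycube_eq: "y \<in> dycube k x \<Longrightarrow> dycube k x = dycube k y"
  by (simp only: mem_dycube) (simp only: dycube_def)

lemma measure_dycube: "measure lebesgue (dycube k (x :: real^'n)) = dsc k ^ CARD('n)"
  unfolding dycube_def by (simp add: measure_completion measure_cube)

lemma dycube_mono: "dycube k x \<subseteq> dycube (k + 1) x"
proof
  fix y assume "y \<in> dycube k x"
  then have "dcorner (dsc (k + 1) / 2) y = dcorner (dsc (k + 1) / 2) x" by (simp add: mem_dycube dsc_Suc)
  then show "y \<in> dycube (k + 1) x" unfolding mem_dycube by (rule dcorner_half[OF dsc_pos])
qed

text \<open>Uniqueness for \<open>THE\<close>: the volume determines the scale because powers of 2
  are injective, and a dyadic cube of given scale is determined by any of its points.\<close>

lemma dyadic_parent_dycube: "dyadic_parent (dycube k (x :: real^'n)) = dycube (k + 1) x"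
  unfolding dyadic_parent_def
proof (rule the_equality)
  show "dycube (k + 1) x \<in> dyadic_cubes \<and> dycube k x \<subseteq> dycube (k + 1) x \<and>
    measure lebesgue (dycube (k + 1) x) = 2 ^ CARD('n) * measure lebesgue (dycube k x)"
    using dycube_mono[of k x] by (auto simp: dyadic_cubes_eq measure_dycube dsc_Suc power_mult_distrib)
next
  fix P' :: "(real^'n) set"
  assume P': "P' \<in> dyadic_cubes \<and> dycube k x \<subseteq> P' \<and>
     measure lebesgue P' = 2 ^ CARD('n) * measure lebesgue (dycube k x)"
  then obtain k' z where z: "P' = dycube k' z" by (auto simp: dyadic_cubes_eq)
  have "dsc k' ^ CARD('n) = dsc (k + 1) ^ CARD('n)"
    using P' unfolding z by (simp add: measure_dycube dsc_Suc power_mult_distrib)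
  then have "dsc k' = dsc (k + 1)" by (rule power_eq_imp_eq_base) auto
  then have "(2::real) powr of_int k' = 2 powr of_int (k + 1)" by (subst (1 2) powr_real_of_int') simp_all
  then have "k' = k + 1" by (subst (asm) powr_inj) auto
  moreover have "x \<in> P'" using P' self_mem_dycube by blast
  ultimately show "P' = dycube (k + 1) x" using dycube_eq z by blast
qed

lemma countable_dyadic_cubes: "countable (dyadic_cubes :: (real^'n) set set)"
proof -
  have eq: "dyadic_cubes = (\<lambda>(k, m). cube (\<chi> i. dsc k * of_int (m i)) (dsc k)) ` (UNIV :: (int \<times> ('n \<Rightarrow> int)) set)"
    unfolding dyadic_cubes_def cube_def by (auto simp: image_iff algebra_simps)
  have "countable (UNIV :: (int \<times> ('n \<Rightarrow> int)) set)" by simp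
  then show ?thesis unfolding eq by (rule countable_image)
qed

definition dsq :: "(real^'n \<Rightarrow> real) \<Rightarrow> real^'n \<Rightarrow> ennreal" where
  "dsq f x = (\<Sum>\<^sub>\<infinity>P\<in>dyadic_cubes. ennreal ((avg P f - avg (dyadic_parent P) f)\<^sup>2) * indicator P x)"

lemma dsq_SUP: "dsq f x = (SUP F \<in> {F. finite F \<and> F \<subseteq> dyadic_cubes}.
    (\<Sum>P\<in>F. ennreal ((avg P f - avg (dyadic_parent P) f)\<^sup>2) * indicator P x))"
  unfolding dsq_def by (rule nonneg_infsum_complete) simp

lemma dyadic_cubes_borel: "P \<in> dyadic_cubes \<Longrightarrow> P \<in> sets borel"
  by (auto simp: dyadic_cubes_eq)

text \<open>The supremum over finite partial sums is countable, because a countable set has only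
  countably many finite subsets.\<close>

lemma dsq_measurable [measurable]: "dsq f \<in> borel_measurable borel"
proof -
  have "countable {F. finite F \<and> F \<subseteq> (dyadic_cubes :: (real^'n) set set)}"
    using countable_Collect_finite_subset[OF countable_dyadic_cubes] by simp
  moreover have "(\<lambda>x. \<Sum>P\<in>F. ennreal ((avg P f - avg (dyadic_parent P) f)\<^sup>2) * indicator P x) \<in> borel_measurable borel"
    if "F \<subseteq> dyadic_cubes" for F
    using that dyadic_cubes_borel
    by (intro borel_measurable_sum borel_measurable_times_ennreal borel_measurable_indicator) auto
  ultimately have "(\<lambda>x. SUP F \<in> {F. finite F \<and> F \<subseteq> dyadic_cubes}.
    (\<Sum>P\<in>F. ennreal ((avg P f - avg (dyadic_parent P) f)\<^sup>2) * indicator P x)) \<in> borel_measurable borel"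
    by (rule borel_measurable_SUP) (simp only: mem_Collect_eq)
  then show ?thesis unfolding dsq_SUP[abs_def] .
qed

lemma avg_dycube:
  fixes f :: "real^'n \<Rightarrow> real"
  assumes [measurable]: "f \<in> borel_measurable borel"
  shows "avg (dycube k x) f = cube_avg f (dcorner (dsc k) x) (dsc k)"
  unfolding avg_def cube_avg_def measure_dycube
  by (simp add: dycube_def set_lebesgue_integral_def integral_completion)

lemma sum_quarter_powers_le:
  assumes "finite K" and "\<And>k. k \<in> K \<Longrightarrow> k \<ge> \<kappa>"
  shows "(\<Sum>k\<in>K. (1/4 :: real) ^ nat (k - \<kappa>)) \<le> 2"
proof -
  have inj: "inj_on (\<lambda>k. nat (k - \<kappa>)) K"
  proof (rule inj_onI)
    fix a b assume "a \<in> K" "b \<in> K" "nat (a - \<kappa>) = nat (b - \<kappa>)"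
    with assms(2)[of a] assms(2)[of b] show "a = b" by (simp add: eq_nat_nat_iff)
  qed
  obtain N where N: "(\<lambda>k. nat (k - \<kappa>)) ` K \<subseteq> {..<N}"
    using finite_nat_iff_bounded[of "(\<lambda>k. nat (k - \<kappa>)) ` K"] assms by auto
  have "(\<Sum>k\<in>K. (1/4 :: real) ^ nat (k - \<kappa>)) = (\<Sum>i\<in>(\<lambda>k. nat (k - \<kappa>)) ` K. (1/4) ^ i)"
    by (simp add: sum.reindex[OF inj])
  also have "\<dots> \<le> (\<Sum>i<N. (1/4) ^ i)" using N by (intro sum_mono2) auto
  also have "\<dots> \<le> 2" by (subst geometric_sum) (auto simp: field_simps)
  finally show ?thesis .
qed

lemma ex_dyadic_scale:
  fixes l :: real
  assumes "l > 0"
  shows "\<exists>\<kappa>. l \<le> dsc \<kappa> \<and> dsc \<kappa> \<le> 2 * l"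
proof -
  let ?k = "\<lceil>log 2 l\<rceil>"
  have e: "dsc ?k = 2 powr (of_int ?k)" by (simp add: powr_real_of_int')
  have "l = 2 powr (log 2 l)" using assms by simp
  also have "\<dots> \<le> 2 powr (of_int ?k)" by (intro powr_mono) auto
  finally have "l \<le> dsc ?k" using e by simp
  moreover have "2 powr (of_int ?k) \<le> 2 powr (log 2 l + 1)"
    by (intro powr_mono) (auto simp: less_imp_le)
  then have "dsc ?k \<le> 2 * l" using assms e by (simp add: powr_add)
  ultimately show ?thesis by blast
qed

text \<open>An exponential tail bound for \<open>T f\<close> on a cube, at the points where \<open>A\<close> dominates the averages
  of \<open>|f|\<close>; stating it with a covering set \<open>E\<close> leaves the measurability of the level sets of
  \<open>T f\<close> and of the maximal function aside.\<close>

definition cube_tail_bound :: "((real^'n \<Rightarrow> real) \<Rightarrow> real^'n \<Rightarrow> ennreal) \<Rightarrow> real \<Rightarrow> real \<Rightarrow> bool" where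
  "cube_tail_bound T \<alpha> C \<longleftrightarrow> (\<forall>l>0. \<forall>a :: real^'n. \<forall>f. \<forall>s. integrable lborel f \<longrightarrow> (\<exists>E\<in>sets borel.
     emeasure lborel E \<le> ennreal (C * exp (- \<alpha> * s) * l ^ CARD('n)) \<and>
     (\<forall>x\<in>cbox a (a + (\<chi> i. l)). \<forall>A\<ge>0.
        (\<forall>v r. r > 0 \<longrightarrow> x \<in> cube v r \<longrightarrow> (LINT z:cube v r|lborel. \<bar>f z\<bar>) \<le> A * r ^ CARD('n)) \<longrightarrow>
        (LINT z|lborel. \<bar>f z\<bar>) \<le> A * l ^ CARD('n) \<longrightarrow> T f x > ennreal (s * A\<^sup>2) \<longrightarrow> x \<in> E)))"

text \<open>A cube need not be dyadic; it is covered by 2^n dyadic cubes of side \<open>r0\<close>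
  between \<open>l\<close> and \<open>2 * l\<close>, and \<open>tail\<close> is applied on each. At
  coarser scales the average is at most A (l / 2^k)^n because the total mass of |f| is at most A
  l^n, so these scales contribute no more than 8 A^2.\<close>

lemma dyadic_tail:
  "\<exists>\<alpha>>0. \<exists>C>0. cube_tail_bound (dsq :: (real^'n \<Rightarrow> real) \<Rightarrow> _) \<alpha> C"
proof -
  let ?n = "CARD('n)"
  define c0 where "c0 = (1 + (2 ^ ?n + 6) :: real)"
  have c0: "c0 > 0" by (simp add: c0_def add_pos_pos)
  define \<alpha> where "\<alpha> = 1 / (2 * c0)"
  have \<alpha>: "\<alpha> > 0" using c0 by (simp add: \<alpha>_def)
  \<comment> \<open>The two factors \<open>2 ^ n\<close> count the covering cubes and come from
    \<open>r0 <= 2 * l\<close>; \<open>exp (8 * \<alpha>)\<close> compensates the shift from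
    \<open>s\<close> to \<open>s - 8\<close>.\<close>
  define C where "C = 2 ^ ?n * c0 * exp (8 * \<alpha>) * 2 ^ ?n"
  have C: "C > 0" using c0 by (simp add: C_def)
  have "\<exists>E\<in>sets borel.
     emeasure lborel E \<le> ennreal (C * exp (- \<alpha> * s) * l ^ ?n) \<and>
     (\<forall>x\<in>cbox a (a + (\<chi> i. l)). \<forall>A\<ge>0.
        (\<forall>v r. r > 0 \<longrightarrow> x \<in> cube v r \<longrightarrow> (LINT z:cube v r|lborel. \<bar>f z\<bar>) \<le> A * r ^ ?n) \<longrightarrow>
        (LINT z|lborel. \<bar>f z\<bar>) \<le> A * l ^ ?n \<longrightarrow> dsq f x > ennreal (s * A\<^sup>2) \<longrightarrow> x \<in> E)"
    if l: "l > 0" and f: "integrable lborel f" for l s :: real and a :: "real^'n" and f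
  proof -
    obtain \<kappa> where \<kappa>: "l \<le> dsc \<kappa>" "dsc \<kappa> \<le> 2 * l" using ex_dyadic_scale[OF l] by blast
    define r0 where "r0 = dsc \<kappa>"
    have r0: "r0 > 0" by (simp add: r0_def)
    interpret dyadic_tree f r0 by unfold_locales (use f r0 in auto)
    have scj: "sc j = dsc (\<kappa> - int j)" for j
      unfolding sc_def by (simp add: r0_def power_int_diff)
    define v0 where "v0 = dcorner r0 a"
    \<comment> \<open>The cube of side \<open>2 * r0\<close> at the lattice corner \<open>v0\<close>
      below \<open>a\<close> contains the given cube because \<open>l <= r0\<close>. Its children
      are lattice cubes of side \<open>r0\<close>.\<close>
    define ch where "ch t = child v0 (2 * r0) t" for t :: "'n set"
    \<comment> \<open>The 8 is reserved for the coarse scales. If \<open>s < 8\<close>, the empty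
      sum already exceeds \<open>s'\<close> and \<open>E\<close> is the whole cover.\<close>
    define s' where "s' = s - 8"
    define E where "E = (\<Union>t. {x \<in> cube (ch t) r0. \<exists>N. (\<Sum>j<N. B j x) > s'})"
    have Em: "{x \<in> cube (ch t) r0. \<exists>N. (\<Sum>j<N. B j x) > s'} \<in> sets borel" for t
    proof -
      have "{x \<in> cube (ch t) r0. \<exists>N. (\<Sum>j<N. B j x) > s'} = cube (ch t) r0 \<inter> {x \<in> space borel. \<exists>N. (\<Sum>j<N. B j x) > s'}"
        by auto
      also have "\<dots> \<in> sets borel" by measurable
      finally show ?thesis .
    qed
    have E: "E \<in> sets borel" unfolding E_def by (intro sets.finite_UN Em) auto
    have Ich: "I 0 (ch t)" for t
      unfolding I_def
    proof (intro exI[of _ "\<lambda>i. \<lfloor>a $ i / r0\<rfloor> + (if i \<in> t then 1 else 0)"])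
      show "ch t = (\<chi> i. sc 0 * of_int (\<lfloor>a $ i / r0\<rfloor> + (if i \<in> t then 1 else 0)))"
        by (auto simp: vec_eq_iff ch_def child_nth v0_def dcorner_def sc_def algebra_simps)
    qed
    have "emeasure lborel E \<le> (\<Sum>t\<in>(UNIV :: 'n set set). emeasure lborel {x \<in> cube (ch t) r0. \<exists>N. (\<Sum>j<N. B j x) > s'})"
      unfolding E_def by (intro emeasure_subadditive_finite) (use Em in auto)
    also have "\<dots> \<le> (\<Sum>t\<in>(UNIV :: 'n set set). ennreal (c0 * exp (- \<alpha> * s') * r0 ^ ?n))"
      using tail[OF Ich] by (intro sum_mono) (simp add: c0_def \<alpha>_def)
    also have "\<dots> = ennreal (2 ^ ?n * (c0 * exp (- \<alpha> * s') * r0 ^ ?n))"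
      using c0 r0 by (subst sum_ennreal) (auto simp: card_UNIV_subsets)
    also have "\<dots> \<le> ennreal (C * exp (- \<alpha> * s) * l ^ ?n)"
    proof (rule ennreal_leI)
      have "r0 ^ ?n \<le> (2 * l) ^ ?n" using \<kappa> r0 by (intro power_mono) (auto simp: r0_def)
      then have "2 ^ ?n * (c0 * exp (- \<alpha> * s') * r0 ^ ?n) \<le> 2 ^ ?n * (c0 * exp (- \<alpha> * s') * (2 * l) ^ ?n)"
        using c0 by (intro mult_left_mono) auto
      also have "\<dots> = C * exp (- \<alpha> * s) * l ^ ?n"
      proof -
        have "exp (- \<alpha> * s') = exp (8 * \<alpha>) * exp (- \<alpha> * s)"
          by (simp add: s'_def exp_add[symmetric] algebra_simps)
        then show ?thesis by (simp add: C_def power_mult_distrib mult_ac)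
      qed
      finally show "2 ^ ?n * (c0 * exp (- \<alpha> * s') * r0 ^ ?n) \<le> C * exp (- \<alpha> * s) * l ^ ?n" .
    qed
    finally have Ebd: "emeasure lborel E \<le> ennreal (C * exp (- \<alpha> * s) * l ^ ?n)" .
    have "x \<in> E" if x: "x \<in> cbox a (a + (\<chi> i. l))" and A: "A \<ge> 0"
      and near: "\<forall>v r. r > 0 \<longrightarrow> x \<in> cube v r \<longrightarrow> (LINT z:cube v r|lborel. \<bar>f z\<bar>) \<le> A * r ^ ?n"
      and L1: "(LINT z|lborel. \<bar>f z\<bar>) \<le> A * l ^ ?n" and big: "dsq f x > ennreal (s * A\<^sup>2)" for x A
    proof (rule ccontr)
      assume nE: "x \<notin> E"
      have "x \<in> cube v0 (2 * r0)"
        unfolding cube_def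
      proof (intro CollectI allI)
        fix i
        have xi: "a $ i \<le> x $ i" "x $ i \<le> a $ i + l" using x by (auto simp: mem_box_cart)
        have fl: "of_int \<lfloor>a $ i / r0\<rfloor> \<le> a $ i / r0" "a $ i / r0 < of_int \<lfloor>a $ i / r0\<rfloor> + 1" by linarith+
        have "v0 $ i \<le> a $ i" "a $ i < v0 $ i + r0"
          using mult_left_mono[OF fl(1), of r0] mult_strict_left_mono[OF fl(2) r0] r0
          by (simp_all add: v0_def dcorner_def distrib_left)
        then show "v0 $ i \<le> x $ i \<and> x $ i < v0 $ i + 2 * r0" using xi \<kappa> unfolding r0_def by linarith
      qed
      then obtain t where "x \<in> cube (ch t) r0" using cube_ex_child[of x v0 "2 * r0"] by (auto simp: ch_def)
      then have le: "(\<Sum>j<N. B j x) \<le> s'" for N using nE by (auto simp: E_def not_less)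
      have s'0: "s' \<ge> 0" using le[of 0] by simp
      define \<Phi> where "\<Phi> k = cube_avg f (dcorner (dsc k) x) (dsc k)" for k
      have e: "ennreal ((avg (dycube k x) f - avg (dyadic_parent (dycube k x)) f)\<^sup>2) = ennreal ((\<Phi> k - \<Phi> (k + 1))\<^sup>2)" for k
        by (simp add: dyadic_parent_dycube avg_dycube \<Phi>_def)
      have HA: "H j x \<le> A" for j
      proof -
        have "x \<in> cube (dcorner (sc j) x) (sc j)" by (simp add: mem_cube_dcorner sc_pos)
        then have "(LINT z:cube (dcorner (sc j) x) (sc j)|lborel. \<bar>f z\<bar>) \<le> A * sc j ^ ?n"
          using near sc_pos by blast
        then show ?thesis using sc_pos[of j] by (simp add: H_def cube_avg_def divide_le_eq)
      qed
      have AA: "dyadic_tree.A f r0 j x \<le> A" for j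
        unfolding A_def using HA by (subst Max_le_iff) auto
      have small: "(\<Phi> (\<kappa> - int j) - \<Phi> (\<kappa> - int j + 1))\<^sup>2 \<le> A\<^sup>2 * B j x" if j: "j \<ge> 1" for j
      proof -
        have kk: "\<kappa> - int (j - 1) = \<kappa> - int j + 1" using j by simp
        have F: "F j x = \<Phi> (\<kappa> - int j)" "F (j - 1) x = \<Phi> (\<kappa> - int j + 1)"
          by (simp_all only: F_def \<Phi>_def scj kk)
        show ?thesis
        proof (cases "dyadic_tree.A f r0 j x = 0")
          case True
          have "F j x = 0" "F (j - 1) x = 0"
            using F_le_H[of j x] H_le_A[of j j x] F_le_H[of "j - 1" x] H_le_A[of "j - 1" j x] True by simp_all
          then show ?thesis using A B_nonneg unfolding F by simp
        next
          case False
          then have "(F j x - F (j - 1) x)\<^sup>2 = (dyadic_tree.A f r0 j x)\<^sup>2 * B j x"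
            using j by (simp add: B_def)
          also have "\<dots> \<le> A\<^sup>2 * B j x"
            using AA A_nonneg B_nonneg by (intro mult_right_mono power_mono) auto
          finally show ?thesis unfolding F .
        qed
      qed
      have \<Phi>_le: "\<bar>\<Phi> k\<bar> \<le> A * (1/2) ^ nat (k - \<kappa>)" if k: "k \<ge> \<kappa>" for k
      proof -
        have "\<bar>\<Phi> k\<bar> \<le> cube_avg (\<lambda>x. \<bar>f x\<bar>) (dcorner (dsc k) x) (dsc k)"
          unfolding \<Phi>_def by (intro cube_avg_abs_le f) simp
        also have "\<dots> \<le> (1 / dsc k ^ ?n) * (LINT z|lborel. \<bar>f z\<bar>)"
          unfolding cube_avg_def set_lebesgue_integral_def
          using f by (intro mult_left_mono integral_mono integrable_mult_indicator integrable_abs) (auto simp: indicator_def)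
        also have "\<dots> \<le> (1 / dsc k ^ ?n) * (A * l ^ ?n)" by (intro mult_left_mono L1) auto
        also have "\<dots> = A * (l / dsc k) ^ ?n" by (simp add: power_divide)
        also have "\<dots> \<le> A * ((1/2) ^ nat (k - \<kappa>)) ^ ?n"
        proof (intro mult_left_mono power_mono A)
          have "dsc k = dsc \<kappa> * 2 ^ nat (k - \<kappa>)"
            using k power_int_add[of "2::real" \<kappa> "k - \<kappa>"] by (simp add: power_int_def[of _ "k - \<kappa>"])
          then have "l / dsc k \<le> dsc \<kappa> / (dsc \<kappa> * 2 ^ nat (k - \<kappa>))"
            using \<kappa>(1) by (simp only:) (intro divide_right_mono, auto)
          then show "l / dsc k \<le> (1/2) ^ nat (k - \<kappa>)" by (simp add: power_one_over)
        qed (use l in auto)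
        also have "\<dots> \<le> A * ((1/2) ^ nat (k - \<kappa>)) ^ 1"
          using A zero_less_card_finite[where 'a='n]
          by (intro mult_left_mono power_decreasing) (auto intro: power_le_one)
        finally show ?thesis by simp
      qed
      have large: "(\<Phi> k - \<Phi> (k + 1))\<^sup>2 \<le> 4 * A\<^sup>2 * (1/4) ^ nat (k - \<kappa>)" if k: "k \<ge> \<kappa>" for k
      proof -
        let ?h = "(1/2 :: real) ^ nat (k - \<kappa>)"
        have "(1/2 :: real) ^ nat (k + 1 - \<kappa>) \<le> ?h" using k by (intro power_decreasing) auto
        then have "A * (1/2) ^ nat (k + 1 - \<kappa>) \<le> A * ?h" using A by (intro mult_left_mono) auto
        then have "\<bar>\<Phi> k - \<Phi> (k + 1)\<bar> \<le> 2 * A * ?h"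
          using \<Phi>_le[OF k] \<Phi>_le[of "k + 1"] k by linarith
        then have "(\<Phi> k - \<Phi> (k + 1))\<^sup>2 \<le> (2 * A * ?h)\<^sup>2"
          by (metis abs_ge_zero order_trans power2_abs power_mono)
        also have "\<dots> = 4 * A\<^sup>2 * (?h * ?h)" by (simp add: power2_eq_square)
        also have "?h * ?h = (1/4) ^ nat (k - \<kappa>)" by (simp add: power_mult_distrib[symmetric])
        finally show ?thesis .
      qed
      have "dsq f x \<le> ennreal (s * A\<^sup>2)"
        unfolding dsq_SUP
      proof (rule SUP_least)
        fix \<F> :: "(real^'n) set set" assume "\<F> \<in> {F. finite F \<and> F \<subseteq> dyadic_cubes}"
        then have \<F>: "finite \<F>" "\<F> \<subseteq> dyadic_cubes" by auto
        let ?w = "\<lambda>P. ennreal ((avg P f - avg (dyadic_parent P) f)\<^sup>2)"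
        have sub: "{P\<in>\<F>. x \<in> P} \<subseteq> (\<lambda>k. dycube k x) ` UNIV"
        proof
          fix P assume "P \<in> {P\<in>\<F>. x \<in> P}"
          then obtain k z where "P = dycube k z" "x \<in> P" using \<F>(2) by (auto simp: dyadic_cubes_eq)
          then have "P = dycube k x" using dycube_eq by blast
          then show "P \<in> (\<lambda>k. dycube k x) ` UNIV" by (rule image_eqI) simp
        qed
        have fin: "finite {P\<in>\<F>. x \<in> P}" using \<F>(1) by simp
        obtain K :: "int set" where K: "finite K" "{P\<in>\<F>. x \<in> P} = (\<lambda>k. dycube k x) ` K"
          using finite_subset_image[OF fin sub] by blast
        have "(\<Sum>P\<in>\<F>. ?w P * indicator P x) = (\<Sum>P\<in>{P\<in>\<F>. x \<in> P}. ?w P)"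
          using \<F>(1) by (intro sum.mono_neutral_cong_right) auto
        also have "\<dots> \<le> (\<Sum>k\<in>K. ?w (dycube k x))"
          unfolding K(2) using sum_image_le[OF K(1), of ?w "\<lambda>k. dycube k x"] by (simp add: comp_def)
        also have "\<dots> = ennreal (\<Sum>k\<in>K. (\<Phi> k - \<Phi> (k + 1))\<^sup>2)"
          unfolding e by (intro sum_ennreal) simp
        also have "\<dots> \<le> ennreal (s * A\<^sup>2)"
        proof (rule ennreal_leI)
          have "(\<Sum>k\<in>K. (\<Phi> k - \<Phi> (k + 1))\<^sup>2) = (\<Sum>k\<in>K \<inter> {\<kappa>..}. (\<Phi> k - \<Phi> (k + 1))\<^sup>2) + (\<Sum>k\<in>K - {\<kappa>..}. (\<Phi> k - \<Phi> (k + 1))\<^sup>2)"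
            by (rule sum.Int_Diff[OF K(1)])
          also have "\<dots> \<le> 8 * A\<^sup>2 + A\<^sup>2 * s'"
          proof (rule add_mono)
            have "(\<Sum>k\<in>K \<inter> {\<kappa>..}. (\<Phi> k - \<Phi> (k + 1))\<^sup>2) \<le> (\<Sum>k\<in>K \<inter> {\<kappa>..}. 4 * A\<^sup>2 * (1/4) ^ nat (k - \<kappa>))"
              by (intro sum_mono large) auto
            also have "\<dots> = 4 * A\<^sup>2 * (\<Sum>k\<in>K \<inter> {\<kappa>..}. (1/4) ^ nat (k - \<kappa>))" by (simp add: sum_distrib_left)
            also have "\<dots> \<le> 4 * A\<^sup>2 * 2" using K(1) by (intro mult_left_mono sum_quarter_powers_le) auto
            finally show "(\<Sum>k\<in>K \<inter> {\<kappa>..}. (\<Phi> k - \<Phi> (k + 1))\<^sup>2) \<le> 8 * A\<^sup>2" by simp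
          next
            let ?g = "\<lambda>k. nat (\<kappa> - k)"
            have inj: "inj_on ?g (K - {\<kappa>..})" by (auto simp: inj_on_def)
            obtain N where N: "?g ` (K - {\<kappa>..}) \<subseteq> {..<N}"
              using finite_nat_iff_bounded[of "?g ` (K - {\<kappa>..})"] K(1) by auto
            have "(\<Sum>k\<in>K - {\<kappa>..}. (\<Phi> k - \<Phi> (k + 1))\<^sup>2) \<le> (\<Sum>k\<in>K - {\<kappa>..}. A\<^sup>2 * B (?g k) x)"
            proof (rule sum_mono)
              fix k assume "k \<in> K - {\<kappa>..}"
              then have "\<kappa> - int (?g k) = k" "?g k \<ge> 1" by auto
              then show "(\<Phi> k - \<Phi> (k + 1))\<^sup>2 \<le> A\<^sup>2 * B (?g k) x" using small[of "?g k"] by simp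
            qed
            also have "\<dots> = A\<^sup>2 * (\<Sum>j\<in>?g ` (K - {\<kappa>..}). B j x)"
              by (simp add: sum_distrib_left sum.reindex[OF inj])
            also have "\<dots> \<le> A\<^sup>2 * (\<Sum>j<N. B j x)"
              using N by (intro mult_left_mono sum_mono2) (auto simp: B_nonneg)
            also have "\<dots> \<le> A\<^sup>2 * s'" by (intro mult_left_mono le) simp
            finally show "(\<Sum>k\<in>K - {\<kappa>..}. (\<Phi> k - \<Phi> (k + 1))\<^sup>2) \<le> A\<^sup>2 * s'" .
          qed
          also have "\<dots> = s * A\<^sup>2" by (simp add: s'_def algebra_simps)
          finally show "(\<Sum>k\<in>K. (\<Phi> k - \<Phi> (k + 1))\<^sup>2) \<le> s * A\<^sup>2" .
        qed
        finally show "(\<Sum>P\<in>\<F>. ?w P * indicator P x) \<le> ennreal (s * A\<^sup>2)" .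
      qed
      then show False using big by simp
    qed
    then show ?thesis using E Ebd by blast
  qed
  then show ?thesis unfolding cube_tail_bound_def using \<alpha> C by blast
qed

section \<open>The maximal function\<close>

definition bbox :: "real^'n \<Rightarrow> real \<Rightarrow> (real^'n) set" where
  "bbox a l = cbox a (a + (\<chi> i. l))"

lemma bbox_sets [measurable]: "bbox a l \<in> sets borel" by (simp add: bbox_def)

lemma cubes_eq: "cubes = {bbox a l | a l. l > 0}" by (simp add: cubes_def bbox_def)

lemma emeasure_bbox: "l \<ge> 0 \<Longrightarrow> emeasure lborel (bbox a l :: (real^'n) set) = ennreal (l ^ CARD('n))"
  unfolding bbox_def by (rule emeasure_cbox_const)

lemma emeasure_lebesgue_bbox:
  "l \<ge> 0 \<Longrightarrow> emeasure lebesgue (bbox a l :: (real^'n) set) = ennreal (l ^ CARD('n))"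
  using emeasure_bbox[of l a] by (simp add: emeasure_completion)

lemma maximal_fun_eq:
  "maximal_fun f x = (SUP Q \<in> {Q \<in> cubes. x \<in> Q}. (\<integral>\<^sup>+y\<in>Q. ennreal \<bar>f y\<bar> \<partial>lborel) / emeasure lebesgue Q)"
  unfolding maximal_fun_def nn_integral_completion ..

lemma maximal_fun_lower:
  fixes x :: "real^'n"
  assumes "l > 0" "x \<in> bbox a l"
  shows "(\<integral>\<^sup>+y\<in>bbox a l. ennreal \<bar>f y\<bar> \<partial>lborel) \<le> maximal_fun f x * ennreal (l ^ CARD('n))"
proof -
  let ?I = "\<integral>\<^sup>+y\<in>bbox a l. ennreal \<bar>f y\<bar> \<partial>lborel" and ?v = "ennreal (l ^ CARD('n))"
  have v: "?v \<noteq> 0" "?v \<noteq> top" using assms(1) by auto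
  have "?I / ?v \<le> maximal_fun f x"
    unfolding maximal_fun_eq
    by (rule SUP_upper2[of "bbox a l"]) (use assms emeasure_lebesgue_bbox[of l a] in \<open>auto simp: cubes_eq\<close>)
  then have "?I / ?v * ?v \<le> maximal_fun f x * ?v" by (rule mult_right_mono) simp
  then show ?thesis using v by (simp add: ennreal_divide_times less_top)
qed

text \<open>Bound, support and Borel measurability hold at every point here, as opposed to almost
  everywhere in \<open>Linf_c\<close>.\<close>

locale nice_fun =
  fixes f :: "real^'n \<Rightarrow> real" and K l :: real and a :: "real^'n"
  assumes f_borel [measurable]: "f \<in> borel_measurable borel" and f_le: "\<And>x. \<bar>f x\<bar> \<le> K"
    and supp: "\<And>x. x \<notin> bbox a l \<Longrightarrow> f x = 0" and l: "l > 0"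
begin

lemma K0: "K \<ge> 0" using f_le[of 0] by linarith

lemma nn_int_bbox_le: "r > 0 \<Longrightarrow> (\<integral>\<^sup>+y\<in>bbox b r. ennreal \<bar>f y\<bar> \<partial>lborel) \<le> ennreal (K * r ^ CARD('n))"
proof -
  assume r: "r > 0"
  have "(\<integral>\<^sup>+y\<in>bbox b r. ennreal \<bar>f y\<bar> \<partial>lborel) \<le> (\<integral>\<^sup>+y\<in>bbox b r. ennreal K \<partial>lborel)"
    using f_le by (intro nn_integral_mono mult_right_mono ennreal_leI) auto
  also have "\<dots> = ennreal (K * r ^ CARD('n))"
    using r K0 by (simp add: nn_integral_cmult_indicator emeasure_bbox ennreal_mult)
  finally show ?thesis .
qed

lemma nn_int_eq: "(\<integral>\<^sup>+y\<in>bbox a l. ennreal \<bar>f y\<bar> \<partial>lborel) = (\<integral>\<^sup>+y. ennreal \<bar>f y\<bar> \<partial>lborel)"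
  using supp by (intro nn_integral_cong) (auto simp: indicator_def)

lemma bint_f: "bint f"
proof -
  have "(\<integral>\<^sup>+y. ennreal \<bar>f y\<bar> \<partial>lborel) < \<infinity>"
    using le_less_trans[OF nn_int_bbox_le[OF l, of a] ennreal_less_top] nn_int_eq by simp
  then have "integrable lborel f" by (simp add: integrable_iff_bounded)
  then show ?thesis using f_le unfolding bint_def by blast
qed

lemma maximal_le: "maximal_fun f x \<le> ennreal K"
  unfolding maximal_fun_eq
proof (rule SUP_least)
  fix Q :: "(real^'n) set" assume "Q \<in> {Q \<in> cubes. x \<in> Q}"
  then obtain b r where Q: "Q = bbox b r" "r > 0" by (auto simp: cubes_eq)
  have "(\<integral>\<^sup>+y\<in>Q. ennreal \<bar>f y\<bar> \<partial>lborel) / ennreal (r ^ CARD('n)) \<le> ennreal K"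
    using nn_int_bbox_le[OF Q(2), of b] K0 Q(2)
    by (intro divide_le_posI_ennreal) (auto simp: Q(1) ennreal_mult' mult.commute)
  then show "(\<integral>\<^sup>+y\<in>Q. ennreal \<bar>f y\<bar> \<partial>lborel) / emeasure lebesgue Q \<le> ennreal K"
    using Q by (simp add: emeasure_lebesgue_bbox emeasure_bbox)
qed

definition mf :: "real^'n \<Rightarrow> real" where "mf x = enn2real (maximal_fun f x)"

lemma mf_nonneg: "mf x \<ge> 0" by (simp add: mf_def)

lemma maximal_eq: "maximal_fun f x = ennreal (mf x)"
  using le_less_trans[OF maximal_le[of x] ennreal_less_top] by (simp add: mf_def)

lemma mf_cube:
  assumes "r > 0" "x \<in> cube v r"
  shows "(\<integral>\<^sup>+z\<in>cube v r. ennreal \<bar>f z\<bar> \<partial>lborel) \<le> ennreal (mf x * r ^ CARD('n))"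
proof -
  have sub: "cube v r \<subseteq> bbox v r" unfolding bbox_def by (rule cube_subset_cbox)
  have "(\<integral>\<^sup>+z\<in>cube v r. ennreal \<bar>f z\<bar> \<partial>lborel) \<le> (\<integral>\<^sup>+z\<in>bbox v r. ennreal \<bar>f z\<bar> \<partial>lborel)"
    using sub by (intro nn_integral_mono) (auto simp: indicator_def)
  also have "\<dots> \<le> maximal_fun f x * ennreal (r ^ CARD('n))"
    using assms sub by (intro maximal_fun_lower) auto
  finally show ?thesis by (simp add: maximal_eq ennreal_mult'[OF mf_nonneg])
qed

lemma mf_cube_integral:
  assumes "r > 0" "x \<in> cube v r"
  shows "(LINT z:cube v r|lborel. \<bar>f z\<bar>) \<le> mf x * r ^ CARD('n)"
proof -
  have i: "integrable lborel (\<lambda>z. \<bar>f z\<bar> * indicator (cube v r) z)"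
    by (intro bint_integrable bint_indicator_mult bint_abs bint_f) simp
  have "ennreal (LINT z|lborel. \<bar>f z\<bar> * indicator (cube v r) z) = (\<integral>\<^sup>+z. ennreal (\<bar>f z\<bar> * indicator (cube v r) z) \<partial>lborel)"
    by (intro nn_integral_eq_integral[symmetric] i) simp
  also have "\<dots> = (\<integral>\<^sup>+z\<in>cube v r. ennreal \<bar>f z\<bar> \<partial>lborel)"
    by (intro nn_integral_cong) (auto simp: indicator_def)
  also have "\<dots> \<le> ennreal (mf x * r ^ CARD('n))" by (rule mf_cube[OF assms])
  finally have "(LINT z|lborel. \<bar>f z\<bar> * indicator (cube v r) z) \<le> mf x * r ^ CARD('n)"
    using mf_nonneg assms(1) by (subst (asm) ennreal_le_iff) auto
  then show ?thesis by (simp add: set_lebesgue_integral_def mult.commute)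
qed

lemma mf_ccube:
  assumes "R > 0"
  shows "(\<integral>\<^sup>+z\<in>ccube x R. ennreal \<bar>f z\<bar> \<partial>lborel) \<le> ennreal (mf x * (2 * R) ^ CARD('n))"
  unfolding ccube_def using assms by (intro mf_cube) (auto simp: cube_def)

lemma mf_L1:
  assumes "x \<in> bbox a l"
  shows "(LINT z|lborel. \<bar>f z\<bar>) \<le> mf x * l ^ CARD('n)"
proof -
  have "ennreal (LINT z|lborel. \<bar>f z\<bar>) = (\<integral>\<^sup>+z\<in>bbox a l. ennreal \<bar>f z\<bar> \<partial>lborel)"
    unfolding nn_int_eq by (rule nn_integral_abs_bint[OF bint_f, symmetric])
  also have "\<dots> \<le> maximal_fun f x * ennreal (l ^ CARD('n))" by (rule maximal_fun_lower[OF l assms])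
  also have "\<dots> = ennreal (mf x * l ^ CARD('n))" by (simp add: maximal_eq ennreal_mult'[OF mf_nonneg])
  finally show ?thesis using mf_nonneg l by (subst (asm) ennreal_le_iff) auto
qed

text \<open>Enlarging a cube slightly changes the average little, so the superlevel sets are open.\<close>

lemma maximal_measurable [measurable]: "maximal_fun f \<in> borel_measurable borel"
proof (rule borel_measurableI_greater)
  fix b :: ennreal
  have "\<exists>T. open T \<and> x \<in> T \<and> T \<subseteq> {x. b < maximal_fun f x}" if x: "b < maximal_fun f x" for x
  proof -
    let ?n = "CARD('n)"
    obtain Q where "Q \<in> cubes" "x \<in> Q" and Q: "b < (\<integral>\<^sup>+y\<in>Q. ennreal \<bar>f y\<bar> \<partial>lborel) / emeasure lebesgue Q"
      using x unfolding maximal_fun_eq less_SUP_iff by auto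
    then obtain v r where v: "Q = bbox v r" "r > 0" "x \<in> bbox v r" by (auto simp: cubes_eq)
    define I where "I = enn2real (\<integral>\<^sup>+y\<in>bbox v r. ennreal \<bar>f y\<bar> \<partial>lborel)"
    have I: "(\<integral>\<^sup>+y\<in>bbox v r. ennreal \<bar>f y\<bar> \<partial>lborel) = ennreal I"
      using le_less_trans[OF nn_int_bbox_le[OF v(2), of v] ennreal_less_top] by (simp add: I_def)
    have I0: "I \<ge> 0" by (simp add: I_def)
    have bI: "b < ennreal (I / r ^ ?n)"
      using Q I0 v(2) unfolding v(1) I by (simp add: emeasure_lebesgue_bbox emeasure_bbox divide_ennreal)
    define b' where "b' = enn2real b"
    have b: "b = ennreal b'" using bI less_trans[OF bI ennreal_less_top] by (simp add: b'_def)
    have b'0: "b' \<ge> 0" by (simp add: b'_def)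
    have "b' < I / r ^ ?n" using bI b'0 unfolding b by (simp add: ennreal_less_iff)
    \<comment> \<open>Written with \<open>2 * 0\<close> so as to match the limit of the enlarged
      volume as \<delta> tends to 0.\<close>
    then have lt: "b' * (r + 2 * 0) ^ ?n < I" using v(2) by (simp add: pos_less_divide_eq)
    have "((\<lambda>\<delta>. b' * (r + 2 * \<delta>) ^ ?n) \<longlongrightarrow> b' * (r + 2 * 0) ^ ?n) (at_right 0)"
      by (intro tendsto_intros)
    from order_tendstoD(2)[OF this lt] eventually_at_right_less[of "0::real"]
    have "\<forall>\<^sub>F \<delta> in at_right 0. b' * (r + 2 * \<delta>) ^ ?n < I \<and> 0 < \<delta>" by (rule eventually_conj)
    then obtain \<delta> where \<delta>: "b' * (r + 2 * \<delta>) ^ ?n < I" "\<delta> > 0"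
      using eventually_happens trivial_limit_at_right_real by blast
    define w where "w = v - (\<chi> i. \<delta>)"
    define r' where "r' = r + 2 * \<delta>"
    have r': "r' > 0" using v(2) \<delta>(2) by (simp add: r'_def)
    have sub: "bbox v r \<subseteq> box w (w + (\<chi> i. r'))"
    proof
      fix y assume "y \<in> bbox v r"
      then have y: "v $ i \<le> y $ i" "y $ i \<le> v $ i + r" for i by (auto simp: bbox_def mem_box_cart)
      have "v $ i - \<delta> < y $ i \<and> y $ i < v $ i - \<delta> + (r + 2 * \<delta>)" for i
        using y[of i] \<delta>(2) by linarith
      then show "y \<in> box w (w + (\<chi> i. r'))" by (simp add: mem_box_cart w_def r'_def)
    qed
    have sub': "box w (w + (\<chi> i. r')) \<subseteq> bbox w r'" unfolding bbox_def by (rule box_subset_cbox)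
    have "b < maximal_fun f y" if "y \<in> box w (w + (\<chi> i. r'))" for y
    proof -
      have "ennreal I \<le> (\<integral>\<^sup>+y\<in>bbox w r'. ennreal \<bar>f y\<bar> \<partial>lborel)"
        unfolding I[symmetric] using sub sub' by (intro nn_integral_mono) (auto simp: indicator_def)
      also have "\<dots> \<le> maximal_fun f y * ennreal (r' ^ ?n)"
        using that sub' by (intro maximal_fun_lower r') auto
      also have "\<dots> = ennreal (mf y * r' ^ ?n)" by (simp add: maximal_eq ennreal_mult'[OF mf_nonneg])
      finally have "I \<le> mf y * r' ^ ?n" using mf_nonneg r' by (subst (asm) ennreal_le_iff) auto
      with \<delta>(1) have "b' * r' ^ ?n < mf y * r' ^ ?n" by (simp add: r'_def)
      then have "b' < mf y" using r' by (simp add: mult_less_cancel_right)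
      then show ?thesis unfolding b maximal_eq using b'0 by (simp add: ennreal_less_iff)
    qed
    moreover have "x \<in> box w (w + (\<chi> i. r'))" using v(3) sub by blast
    ultimately show ?thesis by (intro exI[of _ "box w (w + (\<chi> i. r'))"]) (auto simp: open_box)
  qed
  then have "open {x. b < maximal_fun f x}" by (subst open_subopen) auto
  then show "{x \<in> space borel. b < maximal_fun f x} \<in> sets borel" by simp
qed

end

section \<open>Replacing an essentially bounded function by a Borel representative\<close>

text \<open>The complement of the essential support is an uncountable union of open sets on which
  \<open>f\<close> vanishes almost everywhere; Lindelof's theorem makes the union countable, so the
  null sets can be collected.\<close>

lemma AE_zero_off_ess_supp:
  fixes f :: "real^'n \<Rightarrow> real"
  shows "AE x in lebesgue. x \<notin> ess_supp f \<longrightarrow> f x = 0"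
proof -
  let ?U = "{U. open U \<and> (AE x in lebesgue. x \<in> U \<longrightarrow> f x = 0)}"
  obtain V where V: "V \<subseteq> ?U" "countable V" "\<Union>V = \<Union>?U"
    using Lindelof[of ?U] by blast
  have "AE x in lebesgue. \<forall>U\<in>V. x \<in> U \<longrightarrow> f x = 0"
    using V(1) by (intro AE_ball_countable' V(2)) auto
  then show ?thesis
  proof eventually_elim
    case (elim x)
    then show ?case using V(3) by (auto simp: ess_supp_def)
  qed
qed

text \<open>A Borel function equal to \<open>f\<close> almost everywhere is set to 0 off the cube
  and where it exceeds the essential bound; both changes happen on null sets.\<close>

lemma Borel_representative:
  fixes f :: "real^'n \<Rightarrow> real"
  assumes "f \<in> Linf_c" "ess_supp f \<subseteq> bbox a l" "l > 0"
  shows "\<exists>g K. nice_fun g K l a \<and> (AE x in lebesgue. f x = g x)"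
proof -
  obtain C where f: "f \<in> borel_measurable lebesgue" and C: "AE x in lebesgue. \<bar>f x\<bar> \<le> C"
    using assms(1) by (auto simp: Linf_c_def)
  obtain h where h[measurable]: "h \<in> borel_measurable borel" and fh: "AE x in lborel. f x = h x"
    using completion_ex_borel_measurable_real[OF f] by auto
  define g where "g x = (if x \<in> bbox a l \<and> \<bar>h x\<bar> \<le> \<bar>C\<bar> then h x else 0)" for x
  have "nice_fun g \<bar>C\<bar> l a"
  proof
    show "g \<in> borel_measurable borel" unfolding g_def[abs_def] by measurable
  qed (use assms(3) in \<open>auto simp: g_def\<close>)
  moreover have "AE x in lebesgue. f x = g x"
    using AE_completion[OF fh] C AE_zero_off_ess_supp[of f]
  proof eventually_elim
    case (elim x)
    then show ?case using assms(2) by (auto simp: g_def)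
  qed
  ultimately show ?thesis by blast
qed

section \<open>Independence of the representative\<close>

lemma maximal_fun_cong_AE:
  assumes "AE x in lebesgue. f x = g x"
  shows "maximal_fun f x = maximal_fun g x"
proof -
  have "(\<integral>\<^sup>+y\<in>Q. ennreal \<bar>f y\<bar> \<partial>lebesgue) = (\<integral>\<^sup>+y\<in>Q. ennreal \<bar>g y\<bar> \<partial>lebesgue)" for Q
    by (rule nn_integral_cong_AE) (use assms in eventually_elim, simp)
  then show ?thesis unfolding maximal_fun_def by simp
qed

context
  fixes f g :: "real^'n \<Rightarrow> real"
  assumes f: "f \<in> borel_measurable lebesgue" and g: "g \<in> borel_measurable lebesgue"
    and fg: "AE x in lebesgue. f x = g x"
begin

lemma avg_cong_AE:
  assumes "P \<in> sets lebesgue"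
  shows "avg P f = avg P g"
proof -
  have "(LINT x:P|lebesgue. f x) = (LINT x:P|lebesgue. g x)"
    unfolding set_lebesgue_integral_def
  proof (rule integral_cong_AE)
    show "AE x in lebesgue. indicator P x *\<^sub>R f x = indicator P x *\<^sub>R g x"
      using fg by eventually_elim simp
  qed (use f g assms in measurable)
  then show ?thesis by (simp add: avg_def)
qed

lemma dyadic_square_fun_cong_AE: "dyadic_square_fun f x = ennreal_sqrt (dsq g x)"
proof -
  have "(avg P f - avg (dyadic_parent P) f)\<^sup>2 = (avg P g - avg (dyadic_parent P) g)\<^sup>2"
    if P: "P \<in> dyadic_cubes" for P
  proof -
    obtain k z where z: "P = dycube k z" using P by (auto simp: dyadic_cubes_eq)
    show ?thesis unfolding z dyadic_parent_dycube
      by (subst (1 2) avg_cong_AE) (auto intro: sets_completionI_sets)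
  qed
  then show ?thesis unfolding dyadic_square_fun_def dsq_def
    by (intro arg_cong[of _ _ ennreal_sqrt] infsum_cong) simp
qed

lemma convolve_cong_AE:
  assumes [measurable]: "\<psi> \<in> borel_measurable borel"
  shows "convolve \<psi> f y = convolve \<psi> g y"
  unfolding convolve_def
proof (rule integral_cong_AE)
  have "(\<lambda>z. \<psi> (y - z)) \<in> borel_measurable lborel" by measurable
  then have \<psi>: "(\<lambda>z. \<psi> (y - z)) \<in> borel_measurable lebesgue" by (rule measurable_completion)
  show "(\<lambda>z. \<psi> (y - z) * complex_of_real (f z)) \<in> borel_measurable lebesgue"
    by (intro borel_measurable_times \<psi> measurable_compose[OF f borel_measurable_continuous_onI] continuous_intros)
  show "(\<lambda>z. \<psi> (y - z) * complex_of_real (g z)) \<in> borel_measurable lebesgue"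
    by (intro borel_measurable_times \<psi> measurable_compose[OF g borel_measurable_continuous_onI] continuous_intros)
  show "AE z in lebesgue. \<psi> (y - z) * complex_of_real (f z) = \<psi> (y - z) * complex_of_real (g z)"
    using fg by eventually_elim simp
qed

end

text \<open>As \<open>g\<close> is real, the real and imaginary parts of the kernel produce the real
  and imaginary parts of the convolution, so the squares add.\<close>

lemma convolve_dilate:
  fixes \<phi> :: "real^'n \<Rightarrow> complex"
  assumes re: "lp_kernel (\<lambda>u. Re (\<phi> u)) c" and im: "lp_kernel (\<lambda>u. Im (\<phi> u)) c"
    and g: "bint g" and t: "t > 0" and [measurable]: "\<phi> \<in> borel_measurable borel"
  shows "(cmod (convolve (dilate \<phi> t) g y))\<^sup>2 =
    (KC (lp_kernel.dl (\<lambda>u. Re (\<phi> u)) t) g y)\<^sup>2 + (KC (lp_kernel.dl (\<lambda>u. Im (\<phi> u)) t) g y)\<^sup>2"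
proof -
  interpret R: lp_kernel "\<lambda>u. Re (\<phi> u)" c by (rule re)
  interpret I: lp_kernel "\<lambda>u. Im (\<phi> u)" c by (rule im)
  have [measurable]: "g \<in> borel_measurable borel" by (rule bint_meas[OF g])
  have d: "dilate \<phi> t u = complex_of_real (R.dl t u) + \<i> * complex_of_real (I.dl t u)" for u
    by (simp add: dilate_def R.dl_def I.dl_def complex_eq_iff)
  have m: "(\<lambda>z. dilate \<phi> t (y - z) * complex_of_real (g z)) \<in> borel_measurable lborel"
    unfolding dilate_def by measurable
  have iR: "integrable lborel (\<lambda>z. complex_of_real (R.dl t (y - z) * g z))"
    by (intro integrable_of_real bint_integrable KC_integrand R.dl_bint t g)
  have iI: "integrable lborel (\<lambda>z. \<i> * complex_of_real (I.dl t (y - z) * g z))"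
    by (intro integrable_mult_right integrable_of_real bint_integrable KC_integrand I.dl_bint t g)
  have "convolve (dilate \<phi> t) g y = (LINT z|lborel. dilate \<phi> t (y - z) * complex_of_real (g z))"
    unfolding convolve_def by (rule integral_completion[OF m])
  also have "\<dots> = (LINT z|lborel. complex_of_real (R.dl t (y - z) * g z) + \<i> * complex_of_real (I.dl t (y - z) * g z))"
    by (simp add: d distrib_right mult.assoc)
  also have "\<dots> = complex_of_real (KC (R.dl t) g y) + \<i> * complex_of_real (KC (I.dl t) g y)"
    unfolding KC_def
    by (subst Bochner_Integration.integral_add[OF iR iI]) (simp del: of_real_mult)
  finally show ?thesis by (simp add: cmod_power2)
qed

lemma ennreal_sqrt_measurable [measurable]: "ennreal_sqrt \<in> borel_measurable borel"
  unfolding ennreal_sqrt_def[abs_def] by measurable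

lemma ennreal_sqrt_less:
  assumes "ennreal t * ennreal A < ennreal_sqrt z" "t \<ge> 0" "A \<ge> 0"
  shows "ennreal (t\<^sup>2 * A\<^sup>2) < z"
proof (rule ccontr)
  assume "\<not> ?thesis"
  then have z: "z \<le> ennreal (t\<^sup>2 * A\<^sup>2)" by simp
  then have "z < top" using le_less_trans ennreal_less_top by blast
  then obtain r where r: "z = ennreal r" "r \<ge> 0" by (cases z) auto
  have "r \<le> (t * A)\<^sup>2" using z r by (simp add: power_mult_distrib)
  then have "sqrt r \<le> t * A" using assms by (intro real_le_lsqrt) auto
  then have "ennreal_sqrt z \<le> ennreal t * ennreal A"
    using r assms by (simp add: ennreal_sqrt_def ennreal_mult[symmetric] ennreal_leI)
  then show False using assms(1) by simp
qed

lemma lmeasurable_bound: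
  assumes S: "S \<in> sets borel" and E: "E \<in> sets borel" and "S \<subseteq> E" "emeasure lborel E \<le> ennreal b" "b \<ge> 0"
  shows "S \<in> lmeasurable \<and> measure lebesgue S \<le> b"
proof -
  have e: "emeasure lebesgue S \<le> ennreal b"
  proof -
    have "emeasure lebesgue S = emeasure lborel S" using S by (simp add: emeasure_completion)
    also have "\<dots> \<le> emeasure lborel E" by (rule emeasure_mono) (use assms in auto)
    finally show ?thesis using assms(4) by (rule order_trans)
  qed
  then have "S \<in> lmeasurable"
    using S le_less_trans[OF e ennreal_less_top] by (intro fmeasurableI) (auto intro: sets_completionI_sets)
  moreover have "measure lebesgue S \<le> b"
    unfolding measure_def using e assms(5) by (metis enn2real_leI)
  ultimately show ?thesis by blast
qed

lemma measure_bbox: "l > 0 \<Longrightarrow> measure lebesgue (bbox a l :: (real^'n) set) = l ^ CARD('n)"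
  by (simp add: measure_def emeasure_lebesgue_bbox emeasure_bbox)

section \<open>Level sets relative to the maximal function\<close>

context nice_fun
begin

lemma dyadic_part:
  assumes tail: "cube_tail_bound (dsq :: (real^'n \<Rightarrow> real) \<Rightarrow> _) \<alpha> C"
    and C: "C > 0" and t: "t > 0"
  shows "{x \<in> bbox a l. ennreal_sqrt (dsq f x) > ennreal t * maximal_fun f x} \<in> lmeasurable \<and>
    measure lebesgue {x \<in> bbox a l. ennreal_sqrt (dsq f x) > ennreal t * maximal_fun f x}
      \<le> C * exp (- \<alpha> * t\<^sup>2) * l ^ CARD('n)"
proof -
  let ?S = "{x \<in> bbox a l. ennreal_sqrt (dsq f x) > ennreal t * maximal_fun f x}"
  obtain E where E: "E \<in> sets borel" "emeasure lborel E \<le> ennreal (C * exp (- \<alpha> * t\<^sup>2) * l ^ CARD('n))"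
    and imp: "\<forall>x\<in>cbox a (a + (\<chi> i. l)). \<forall>A\<ge>0.
        (\<forall>v r. r > 0 \<longrightarrow> x \<in> cube v r \<longrightarrow> (LINT z:cube v r|lborel. \<bar>f z\<bar>) \<le> A * r ^ CARD('n)) \<longrightarrow>
        (LINT z|lborel. \<bar>f z\<bar>) \<le> A * l ^ CARD('n) \<longrightarrow> dsq f x > ennreal (t\<^sup>2 * A\<^sup>2) \<longrightarrow> x \<in> E"
    using tail[unfolded cube_tail_bound_def, THEN spec[of _ l], THEN mp, OF l, THEN spec[of _ a], THEN spec[of _ f], THEN spec[of _ "t\<^sup>2"],
        THEN mp, OF bint_integrable[OF bint_f]]
    by (elim bexE conjE) (rule that)
  have "?S \<subseteq> E"
  proof
    fix x assume x: "x \<in> ?S"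
    then have "ennreal t * ennreal (mf x) < ennreal_sqrt (dsq f x)" by (simp add: maximal_eq)
    then have "ennreal (t\<^sup>2 * (mf x)\<^sup>2) < dsq f x"
      by (rule ennreal_sqrt_less) (use t mf_nonneg in auto)
    moreover have "x \<in> bbox a l" using x by simp
    ultimately show "x \<in> E"
      using imp[rule_format, of x "mf x"] mf_nonneg mf_cube_integral mf_L1 unfolding bbox_def by blast
  qed
  moreover have "?S \<in> sets borel"
  proof -
    have "?S = bbox a l \<inter> {x \<in> space borel. ennreal t * maximal_fun f x < ennreal_sqrt (dsq f x)}" by auto
    also have "\<dots> \<in> sets borel" by measurable
    finally show ?thesis .
  qed
  ultimately show ?thesis using E C l by (intro lmeasurable_bound[of _ E]) auto
qed

end

lemma g_star_eq:
  fixes \<phi> :: "real^'n \<Rightarrow> complex"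
  assumes re: "lp_kernel (\<lambda>u. Re (\<phi> u)) c" and im: "lp_kernel (\<lambda>u. Im (\<phi> u)) c"
    and \<phi>[measurable]: "\<phi> \<in> borel_measurable borel"
    and f: "f \<in> borel_measurable lebesgue" and g: "bint g" and fg: "AE x in lebesgue. f x = g x"
  shows "g_star \<phi> \<mu> f x = ennreal_sqrt (lp_kernel.gint (\<lambda>u. Re (\<phi> u)) (real CARD('n) * \<mu>) g x
     + lp_kernel.gint (\<lambda>u. Im (\<phi> u)) (real CARD('n) * \<mu>) g x)"
proof -
  interpret R: lp_kernel "\<lambda>u. Re (\<phi> u)" c by (rule re)
  interpret I: lp_kernel "\<lambda>u. Im (\<phi> u)" c by (rule im)
  let ?p = "real CARD('n) * \<mu>"
  have gm[measurable]: "g \<in> borel_measurable borel" by (rule bint_meas[OF g])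
  then have gl: "g \<in> borel_measurable lebesgue" by (intro measurable_completion) simp
  have "(\<integral>\<^sup>+y. ennreal ((cmod (convolve (dilate \<phi> t) f y))\<^sup>2
        * (t / (t + norm (x - y))) powr ?p / t ^ (CARD('n) + 1)) \<partial>lebesgue) = R.gfun ?p g x t + I.gfun ?p g x t"
    if t: "t > 0" for t
  proof -
    let ?w = "\<lambda>y. (t / (t + norm (x - y))) powr ?p"
    have "dilate \<phi> t \<in> borel_measurable borel" unfolding dilate_def[abs_def] by measurable
    then have "(cmod (convolve (dilate \<phi> t) f y))\<^sup>2 = (KC (R.dl t) g y)\<^sup>2 + (KC (I.dl t) g y)\<^sup>2" for y
      using convolve_cong_AE[OF f gl fg] convolve_dilate[OF re im g t \<phi>] by simp
    then have "(\<integral>\<^sup>+y. ennreal ((cmod (convolve (dilate \<phi> t) f y))\<^sup>2 * ?w y / t ^ (CARD('n) + 1)) \<partial>lebesgue)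
      = (\<integral>\<^sup>+y. ennreal ((KC (R.dl t) g y)\<^sup>2 * ?w y / t ^ (CARD('n) + 1) + (KC (I.dl t) g y)\<^sup>2 * ?w y / t ^ (CARD('n) + 1)) \<partial>lborel)"
      by (simp add: nn_integral_completion distrib_right add_divide_distrib)
    also have "\<dots> = (\<integral>\<^sup>+y. ennreal ((KC (R.dl t) g y)\<^sup>2 * ?w y / t ^ (CARD('n) + 1)) +
        ennreal ((KC (I.dl t) g y)\<^sup>2 * ?w y / t ^ (CARD('n) + 1)) \<partial>lborel)"
      using t by (intro nn_integral_cong ennreal_plus) auto
    also have "\<dots> = R.gfun ?p g x t + I.gfun ?p g x t"
      unfolding R.gfun_def I.gfun_def by (rule nn_integral_add) measurable
    finally show ?thesis .
  qed
  then have "(\<integral>\<^sup>+t\<in>{0<..}. (\<integral>\<^sup>+y. ennreal ((cmod (convolve (dilate \<phi> t) f y))\<^sup>2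
        * (t / (t + norm (x - y))) powr ?p / t ^ (CARD('n) + 1)) \<partial>lebesgue) \<partial>lebesgue)
     = (\<integral>\<^sup>+t. R.gfun ?p g x t * indicator {0<..} t + I.gfun ?p g x t * indicator {0<..} t \<partial>lborel)"
    unfolding nn_integral_completion by (intro nn_integral_cong) (auto simp: indicator_def)
  also have "\<dots> = R.gint ?p g x + I.gint ?p g x"
    unfolding R.gint_def I.gint_def by (rule nn_integral_add) measurable
  finally show ?thesis unfolding g_star_def by simp
qed

context nice_fun
begin

text \<open>The closed cube does not fit into the half-open cube of the same side, so the tail bound
  is applied with side \<open>2 * l\<close>, at the cost of the factor 2^n.\<close>

lemma kernel_part:
  assumes tail: "tail_bound (lp_kernel.gint \<psi> p) \<alpha> C"
  shows "\<exists>E \<in> sets borel. emeasure lborel E \<le> ennreal (2 ^ CARD('n) * C * exp (- \<alpha> * s) * l ^ CARD('n)) \<and>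
    (\<forall>x\<in>bbox a l. lp_kernel.gint \<psi> p f x > ennreal (s * (mf x)\<^sup>2) \<longrightarrow> x \<in> E)"
proof -
  have l2: "0 < 2 * l" using l by simp
  obtain E where E: "E \<in> sets borel" "emeasure lborel E \<le> ennreal (C * exp (- \<alpha> * s) * (2 * l) ^ CARD('n))"
    and imp: "\<forall>x\<in>cube a (2 * l). \<forall>A\<ge>0. (\<forall>R>0. (\<integral>\<^sup>+z\<in>ccube x R. ennreal \<bar>f z\<bar> \<partial>lborel) \<le> ennreal (A * (2 * R) ^ CARD('n))) \<longrightarrow>
       (LINT z|lborel. \<bar>f z\<bar>) \<le> A * (2 * l) ^ CARD('n) \<longrightarrow> lp_kernel.gint \<psi> p f x > ennreal (s * A\<^sup>2) \<longrightarrow> x \<in> E"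
    using tail[unfolded tail_bound_def, rule_format, OF l2 bint_f, of s a] by (elim bexE conjE) (rule that)
  have "x \<in> E" if x: "x \<in> bbox a l" and big: "lp_kernel.gint \<psi> p f x > ennreal (s * (mf x)\<^sup>2)" for x
  proof -
    have xc: "x \<in> cube a (2 * l)"
      unfolding cube_def
    proof (intro CollectI allI)
      fix i
      have "a $ i \<le> x $ i" "x $ i \<le> a $ i + l" using x by (auto simp: bbox_def mem_box_cart)
      then show "a $ i \<le> x $ i \<and> x $ i < a $ i + 2 * l" using l by linarith
    qed
    have "mf x * l ^ CARD('n) \<le> mf x * (2 * l) ^ CARD('n)"
      using l mf_nonneg by (intro mult_left_mono power_mono) auto
    then have "(LINT z|lborel. \<bar>f z\<bar>) \<le> mf x * (2 * l) ^ CARD('n)"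
      using mf_L1[OF x] by linarith
    then show ?thesis using imp[rule_format, OF xc mf_nonneg _ _ big] mf_ccube by blast
  qed
  moreover have eq: "C * exp (- \<alpha> * s) * (2 * l) ^ CARD('n) = 2 ^ CARD('n) * C * exp (- \<alpha> * s) * l ^ CARD('n)"
    by (simp add: power_mult_distrib)
  ultimately show ?thesis using E(2)[unfolded eq] by (intro bexI[of _ E] conjI ballI impI E(1)) auto
qed

end

theorem theorem2p6:
  fixes \<phi> :: "real^'n \<Rightarrow> complex" and \<mu> :: real
  assumes "schwartz \<phi>"
    and "(LINT x|lebesgue. \<phi> x) = 0"
    and "\<mu> > 3"
  shows "\<exists>\<alpha>>0. \<exists>c>0. \<forall>Q \<in> (cubes :: (real^'n) set set). \<forall>f \<in> Linf_c. ess_supp f \<subseteq> Q \<longrightarrow>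
    (\<forall>t>0.
       {x \<in> Q. dyadic_square_fun f x > ennreal t * maximal_fun f x} \<in> lmeasurable \<and>
       measure lebesgue {x \<in> Q. dyadic_square_fun f x > ennreal t * maximal_fun f x}
         \<le> c * exp (- \<alpha> * t\<^sup>2) * measure lebesgue Q) \<and>
    (\<forall>t>0.
       {x \<in> Q. g_star \<phi> \<mu> f x > ennreal t * maximal_fun f x} \<in> lmeasurable \<and>
       measure lebesgue {x \<in> Q. g_star \<phi> \<mu> f x > ennreal t * maximal_fun f x}
         \<le> c * exp (- \<alpha> * t\<^sup>2) * measure lebesgue Q)"
proof -
  let ?n = "CARD('n)"
  define p where "p = real ?n * \<mu>"
  have p: "p > 3 * real ?n" unfolding p_def using assms(3) by simp
  obtain c where re: "lp_kernel (\<lambda>u. Re (\<phi> u)) c" and im: "lp_kernel (\<lambda>u. Im (\<phi> u)) c"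
    using schwartz_lp_kernel[OF assms(1,2)] by blast
  interpret R: lp_kernel "\<lambda>u. Re (\<phi> u)" c by (rule re)
  interpret I: lp_kernel "\<lambda>u. Im (\<phi> u)" c by (rule im)
  have \<phi>[measurable]: "\<phi> \<in> borel_measurable borel" by (rule schwartz_borel[OF assms(1)])
  obtain \<alpha>1 C1 where d: "\<alpha>1 > 0" "C1 > 0" and dt: "cube_tail_bound (dsq :: (real^'n \<Rightarrow> real) \<Rightarrow> _) \<alpha>1 C1"
    using dyadic_tail by (elim exE conjE) (rule that)
  obtain \<alpha>2 C2 where r: "\<alpha>2 > 0" "C2 > 0" and rt: "tail_bound (R.gint p) \<alpha>2 C2"
    using R.kernel_tail[OF p] by (elim exE conjE) (rule that)
  obtain \<alpha>3 C3 where i: "\<alpha>3 > 0" "C3 > 0" and it: "tail_bound (I.gint p) \<alpha>3 C3"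
    using I.kernel_tail[OF p] by (elim exE conjE) (rule that)
  \<comment> \<open>The square of the continuous square function is a sum of two parts. If it
    exceeds t^2 (M f)^2, one part exceeds half of that, which halves the exponents \<alpha>2 and
    \<alpha>3.\<close>
  define \<alpha> where "\<alpha> = min \<alpha>1 (min (\<alpha>2 / 2) (\<alpha>3 / 2))"
  define D where "D = C1 + 2 ^ ?n * C2 + 2 ^ ?n * C3"
  have \<alpha>: "\<alpha> > 0" "\<alpha> \<le> \<alpha>1" "\<alpha> \<le> \<alpha>2 / 2" "\<alpha> \<le> \<alpha>3 / 2" using d r i by (auto simp: \<alpha>_def)
  have D: "D > 0" using d r i by (simp add: D_def add_pos_pos)
  have ex: "exp (- \<beta> * s) \<le> exp (- \<alpha> * t\<^sup>2)" if "\<alpha> * t\<^sup>2 \<le> \<beta> * s" for \<beta> s t using that by simp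
  have main: "({x \<in> bbox a l. dyadic_square_fun f x > ennreal t * maximal_fun f x} \<in> lmeasurable \<and>
       measure lebesgue {x \<in> bbox a l. dyadic_square_fun f x > ennreal t * maximal_fun f x}
         \<le> D * exp (- \<alpha> * t\<^sup>2) * l ^ ?n) \<and>
       {x \<in> bbox a l. g_star \<phi> \<mu> f x > ennreal t * maximal_fun f x} \<in> lmeasurable \<and>
       measure lebesgue {x \<in> bbox a l. g_star \<phi> \<mu> f x > ennreal t * maximal_fun f x}
         \<le> D * exp (- \<alpha> * t\<^sup>2) * l ^ ?n"
    if f: "f \<in> Linf_c" and supp: "ess_supp f \<subseteq> bbox a l" and l: "l > 0" and t: "t > 0"
    for f :: "real^'n \<Rightarrow> real" and a l t
  proof -
    obtain g K where nice: "nice_fun g K l a" and fg: "AE x in lebesgue. f x = g x"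
      using Borel_representative[OF f supp l] by blast
    interpret nice_fun g K l a by (rule nice)
    have fm: "f \<in> borel_measurable lebesgue" using f by (simp add: Linf_c_def)
    have gm: "g \<in> borel_measurable lebesgue" by (intro measurable_completion) simp
    have mfg: "maximal_fun f x = maximal_fun g x" for x by (rule maximal_fun_cong_AE[OF fg])
    have bd: "C * exp (- \<beta> * s) * l ^ ?n \<le> C * exp (- \<alpha> * t\<^sup>2) * l ^ ?n"
      if "C > 0" "\<alpha> * t\<^sup>2 \<le> \<beta> * s" for C \<beta> s
      using that l ex by (intro mult_right_mono mult_left_mono) auto
    have "{x \<in> bbox a l. dyadic_square_fun f x > ennreal t * maximal_fun f x} \<in> lmeasurable \<and>
       measure lebesgue {x \<in> bbox a l. dyadic_square_fun f x > ennreal t * maximal_fun f x}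
         \<le> D * exp (- \<alpha> * t\<^sup>2) * l ^ ?n"
    proof -
      have "C1 * exp (- \<alpha>1 * t\<^sup>2) * l ^ ?n \<le> C1 * exp (- \<alpha> * t\<^sup>2) * l ^ ?n"
        using d \<alpha> by (intro bd mult_right_mono) auto
      also have "\<dots> \<le> D * exp (- \<alpha> * t\<^sup>2) * l ^ ?n"
        using l r i by (intro mult_right_mono) (auto simp: D_def)
      finally show ?thesis
        using dyadic_part[OF dt d(2) t] unfolding mfg dyadic_square_fun_cong_AE[OF fm gm fg] by auto
    qed
    moreover have "{x \<in> bbox a l. g_star \<phi> \<mu> f x > ennreal t * maximal_fun f x} \<in> lmeasurable \<and>
       measure lebesgue {x \<in> bbox a l. g_star \<phi> \<mu> f x > ennreal t * maximal_fun f x}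
         \<le> D * exp (- \<alpha> * t\<^sup>2) * l ^ ?n"
    proof -
      have gs: "g_star \<phi> \<mu> f x = ennreal_sqrt (R.gint p g x + I.gint p g x)" for x
        unfolding p_def by (rule g_star_eq[OF re im \<phi> fm bint_f fg])
      let ?S = "{x \<in> bbox a l. g_star \<phi> \<mu> f x > ennreal t * maximal_fun f x}"
      obtain E where E: "E \<in> sets borel" "emeasure lborel E \<le> ennreal (2 ^ ?n * C2 * exp (- \<alpha>2 * (t\<^sup>2 / 2)) * l ^ ?n)"
        "\<forall>x\<in>bbox a l. R.gint p g x > ennreal (t\<^sup>2 / 2 * (mf x)\<^sup>2) \<longrightarrow> x \<in> E"
        using kernel_part[OF rt, of "t\<^sup>2 / 2"] by (elim bexE conjE) (rule that)
      obtain E' where E': "E' \<in> sets borel" "emeasure lborel E' \<le> ennreal (2 ^ ?n * C3 * exp (- \<alpha>3 * (t\<^sup>2 / 2)) * l ^ ?n)"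
        "\<forall>x\<in>bbox a l. I.gint p g x > ennreal (t\<^sup>2 / 2 * (mf x)\<^sup>2) \<longrightarrow> x \<in> E'"
        using kernel_part[OF it, of "t\<^sup>2 / 2"] by (elim bexE conjE) (rule that)
      have "?S \<subseteq> E \<union> E'"
      proof
        fix x assume x: "x \<in> ?S"
        then have "ennreal t * ennreal (mf x) < ennreal_sqrt (R.gint p g x + I.gint p g x)"
          by (simp add: gs mfg maximal_eq)
        then have big: "ennreal (t\<^sup>2 * (mf x)\<^sup>2) < R.gint p g x + I.gint p g x"
          by (rule ennreal_sqrt_less) (use t mf_nonneg in auto)
        show "x \<in> E \<union> E'"
        proof (rule ccontr)
          assume "x \<notin> E \<union> E'"
          then have "R.gint p g x + I.gint p g x \<le> ennreal (t\<^sup>2 / 2 * (mf x)\<^sup>2) + ennreal (t\<^sup>2 / 2 * (mf x)\<^sup>2)"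
            using x E(3) E'(3) by (intro add_mono) (auto simp: not_less[symmetric])
          also have "\<dots> = ennreal (t\<^sup>2 * (mf x)\<^sup>2)" by (subst ennreal_plus[symmetric]) auto
          finally show False using big by simp
        qed
      qed
      moreover have "?S \<in> sets borel"
      proof -
        have "?S = bbox a l \<inter> {x \<in> space borel. ennreal t * maximal_fun g x < ennreal_sqrt (R.gint p g x + I.gint p g x)}"
          by (auto simp: gs mfg)
        also have "\<dots> \<in> sets borel" by measurable
        finally show ?thesis .
      qed
      moreover have "emeasure lborel (E \<union> E') \<le> ennreal (D * exp (- \<alpha> * t\<^sup>2) * l ^ ?n)"
      proof -
        have "emeasure lborel (E \<union> E') \<le> emeasure lborel E + emeasure lborel E'"
          using E(1) E'(1) by (intro emeasure_subadditive) auto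
        also have "\<dots> \<le> ennreal (2 ^ ?n * C2 * exp (- \<alpha>2 * (t\<^sup>2 / 2)) * l ^ ?n) + ennreal (2 ^ ?n * C3 * exp (- \<alpha>3 * (t\<^sup>2 / 2)) * l ^ ?n)"
          by (intro add_mono E E')
        also have "\<dots> \<le> ennreal (2 ^ ?n * C2 * exp (- \<alpha> * t\<^sup>2) * l ^ ?n) + ennreal (2 ^ ?n * C3 * exp (- \<alpha> * t\<^sup>2) * l ^ ?n)"
          using r i mult_right_mono[OF \<alpha>(3), of "t\<^sup>2"] mult_right_mono[OF \<alpha>(4), of "t\<^sup>2"]
          by (intro add_mono ennreal_leI bd) auto
        also have "\<dots> = ennreal ((2 ^ ?n * C2 + 2 ^ ?n * C3) * exp (- \<alpha> * t\<^sup>2) * l ^ ?n)"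
          using r i l by (subst ennreal_plus[symmetric]) (auto simp: distrib_right)
        also have "\<dots> \<le> ennreal (D * exp (- \<alpha> * t\<^sup>2) * l ^ ?n)"
          using l d by (intro ennreal_leI mult_right_mono) (auto simp: D_def)
        finally show ?thesis .
      qed
      ultimately show ?thesis using E(1) E'(1) D l by (intro lmeasurable_bound[of _ "E \<union> E'"]) auto
    qed
    ultimately show ?thesis by blast
  qed
  show ?thesis
  proof (rule exI[of _ \<alpha>], rule conjI[OF \<alpha>(1)], rule exI[of _ D], rule conjI[OF D], intro ballI impI)
    fix Q :: "(real^'n) set" and f assume Q: "Q \<in> cubes" and f: "f \<in> Linf_c" "ess_supp f \<subseteq> Q"
    obtain a l where al: "Q = bbox a l" "l > 0" using Q by (auto simp: cubes_eq)
    show "(\<forall>t>0.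
       {x \<in> Q. dyadic_square_fun f x > ennreal t * maximal_fun f x} \<in> lmeasurable \<and>
       measure lebesgue {x \<in> Q. dyadic_square_fun f x > ennreal t * maximal_fun f x}
         \<le> D * exp (- \<alpha> * t\<^sup>2) * measure lebesgue Q) \<and>
    (\<forall>t>0.
       {x \<in> Q. g_star \<phi> \<mu> f x > ennreal t * maximal_fun f x} \<in> lmeasurable \<and>
       measure lebesgue {x \<in> Q. g_star \<phi> \<mu> f x > ennreal t * maximal_fun f x}
         \<le> D * exp (- \<alpha> * t\<^sup>2) * measure lebesgue Q)"
      using main[OF f(1) f(2)[unfolded al(1)] al(2)] unfolding al(1) measure_bbox[OF al(2)] by blast
  qed
qed

end
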